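(* Let $g\ge1$ be an integer and let $V$ be an object in $\mathrm{Rep}_{\mathbb R}(\mathcal G^g)$. Then $V$ is isomorphic to a subquotient of $V_1\boxtimes\cdots\boxtimes V_g$ for some objects $V_1,\dots,V_g$ in $\mathrm{Rep}_{\mathbb R}(\mathcal G)$.
   Context: $\mathcal G$ is the tannakian fundamental group (an affine group scheme over $\mathbb R$) of the category $\mathrm{MHS}_{\mathbb R}$ of mixed $\mathbb R$-Hodge structures in the sense of Deligne, with respect to the fiber functor $V\mapsto\bigoplus_n\mathrm{Gr}^W_nV_{\mathbb R}$. $\mathrm{Rep}_{\mathbb R}(\mathcal G^g)$ is the category of $\mathbb R$-linear representations of the $g$-fold product $\mathcal G^g$ on finite dimensional $\mathbb R$-vector spaces; $\mathrm{Rep}_{\mathbb R}(\mathcal G)\cong\mathrm{MHS}_{\mathbb R}$. The exterior product $V_1\boxtimes\cdots\boxtimes V_g$ is the vector space $V_1\otimes_{\mathbb R}\cdots\otimes_{\mathbb R}V_g$ on which the $\mu$-th factor of $\mathcal G^g$ acts through $V_\mu$. *)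

theory Defs
  imports Complex_Main "HOL-Algebra.Module" "HOL-Algebra.AbelCoset" "HOL-Algebra.RingHom" "HOL-Algebra.Bij"
    "HOL-Algebra.Product_Groups"
begin

section \<open>Linear algebra over ring records\<close>

definition real_ring :: "real ring" where
  "real_ring = \<lparr>carrier = UNIV, monoid.mult = (*), one = 1, ring.zero = 0, add = (+)\<rparr>"

definition complex_ring :: "complex ring" where
  "complex_ring = \<lparr>carrier = UNIV, monoid.mult = (*), one = 1, ring.zero = 0, add = (+)\<rparr>"

text \<open>
  The free module \<open>R\<^sup>I\<close>. Modules are ring records in HOL-Algebra; the fields \<open>mult\<close> and \<open>one\<close> have
  no meaning for a module and are left undefined here and below.
\<close>

definition free_module :: "('r, 'm) ring_scheme \<Rightarrow> 'i set \<Rightarrow> ('r, 'i \<Rightarrow> 'r) module" where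
  "free_module R I =
     \<lparr>carrier = I \<rightarrow>\<^sub>E carrier R,
      monoid.mult = undefined, one = undefined,
      ring.zero = (\<lambda>i\<in>I. \<zero>\<^bsub>R\<^esub>),
      add = (\<lambda>x y. \<lambda>i\<in>I. x i \<oplus>\<^bsub>R\<^esub> y i),
      smult = (\<lambda>a x. \<lambda>i\<in>I. a \<otimes>\<^bsub>R\<^esub> x i)\<rparr>"

definition unit_vec :: "('r, 'm) ring_scheme \<Rightarrow> 'i set \<Rightarrow> 'i \<Rightarrow> 'i \<Rightarrow> 'r" where
  "unit_vec R I i = (\<lambda>j\<in>I. if j = i then \<one>\<^bsub>R\<^esub> else \<zero>\<^bsub>R\<^esub>)"

definition span_submodule ::
    "('r, 'm) ring_scheme \<Rightarrow> ('r, 'v, 'n) module_scheme \<Rightarrow> 'v set \<Rightarrow> 'v set" where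
  "span_submodule R M S = (\<lambda>N. submodule N R M) hull S"

text \<open>\<open>M / N\<close>, with the cosets \<open>N + x\<close> as elements.\<close>

definition quot_module ::
    "('r, 'v, 'n) module_scheme \<Rightarrow> 'v set \<Rightarrow> ('r, 'v set) module" where
  "quot_module M N =
     \<lparr>carrier = a_rcosets\<^bsub>M\<^esub> N,
      monoid.mult = undefined, one = undefined,
      ring.zero = N,
      add = (\<lambda>X Y. X <+>\<^bsub>M\<^esub> Y),
      smult = (\<lambda>a X. N <+>\<^bsub>M\<^esub> ((\<lambda>x. a \<odot>\<^bsub>M\<^esub> x) ` X))\<rparr>"

definition direct_sum_module :: "('k \<Rightarrow> ('r, 'v) module) \<Rightarrow> ('r, 'k \<Rightarrow> 'v) module" where
  "direct_sum_module M =
     \<lparr>carrier = {x. (\<forall>k. x k \<in> carrier (M k)) \<and> finite {k. x k \<noteq> \<zero>\<^bsub>M k\<^esub>}},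
      monoid.mult = undefined, one = undefined,
      ring.zero = (\<lambda>k. \<zero>\<^bsub>M k\<^esub>),
      add = (\<lambda>x y k. x k \<oplus>\<^bsub>M k\<^esub> y k),
      smult = (\<lambda>a x k. a \<odot>\<^bsub>M k\<^esub> x k)\<rparr>"

text \<open>The automorphism group \<open>GL\<^sub>R(M)\<close>.\<close>

definition GL :: "('r, 'm) ring_scheme \<Rightarrow> ('r, 'v, 'n) module_scheme \<Rightarrow> ('v \<Rightarrow> 'v) monoid" where
  "GL R M = BijGroup (carrier M)
     \<lparr>carrier := {f \<in> Bij (carrier M).
        (\<forall>x\<in>carrier M. \<forall>y\<in>carrier M. f (x \<oplus>\<^bsub>M\<^esub> y) = f x \<oplus>\<^bsub>M\<^esub> f y) \<and>
        (\<forall>a\<in>carrier R. \<forall>x\<in>carrier M. f (a \<odot>\<^bsub>M\<^esub> x) = a \<odot>\<^bsub>M\<^esub> f x)}\<rparr>"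

text \<open>
  A linear map \<open>\<real>\<^sup>I \<rightarrow> \<real>\<^sup>J\<close> is given by its matrix \<open>f\<close>. For a ring homomorphism \<open>\<eta> : \<real> \<rightarrow> B\<close>,
  \<open>lin_map B \<eta> I J f\<close> is its scalar extension \<open>B\<^sup>I \<rightarrow> B\<^sup>J\<close> along \<open>\<eta>\<close>.
\<close>

definition lin_map ::
    "('b, 'm) ring_scheme \<Rightarrow> (real \<Rightarrow> 'b) \<Rightarrow> 'i set \<Rightarrow> 'j set \<Rightarrow> ('j \<Rightarrow> 'i \<Rightarrow> real)
     \<Rightarrow> ('i \<Rightarrow> 'b) \<Rightarrow> ('j \<Rightarrow> 'b)" where
  "lin_map B \<eta> I J f x = (\<lambda>j\<in>J. \<Oplus>\<^bsub>B\<^esub>i\<in>I. \<eta> (f j i) \<otimes>\<^bsub>B\<^esub> x i)"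

text \<open>The map \<open>A\<^sup>I \<rightarrow> B\<^sup>I\<close> induced by a map \<open>\<phi> : A \<rightarrow> B\<close>.\<close>

definition vec_map :: "('a \<Rightarrow> 'b) \<Rightarrow> 'i set \<Rightarrow> ('i \<Rightarrow> 'a) \<Rightarrow> 'i \<Rightarrow> 'b" where
  "vec_map \<phi> I x = (\<lambda>i\<in>I. \<phi> (x i))"

text \<open>
  \<open>u \<otimes> v\<close> for \<open>u\<close> in \<open>B\<^sup>m\<close> and \<open>v\<close> in \<open>B\<^sup>n\<close>, under the identification of \<open>B\<^sup>m \<otimes> B\<^sup>n\<close> with \<open>B\<^sup>m\<^sup>n\<close>
  for which \<open>e\<^sub>i \<otimes> e\<^sub>j\<close> is the basis vector with number \<open>i * n + j\<close>.
\<close>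

definition vec_tensor ::
    "('b, 'm) ring_scheme \<Rightarrow> nat \<Rightarrow> nat \<Rightarrow> (nat \<Rightarrow> 'b) \<Rightarrow> (nat \<Rightarrow> 'b) \<Rightarrow> nat \<Rightarrow> 'b" where
  "vec_tensor B m n u v = (\<lambda>k\<in>{..<m * n}. u (k div n) \<otimes>\<^bsub>B\<^esub> v (k mod n))"


section \<open>Mixed real Hodge structures\<close>

text \<open>
  The underlying real vector space is \<open>\<real>\<^sup>d\<close>, its complexification \<open>\<complex>\<^sup>d\<close>; \<open>weight\<close> is the increasing
  filtration \<open>W\<close> of the former and \<open>hodge\<close> the decreasing filtration \<open>F\<close> of the latter.
\<close>

record mhs_data =
  dim :: nat
  weight :: "int \<Rightarrow> (nat \<Rightarrow> real) set"
  hodge :: "int \<Rightarrow> (nat \<Rightarrow> complex) set"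

text \<open>
  \<open>W\<^sub>k \<otimes>\<^sub>\<real> B\<close> as a submodule of \<open>B\<^sup>d\<close>, and \<open>Gr\<^sub>k \<otimes>\<^sub>\<real> B = (W\<^sub>k \<otimes>\<^sub>\<real> B) / (W\<^bsub>k-1\<^esub> \<otimes>\<^sub>\<real> B)\<close>, for a
  commutative ring \<open>B\<close> with structure map \<open>\<eta> : \<real> \<rightarrow> B\<close>. (As \<open>\<real>\<close> is a field, \<open>_ \<otimes>\<^sub>\<real> B\<close> is exact,
  so it commutes with the formation of subspaces and of quotients.)
\<close>

definition weight_ext ::
    "('b, 'm) ring_scheme \<Rightarrow> (real \<Rightarrow> 'b) \<Rightarrow> mhs_data \<Rightarrow> int \<Rightarrow> (nat \<Rightarrow> 'b) set" where
  "weight_ext B \<eta> H k =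
     span_submodule B (free_module B {..<dim H}) (vec_map \<eta> {..<dim H} ` weight H k)"

definition gr ::
    "('b, 'm) ring_scheme \<Rightarrow> (real \<Rightarrow> 'b) \<Rightarrow> mhs_data \<Rightarrow> int \<Rightarrow> ('b, (nat \<Rightarrow> 'b) set) module" where
  "gr B \<eta> H k =
     quot_module ((free_module B {..<dim H})\<lparr>carrier := weight_ext B \<eta> H k\<rparr>)
                 (weight_ext B \<eta> H (k - 1))"

abbreviation gr_complex :: "mhs_data \<Rightarrow> int \<Rightarrow> (complex, (nat \<Rightarrow> complex) set) module" where
  "gr_complex \<equiv> gr complex_ring complex_of_real"

text \<open>The filtration which \<open>F\<close> induces on \<open>Gr\<^sub>k \<otimes> \<complex>\<close>.\<close>

definition hodge_gr :: "mhs_data \<Rightarrow> int \<Rightarrow> int \<Rightarrow> (nat \<Rightarrow> complex) set set" where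
  "hodge_gr H k p =
     (\<lambda>v. weight_ext complex_ring complex_of_real H (k - 1)
            +>\<^bsub>free_module complex_ring {..<dim H}\<^esub> v)
     ` (hodge H p \<inter> weight_ext complex_ring complex_of_real H k)"

text \<open>Its complex conjugate.\<close>

definition hodge_gr_conj :: "mhs_data \<Rightarrow> int \<Rightarrow> int \<Rightarrow> (nat \<Rightarrow> complex) set set" where
  "hodge_gr_conj H k p = (\<lambda>X. vec_map cnj {..<dim H} ` X) ` hodge_gr H k p"

text \<open>
  The last condition says that \<open>F\<close> induces a Hodge structure of weight \<open>k\<close> on \<open>Gr\<^sub>k\<close>, that is,
  \<open>Gr\<^sub>k \<otimes> \<complex>\<close> is the direct sum of \<open>F\<^sup>p\<close> and of the conjugate of \<open>F\<^sup>q\<close> whenever \<open>p + q = k + 1\<close>.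
\<close>

definition is_mhs :: "mhs_data \<Rightarrow> bool" where
  "is_mhs H \<longleftrightarrow>
     (let V = free_module real_ring {..<dim H}; V\<^sub>C = free_module complex_ring {..<dim H} in
      (\<forall>k. submodule (weight H k) real_ring V) \<and>
      mono (weight H) \<and>
      (\<exists>k. weight H k = {\<zero>\<^bsub>V\<^esub>}) \<and>
      (\<exists>k. weight H k = carrier V) \<and>
      (\<forall>p. submodule (hodge H p) complex_ring V\<^sub>C) \<and>
      antimono (hodge H) \<and>
      (\<exists>p. hodge H p = carrier V\<^sub>C) \<and>
      (\<exists>p. hodge H p = {\<zero>\<^bsub>V\<^sub>C\<^esub>}) \<and>
      (\<forall>k p q. p + q = k + 1 \<longrightarrow>
         hodge_gr H k p <+>\<^bsub>gr_complex H k\<^esub> hodge_gr_conj H k q = carrier (gr_complex H k) \<and>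
         hodge_gr H k p \<inter> hodge_gr_conj H k q = {\<zero>\<^bsub>gr_complex H k\<^esub>}))"

text \<open>Morphisms \<open>H \<rightarrow> H'\<close>: real matrices compatible with both filtrations.\<close>

definition mhs_hom :: "mhs_data \<Rightarrow> mhs_data \<Rightarrow> (nat \<Rightarrow> nat \<Rightarrow> real) \<Rightarrow> bool" where
  "mhs_hom H H' f \<longleftrightarrow>
     (\<forall>k. lin_map real_ring (\<lambda>r. r) {..<dim H} {..<dim H'} f ` weight H k \<subseteq> weight H' k) \<and>
     (\<forall>p. lin_map complex_ring complex_of_real {..<dim H} {..<dim H'} f ` hodge H p \<subseteq> hodge H' p)"

definition mhs_tensor :: "mhs_data \<Rightarrow> mhs_data \<Rightarrow> mhs_data" where
  "mhs_tensor H H' =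
     \<lparr>dim = dim H * dim H',
      weight = (\<lambda>m. span_submodule real_ring (free_module real_ring {..<dim H * dim H'})
        {vec_tensor real_ring (dim H) (dim H') u v | u v k l.
           k + l = m \<and> u \<in> weight H k \<and> v \<in> weight H' l}),
      hodge = (\<lambda>r. span_submodule complex_ring (free_module complex_ring {..<dim H * dim H'})
        {vec_tensor complex_ring (dim H) (dim H') u v | u v p q.
           p + q = r \<and> u \<in> hodge H p \<and> v \<in> hodge H' q})\<rparr>"

text \<open>The unit object \<open>\<real>(0)\<close>.\<close>

definition mhs_unit :: mhs_data where
  "mhs_unit =
     \<lparr>dim = 1,
      weight = (\<lambda>k. if 0 \<le> k then carrier (free_module real_ring {..<1})
                    else {\<zero>\<^bsub>free_module real_ring {..<1}\<^esub>}),
      hodge = (\<lambda>p. if p \<le> 0 then carrier (free_module complex_ring {..<1})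
                   else {\<zero>\<^bsub>free_module complex_ring {..<1}\<^esub>})\<rparr>"


section \<open>The fiber functor and its extensions of scalars\<close>

text \<open>
  \<open>A\<close> ranges over the commutative \<open>\<real>\<close>-algebras with carrier in a type \<open>'u\<close>, which plays the role of
  the universe of the functor of points: \<open>algebra real_ring A\<close>. Everything below is polymorphic
  in \<open>'u\<close>. The coordinate rings of the group schemes in question have at most the cardinality of
  the continuum, hence by Yoneda any \<open>'u\<close> of at least this cardinality gives the same
  representations; for a smaller \<open>'u\<close> only the zero algebra is left.
\<close>

definition alg_hom ::
    "(real, 'u) module \<Rightarrow> (real, 'u) module \<Rightarrow> ('u \<Rightarrow> 'u) set" where
  "alg_hom A B = {\<phi> \<in> ring_hom A B. \<forall>r. \<forall>a\<in>carrier A. \<phi> (r \<odot>\<^bsub>A\<^esub> a) = r \<odot>\<^bsub>B\<^esub> \<phi> a}"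

definition str_map :: "(real, 'u) module \<Rightarrow> real \<Rightarrow> 'u" where
  "str_map A r = r \<odot>\<^bsub>A\<^esub> \<one>\<^bsub>A\<^esub>"

abbreviation alg_lin_map ::
    "(real, 'u) module \<Rightarrow> 'i set \<Rightarrow> 'j set \<Rightarrow> ('j \<Rightarrow> 'i \<Rightarrow> real) \<Rightarrow> ('i \<Rightarrow> 'u) \<Rightarrow> ('j \<Rightarrow> 'u)" where
  "alg_lin_map A \<equiv> lin_map A (str_map A)"

type_synonym 'u gr_elem = "int \<Rightarrow> (nat \<Rightarrow> 'u) set"

text \<open>\<open>\<omega>(H) \<otimes>\<^sub>\<real> A\<close>, where \<open>\<omega>(H) = \<Oplus>\<^sub>k Gr\<^sub>k H\<close>.\<close>

definition fiber :: "(real, 'u) module \<Rightarrow> mhs_data \<Rightarrow> ('u, 'u gr_elem) module" where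
  "fiber A H = direct_sum_module (gr A (str_map A) H)"

text \<open>
  The map into \<open>\<omega>(H) \<otimes> B\<close> which a filtered additive map \<open>f\<close> of the underlying modules induces on
  the associated graded modules.
\<close>

definition fiber_map ::
    "(real, 'u) module \<Rightarrow> mhs_data \<Rightarrow> ((nat \<Rightarrow> 'u) \<Rightarrow> (nat \<Rightarrow> 'u)) \<Rightarrow> 'u gr_elem \<Rightarrow> 'u gr_elem" where
  "fiber_map B H f x =
     (\<lambda>k. weight_ext B (str_map B) H (k - 1) <+>\<^bsub>free_module B {..<dim H}\<^esub> (f ` x k))"

text \<open>
  The bilinear map \<open>(\<omega>(H) \<otimes> A) \<times> (\<omega>(H') \<otimes> A) \<rightarrow> \<omega>(H \<otimes> H') \<otimes> A\<close> with \<open>([u], [v]) \<mapsto> [u \<otimes> v]\<close> for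
  \<open>[u]\<close> in \<open>Gr\<^sub>k\<close>, \<open>[v]\<close> in \<open>Gr\<^sub>l\<close> and \<open>[u \<otimes> v]\<close> in \<open>Gr\<^bsub>k+l\<^esub>\<close>; it is the tensor structure of \<open>\<omega>\<close>.
\<close>

definition fiber_tensor ::
    "(real, 'u) module \<Rightarrow> mhs_data \<Rightarrow> mhs_data \<Rightarrow> 'u gr_elem \<Rightarrow> 'u gr_elem \<Rightarrow> 'u gr_elem" where
  "fiber_tensor A H H' x y =
     (\<lambda>m. \<Oplus>\<^bsub>gr A (str_map A) (mhs_tensor H H') m\<^esub>
        k \<in> {k. x k \<noteq> \<zero>\<^bsub>gr A (str_map A) H k\<^esub> \<and> y (m - k) \<noteq> \<zero>\<^bsub>gr A (str_map A) H' (m - k)\<^esub>}.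
          weight_ext A (str_map A) (mhs_tensor H H') (m - 1)
            <+>\<^bsub>free_module A {..<dim H * dim H'}\<^esub>
          {vec_tensor A (dim H) (dim H') u v | u v. u \<in> x k \<and> v \<in> y (m - k)})"


section \<open>Group schemes and their representations\<close>

text \<open>
  A group scheme over \<open>\<real>\<close> is given by its functor of points on \<open>\<real>\<close>-algebras. The functoriality is
  recorded by the graphs of the maps \<open>G(A) \<rightarrow> G(B)\<close>: for \<open>\<phi>\<close> in \<open>alg_hom A B\<close>, \<open>x\<close> in \<open>G(A)\<close> and \<open>y\<close>
  in \<open>G(B)\<close>, \<open>base_change A B \<phi> x y\<close> says that \<open>y\<close> is the image of \<open>x\<close>.
\<close>

record ('u, 'p) grp_functor =
  points :: "(real, 'u) module \<Rightarrow> 'p monoid"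
  base_change :: "(real, 'u) module \<Rightarrow> (real, 'u) module \<Rightarrow> ('u \<Rightarrow> 'u) \<Rightarrow> 'p \<Rightarrow> 'p \<Rightarrow> bool"

text \<open>The \<open>g\<close>-fold product of a group scheme with itself.\<close>

definition power_functor :: "nat \<Rightarrow> ('u, 'p) grp_functor \<Rightarrow> ('u, nat \<Rightarrow> 'p) grp_functor" where
  "power_functor g G =
     \<lparr>points = (\<lambda>A. product_group {..<g} (\<lambda>_. points G A)),
      base_change = (\<lambda>A B \<phi> x y. \<forall>\<mu><g. base_change G A B \<phi> (x \<mu>) (y \<mu>))\<rparr>"

type_synonym 'u tannaka_point = "mhs_data \<Rightarrow> 'u gr_elem \<Rightarrow> 'u gr_elem"

text \<open>
  The tannakian fundamental group \<open>Aut\<^sup>\<otimes>(\<omega>)\<close> of the category of mixed real Hodge structures: its group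
  of \<open>A\<close>-points consists of the \<open>A\<close>-linear automorphisms of \<open>\<omega> \<otimes> A\<close> which are natural and compatible
  with tensor products and with the unit object. The class of mixed Hodge structures is closed
  under tensor products, so \<open>K\<close> below is the tensor product of \<open>H\<close> and \<open>H'\<close> as an object.

  The image of \<open>g\<close> in \<open>G(A)\<close> under \<open>\<phi> : A \<rightarrow> B\<close> is the automorphism \<open>g \<otimes>\<^sub>A B\<close> of
  \<open>(\<omega>(H) \<otimes> A) \<otimes>\<^sub>A B = \<omega>(H) \<otimes> B\<close>, that is, the only \<open>B\<close>-linear map which agrees with \<open>g\<close> on the image
  of \<open>\<omega>(H) \<otimes> A\<close>.
\<close>

definition mhs_group :: "('u, 'u tannaka_point) grp_functor" where
  "mhs_group =
     \<lparr>points = (\<lambda>A. (product_group {H. is_mhs H} (\<lambda>H. GL A (fiber A H)))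
        \<lparr>carrier := {g \<in> (\<Pi>\<^sub>E H\<in>{H. is_mhs H}. carrier (GL A (fiber A H))).
           (\<forall>H H' f. is_mhs H \<and> is_mhs H' \<and> mhs_hom H H' f \<longrightarrow>
              (let \<omega>f = fiber_map A H' (alg_lin_map A {..<dim H} {..<dim H'} f) in
               \<forall>x\<in>carrier (fiber A H). g H' (\<omega>f x) = \<omega>f (g H x))) \<and>
           (\<forall>H H' K. is_mhs H \<and> is_mhs H' \<and> is_mhs K \<and> K = mhs_tensor H H' \<longrightarrow>
              (\<forall>x\<in>carrier (fiber A H). \<forall>y\<in>carrier (fiber A H').
                 g K (fiber_tensor A H H' x y) = fiber_tensor A H H' (g H x) (g H' y))) \<and>
           (\<forall>x\<in>carrier (fiber A mhs_unit). g mhs_unit x = x)}\<rparr>),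
      base_change = (\<lambda>A B \<phi> g h. \<forall>H. is_mhs H \<longrightarrow>
        (let \<phi>' = fiber_map B H (vec_map \<phi> {..<dim H}) in
         \<forall>x\<in>carrier (fiber A H). h H (\<phi>' x) = \<phi>' (g H x)))\<rparr>"

text \<open>
  A finite dimensional representation of \<open>G\<close>: a homomorphism of group functors from \<open>G\<close> to \<open>GL(V)\<close>,
  where \<open>V = \<real>\<^sup>I\<close> for a finite index set \<open>I\<close>, so that \<open>V \<otimes> A = A\<^sup>I\<close>.
\<close>

record ('i, 'u, 'p) rep_data =
  basis :: "'i set"
  act :: "(real, 'u) module \<Rightarrow> 'p \<Rightarrow> ('i \<Rightarrow> 'u) \<Rightarrow> ('i \<Rightarrow> 'u)"

definition is_rep :: "('u, 'p) grp_functor \<Rightarrow> ('i, 'u, 'p) rep_data \<Rightarrow> bool" where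
  "is_rep G V \<longleftrightarrow>
     finite (basis V) \<and>
     (\<forall>A. algebra real_ring A \<longrightarrow>
        act V A \<in> hom (points G A) (GL A (free_module A (basis V)))) \<and>
     (\<forall>A B \<phi> g h. algebra real_ring A \<and> algebra real_ring B \<and> \<phi> \<in> alg_hom A B \<and>
        g \<in> carrier (points G A) \<and> h \<in> carrier (points G B) \<and> base_change G A B \<phi> g h \<longrightarrow>
        (\<forall>x\<in>carrier (free_module A (basis V)).
           act V B h (vec_map \<phi> (basis V) x) = vec_map \<phi> (basis V) (act V A g x)))"

definition rep_hom ::
    "('u, 'p) grp_functor \<Rightarrow> ('i, 'u, 'p) rep_data \<Rightarrow> ('j, 'u, 'p) rep_data
     \<Rightarrow> ('j \<Rightarrow> 'i \<Rightarrow> real) \<Rightarrow> bool" where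
  "rep_hom G V V' f \<longleftrightarrow>
     (\<forall>A g x. algebra real_ring A \<and> g \<in> carrier (points G A) \<and>
        x \<in> carrier (free_module A (basis V)) \<longrightarrow>
        alg_lin_map A (basis V) (basis V') f (act V A g x)
          = act V' A g (alg_lin_map A (basis V) (basis V') f x))"

text \<open>The linear map of real vector spaces underlying a homomorphism of representations.\<close>

abbreviation rep_map ::
    "('i, 'u, 'p) rep_data \<Rightarrow> ('j, 'u, 'p) rep_data \<Rightarrow> ('j \<Rightarrow> 'i \<Rightarrow> real)
     \<Rightarrow> ('i \<Rightarrow> real) \<Rightarrow> ('j \<Rightarrow> real)" where
  "rep_map V V' f \<equiv> lin_map real_ring (\<lambda>r. r) (basis V) (basis V') f"

text \<open>
  \<open>V\<close> is isomorphic to a subquotient, i.e. to a quotient of a subrepresentation \<open>Y\<close>, of \<open>X\<close>.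
\<close>

definition iso_to_subquotient ::
    "('u, 'p) grp_functor \<Rightarrow> ('i, 'u, 'p) rep_data \<Rightarrow> ('j, 'u, 'p) rep_data \<Rightarrow> bool" where
  "iso_to_subquotient G V X \<longleftrightarrow>
     (\<exists>(Y :: (nat, 'u, 'p) rep_data) \<iota> \<pi>.
        is_rep G Y \<and>
        rep_hom G Y X \<iota> \<and>
        inj_on (rep_map Y X \<iota>) (carrier (free_module real_ring (basis Y))) \<and>
        rep_hom G Y V \<pi> \<and>
        rep_map Y V \<pi> ` carrier (free_module real_ring (basis Y))
          = carrier (free_module real_ring (basis V)))"

text \<open>
  The exterior product of \<open>V\<^sub>0, \<dots>, V\<^bsub>g-1\<^esub>\<close>. The vector space has the basis
  \<open>e\<^sub>i = e\<^bsub>i 0\<^esub> \<otimes> \<dots> \<otimes> e\<^bsub>i (g-1)\<^esub>\<close> for \<open>i\<close> in the product of the bases, and \<open>\<gamma> = (\<gamma>\<^sub>0, \<dots>, \<gamma>\<^bsub>g-1\<^esub>)\<close> acts by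
  \<open>\<gamma> e\<^sub>i = \<gamma>\<^sub>0 e\<^bsub>i 0\<^esub> \<otimes> \<dots> \<otimes> \<gamma>\<^bsub>g-1\<^esub> e\<^bsub>i (g-1)\<^esub>\<close>.
\<close>

definition exterior_product ::
    "nat \<Rightarrow> (nat \<Rightarrow> ('i, 'u, 'p) rep_data) \<Rightarrow> (nat \<Rightarrow> 'i, 'u, nat \<Rightarrow> 'p) rep_data" where
  "exterior_product g V =
     (let I = (\<Pi>\<^sub>E \<mu>\<in>{..<g}. basis (V \<mu>)) in
      \<lparr>basis = I,
       act = (\<lambda>A \<gamma>. \<lambda>x\<in>carrier (free_module A I). \<lambda>j\<in>I.
         \<Oplus>\<^bsub>A\<^esub>i\<in>I. x i \<otimes>\<^bsub>A\<^esub>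
           (\<Otimes>\<^bsub>A\<^esub>\<mu>\<in>{..<g}. act (V \<mu>) A (\<gamma> \<mu>) (unit_vec A (basis (V \<mu>)) (i \<mu>)) (j \<mu>)))\<rparr>)"

end

theory Submission
  imports Defs
begin

text \<open>
  Write \<open>\<rho>\<close> for the action of \<open>G\<^sup>g\<close> on \<open>V\<close>, and let \<open>B\<^sub>\<mu> \<subseteq> End(V)\<close> be the linear span of the matrices that occur in
  the action of the \<open>\<mu>\<close>-th copy of \<open>G\<close>: of all \<open>l(\<rho>(x))\<close>, where \<open>x\<close> is an \<open>A\<close>-point of this copy and the
  linear form \<open>l : A \<rightarrow> \<real>\<close> is applied to the entries. If there are enough algebras, this is the
  image of the dual of the coordinate ring of \<open>G\<close>, described without that ring. It is stable under left
  multiplication by the \<open>\<mu>\<close>-th copy of \<open>G\<close> and thereby a representation of \<open>G\<close> (\<open>factor_exists\<close>). Now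
  consider the linear map
  \<open>V \<otimes> B\<^sub>1 \<otimes> \<dots> \<otimes> B\<^bsub>g-1\<^esub> \<rightarrow> V\<close>, \<open>v \<otimes> b\<^sub>1 \<otimes> \<dots> \<otimes> b\<^bsub>g-1\<^esub> \<mapsto> b\<^bsub>g-1\<^esub> \<cdots> b\<^sub>1 v\<close>, where the copy of \<open>G\<close> with the number \<open>0\<close>
  acts on \<open>V\<close> and the \<open>\<mu>\<close>-th one on \<open>B\<^sub>\<mu>\<close>. It is equivariant, because different copies of \<open>G\<close> commute:
  \<open>(\<gamma>\<^bsub>g-1\<^esub> b\<^bsub>g-1\<^esub>) \<cdots> (\<gamma>\<^sub>1 b\<^sub>1) (\<gamma>\<^sub>0 v) = \<gamma>\<^bsub>g-1\<^esub> \<cdots> \<gamma>\<^sub>0 (b\<^bsub>g-1\<^esub> \<cdots> b\<^sub>1 v)\<close> (\<open>PM_equivariant\<close>). It is surjective,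
  because every \<open>B\<^sub>\<mu>\<close> contains the identity (\<open>PM_surj\<close>). Hence \<open>V\<close> is even a quotient of an exterior product.

  That \<open>B\<^sub>\<mu>\<close> is stable under left multiplication and commutes with the other copies has to be shown for
  points over different algebras \<open>A\<close> and \<open>A'\<close>. Both points are moved to \<open>A \<otimes> A'\<close>, where their product has
  the matrix entries in question (\<open>form_coeff_mult\<close>). This is why it must be known that points of \<open>G\<close> have
  images under homomorphisms of algebras (\<open>bc_group\<close>).

  For the tannakian group the base change of points is given as a relation, and the existence of the
  image of a point is a statement about \<open>\<omega>\<close>. The subspaces \<open>W\<^sub>k\<close> are images of real projection matrices.
  These matrices provide generators and linear coordinates of \<open>Gr\<^sub>k \<otimes> A\<close> which are compatible with base
  change, so that \<open>\<omega>(H) \<otimes> B\<close> is the scalar extension of \<open>\<omega>(H) \<otimes> A\<close> (\<open>scalar_ext_fiber\<close>). An automorphism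
  of \<open>\<omega> \<otimes> A\<close> therefore extends uniquely to \<open>\<omega> \<otimes> B\<close>, and the extension is again natural and compatible
  with tensor products, since both sides of the required identities are linear and agree on the image
  of \<open>\<omega> \<otimes> A\<close> (\<open>base_change_exists\<close>).
\<close>

section \<open>Rings, sums and linear forms\<close>

lemma real_ring_simps [simp]:
  "carrier real_ring = UNIV" "x \<otimes>\<^bsub>real_ring\<^esub> y = x * y" "\<one>\<^bsub>real_ring\<^esub> = 1"
  "\<zero>\<^bsub>real_ring\<^esub> = 0" "x \<oplus>\<^bsub>real_ring\<^esub> y = x + y"
  by (simp_all add: real_ring_def)

lemma cring_real_ring: "cring real_ring"
  by (rule cringI, rule abelian_groupI)
     (auto simp: algebra_simps intro!: comm_monoidI exI[of _ "- _"])

lemma finsum_real_ring [simp]: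
  assumes "finite I" shows "(\<Oplus>\<^bsub>real_ring\<^esub>i\<in>I. f i) = sum f I"
proof -
  interpret cring real_ring by (rule cring_real_ring)
  from assms show ?thesis by (induction I) auto
qed

context abelian_monoid
begin

lemma finsum_delta:
  assumes "finite I" "i \<in> I" "f i \<in> carrier G"
  shows "(\<Oplus>j\<in>I. if j = i then f j else \<zero>) = f i"
proof -
  have "(\<Oplus>j\<in>I. if j = i then f j else \<zero>) = (\<Oplus>j\<in>I. if j = i then f i else \<zero>)"
    by (rule add.finprod_cong') (use assms in auto)
  also have "\<dots> = f i"
    using add.finprod_singleton_swap[of i I "\<lambda>_. f i"] assms by auto
  finally show ?thesis .
qed

lemma finsum_swap:
  assumes "finite I" "finite J" "\<And>i j. i \<in> I \<Longrightarrow> j \<in> J \<Longrightarrow> f i j \<in> carrier G"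
  shows "(\<Oplus>i\<in>I. \<Oplus>j\<in>J. f i j) = (\<Oplus>j\<in>J. \<Oplus>i\<in>I. f i j)"
  using assms(1,3)
proof (induction I)
  case empty
  then show ?case by (simp add: add.finprod_one_eqI)
next
  case (insert a I)
  have "(\<Oplus>i\<in>insert a I. \<Oplus>j\<in>J. f i j) = (\<Oplus>j\<in>J. f a j) \<oplus> (\<Oplus>i\<in>I. \<Oplus>j\<in>J. f i j)"
    using insert by (subst finsum_insert) (auto intro!: finsum_closed)
  also have "\<dots> = (\<Oplus>j\<in>J. f a j) \<oplus> (\<Oplus>j\<in>J. \<Oplus>i\<in>I. f i j)"
    using insert by simp
  also have "\<dots> = (\<Oplus>j\<in>J. f a j \<oplus> (\<Oplus>i\<in>I. f i j))"
    using insert by (subst finsum_addf) (auto intro!: finsum_closed)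
  also have "\<dots> = (\<Oplus>j\<in>J. \<Oplus>i\<in>insert a I. f i j)"
    using insert by (intro finsum_cong') (auto intro!: finsum_closed)
  finally show ?case .
qed

lemma finsum_reindex_bij:
  assumes "bij_betw h I J" "f \<in> J \<rightarrow> carrier G"
  shows "(\<Oplus>j\<in>J. f j) = (\<Oplus>i\<in>I. f (h i))"
proof -
  from assms have "J = h ` I" "inj_on h I" by (auto simp: bij_betw_def)
  with assms show ?thesis using finsum_reindex[of f h I] by simp
qed

lemma finsum_Times:
  assumes "finite I" "finite J" "\<And>i j. i \<in> I \<Longrightarrow> j \<in> J \<Longrightarrow> f (i, j) \<in> carrier G"
  shows "(\<Oplus>p\<in>I \<times> J. f p) = (\<Oplus>i\<in>I. \<Oplus>j\<in>J. f (i, j))"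
  using assms(1,3)
proof (induction I)
  case empty
  then show ?case by simp
next
  case (insert a I)
  have eq: "insert a I \<times> J = Pair a ` J \<union> I \<times> J" by auto
  have "(\<Oplus>p\<in>insert a I \<times> J. f p) = (\<Oplus>p\<in>Pair a ` J. f p) \<oplus> (\<Oplus>p\<in>I \<times> J. f p)"
    unfolding eq using insert assms(2) by (intro finsum_Un_disjoint) auto
  also have "(\<Oplus>p\<in>Pair a ` J. f p) = (\<Oplus>j\<in>J. f (a, j))"
    using insert by (intro finsum_reindex) (auto simp: inj_on_def)
  finally show ?case
    using insert by (subst finsum_insert) (auto intro!: finsum_closed)
qed

lemma finsum_hom:
  assumes H: "abelian_monoid H"
    and h: "\<And>x y. x \<in> carrier G \<Longrightarrow> y \<in> carrier G \<Longrightarrow> h (x \<oplus> y) = h x \<oplus>\<^bsub>H\<^esub> h y"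
      "h \<zero> = \<zero>\<^bsub>H\<^esub>" "\<And>x. x \<in> carrier G \<Longrightarrow> h x \<in> carrier H"
    and "finite I" "\<And>i. i \<in> I \<Longrightarrow> f i \<in> carrier G"
  shows "h (\<Oplus>i\<in>I. f i) = (\<Oplus>\<^bsub>H\<^esub>i\<in>I. h (f i))"
proof -
  interpret H: abelian_monoid H by (rule H)
  from assms(5,6) show ?thesis
  proof (induction I)
    case (insert a I)
    then have "(\<Oplus>i\<in>I. f i) \<in> carrier G" by (intro finsum_closed) auto
    with insert h show ?case by (simp add: Pi_def)
  qed (use h in simp)
qed

end

text \<open>
  Linear forms turn identities over different algebras into identities between real numbers, and
  there are enough of them to get back.
\<close>

definition linear_form :: "(real, 'u) module \<Rightarrow> ('u \<Rightarrow> real) \<Rightarrow> bool" where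
  "linear_form A l \<longleftrightarrow>
     (\<forall>x\<in>carrier A. \<forall>y\<in>carrier A. l (x \<oplus>\<^bsub>A\<^esub> y) = l x + l y) \<and>
     (\<forall>r. \<forall>x\<in>carrier A. l (r \<odot>\<^bsub>A\<^esub> x) = r * l x)"

locale real_alg =
  fixes A :: "(real, 'u) module" (structure)
  assumes alg: "algebra real_ring A"

sublocale real_alg \<subseteq> A: cring A
  using alg by (rule algebra.M_cring)

sublocale real_alg \<subseteq> RM: module real_ring A
  using alg by (rule algebra.module)

context real_alg
begin

lemma smult_closed [simp, intro]: "x \<in> carrier A \<Longrightarrow> r \<odot> x \<in> carrier A"
  by (rule RM.smult_closed) auto

lemma smult_mult_assoc: "x \<in> carrier A \<Longrightarrow> y \<in> carrier A \<Longrightarrow> (r \<odot> x) \<otimes> y = r \<odot> (x \<otimes> y)"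
  using algebra.smult_assoc2[OF alg, of r x y] by simp

lemma mult_smult_assoc: "x \<in> carrier A \<Longrightarrow> y \<in> carrier A \<Longrightarrow> x \<otimes> (r \<odot> y) = r \<odot> (x \<otimes> y)"
  by (metis A.m_comm smult_closed smult_mult_assoc)

lemma smult_add_right: "x \<in> carrier A \<Longrightarrow> y \<in> carrier A \<Longrightarrow> r \<odot> (x \<oplus> y) = r \<odot> x \<oplus> r \<odot> y"
  by (rule RM.smult_r_distr) auto

lemma smult_add_left: "x \<in> carrier A \<Longrightarrow> (r + s) \<odot> x = r \<odot> x \<oplus> s \<odot> x"
  using RM.smult_l_distr[of r s x] by simp

lemma smult_smult: "x \<in> carrier A \<Longrightarrow> r \<odot> (s \<odot> x) = (r * s) \<odot> x"
  using RM.smult_assoc1[of r s x] by simp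

lemma smult_1 [simp]: "x \<in> carrier A \<Longrightarrow> 1 \<odot> x = x"
  using RM.smult_one[of x] by simp

lemma smult_0 [simp]: "x \<in> carrier A \<Longrightarrow> 0 \<odot> x = \<zero>"
  using RM.smult_l_null[of x] by simp

lemma smult_neg1: "x \<in> carrier A \<Longrightarrow> (- 1) \<odot> x = \<ominus> x"
  by (metis A.add.inv_equality add.left_inverse smult_0 smult_1 smult_add_left smult_closed)

lemma str_map_closed [simp]: "str_map A r \<in> carrier A"
  by (simp add: str_map_def)

lemma str_map_mult: "x \<in> carrier A \<Longrightarrow> str_map A r \<otimes> x = r \<odot> x"
  by (simp add: str_map_def smult_mult_assoc)

lemma str_map_mult': "x \<in> carrier A \<Longrightarrow> x \<otimes> str_map A r = r \<odot> x"
  by (subst A.m_comm) (auto simp: str_map_mult)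

lemma str_map_0 [simp]: "str_map A 0 = \<zero>" and str_map_1 [simp]: "str_map A 1 = \<one>"
  by (simp_all add: str_map_def)

lemma str_map_add: "str_map A (r + s) = str_map A r \<oplus> str_map A s"
  by (simp add: str_map_def smult_add_left)

lemma str_map_times: "str_map A (r * s) = str_map A r \<otimes> str_map A s"
  by (simp add: str_map_mult) (simp add: str_map_def smult_smult)

lemma str_map_sum: "finite I \<Longrightarrow> str_map A (sum f I) = (\<Oplus>i\<in>I. str_map A (f i))"
  by (induction I rule: finite_induct) (auto simp: str_map_add)

lemma linear_form_0: "linear_form A l \<Longrightarrow> l \<zero> = 0"
  unfolding linear_form_def by (metis A.zero_closed smult_0 mult_zero_left)

lemma linear_form_sum:
  assumes "linear_form A l" "finite I" "\<And>i. i \<in> I \<Longrightarrow> f i \<in> carrier A"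
  shows "l (\<Oplus>i\<in>I. f i) = (\<Sum>i\<in>I. l (f i))"
  using assms(2,3)
proof (induction I)
  case (insert a I)
  then have "(\<Oplus>i\<in>I. f i) \<in> carrier A" by (intro A.finsum_closed) auto
  with insert assms(1) show ?case by (simp add: Pi_def linear_form_def)
qed (simp add: linear_form_0[OF assms(1)])

text \<open>
  A submodule which is maximal among those avoiding \<open>v\<close> is a complement of the line \<open>\<real>v\<close>, and the
  projection to this line is a linear form.
\<close>

lemma linear_form_exists:
  assumes v: "v \<in> carrier A" "v \<noteq> \<zero>"
  shows "\<exists>l. linear_form A l \<and> l v = 1"
proof -
  define sub where "sub N \<longleftrightarrow> N \<subseteq> carrier A \<and> \<zero> \<in> N \<and> (\<forall>x\<in>N. \<forall>y\<in>N. x \<oplus> y \<in> N) \<and>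
     (\<forall>r. \<forall>x\<in>N. r \<odot> x \<in> N)" for N
  have "\<exists>M\<in>{N. sub N \<and> v \<notin> N}. \<forall>X\<in>{N. sub N \<and> v \<notin> N}. M \<subseteq> X \<longrightarrow> X = M"
  proof (rule subset_Zorn_nonempty)
    have "sub {\<zero>}"
      unfolding sub_def using RM.smult_r_null by auto
    with v show "{N. sub N \<and> v \<notin> N} \<noteq> {}" by blast
  next
    fix \<C> assume \<C>: "\<C> \<noteq> {}" "subset.chain {N. sub N \<and> v \<notin> N} \<C>"
    have ch: "\<And>X Y. X \<in> \<C> \<Longrightarrow> Y \<in> \<C> \<Longrightarrow> X \<subseteq> Y \<or> Y \<subseteq> X"
      using \<C>(2) by (auto simp: subset_chain_def)
    have s: "\<And>X. X \<in> \<C> \<Longrightarrow> sub X \<and> v \<notin> X"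
      using \<C>(2) by (auto simp: subset_chain_def)
    have "sub (\<Union>\<C>)"
      unfolding sub_def
    proof (intro conjI allI ballI)
      show "\<Union>\<C> \<subseteq> carrier A" using s unfolding sub_def by blast
      show "\<zero> \<in> \<Union>\<C>" using s \<C>(1) by (auto simp: sub_def)
      fix x y assume "x \<in> \<Union>\<C>" "y \<in> \<Union>\<C>"
      then obtain X Y where "X \<in> \<C>" "Y \<in> \<C>" "x \<in> X" "y \<in> Y" by blast
      with ch[of X Y] s[of X] s[of Y] show "x \<oplus> y \<in> \<Union>\<C>" unfolding sub_def by blast
    next
      fix r x assume "x \<in> \<Union>\<C>"
      with s show "r \<odot> x \<in> \<Union>\<C>" unfolding sub_def by blast
    qed
    with s show "\<Union>\<C> \<in> {N. sub N \<and> v \<notin> N}" by blast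
  qed
  then obtain M where M: "sub M" "v \<notin> M" and max: "\<And>X. sub X \<Longrightarrow> v \<notin> X \<Longrightarrow> M \<subseteq> X \<Longrightarrow> X = M"
    by blast
  have Mc: "M \<subseteq> carrier A" and M0: "\<zero> \<in> M" and Ma: "\<And>x y. x \<in> M \<Longrightarrow> y \<in> M \<Longrightarrow> x \<oplus> y \<in> M"
    and Ms: "\<And>r x. x \<in> M \<Longrightarrow> r \<odot> x \<in> M"
    using M by (auto simp: sub_def)
  \<comment> \<open>By maximality, \<open>M + \<real>x\<close> contains \<open>v\<close> unless \<open>x\<close> is in \<open>M\<close>.\<close>
  have ex: "\<exists>r. \<exists>n\<in>M. x = n \<oplus> r \<odot> v" if x: "x \<in> carrier A" for x
  proof (cases "x \<in> M")
    case True
    then show ?thesis using v Mc by (intro exI[of _ 0] bexI[of _ x]) auto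
  next
    case False
    define X where "X = {n \<oplus> r \<odot> x | n r. n \<in> M}"
    have "sub X"
      unfolding sub_def
    proof (intro conjI allI ballI)
      show "X \<subseteq> carrier A" using Mc x by (auto simp: X_def)
      show "\<zero> \<in> X" using M0 x unfolding X_def by (auto intro!: exI[of _ \<zero>] exI[of _ 0])
    next
      fix a b assume "a \<in> X" "b \<in> X"
      then obtain n r n' r' where "a = n \<oplus> r \<odot> x" "b = n' \<oplus> r' \<odot> x" "n \<in> M" "n' \<in> M"
        by (auto simp: X_def)
      moreover from this have "a \<oplus> b = (n \<oplus> n') \<oplus> (r + r') \<odot> x"
        using x Mc by (simp add: smult_add_left subset_iff A.add.m_ac)
      ultimately show "a \<oplus> b \<in> X" unfolding X_def using Ma by blast
    next
      fix s a assume "a \<in> X"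
      then obtain n r where *: "a = n \<oplus> r \<odot> x" "n \<in> M" by (auto simp: X_def)
      then have "s \<odot> a = s \<odot> n \<oplus> (s * r) \<odot> x"
        using x Mc by (simp add: smult_add_right subset_iff smult_smult)
      with * show "s \<odot> a \<in> X" unfolding X_def using Ms by blast
    qed
    moreover have "M \<subseteq> X"
    proof
      fix n assume n: "n \<in> M"
      with Mc x have "n = n \<oplus> 0 \<odot> x" by (simp add: subset_iff)
      with n show "n \<in> X" unfolding X_def by blast
    qed
    moreover have "x \<in> X"
    proof -
      have "x = \<zero> \<oplus> 1 \<odot> x" using x by simp
      with M0 show ?thesis unfolding X_def by blast
    qed
    ultimately have "v \<in> X" using max[of X] False by blast
    then obtain n r where n: "n \<in> M" "v = n \<oplus> r \<odot> x" by (auto simp: X_def)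
    have "r \<noteq> 0"
      using n Mc x M(2) by (auto simp: subset_iff)
    have nc: "n \<in> carrier A" using n Mc by auto
    have "(1 / r) \<odot> v = (1 / r) \<odot> n \<oplus> x"
      using n(2) \<open>r \<noteq> 0\<close> nc x by (simp add: smult_add_right smult_smult)
    then have "(- (1 / r)) \<odot> n \<oplus> (1 / r) \<odot> v = ((- (1 / r)) \<odot> n \<oplus> (1 / r) \<odot> n) \<oplus> x"
      using nc x by (simp add: A.add.m_assoc)
    also have "(- (1 / r)) \<odot> n \<oplus> (1 / r) \<odot> n = \<zero>"
      using nc smult_add_left[of n "- (1 / r)" "1 / r"] by simp
    finally have "x = (- (1 / r)) \<odot> n \<oplus> (1 / r) \<odot> v" using x by simp
    with Ms n show ?thesis by blast
  qed
  have uniq: "r = r'" if "n \<in> M" "n' \<in> M" "n \<oplus> r \<odot> v = n' \<oplus> r' \<odot> v" for n n' r r'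
  proof (rule ccontr)
    assume "r \<noteq> r'"
    have c: "n \<in> carrier A" "n' \<in> carrier A" using that Mc by auto
    have "(r - r') \<odot> v = n' \<oplus> (- 1) \<odot> n"
    proof -
      have "(r - r') \<odot> v = r \<odot> v \<oplus> (- r') \<odot> v"
        using v smult_add_left[of v r "- r'"] by simp
      also have "\<dots> = (n \<oplus> r \<odot> v) \<oplus> ((- 1) \<odot> n \<oplus> (- r') \<odot> v)"
        using c v by (simp add: smult_neg1) (simp add: A.add.m_ac A.r_neg1 A.r_neg2)
      also have "\<dots> = (n' \<oplus> r' \<odot> v) \<oplus> ((- 1) \<odot> n \<oplus> (- r') \<odot> v)"
        using that by simp
      also have "\<dots> = n' \<oplus> (- 1) \<odot> n \<oplus> (r' \<odot> v \<oplus> (- r') \<odot> v)"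
        using c v by (simp add: A.add.m_ac)
      also have "r' \<odot> v \<oplus> (- r') \<odot> v = \<zero>"
        using v smult_add_left[of v r' "- r'"] by simp
      finally show ?thesis using c by simp
    qed
    with Ma Ms that have "(r - r') \<odot> v \<in> M" by metis
    from Ms[OF this, of "1 / (r - r')"] have "v \<in> M"
      using \<open>r \<noteq> r'\<close> v by (simp add: smult_smult)
    with M show False by simp
  qed
  define l where "l x = (THE r. \<exists>n\<in>M. x = n \<oplus> r \<odot> v)" for x
  have l: "l (n \<oplus> r \<odot> v) = r" if "n \<in> M" for n r
    unfolding l_def using that uniq by blast
  have "linear_form A l"
    unfolding linear_form_def
  proof (intro conjI ballI allI)
    fix x y assume "x \<in> carrier A" "y \<in> carrier A"
    with ex obtain r n s m where *: "n \<in> M" "m \<in> M" "x = n \<oplus> r \<odot> v" "y = m \<oplus> s \<odot> v" by metis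
    then have "x \<oplus> y = (n \<oplus> m) \<oplus> (r + s) \<odot> v"
      using v Mc by (simp add: smult_add_left subset_iff A.add.m_ac)
    with * l Ma show "l (x \<oplus> y) = l x + l y" by metis
  next
    fix s x assume "x \<in> carrier A"
    with ex obtain r n where *: "n \<in> M" "x = n \<oplus> r \<odot> v" by metis
    then have "s \<odot> x = s \<odot> n \<oplus> (s * r) \<odot> v"
      using v Mc by (simp add: smult_add_right subset_iff smult_smult)
    with * l Ms show "l (s \<odot> x) = s * l x" by metis
  qed
  moreover have "l v = 1" using l[OF M0, of 1] v by simp
  ultimately show ?thesis by blast
qed

lemma linear_forms_separate:
  assumes "x \<in> carrier A" "y \<in> carrier A" "\<And>l. linear_form A l \<Longrightarrow> l x = l y"
  shows "x = y"
proof (rule ccontr)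
  assume "x \<noteq> y"
  then have "x \<ominus> y \<noteq> \<zero>" using assms(1,2) by (metis A.minus_eq A.a_inv_closed A.minus_minus A.sum_zero_eq_neg)
  with linear_form_exists[of "x \<ominus> y"] assms obtain l where l: "linear_form A l" "l (x \<ominus> y) = 1"
    by auto
  have "x \<ominus> y = x \<oplus> (- 1) \<odot> y"
    using assms by (simp add: smult_neg1 a_minus_def)
  with l assms have "l x - l y = 1" by (simp add: linear_form_def)
  with assms(3)[OF l(1)] show False by simp
qed

end

section \<open>Bases adapted to coordinates\<close>

text \<open>
  Gauss elimination: a vector in \<open>S\<close> is determined by its coordinates at the pivots \<open>p\<^sub>0, p\<^sub>1, \<dots>\<close>, and
  these may be prescribed. A maximal set of pivots has this property, because a nonzero vector that
  vanishes at all pivots provides a new one.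
\<close>

lemma echelon_basis:
  fixes S :: "('k \<Rightarrow> real) set"
  assumes I: "finite I"
    and S: "\<And>a b u v. u \<in> S \<Longrightarrow> v \<in> S \<Longrightarrow> (\<lambda>i. a * u i + b * v i) \<in> S"
  shows "\<exists>(n :: nat) s p. (\<forall>j<n. s j \<in> S) \<and> (\<forall>j<n. p j \<in> I) \<and>
    (\<forall>i<n. \<forall>j<n. s j (p i) = (if i = j then 1 else 0)) \<and>
    (\<forall>v\<in>S. \<forall>i\<in>I. v i = (\<Sum>j<n. v (p j) * s j i))"
proof -
  define Q where "Q J s \<longleftrightarrow> J \<subseteq> I \<and> (\<forall>j\<in>J. s j \<in> S) \<and>
    (\<forall>i\<in>J. \<forall>j\<in>J. s j i = (if i = j then 1 else 0))" for J and s :: "'k \<Rightarrow> 'k \<Rightarrow> real"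
  define K where "K = (GREATEST k. \<exists>J s. Q J s \<and> card J = k)"
  have "Q {} (\<lambda>_ _. 0)" by (simp add: Q_def)
  then have ex: "\<exists>J s. Q J s \<and> card J = 0" by force
  have bound: "\<forall>k. (\<exists>J s. Q J s \<and> card J = k) \<longrightarrow> k \<le> card I"
    using I by (auto simp: Q_def card_mono)
  obtain J s where Q: "Q J s" and "card J = K"
    using GreatestI_nat[of "\<lambda>k. \<exists>J s. Q J s \<and> card J = k", OF ex] bound unfolding K_def by blast
  moreover have "card J' \<le> K" if "Q J' s'" for J' s'
    unfolding K_def using that bound
    by (intro Greatest_le_nat[of "\<lambda>k. \<exists>J s. Q J s \<and> card J = k" _ "card I"]) auto
  ultimately have max: "card J' \<le> card J" if "Q J' s'" for J' s' using that by blast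
  have finJ: "finite J" using Q I finite_subset by (auto simp: Q_def)
  have sS: "\<And>j. j \<in> J \<Longrightarrow> s j \<in> S" and sd: "\<And>i j. i \<in> J \<Longrightarrow> j \<in> J \<Longrightarrow> s j i = (if i = j then 1 else 0)"
    and JI: "J \<subseteq> I" using Q by (auto simp: Q_def)
  have rep: "v i = (\<Sum>j\<in>J. v j * s j i)" if v: "v \<in> S" and i: "i \<in> I" for v i
  proof (rule ccontr)
    assume ne: "v i \<noteq> (\<Sum>j\<in>J. v j * s j i)"
    define r where "r = (\<lambda>i. v i - (\<Sum>j\<in>J. v j * s j i))"
    have "(\<lambda>i. v i - (\<Sum>j\<in>K. v j * s j i)) \<in> S" if "finite K" "K \<subseteq> J" for K
      using that
    proof (induction K)
      case empty
      from S[OF v v, of 1 0] show ?case by simp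
    next
      case (insert a K)
      then have "(\<lambda>i. v i - (\<Sum>j\<in>K. v j * s j i)) \<in> S" "s a \<in> S" using sS by auto
      from S[OF this, of 1 "- v a"] show ?case using insert by (simp add: algebra_simps)
    qed
    from this[OF finJ] have rS: "r \<in> S" by (simp add: r_def)
    have r0: "r j = 0" if "j \<in> J" for j
    proof -
      have "(\<Sum>l\<in>J. v l * s l j) = (\<Sum>l\<in>J. if l = j then v l else 0)"
        using that sd by (intro sum.cong) auto
      also have "\<dots> = v j" using that finJ by simp
      finally show ?thesis by (simp add: r_def)
    qed
    have ri: "r i \<noteq> 0" using ne by (simp add: r_def)
    then have iJ: "i \<notin> J" using r0 by auto
    define t where "t = (\<lambda>k. 1 / r i * r k + 0 * r k)"
    have tS: "t \<in> S" unfolding t_def by (rule S[OF rS rS])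
    define s' where "s' j = (if j = i then t else (\<lambda>k. 1 * s j k + (- s j i) * t k))" for j
    have "Q (insert i J) s'"
      unfolding Q_def
    proof (intro conjI ballI)
      show "insert i J \<subseteq> I" using i JI by auto
      show "s' j \<in> S" if "j \<in> insert i J" for j
        using that tS sS S[OF sS tS, of j 1 "- s j i"] by (auto simp: s'_def)
      show "s' l k = (if k = l then 1 else 0)" if "k \<in> insert i J" "l \<in> insert i J" for k l
        using that iJ ri r0 sd by (auto simp: s'_def t_def)
    qed
    from max[OF this] show False using iJ finJ by simp
  qed
  obtain p where p: "bij_betw p {..<card J} J"
    using ex_bij_betw_nat_finite[OF finJ] by (auto simp: atLeast0LessThan)
  have pJ: "\<And>j. j < card J \<Longrightarrow> p j \<in> J" using p by (auto simp: bij_betw_def)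
  have pi: "\<And>i j. i < card J \<Longrightarrow> j < card J \<Longrightarrow> p i = p j \<longleftrightarrow> i = j"
    using p by (auto simp: bij_betw_def inj_on_def)
  show ?thesis
  proof (intro exI[of _ "card J"] exI[of _ "\<lambda>j. s (p j)"] exI[of _ p] conjI ballI)
    show "v i = (\<Sum>j<card J. v (p j) * s (p j) i)" if "v \<in> S" "i \<in> I" for v i
      using rep[OF that] sum.reindex_bij_betw[OF p, of "\<lambda>j. v j * s j i"] by simp
  qed (use pJ sS JI sd pi in auto)
qed

inductive_set fun_span :: "('k \<Rightarrow> real) set \<Rightarrow> ('k \<Rightarrow> real) set" for S where
  base: "v \<in> S \<Longrightarrow> v \<in> fun_span S"
| comb: "u \<in> fun_span S \<Longrightarrow> v \<in> fun_span S \<Longrightarrow> (\<lambda>i. a * u i + b * v i) \<in> fun_span S"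


section \<open>Tensor products of algebras\<close>

text \<open>
  The tensor product of two algebras \<open>A\<close> and \<open>B\<close>, realized inside the space of functions on the
  bilinear forms: \<open>a \<otimes> b\<close> is evaluation at \<open>(a, b)\<close>. The product of \<open>s\<close> and \<open>t\<close> is then the
  convolution \<open>F \<mapsto> s (x \<mapsto> t (y \<mapsto> F (x y)))\<close>, for which no choice of representatives is needed.
\<close>

definition bilinear_forms :: "(real, 'u) module \<Rightarrow> (real, 'v) module \<Rightarrow> ('u \<Rightarrow> 'v \<Rightarrow> real) set" where
  "bilinear_forms A B = {F.
     (\<forall>x\<in>carrier A. \<forall>x'\<in>carrier A. \<forall>y\<in>carrier B. F (x \<oplus>\<^bsub>A\<^esub> x') y = F x y + F x' y) \<and>
     (\<forall>x\<in>carrier A. \<forall>y\<in>carrier B. \<forall>y'\<in>carrier B. F x (y \<oplus>\<^bsub>B\<^esub> y') = F x y + F x y') \<and>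
     (\<forall>r. \<forall>x\<in>carrier A. \<forall>y\<in>carrier B. F (r \<odot>\<^bsub>A\<^esub> x) y = r * F x y) \<and>
     (\<forall>r. \<forall>x\<in>carrier A. \<forall>y\<in>carrier B. F x (r \<odot>\<^bsub>B\<^esub> y) = r * F x y)}"

definition tens_elem ::
    "(real, 'u) module \<Rightarrow> (real, 'v) module \<Rightarrow> ('u \<times> 'v) list \<Rightarrow> ('u \<Rightarrow> 'v \<Rightarrow> real) \<Rightarrow> real" where
  "tens_elem A B L = (\<lambda>F. if F \<in> bilinear_forms A B then (\<Sum>(a, b)\<leftarrow>L. F a b) else 0)"

definition tens_alg ::
    "(real, 'u) module \<Rightarrow> (real, 'v) module \<Rightarrow> (real, ('u \<Rightarrow> 'v \<Rightarrow> real) \<Rightarrow> real) module" where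
  "tens_alg A B =
     \<lparr>carrier = tens_elem A B ` lists (carrier A \<times> carrier B),
      monoid.mult = (\<lambda>s t F. if F \<in> bilinear_forms A B
        then s (\<lambda>x y. t (\<lambda>x' y'. F (x \<otimes>\<^bsub>A\<^esub> x') (y \<otimes>\<^bsub>B\<^esub> y'))) else 0),
      one = tens_elem A B [(\<one>\<^bsub>A\<^esub>, \<one>\<^bsub>B\<^esub>)],
      ring.zero = tens_elem A B [],
      add = (\<lambda>s t F. s F + t F),
      smult = (\<lambda>r s F. r * s F)\<rparr>"

locale two_algs = A: real_alg A + B: real_alg B
  for A :: "(real, 'u) module" and B :: "(real, 'v) module"
begin

abbreviation "T \<equiv> tens_alg A B"
abbreviation "Bil \<equiv> bilinear_forms A B"
abbreviation "te \<equiv> tens_elem A B"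
abbreviation "LL \<equiv> lists (carrier A \<times> carrier B)"

lemma te_Bil: "F \<in> Bil \<Longrightarrow> te L F = (\<Sum>(a, b)\<leftarrow>L. F a b)"
  by (simp add: tens_elem_def)

lemma te_notBil: "F \<notin> Bil \<Longrightarrow> te L F = 0"
  by (simp add: tens_elem_def)

lemma carrier_T: "t \<in> carrier T \<longleftrightarrow> (\<exists>L\<in>LL. t = te L)"
  by (auto simp: tens_alg_def)

lemma T_add: "s \<oplus>\<^bsub>T\<^esub> t = (\<lambda>F. s F + t F)" and T_smult: "r \<odot>\<^bsub>T\<^esub> s = (\<lambda>F. r * s F)"
  and T_zero: "\<zero>\<^bsub>T\<^esub> = te []" and T_one: "\<one>\<^bsub>T\<^esub> = te [(\<one>\<^bsub>A\<^esub>, \<one>\<^bsub>B\<^esub>)]"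
  and T_mult: "s \<otimes>\<^bsub>T\<^esub> t =
    (\<lambda>F. if F \<in> Bil then s (\<lambda>x y. t (\<lambda>x' y'. F (x \<otimes>\<^bsub>A\<^esub> x') (y \<otimes>\<^bsub>B\<^esub> y'))) else 0)"
  by (simp_all add: tens_alg_def)

lemma add_te: "te L \<oplus>\<^bsub>T\<^esub> te M = te (L @ M)"
  by (auto simp: T_add tens_elem_def)

lemma smult_te: assumes "L \<in> LL" shows "r \<odot>\<^bsub>T\<^esub> te L = te (map (\<lambda>(a, b). (r \<odot>\<^bsub>A\<^esub> a, b)) L)"
proof
  fix F show "(r \<odot>\<^bsub>T\<^esub> te L) F = te (map (\<lambda>(a, b). (r \<odot>\<^bsub>A\<^esub> a, b)) L) F"
  proof (cases "F \<in> Bil")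
    case True
    with assms show ?thesis
      by (induction L) (auto simp: T_smult te_Bil bilinear_forms_def distrib_left)
  qed (simp add: T_smult te_notBil)
qed

lemma Bil_translate:
  assumes "F \<in> Bil" "x \<in> carrier A" "y \<in> carrier B"
  shows "(\<lambda>x' y'. F (x \<otimes>\<^bsub>A\<^esub> x') (y \<otimes>\<^bsub>B\<^esub> y')) \<in> Bil"
  using assms unfolding bilinear_forms_def
  by (auto simp: A.A.r_distr B.A.r_distr A.mult_smult_assoc B.mult_smult_assoc)

lemma Bil_translate':
  assumes "F \<in> Bil" "x \<in> carrier A" "y \<in> carrier B"
  shows "(\<lambda>x' y'. F (x' \<otimes>\<^bsub>A\<^esub> x) (y' \<otimes>\<^bsub>B\<^esub> y)) \<in> Bil"
  using assms unfolding bilinear_forms_def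
  by (auto simp: A.A.l_distr B.A.l_distr A.smult_mult_assoc B.smult_mult_assoc)

lemma Bil_conv:
  assumes F: "F \<in> Bil" and L: "L \<in> LL"
  shows "(\<lambda>x y. \<Sum>(a, b)\<leftarrow>L. F (x \<otimes>\<^bsub>A\<^esub> a) (y \<otimes>\<^bsub>B\<^esub> b)) \<in> Bil"
  using L
proof (induction L)
  case Nil
  then show ?case by (simp add: bilinear_forms_def)
next
  case (Cons ab L)
  obtain a b where ab: "ab = (a, b)" by (cases ab)
  from Cons ab have "(\<lambda>x' y'. F (x' \<otimes>\<^bsub>A\<^esub> a) (y' \<otimes>\<^bsub>B\<^esub> b)) \<in> Bil"
    using Bil_translate'[OF F] by auto
  with Cons ab show ?case by (auto simp: bilinear_forms_def algebra_simps)
qed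

text \<open>
  Bilinear forms are evaluated on the carriers only. Elsewhere their values are arbitrary, and the
  ring axioms may fail for the expressions which occur in a convolution.
\<close>

lemma Bil_cong:
  assumes "\<And>x y. x \<in> carrier A \<Longrightarrow> y \<in> carrier B \<Longrightarrow> F x y = F' x y"
  shows "F \<in> Bil \<longleftrightarrow> F' \<in> Bil"
proof -
  have *: "F' \<in> Bil" if "F \<in> Bil" "\<And>x y. x \<in> carrier A \<Longrightarrow> y \<in> carrier B \<Longrightarrow> F x y = F' x y" for F F'
    using that(1) unfolding bilinear_forms_def by (auto simp: that(2)[symmetric])
  show ?thesis using *[of F F'] *[of F' F] assms by force
qed

lemma te_cong:
  assumes L: "L \<in> LL" and eq: "\<And>x y. x \<in> carrier A \<Longrightarrow> y \<in> carrier B \<Longrightarrow> F x y = F' x y"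
  shows "te L F = te L F'"
proof -
  have "F \<in> Bil \<longleftrightarrow> F' \<in> Bil" by (rule Bil_cong) (rule eq)
  moreover have "(\<Sum>(a, b)\<leftarrow>L. F a b) = (\<Sum>(a, b)\<leftarrow>L. F' a b)"
    using L by (induction L) (auto simp: eq)
  ultimately show ?thesis by (simp add: tens_elem_def)
qed

lemma mult_te_eval:
  assumes L: "L \<in> LL" and M: "M \<in> LL" and F: "F \<in> Bil"
  shows "(te L \<otimes>\<^bsub>T\<^esub> te M) F = (\<Sum>(a, b)\<leftarrow>L. \<Sum>(c, d)\<leftarrow>M. F (a \<otimes>\<^bsub>A\<^esub> c) (b \<otimes>\<^bsub>B\<^esub> d))"
proof -
  have eq: "te M (\<lambda>x' y'. F (x \<otimes>\<^bsub>A\<^esub> x') (y \<otimes>\<^bsub>B\<^esub> y')) = (\<Sum>(c, d)\<leftarrow>M. F (x \<otimes>\<^bsub>A\<^esub> c) (y \<otimes>\<^bsub>B\<^esub> d))"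
    if "x \<in> carrier A" "y \<in> carrier B" for x y
    using Bil_translate[OF F that] by (simp add: te_Bil)
  have "(te L \<otimes>\<^bsub>T\<^esub> te M) F = te L (\<lambda>x y. \<Sum>(c, d)\<leftarrow>M. F (x \<otimes>\<^bsub>A\<^esub> c) (y \<otimes>\<^bsub>B\<^esub> d))"
    unfolding T_mult using F by simp (intro te_cong L eq)
  then show ?thesis using Bil_conv[OF F M] by (simp add: te_Bil)
qed

lemma mult_te:
  assumes L: "L \<in> LL" and M: "M \<in> LL"
  shows "te L \<otimes>\<^bsub>T\<^esub> te M = te (concat (map (\<lambda>(a, b). map (\<lambda>(c, d). (a \<otimes>\<^bsub>A\<^esub> c, b \<otimes>\<^bsub>B\<^esub> d)) M) L))"
    (is "_ = te (?N L)")
proof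
  fix F show "(te L \<otimes>\<^bsub>T\<^esub> te M) F = te (?N L) F"
  proof (cases "F \<in> Bil")
    case True
    have "(\<Sum>(x, y)\<leftarrow>map (\<lambda>(c, d). (a \<otimes>\<^bsub>A\<^esub> c, b \<otimes>\<^bsub>B\<^esub> d)) M'. F x y) =
        (\<Sum>(c, d)\<leftarrow>M'. F (a \<otimes>\<^bsub>A\<^esub> c) (b \<otimes>\<^bsub>B\<^esub> d))" for a b M'
      by (induction M') auto
    then have "(\<Sum>(a, b)\<leftarrow>?N L. F a b) = (\<Sum>(a, b)\<leftarrow>L. \<Sum>(c, d)\<leftarrow>M. F (a \<otimes>\<^bsub>A\<^esub> c) (b \<otimes>\<^bsub>B\<^esub> d))"
      by (induction L) auto
    with True mult_te_eval[OF L M True] show ?thesis by (simp add: te_Bil)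
  qed (simp add: T_mult te_notBil)
qed

lemma mult_LL:
  "L \<in> LL \<Longrightarrow> M \<in> LL \<Longrightarrow> concat (map (\<lambda>(a, b). map (\<lambda>(c, d). (a \<otimes>\<^bsub>A\<^esub> c, b \<otimes>\<^bsub>B\<^esub> d)) M) L) \<in> LL"
proof (induction L)
  case (Cons p L)
  have "map (\<lambda>(c, d). (a \<otimes>\<^bsub>A\<^esub> c, b \<otimes>\<^bsub>B\<^esub> d)) M \<in> LL" if "a \<in> carrier A" "b \<in> carrier B" for a b
    using Cons.prems(2) that by (induction M) auto
  with Cons show ?case by auto
qed simp

lemma mult_comm_te:
  assumes L: "L \<in> LL" and M: "M \<in> LL"
  shows "te L \<otimes>\<^bsub>T\<^esub> te M = te M \<otimes>\<^bsub>T\<^esub> te L"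
proof
  fix F show "(te L \<otimes>\<^bsub>T\<^esub> te M) F = (te M \<otimes>\<^bsub>T\<^esub> te L) F"
  proof (cases "F \<in> Bil")
    case True
    have swap: "(\<Sum>p\<leftarrow>L'. \<Sum>q\<leftarrow>M'. f p q) = (\<Sum>q\<leftarrow>M'. \<Sum>p\<leftarrow>L'. f p q)"
      for L' :: "'x list" and M' :: "'y list" and f :: "'x \<Rightarrow> 'y \<Rightarrow> real"
      by (induction L') (auto simp: sum_list_addf)
    have "(\<Sum>(a, b)\<leftarrow>L. \<Sum>(c, d)\<leftarrow>M. F (a \<otimes>\<^bsub>A\<^esub> c) (b \<otimes>\<^bsub>B\<^esub> d)) =
        (\<Sum>p\<leftarrow>L. \<Sum>q\<leftarrow>M. F (fst p \<otimes>\<^bsub>A\<^esub> fst q) (snd p \<otimes>\<^bsub>B\<^esub> snd q))"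
      by (simp add: case_prod_unfold)
    also have "\<dots> = (\<Sum>q\<leftarrow>M. \<Sum>p\<leftarrow>L. F (fst p \<otimes>\<^bsub>A\<^esub> fst q) (snd p \<otimes>\<^bsub>B\<^esub> snd q))"
      by (rule swap)
    also have "\<dots> = (\<Sum>q\<leftarrow>M. \<Sum>p\<leftarrow>L. F (fst q \<otimes>\<^bsub>A\<^esub> fst p) (snd q \<otimes>\<^bsub>B\<^esub> snd p))"
    proof (intro arg_cong[of _ _ sum_list] map_cong refl)
      fix p q assume "q \<in> set M" "p \<in> set L"
      with L M have "p \<in> carrier A \<times> carrier B" "q \<in> carrier A \<times> carrier B"
        unfolding in_lists_conv_set by blast+
      then show "F (fst p \<otimes>\<^bsub>A\<^esub> fst q) (snd p \<otimes>\<^bsub>B\<^esub> snd q) = F (fst q \<otimes>\<^bsub>A\<^esub> fst p) (snd q \<otimes>\<^bsub>B\<^esub> snd p)"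
        using A.A.m_comm[of "fst p" "fst q"] B.A.m_comm[of "snd p" "snd q"] by (simp add: mem_Times_iff)
    qed
    finally show ?thesis
      by (simp add: mult_te_eval[OF L M True] mult_te_eval[OF M L True] case_prod_unfold)
  qed (simp add: T_mult)
qed

lemma algebra_T: "algebra real_ring T"
proof -
  have closed: "s \<otimes>\<^bsub>T\<^esub> t \<in> carrier T" "s \<oplus>\<^bsub>T\<^esub> t \<in> carrier T" "r \<odot>\<^bsub>T\<^esub> s \<in> carrier T"
    if "s \<in> carrier T" "t \<in> carrier T" for r s t
  proof -
    from that obtain L M where *: "L \<in> LL" "M \<in> LL" "s = te L" "t = te M" by (auto simp: carrier_T)
    show "s \<otimes>\<^bsub>T\<^esub> t \<in> carrier T" using * mult_LL[of L M] by (auto simp: mult_te carrier_T)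
    have "L @ M \<in> LL" using * by auto
    then show "s \<oplus>\<^bsub>T\<^esub> t \<in> carrier T" using * add_te[of L M] unfolding carrier_T by blast
    have "map (\<lambda>(a, b). (r \<odot>\<^bsub>A\<^esub> a, b)) L \<in> LL" using * by (auto simp: in_lists_conv_set)
    then show "r \<odot>\<^bsub>T\<^esub> s \<in> carrier T" using * smult_te[of L r] unfolding carrier_T by blast
  qed
  have zero: "\<zero>\<^bsub>T\<^esub> \<in> carrier T" by (auto simp: carrier_T T_zero intro!: bexI[of _ "[]"])
  have one: "\<one>\<^bsub>T\<^esub> \<in> carrier T"
    by (auto simp: carrier_T T_one intro!: bexI[of _ "[(\<one>\<^bsub>A\<^esub>, \<one>\<^bsub>B\<^esub>)]"])
  have comm: "s \<otimes>\<^bsub>T\<^esub> t = t \<otimes>\<^bsub>T\<^esub> s" if "s \<in> carrier T" "t \<in> carrier T" for s t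
    using that mult_comm_te unfolding carrier_T by blast
  have assoc: "(s \<otimes>\<^bsub>T\<^esub> t) \<otimes>\<^bsub>T\<^esub> u = s \<otimes>\<^bsub>T\<^esub> (t \<otimes>\<^bsub>T\<^esub> u)"
    if "s \<in> carrier T" "t \<in> carrier T" "u \<in> carrier T" for s t u
  proof
    fix F
    from that obtain L M N where *: "L \<in> LL" "M \<in> LL" "N \<in> LL" "s = te L" "t = te M" "u = te N"
      by (auto simp: carrier_T)
    show "((s \<otimes>\<^bsub>T\<^esub> t) \<otimes>\<^bsub>T\<^esub> u) F = (s \<otimes>\<^bsub>T\<^esub> (t \<otimes>\<^bsub>T\<^esub> u)) F"
    proof (cases "F \<in> Bil")
      case True
      define G where "G = (\<lambda>x y. \<Sum>(a, b)\<leftarrow>N. F (x \<otimes>\<^bsub>A\<^esub> a) (y \<otimes>\<^bsub>B\<^esub> b))"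
      have G: "G \<in> Bil" unfolding G_def by (rule Bil_conv[OF True *(3)])
      have uG: "u (\<lambda>x' y'. F (x \<otimes>\<^bsub>A\<^esub> x') (y \<otimes>\<^bsub>B\<^esub> y')) = G x y"
        if "x \<in> carrier A" "y \<in> carrier B" for x y
        using Bil_translate[OF True that] by (simp add: *(6) te_Bil G_def)
      obtain K where K: "K \<in> LL" "s \<otimes>\<^bsub>T\<^esub> t = te K"
        using * mult_LL mult_te by metis
      have "((s \<otimes>\<^bsub>T\<^esub> t) \<otimes>\<^bsub>T\<^esub> u) F = te K G"
        unfolding K(2) T_mult[of "te K"] using True by simp (intro te_cong K(1) uG)
      also have "\<dots> = s (\<lambda>x y. t (\<lambda>x' y'. G (x \<otimes>\<^bsub>A\<^esub> x') (y \<otimes>\<^bsub>B\<^esub> y')))"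
        unfolding K(2)[symmetric] T_mult using G by simp
      also have "\<dots> = s (\<lambda>x y. (t \<otimes>\<^bsub>T\<^esub> u) (\<lambda>x' y'. F (x \<otimes>\<^bsub>A\<^esub> x') (y \<otimes>\<^bsub>B\<^esub> y')))"
        unfolding *(4)
      proof (rule te_cong[OF *(1)])
        fix x y assume xy: "x \<in> carrier A" "y \<in> carrier B"
        show "t (\<lambda>x' y'. G (x \<otimes>\<^bsub>A\<^esub> x') (y \<otimes>\<^bsub>B\<^esub> y')) =
            (t \<otimes>\<^bsub>T\<^esub> u) (\<lambda>x' y'. F (x \<otimes>\<^bsub>A\<^esub> x') (y \<otimes>\<^bsub>B\<^esub> y'))"
          unfolding T_mult using Bil_translate[OF True xy] apply simp
          unfolding *(5)
        proof (rule te_cong[OF *(2)])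
          fix x' y' assume xy': "x' \<in> carrier A" "y' \<in> carrier B"
          have "u (\<lambda>x'' y''. F (x \<otimes>\<^bsub>A\<^esub> (x' \<otimes>\<^bsub>A\<^esub> x'')) (y \<otimes>\<^bsub>B\<^esub> (y' \<otimes>\<^bsub>B\<^esub> y''))) =
              u (\<lambda>x'' y''. F ((x \<otimes>\<^bsub>A\<^esub> x') \<otimes>\<^bsub>A\<^esub> x'') ((y \<otimes>\<^bsub>B\<^esub> y') \<otimes>\<^bsub>B\<^esub> y''))"
            unfolding *(6) using xy xy' by (intro te_cong[OF *(3)]) (simp add: A.A.m_assoc B.A.m_assoc)
          also have "\<dots> = G (x \<otimes>\<^bsub>A\<^esub> x') (y \<otimes>\<^bsub>B\<^esub> y')" using xy xy' by (intro uG) auto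
          finally show "G (x \<otimes>\<^bsub>A\<^esub> x') (y \<otimes>\<^bsub>B\<^esub> y') =
            u (\<lambda>x'' y''. F (x \<otimes>\<^bsub>A\<^esub> (x' \<otimes>\<^bsub>A\<^esub> x'')) (y \<otimes>\<^bsub>B\<^esub> (y' \<otimes>\<^bsub>B\<^esub> y'')))" by simp
        qed
      qed
      also have "\<dots> = (s \<otimes>\<^bsub>T\<^esub> (t \<otimes>\<^bsub>T\<^esub> u)) F"
        unfolding T_mult[of s] using True by simp
      finally show ?thesis .
    qed (simp add: T_mult)
  qed
  have T0: "t F = 0" if "t \<in> carrier T" "F \<notin> Bil" for t F
    using that by (auto simp: carrier_T te_notBil)
  have lone: "\<one>\<^bsub>T\<^esub> \<otimes>\<^bsub>T\<^esub> s = s" if "s \<in> carrier T" for s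
  proof
    fix F
    from that obtain L where L: "L \<in> LL" "s = te L" by (auto simp: carrier_T)
    show "(\<one>\<^bsub>T\<^esub> \<otimes>\<^bsub>T\<^esub> s) F = s F"
    proof (cases "F \<in> Bil")
      case True
      have "(\<one>\<^bsub>T\<^esub> \<otimes>\<^bsub>T\<^esub> s) F = (\<Sum>(c, d)\<leftarrow>L. F (\<one>\<^bsub>A\<^esub> \<otimes>\<^bsub>A\<^esub> c) (\<one>\<^bsub>B\<^esub> \<otimes>\<^bsub>B\<^esub> d))"
        unfolding T_one L(2) using L True by (subst mult_te_eval) auto
      also have "\<dots> = (\<Sum>(c, d)\<leftarrow>L. F c d)"
        using L by (intro arg_cong[of _ _ sum_list] map_cong refl) (auto simp: in_lists_conv_set)
      finally show ?thesis using True L by (simp add: te_Bil)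
    qed (use that in \<open>simp add: T_mult T0\<close>)
  qed
  have ldist: "(s \<oplus>\<^bsub>T\<^esub> t) \<otimes>\<^bsub>T\<^esub> u = s \<otimes>\<^bsub>T\<^esub> u \<oplus>\<^bsub>T\<^esub> t \<otimes>\<^bsub>T\<^esub> u" for s t u
    by (auto simp: T_mult T_add)
  have cr: "cring T"
  proof (rule cringI)
    show "abelian_group T"
    proof (rule abelian_groupI)
      fix s assume "s \<in> carrier T"
      then have "(- 1) \<odot>\<^bsub>T\<^esub> s \<in> carrier T" using closed by blast
      moreover have "(- 1) \<odot>\<^bsub>T\<^esub> s \<oplus>\<^bsub>T\<^esub> s = \<zero>\<^bsub>T\<^esub>"
        by (auto simp: T_smult T_add T_zero tens_elem_def)
      ultimately show "\<exists>t\<in>carrier T. t \<oplus>\<^bsub>T\<^esub> s = \<zero>\<^bsub>T\<^esub>" by blast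
    qed (use closed zero in \<open>auto simp: T_add T_zero tens_elem_def\<close>)
    show "comm_monoid T"
      by (rule comm_monoidI) (use closed one comm assoc lone in auto)
  qed (rule ldist)
  show ?thesis
  proof (rule algebraI[OF cring_real_ring cr])
    show "(x \<odot>\<^bsub>T\<^esub> s) \<otimes>\<^bsub>T\<^esub> t = x \<odot>\<^bsub>T\<^esub> (s \<otimes>\<^bsub>T\<^esub> t)" for x s t
      by (auto simp: T_mult T_smult)
  qed (use closed in \<open>auto simp: T_smult T_add algebra_simps\<close>)
qed

end

definition transport :: "('t \<Rightarrow> 'u) \<Rightarrow> (real, 't) module \<Rightarrow> (real, 'u) module" where
  "transport f T = (let i = inv_into (carrier T) f in
     \<lparr>carrier = f ` carrier T,
      monoid.mult = (\<lambda>x y. f (i x \<otimes>\<^bsub>T\<^esub> i y)),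
      one = f \<one>\<^bsub>T\<^esub>,
      ring.zero = f \<zero>\<^bsub>T\<^esub>,
      add = (\<lambda>x y. f (i x \<oplus>\<^bsub>T\<^esub> i y)),
      smult = (\<lambda>r x. f (r \<odot>\<^bsub>T\<^esub> i x))\<rparr>)"

lemma algebra_transport:
  assumes T: "algebra real_ring T" and f: "inj_on f (carrier T)"
  shows "algebra real_ring (transport f T)"
proof -
  interpret T: real_alg T by (rule real_alg.intro) (rule T)
  let ?U = "transport f T"
  have ops: "carrier ?U = f ` carrier T"
    "x \<in> carrier T \<Longrightarrow> y \<in> carrier T \<Longrightarrow> f x \<otimes>\<^bsub>?U\<^esub> f y = f (x \<otimes>\<^bsub>T\<^esub> y)"
    "x \<in> carrier T \<Longrightarrow> y \<in> carrier T \<Longrightarrow> f x \<oplus>\<^bsub>?U\<^esub> f y = f (x \<oplus>\<^bsub>T\<^esub> y)"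
    "x \<in> carrier T \<Longrightarrow> r \<odot>\<^bsub>?U\<^esub> f x = f (r \<odot>\<^bsub>T\<^esub> x)"
    "\<one>\<^bsub>?U\<^esub> = f \<one>\<^bsub>T\<^esub>" "\<zero>\<^bsub>?U\<^esub> = f \<zero>\<^bsub>T\<^esub>" for x y r
    using f by (simp_all add: transport_def Let_def)
  have "cring ?U"
  proof (rule cringI)
    show "abelian_group ?U"
    proof (rule abelian_groupI)
      fix x assume "x \<in> carrier ?U"
      then obtain y where "y \<in> carrier T" "x = f y" by (auto simp: ops)
      then show "\<exists>z\<in>carrier ?U. z \<oplus>\<^bsub>?U\<^esub> x = \<zero>\<^bsub>?U\<^esub>"
        by (auto simp: ops T.A.l_neg intro!: bexI[of _ "\<ominus>\<^bsub>T\<^esub> y"])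
    qed (auto simp: ops T.A.add.m_ac)
    show "comm_monoid ?U"
      by (rule comm_monoidI) (auto simp: ops T.A.m_ac)
  qed (auto simp: ops T.A.l_distr)
  then show ?thesis
    by (rule algebraI[OF cring_real_ring])
       (auto simp: ops T.smult_add_left T.smult_add_right T.smult_smult T.smult_mult_assoc)
qed

lemma inj_list_pairs:
  assumes inf: "infinite (UNIV :: 'u set)"
  shows "\<exists>e :: ('u \<times> 'u) list \<Rightarrow> 'u. inj e"
proof -
  have "(card_of ((UNIV :: 'u set) \<times> (UNIV :: 'u set)), card_of (UNIV :: 'u set)) \<in> ordLeq"
    by (rule ordIso_imp_ordLeq[OF card_of_Times_same_infinite[OF inf]])
  then obtain h :: "'u \<times> 'u \<Rightarrow> 'u" where h: "inj h"
    unfolding card_of_ordLeq[symmetric] by auto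
  obtain c :: "nat \<Rightarrow> 'u" where c: "inj c"
    using infinite_countable_subset[OF inf] by blast
  \<comment> \<open>The length is recorded separately, since the nested pairs alone do not determine it.\<close>
  define f where "f L = foldr (\<lambda>p z. h (h p, z)) L (c 0)" for L
  have f: "length L = length M \<Longrightarrow> f L = f M \<Longrightarrow> L = M" for L M
    by (induction L M rule: list_induct2) (auto simp: f_def dest!: injD[OF h])
  have "inj (\<lambda>L. h (c (length L), f L))"
    by (rule injI) (auto dest!: injD[OF h] injD[OF c] intro: f)
  then show ?thesis by blast
qed

text \<open>
  If \<open>A\<close> and \<open>B\<close> have carriers in the type \<open>'u\<close>, then so has their tensor product: unless one of
  them is the zero ring, \<open>'u\<close> is infinite and there are as many lists of pairs as elements of \<open>'u\<close>.
\<close>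

lemma tensor_product_exists:
  fixes A B :: "(real, 'u) module"
  assumes A: "algebra real_ring A" and B: "algebra real_ring B"
    and l: "linear_form A l" and m: "linear_form B m"
  obtains T :: "(real, 'u) module" and \<phi> \<psi> n where
    "algebra real_ring T" "\<phi> \<in> alg_hom A T" "\<psi> \<in> alg_hom B T" "linear_form T n"
    "\<And>a b. a \<in> carrier A \<Longrightarrow> b \<in> carrier B \<Longrightarrow> n (\<phi> a \<otimes>\<^bsub>T\<^esub> \<psi> b) = l a * m b"
proof -
  interpret A: real_alg A by (rule real_alg.intro) (rule A)
  interpret B: real_alg B by (rule real_alg.intro) (rule B)
  interpret two_algs A B ..
  have trivial: "id \<in> alg_hom C C" "(\<lambda>_. \<zero>\<^bsub>C\<^esub>) \<in> alg_hom D C" "linear_form C (\<lambda>_. 0)"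
    "\<And>k a. linear_form C k \<Longrightarrow> a \<in> carrier C \<Longrightarrow> k a = 0"
    if C: "algebra real_ring C" "\<one>\<^bsub>C\<^esub> = \<zero>\<^bsub>C\<^esub>" and D: "algebra real_ring D"
    for C D :: "(real, 'u) module"
  proof -
    interpret C: real_alg C by (rule real_alg.intro) (rule C)
    show "id \<in> alg_hom C C" by (auto simp: alg_hom_def ring_hom_def)
    show "(\<lambda>_. \<zero>\<^bsub>C\<^esub>) \<in> alg_hom D C"
      using C by (auto simp: alg_hom_def ring_hom_def C.RM.smult_r_null)
    show "linear_form C (\<lambda>_. 0)" by (simp add: linear_form_def)
    show "k a = 0" if "linear_form C k" "a \<in> carrier C" for k a
    proof -
      have "a = \<zero>\<^bsub>C\<^esub>" using that(2) C(2) by (metis C.A.r_null C.A.r_one)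
      then show ?thesis using C.linear_form_0[OF that(1)] by simp
    qed
  qed
  consider "\<one>\<^bsub>A\<^esub> = \<zero>\<^bsub>A\<^esub>" | "\<one>\<^bsub>B\<^esub> = \<zero>\<^bsub>B\<^esub>" | "\<one>\<^bsub>A\<^esub> \<noteq> \<zero>\<^bsub>A\<^esub>" "\<one>\<^bsub>B\<^esub> \<noteq> \<zero>\<^bsub>B\<^esub>" by blast
  then show ?thesis
  proof cases
    case 1
    note t = trivial[OF A 1 B]
    show ?thesis
      by (rule that[OF A t(1) t(2) t(3)]) (simp add: t(4)[OF l])
  next
    case 2
    note t = trivial[OF B 2 A]
    show ?thesis
      by (rule that[OF B t(2) t(1) t(3)]) (simp add: t(4)[OF m])
  next
    case 3
    have "inj (str_map A)"
    proof (rule injI, rule ccontr)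
      fix r s assume eq: "str_map A r = str_map A s" and "r \<noteq> s"
      have "(r + - s) \<odot>\<^bsub>A\<^esub> \<one>\<^bsub>A\<^esub> = \<zero>\<^bsub>A\<^esub>"
        using eq A.str_map_add[of r "- s"] A.str_map_add[of s "- s"] by (simp add: str_map_def)
      then have "(1 / (r - s)) \<odot>\<^bsub>A\<^esub> ((r - s) \<odot>\<^bsub>A\<^esub> \<one>\<^bsub>A\<^esub>) = \<zero>\<^bsub>A\<^esub>"
        by (simp add: A.RM.smult_r_null)
      with \<open>r \<noteq> s\<close> 3 show False by (simp add: A.smult_smult)
    qed
    then have inf: "infinite (UNIV :: 'u set)"
      using infinite_UNIV_char_0[where 'a = real] finite_imageD[of "str_map A" UNIV]
        finite_subset[of "range (str_map A)" UNIV] by blast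
    from inj_list_pairs[OF inf] obtain e :: "('u \<times> 'u) list \<Rightarrow> 'u" where e: "inj e" by blast
    \<comment> \<open>An injection of the tensor product into \<open>'u\<close>: the code of some list which represents the element.\<close>
    define f where "f t = e (SOME L. L \<in> LL \<and> t = te L)" for t
    have fL: "(SOME L. L \<in> LL \<and> t = te L) \<in> LL \<and> t = te (SOME L. L \<in> LL \<and> t = te L)"
      if "t \<in> carrier T" for t
      using that someI_ex[of "\<lambda>L. L \<in> LL \<and> t = te L"] unfolding carrier_T by blast
    have f: "inj_on f (carrier T)"
    proof (rule inj_onI)
      fix s t assume "s \<in> carrier T" "t \<in> carrier T" "f s = f t"
      moreover from \<open>f s = f t\<close> have "(SOME L. L \<in> LL \<and> s = te L) = (SOME L. L \<in> LL \<and> t = te L)"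
        unfolding f_def by (rule injD[OF e])
      ultimately show "s = t" using fL[of s] fL[of t] by simp
    qed
    let ?U = "transport f T"
    interpret T: real_alg T by (rule real_alg.intro) (rule algebra_T)
    have ops: "carrier ?U = f ` carrier T"
      "x \<in> carrier T \<Longrightarrow> y \<in> carrier T \<Longrightarrow> f x \<otimes>\<^bsub>?U\<^esub> f y = f (x \<otimes>\<^bsub>T\<^esub> y)"
      "x \<in> carrier T \<Longrightarrow> y \<in> carrier T \<Longrightarrow> f x \<oplus>\<^bsub>?U\<^esub> f y = f (x \<oplus>\<^bsub>T\<^esub> y)"
      "x \<in> carrier T \<Longrightarrow> r \<odot>\<^bsub>?U\<^esub> f x = f (r \<odot>\<^bsub>T\<^esub> x)"
      "\<one>\<^bsub>?U\<^esub> = f \<one>\<^bsub>T\<^esub>" for x y r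
      using f by (simp_all add: transport_def Let_def)
    have te1: "te [(a, b)] \<in> carrier T" if "a \<in> carrier A" "b \<in> carrier B" for a b
      using that by (auto simp: carrier_T intro!: bexI[of _ "[(a, b)]"])
    have mult1: "te [(a, b)] \<otimes>\<^bsub>T\<^esub> te [(c, d)] = te [(a \<otimes>\<^bsub>A\<^esub> c, b \<otimes>\<^bsub>B\<^esub> d)]"
      if "a \<in> carrier A" "b \<in> carrier B" "c \<in> carrier A" "d \<in> carrier B" for a b c d
      using that by (subst mult_te) auto
    have addl: "te [(a \<oplus>\<^bsub>A\<^esub> a', b)] = te [(a, b)] \<oplus>\<^bsub>T\<^esub> te [(a', b)]"
      if "a \<in> carrier A" "a' \<in> carrier A" "b \<in> carrier B" for a a' b
      using that by (auto simp: tens_elem_def T_add bilinear_forms_def)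
    have addr: "te [(a, b \<oplus>\<^bsub>B\<^esub> b')] = te [(a, b)] \<oplus>\<^bsub>T\<^esub> te [(a, b')]"
      if "a \<in> carrier A" "b \<in> carrier B" "b' \<in> carrier B" for a b b'
      using that by (auto simp: tens_elem_def T_add bilinear_forms_def)
    have sml: "te [(r \<odot>\<^bsub>A\<^esub> a, b)] = r \<odot>\<^bsub>T\<^esub> te [(a, b)]" "te [(a, r \<odot>\<^bsub>B\<^esub> b)] = r \<odot>\<^bsub>T\<^esub> te [(a, b)]"
      if "a \<in> carrier A" "b \<in> carrier B" for r a b
      using that by (auto simp: tens_elem_def T_smult bilinear_forms_def)
    let ?F = "\<lambda>x y. l x * m y"
    have F: "?F \<in> Bil"
      using l m by (auto simp: bilinear_forms_def linear_form_def algebra_simps)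
    show ?thesis
    proof (rule that[of ?U "\<lambda>a. f (te [(a, \<one>\<^bsub>B\<^esub>)])" "\<lambda>b. f (te [(\<one>\<^bsub>A\<^esub>, b)])"
            "\<lambda>t. inv_into (carrier T) f t ?F"])
      show "algebra real_ring ?U" by (rule algebra_transport[OF algebra_T f])
      show "(\<lambda>a. f (te [(a, \<one>\<^bsub>B\<^esub>)])) \<in> alg_hom A ?U"
        by (auto simp: alg_hom_def ring_hom_def ops te1 mult1 addl sml T_one)
      show "(\<lambda>b. f (te [(\<one>\<^bsub>A\<^esub>, b)])) \<in> alg_hom B ?U"
        by (auto simp: alg_hom_def ring_hom_def ops te1 mult1 addr sml T_one)
      show "linear_form ?U (\<lambda>t. inv_into (carrier T) f t ?F)"
        using f by (auto simp: linear_form_def ops) (simp_all add: T_add T_smult)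
      show "inv_into (carrier T) f (f (te [(a, \<one>\<^bsub>B\<^esub>)]) \<otimes>\<^bsub>?U\<^esub> f (te [(\<one>\<^bsub>A\<^esub>, b)])) ?F = l a * m b"
        if "a \<in> carrier A" "b \<in> carrier B" for a b
        using that f F by (simp add: ops te1 mult1 te_Bil)
    qed
  qed
qed

section \<open>Matrices over algebras\<close>

definition mat_mul ::
    "('b, 'm) ring_scheme \<Rightarrow> 'j set \<Rightarrow> ('i \<Rightarrow> 'j \<Rightarrow> 'b) \<Rightarrow> ('j \<Rightarrow> 'k \<Rightarrow> 'b) \<Rightarrow> 'i \<Rightarrow> 'k \<Rightarrow> 'b" where
  "mat_mul R J M N i k = (\<Oplus>\<^bsub>R\<^esub>j\<in>J. M i j \<otimes>\<^bsub>R\<^esub> N j k)"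

definition mat_vec ::
    "('b, 'm) ring_scheme \<Rightarrow> 'i set \<Rightarrow> 'j set \<Rightarrow> ('j \<Rightarrow> 'i \<Rightarrow> 'b) \<Rightarrow> ('i \<Rightarrow> 'b) \<Rightarrow> 'j \<Rightarrow> 'b" where
  "mat_vec R I J M x = (\<lambda>j\<in>J. \<Oplus>\<^bsub>R\<^esub>i\<in>I. M j i \<otimes>\<^bsub>R\<^esub> x i)"

lemma lin_map_mat_vec: "lin_map R \<eta> I J f = mat_vec R I J (\<lambda>j i. \<eta> (f j i))"
  by (simp add: lin_map_def mat_vec_def fun_eq_iff)

lemma free_module_simps [simp]:
  "carrier (free_module R I) = I \<rightarrow>\<^sub>E carrier R"
  "\<zero>\<^bsub>free_module R I\<^esub> = (\<lambda>i\<in>I. \<zero>\<^bsub>R\<^esub>)"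
  "x \<oplus>\<^bsub>free_module R I\<^esub> y = (\<lambda>i\<in>I. x i \<oplus>\<^bsub>R\<^esub> y i)"
  "a \<odot>\<^bsub>free_module R I\<^esub> x = (\<lambda>i\<in>I. a \<otimes>\<^bsub>R\<^esub> x i)"
  by (simp_all add: free_module_def)

context cring
begin

lemma mat_mul_closed [intro]:
  "(\<And>j. j \<in> J \<Longrightarrow> M i j \<in> carrier R) \<Longrightarrow> (\<And>j. j \<in> J \<Longrightarrow> N j k \<in> carrier R) \<Longrightarrow>
     mat_mul R J M N i k \<in> carrier R"
  unfolding mat_mul_def by (rule finsum_closed) auto

lemma mat_mul_cong:
  assumes "\<And>j. j \<in> J \<Longrightarrow> M i j = M' i' j" "\<And>j. j \<in> J \<Longrightarrow> N j k = N' j k'"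
    "\<And>j. j \<in> J \<Longrightarrow> M' i' j \<in> carrier R" "\<And>j. j \<in> J \<Longrightarrow> N' j k' \<in> carrier R"
  shows "mat_mul R J M N i k = mat_mul R J M' N' i' k'"
  unfolding mat_mul_def by (rule finsum_cong') (use assms in auto)

lemma mat_mul_assoc:
  assumes J: "finite J" and K: "finite K"
    and M: "\<And>j. j \<in> J \<Longrightarrow> M i j \<in> carrier R"
    and N: "\<And>j k. j \<in> J \<Longrightarrow> k \<in> K \<Longrightarrow> N j k \<in> carrier R"
    and P: "\<And>k. k \<in> K \<Longrightarrow> P k l \<in> carrier R"
  shows "mat_mul R K (mat_mul R J M N) P i l = mat_mul R J M (mat_mul R K N P) i l"
proof -
  have "mat_mul R K (mat_mul R J M N) P i l = (\<Oplus>k\<in>K. \<Oplus>j\<in>J. (M i j \<otimes> N j k) \<otimes> P k l)"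
    unfolding mat_mul_def
    by (rule finsum_cong') (use assms in \<open>auto simp: finsum_ldistr Pi_def intro!: finsum_closed\<close>)
  also have "\<dots> = (\<Oplus>j\<in>J. \<Oplus>k\<in>K. (M i j \<otimes> N j k) \<otimes> P k l)"
    by (rule finsum_swap) (use assms in auto)
  also have "\<dots> = mat_mul R J M (mat_mul R K N P) i l"
    unfolding mat_mul_def
    by (rule finsum_cong') (use assms in \<open>auto simp: finsum_rdistr Pi_def m_assoc intro!: finsum_closed finsum_cong'\<close>)
  finally show ?thesis .
qed

lemma mat_mul_delta_left:
  assumes "finite J" "i \<in> J" "\<And>j. j \<in> J \<Longrightarrow> M i j = (if j = i then \<one> else \<zero>)" "\<And>j. j \<in> J \<Longrightarrow> N j k \<in> carrier R"
  shows "mat_mul R J M N i k = N i k"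
proof -
  have "mat_mul R J M N i k = (\<Oplus>j\<in>J. if j = i then N j k else \<zero>)"
    unfolding mat_mul_def by (rule finsum_cong') (use assms in auto)
  also have "\<dots> = N i k" by (rule finsum_delta) (use assms in auto)
  finally show ?thesis .
qed

lemma mat_mul_delta_right:
  assumes "finite J" "k \<in> J" "\<And>j. j \<in> J \<Longrightarrow> N j k = (if j = k then \<one> else \<zero>)" "\<And>j. j \<in> J \<Longrightarrow> M i j \<in> carrier R"
  shows "mat_mul R J M N i k = M i k"
proof -
  have "mat_mul R J M N i k = (\<Oplus>j\<in>J. if j = k then M i j else \<zero>)"
    unfolding mat_mul_def by (rule finsum_cong') (use assms in auto)
  also have "\<dots> = M i k" by (rule finsum_delta) (use assms in auto)
  finally show ?thesis .
qed

lemma mat_vec_closed: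
  assumes "\<And>i j. i \<in> I \<Longrightarrow> j \<in> J \<Longrightarrow> M j i \<in> carrier R" "x \<in> I \<rightarrow>\<^sub>E carrier R"
  shows "mat_vec R I J M x \<in> J \<rightarrow>\<^sub>E carrier R"
  unfolding mat_vec_def using assms by (auto intro!: finsum_closed)

lemma mat_vec_mat_vec:
  assumes "finite I" "finite J"
    and "\<And>i j. i \<in> I \<Longrightarrow> j \<in> J \<Longrightarrow> M j i \<in> carrier R" "\<And>j k. j \<in> J \<Longrightarrow> k \<in> K \<Longrightarrow> N k j \<in> carrier R"
    and "x \<in> I \<rightarrow>\<^sub>E carrier R"
  shows "mat_vec R J K N (mat_vec R I J M x) = mat_vec R I K (mat_mul R J N M) x"
proof -
  have "mat_vec R J K N (mat_vec R I J M x) k = mat_vec R I K (mat_mul R J N M) x k" if k: "k \<in> K" for k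
  proof -
    have "mat_vec R J K N (mat_vec R I J M x) k = mat_mul R J N (mat_mul R I M (\<lambda>i (_::unit). x i)) k ()"
    proof -
      have xi: "x i \<in> carrier R" if "i \<in> I" for i using that assms(5) by auto
      have c: "(\<Oplus>i\<in>I. M j i \<otimes> x i) \<in> carrier R" if "j \<in> J" for j
        using that assms xi by (intro finsum_closed) auto
      show ?thesis using k assms c unfolding mat_vec_def mat_mul_def
        by (simp, intro finsum_cong') auto
    qed
    also have "\<dots> = mat_mul R I (mat_mul R J N M) (\<lambda>i (_::unit). x i) k ()"
      by (rule mat_mul_assoc[symmetric]) (use assms k in auto)
    finally show ?thesis using k by (simp add: mat_vec_def mat_mul_def)
  qed
  then show ?thesis by (auto simp: mat_vec_def fun_eq_iff)
qed

lemma mat_vec_cong: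
  assumes "\<And>i j. i \<in> I \<Longrightarrow> j \<in> J \<Longrightarrow> M j i = M' j i" "\<And>i j. i \<in> I \<Longrightarrow> j \<in> J \<Longrightarrow> M' j i \<in> carrier R"
    "x \<in> I \<rightarrow>\<^sub>E carrier R"
  shows "mat_vec R I J M x = mat_vec R I J M' x"
  unfolding mat_vec_def
  by (intro restrict_ext finsum_cong') (use assms in auto)

lemma mat_vec_delta:
  assumes "finite I" "\<And>i j. i \<in> I \<Longrightarrow> j \<in> I \<Longrightarrow> M j i = (if i = j then \<one> else \<zero>)" "x \<in> I \<rightarrow>\<^sub>E carrier R"
  shows "mat_vec R I I M x = x"
proof
  fix j
  show "mat_vec R I I M x j = x j"
  proof (cases "j \<in> I")
    case True
    then have "mat_vec R I I M x j = mat_mul R I M (\<lambda>i (_::unit). x i) j ()"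
      by (simp add: mat_vec_def mat_mul_def)
    also have "\<dots> = x j"
    proof (rule mat_mul_delta_left[OF assms(1) True])
      show "M j i = (if i = j then \<one> else \<zero>)" if "i \<in> I" for i by (rule assms(2)[OF that True])
      show "x i \<in> carrier R" if "i \<in> I" for i using assms(3) that by blast
    qed
    finally show ?thesis .
  next
    case False
    from PiE_arb[OF assms(3) False] False show ?thesis by (simp add: mat_vec_def)
  qed
qed

lemma unit_vec_closed: "unit_vec R I i \<in> I \<rightarrow>\<^sub>E carrier R"
  by (auto simp: unit_vec_def)

lemma mat_vec_unit_vec:
  assumes "finite I" "i \<in> I" "j \<in> J" "\<And>i. i \<in> I \<Longrightarrow> M j i \<in> carrier R"
  shows "mat_vec R I J M (unit_vec R I i) j = M j i"
proof -
  have "mat_vec R I J M (unit_vec R I i) j = mat_mul R I M (\<lambda>l (_::unit). unit_vec R I i l) j ()"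
    using assms by (simp add: mat_vec_def mat_mul_def)
  also have "\<dots> = (\<Oplus>l\<in>I. if l = i then M j l else \<zero>)"
    unfolding mat_mul_def by (rule finsum_cong') (use assms in \<open>auto simp: unit_vec_def\<close>)
  also have "\<dots> = M j i" by (rule finsum_delta) (use assms in auto)
  finally show ?thesis .
qed

lemma mat_vec_add:
  assumes "finite I" "\<And>i j. i \<in> I \<Longrightarrow> j \<in> J \<Longrightarrow> M j i \<in> carrier R" "x \<in> I \<rightarrow>\<^sub>E carrier R" "y \<in> I \<rightarrow>\<^sub>E carrier R"
  shows "mat_vec R I J M (\<lambda>i\<in>I. x i \<oplus> y i) = (\<lambda>j\<in>J. mat_vec R I J M x j \<oplus> mat_vec R I J M y j)"
proof -
  have "(\<Oplus>i\<in>I. M j i \<otimes> (\<lambda>i\<in>I. x i \<oplus> y i) i) = (\<Oplus>i\<in>I. M j i \<otimes> x i) \<oplus> (\<Oplus>i\<in>I. M j i \<otimes> y i)"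
    if j: "j \<in> J" for j
  proof -
    have x: "\<And>i. i \<in> I \<Longrightarrow> x i \<in> carrier R" "\<And>i. i \<in> I \<Longrightarrow> y i \<in> carrier R" using assms by auto
    have "(\<Oplus>i\<in>I. M j i \<otimes> (\<lambda>i\<in>I. x i \<oplus> y i) i) = (\<Oplus>i\<in>I. M j i \<otimes> x i \<oplus> M j i \<otimes> y i)"
      by (rule finsum_cong') (use x assms(2) j in \<open>auto simp: r_distr\<close>)
    also have "\<dots> = (\<Oplus>i\<in>I. M j i \<otimes> x i) \<oplus> (\<Oplus>i\<in>I. M j i \<otimes> y i)"
      by (rule finsum_addf) (use x assms(2) j in auto)
    finally show ?thesis .
  qed
  then show ?thesis by (auto simp: mat_vec_def)
qed

lemma mat_vec_smult:
  assumes "finite I" "\<And>i j. i \<in> I \<Longrightarrow> j \<in> J \<Longrightarrow> M j i \<in> carrier R" "x \<in> I \<rightarrow>\<^sub>E carrier R" "a \<in> carrier R"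
  shows "mat_vec R I J M (\<lambda>i\<in>I. a \<otimes> x i) = (\<lambda>j\<in>J. a \<otimes> mat_vec R I J M x j)"
proof -
  have "(\<Oplus>i\<in>I. M j i \<otimes> (\<lambda>i\<in>I. a \<otimes> x i) i) = a \<otimes> (\<Oplus>i\<in>I. M j i \<otimes> x i)"
    if j: "j \<in> J" for j
  proof -
    have x: "\<And>i. i \<in> I \<Longrightarrow> x i \<in> carrier R" using assms by auto
    have "(\<Oplus>i\<in>I. M j i \<otimes> (\<lambda>i\<in>I. a \<otimes> x i) i) = (\<Oplus>i\<in>I. a \<otimes> (M j i \<otimes> x i))"
      by (rule finsum_cong') (use x assms(2,4) j in \<open>auto simp: m_lcomm\<close>)
    also have "\<dots> = a \<otimes> (\<Oplus>i\<in>I. M j i \<otimes> x i)"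
      by (rule finsum_rdistr[symmetric]) (use x assms j in auto)
    finally show ?thesis .
  qed
  then show ?thesis by (auto simp: mat_vec_def)
qed

text \<open>
  Every linear map of free modules is given by a matrix, so a representation is determined by its matrix
  entries, and the conditions on representations and their homomorphisms become matrix identities.
\<close>

lemma linear_is_mat_vec:
  assumes I: "finite I"
    and f: "\<And>x. x \<in> I \<rightarrow>\<^sub>E carrier R \<Longrightarrow> f x \<in> J \<rightarrow>\<^sub>E carrier R"
    and add: "\<And>x y. x \<in> I \<rightarrow>\<^sub>E carrier R \<Longrightarrow> y \<in> I \<rightarrow>\<^sub>E carrier R \<Longrightarrow>
      f (\<lambda>i\<in>I. x i \<oplus> y i) = (\<lambda>j\<in>J. f x j \<oplus> f y j)"
    and smult: "\<And>a x. a \<in> carrier R \<Longrightarrow> x \<in> I \<rightarrow>\<^sub>E carrier R \<Longrightarrow>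
      f (\<lambda>i\<in>I. a \<otimes> x i) = (\<lambda>j\<in>J. a \<otimes> f x j)"
    and x: "x \<in> I \<rightarrow>\<^sub>E carrier R"
  shows "f x = mat_vec R I J (\<lambda>j i. f (unit_vec R I i) j) x"
proof -
  have uc: "f (unit_vec R I i) j \<in> carrier R" if "j \<in> J" for i j
    by (rule PiE_mem[OF f[OF unit_vec_closed] that])
  have xc: "\<And>i. i \<in> I \<Longrightarrow> x i \<in> carrier R" by (rule PiE_mem[OF x])
  have part: "f (\<lambda>i\<in>I. if i \<in> K then x i else \<zero>) j = (\<Oplus>i\<in>K. f (unit_vec R I i) j \<otimes> x i)"
    if "finite K" "K \<subseteq> I" "j \<in> J" for K j
    using that
  proof (induction K)
    case empty
    have z: "(\<lambda>i\<in>I. \<zero>) \<in> I \<rightarrow>\<^sub>E carrier R" by auto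
    have "f (\<lambda>i\<in>I. \<zero> \<otimes> (\<lambda>i\<in>I. \<zero>) i) = (\<lambda>j\<in>J. \<zero> \<otimes> f (\<lambda>i\<in>I. \<zero>) j)"
      by (rule smult[OF zero_closed z])
    also have "(\<lambda>i\<in>I. \<zero> \<otimes> (\<lambda>i\<in>I. \<zero>) i) = (\<lambda>i\<in>I. \<zero>)" by auto
    finally have "f (\<lambda>i\<in>I. \<zero>) j = (\<lambda>j\<in>J. \<zero> \<otimes> f (\<lambda>i\<in>I. \<zero>) j) j" by (rule fun_cong)
    also have "\<dots> = \<zero> \<otimes> f (\<lambda>i\<in>I. \<zero>) j" using empty(2) by (rule restrict_apply')
    finally have "f (\<lambda>i\<in>I. \<zero>) j = \<zero> \<otimes> f (\<lambda>i\<in>I. \<zero>) j" .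
    moreover have "f (\<lambda>i\<in>I. \<zero>) j \<in> carrier R" by (rule PiE_mem[OF f[OF z] empty(2)])
    ultimately have "f (\<lambda>i\<in>I. \<zero>) j = \<zero>" by simp
    then show ?case by (simp add: restrict_def)
  next
    case (insert a K)
    let ?p = "\<lambda>i\<in>I. if i \<in> K then x i else \<zero>"
    let ?q = "\<lambda>i\<in>I. x a \<otimes> unit_vec R I a i"
    have a: "a \<in> I" "a \<notin> K" "x a \<in> carrier R" using insert.hyps insert.prems xc by auto
    have pq: "?p \<in> I \<rightarrow>\<^sub>E carrier R" "?q \<in> I \<rightarrow>\<^sub>E carrier R"
      using a(3) xc by (auto simp: unit_vec_def)
    have "(\<lambda>i\<in>I. if i \<in> insert a K then x i else \<zero>) = (\<lambda>i\<in>I. ?p i \<oplus> ?q i)"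
      by (rule restrict_ext) (use a xc in \<open>auto simp: unit_vec_def\<close>)
    then have "f (\<lambda>i\<in>I. if i \<in> insert a K then x i else \<zero>) j = f ?p j \<oplus> f ?q j"
      using add[OF pq] insert.prems(2) by simp
    also have "f ?q j = x a \<otimes> f (unit_vec R I a) j"
      using smult[OF a(3) unit_vec_closed, of a] insert.prems(2) by simp
    also have "f ?p j = (\<Oplus>i\<in>K. f (unit_vec R I i) j \<otimes> x i)" using insert.prems by (intro insert.IH) auto
    also have "\<dots> \<oplus> x a \<otimes> f (unit_vec R I a) j = (\<Oplus>i\<in>insert a K. f (unit_vec R I i) j \<otimes> x i)"
    proof -
      have c: "(\<lambda>i. f (unit_vec R I i) j \<otimes> x i) \<in> K \<rightarrow> carrier R"
        using insert.prems xc uc by auto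
      have "(\<Oplus>i\<in>insert a K. f (unit_vec R I i) j \<otimes> x i) =
          f (unit_vec R I a) j \<otimes> x a \<oplus> (\<Oplus>i\<in>K. f (unit_vec R I i) j \<otimes> x i)"
        by (rule finsum_insert) (use insert.hyps c a uc insert.prems in auto)
      then show ?thesis
        using a uc[of j a] insert.prems finsum_closed[OF c] by (simp add: a_comm m_comm)
    qed
    finally show ?case .
  qed
  have xx: "(\<lambda>i\<in>I. if i \<in> I then x i else \<zero>) = x"
    using x by (intro ext) (simp add: PiE_iff extensional_def)
  show ?thesis
  proof
    fix j
    show "f x j = mat_vec R I J (\<lambda>j i. f (unit_vec R I i) j) x j"
    proof (cases "j \<in> J")
      case True
      from part[OF I subset_refl True] show ?thesis unfolding xx by (simp add: mat_vec_def True)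
    next
      case False
      from PiE_arb[OF f[OF x] False] False show ?thesis by (simp add: mat_vec_def)
    qed
  qed
qed

lemma finsum_PiE_Suc:
  assumes K: "\<And>\<mu>. \<mu> \<le> m \<Longrightarrow> finite (K \<mu>)"
    and f: "\<And>j k. j \<in> PiE {..<m} K \<Longrightarrow> k \<in> K m \<Longrightarrow> f (j(m := k)) \<in> carrier R"
  shows "(\<Oplus>j\<in>PiE {..<Suc m} K. f j) = (\<Oplus>k\<in>K m. \<Oplus>j\<in>PiE {..<m} K. f (j(m := k)))"
proof -
  have bij: "bij_betw (\<lambda>(k, j). j(m := k)) (K m \<times> PiE {..<m} K) (PiE {..<Suc m} K)"
    unfolding bij_betw_def lessThan_Suc PiE_insert_eq using inj_combinator[of m "{..<m}" K]
    by (simp add: case_prod_unfold)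
  have "(\<Oplus>j\<in>PiE {..<Suc m} K. f j) = (\<Oplus>p\<in>K m \<times> PiE {..<m} K. f ((\<lambda>(k, j). j(m := k)) p))"
  proof (rule finsum_reindex_bij[OF bij])
    show "f \<in> PiE {..<Suc m} K \<rightarrow> carrier R"
    proof
      fix z assume "z \<in> PiE {..<Suc m} K"
      then obtain k j where "k \<in> K m" "j \<in> PiE {..<m} K" "z = j(m := k)"
        unfolding lessThan_Suc PiE_insert_eq by fast
      then show "f z \<in> carrier R" by (simp only: f)
    qed
  qed
  also have "\<dots> = (\<Oplus>k\<in>K m. \<Oplus>j\<in>PiE {..<m} K. f (j(m := k)))"
  proof -
    have "finite (K m)" "finite (PiE {..<m} K)" using K by (auto intro!: finite_PiE)
    from finsum_Times[OF this, of "\<lambda>p. f ((\<lambda>(k, j). j(m := k)) p)"] show ?thesis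
      using f by (simp only: prod.case)
  qed
  finally show ?thesis .
qed

lemma finsum_prod_distrib:
  assumes "finite I" "finite J" "\<And>i. i \<in> I \<Longrightarrow> a i \<in> carrier R" "\<And>j. j \<in> J \<Longrightarrow> b j \<in> carrier R"
  shows "(\<Oplus>i\<in>I. \<Oplus>j\<in>J. a i \<otimes> b j) = (\<Oplus>i\<in>I. a i) \<otimes> (\<Oplus>j\<in>J. b j)"
proof -
  have b: "(\<Oplus>j\<in>J. b j) \<in> carrier R" using assms by (auto intro!: finsum_closed)
  have "(\<Oplus>i\<in>I. \<Oplus>j\<in>J. a i \<otimes> b j) = (\<Oplus>i\<in>I. a i \<otimes> (\<Oplus>j\<in>J. b j))"
    by (rule finsum_cong') (use assms b in \<open>auto simp: finsum_rdistr\<close>)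
  also have "\<dots> = (\<Oplus>i\<in>I. a i) \<otimes> (\<Oplus>j\<in>J. b j)"
    by (rule finsum_ldistr[symmetric]) (use assms b in auto)
  finally show ?thesis .
qed

end

locale alg_mor = A: real_alg A + B: real_alg B for A B :: "(real, 'u) module" +
  fixes \<phi> assumes \<phi>: "\<phi> \<in> alg_hom A B"
begin

lemma closed [simp, intro]: "x \<in> carrier A \<Longrightarrow> \<phi> x \<in> carrier B"
  and add [simp]: "x \<in> carrier A \<Longrightarrow> y \<in> carrier A \<Longrightarrow> \<phi> (x \<oplus>\<^bsub>A\<^esub> y) = \<phi> x \<oplus>\<^bsub>B\<^esub> \<phi> y"
  and mult [simp]: "x \<in> carrier A \<Longrightarrow> y \<in> carrier A \<Longrightarrow> \<phi> (x \<otimes>\<^bsub>A\<^esub> y) = \<phi> x \<otimes>\<^bsub>B\<^esub> \<phi> y"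
  and one [simp]: "\<phi> \<one>\<^bsub>A\<^esub> = \<one>\<^bsub>B\<^esub>"
  and smult [simp]: "x \<in> carrier A \<Longrightarrow> \<phi> (r \<odot>\<^bsub>A\<^esub> x) = r \<odot>\<^bsub>B\<^esub> \<phi> x"
  using \<phi> by (auto simp: alg_hom_def ring_hom_def)

lemma zero [simp]: "\<phi> \<zero>\<^bsub>A\<^esub> = \<zero>\<^bsub>B\<^esub>"
  using smult[of "\<zero>\<^bsub>A\<^esub>" 0] by simp

lemma str_map [simp]: "\<phi> (str_map A r) = str_map B r"
  by (simp add: str_map_def)

lemma finsum:
  "finite I \<Longrightarrow> (\<And>i. i \<in> I \<Longrightarrow> f i \<in> carrier A) \<Longrightarrow> \<phi> (\<Oplus>\<^bsub>A\<^esub>i\<in>I. f i) = (\<Oplus>\<^bsub>B\<^esub>i\<in>I. \<phi> (f i))"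
  by (rule A.A.finsum_hom) (use B.A.abelian_monoid_axioms in auto)

lemma finprod:
  assumes "finite I" "\<And>i. i \<in> I \<Longrightarrow> f i \<in> carrier A"
  shows "\<phi> (\<Otimes>\<^bsub>A\<^esub>i\<in>I. f i) = (\<Otimes>\<^bsub>B\<^esub>i\<in>I. \<phi> (f i))"
  using assms
proof (induction I)
  case (insert a I)
  then have "(\<Otimes>\<^bsub>A\<^esub>i\<in>I. f i) \<in> carrier A" by (intro A.A.finprod_closed) auto
  with insert show ?case by (simp add: Pi_def)
qed simp

end


section \<open>Representations in terms of matrices\<close>

definition coeff :: "('i, 'u, 'p) rep_data \<Rightarrow> (real, 'u) module \<Rightarrow> 'p \<Rightarrow> 'i \<Rightarrow> 'i \<Rightarrow> 'u" where
  "coeff V A \<gamma> i j = act V A \<gamma> (unit_vec A (basis V) j) i"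

definition mat_rep :: "'i set \<Rightarrow> ((real, 'u) module \<Rightarrow> 'p \<Rightarrow> 'i \<Rightarrow> 'i \<Rightarrow> 'u) \<Rightarrow> ('i, 'u, 'p) rep_data" where
  "mat_rep K R = \<lparr>basis = K, act = (\<lambda>A \<gamma>. \<lambda>x\<in>carrier (free_module A K). mat_vec A K K (R A \<gamma>) x)\<rparr>"

lemma is_rep_act:
  assumes V: "is_rep G V" and A: "algebra real_ring A" and \<gamma>: "\<gamma> \<in> carrier (points G A)"
  shows "act V A \<gamma> \<in> carrier (GL A (free_module A (basis V)))"
  using assms by (auto simp: is_rep_def hom_def)

lemma rep_act_mat_vec:
  assumes V: "is_rep G V" and A: "algebra real_ring A" and \<gamma>: "\<gamma> \<in> carrier (points G A)"
    and x: "x \<in> carrier (free_module A (basis V))"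
  shows "act V A \<gamma> x = mat_vec A (basis V) (basis V) (coeff V A \<gamma>) x"
proof -
  interpret A: real_alg A by (rule real_alg.intro) (rule A)
  from is_rep_act[OF V A \<gamma>] have *: "act V A \<gamma> \<in> Bij (basis V \<rightarrow>\<^sub>E carrier A)"
    "\<And>x y. x \<in> basis V \<rightarrow>\<^sub>E carrier A \<Longrightarrow> y \<in> basis V \<rightarrow>\<^sub>E carrier A \<Longrightarrow>
      act V A \<gamma> (\<lambda>i\<in>basis V. x i \<oplus>\<^bsub>A\<^esub> y i) = (\<lambda>i\<in>basis V. act V A \<gamma> x i \<oplus>\<^bsub>A\<^esub> act V A \<gamma> y i)"
    "\<And>a x. a \<in> carrier A \<Longrightarrow> x \<in> basis V \<rightarrow>\<^sub>E carrier A \<Longrightarrow>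
      act V A \<gamma> (\<lambda>i\<in>basis V. a \<otimes>\<^bsub>A\<^esub> x i) = (\<lambda>i\<in>basis V. a \<otimes>\<^bsub>A\<^esub> act V A \<gamma> x i)"
    by (auto simp: GL_def)
  have "(\<lambda>j i. act V A \<gamma> (unit_vec A (basis V) i) j) = coeff V A \<gamma>"
    by (simp add: coeff_def fun_eq_iff)
  moreover have "act V A \<gamma> x = mat_vec A (basis V) (basis V) (\<lambda>j i. act V A \<gamma> (unit_vec A (basis V) i) j) x"
  proof (rule A.A.linear_is_mat_vec)
    show "finite (basis V)" using V by (simp add: is_rep_def)
    show "act V A \<gamma> z \<in> basis V \<rightarrow>\<^sub>E carrier A" if "z \<in> basis V \<rightarrow>\<^sub>E carrier A" for z
      using Bij_imp_funcset[OF *(1)] that by blast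
    show "x \<in> basis V \<rightarrow>\<^sub>E carrier A" using x by simp
  qed (fact *(2), fact *(3))
  ultimately show ?thesis by simp
qed

lemma coeff_closed:
  assumes V: "is_rep G V" and A: "algebra real_ring A" and \<gamma>: "\<gamma> \<in> carrier (points G A)"
    and i: "i \<in> basis V"
  shows "coeff V A \<gamma> i j \<in> carrier A"
proof -
  interpret A: real_alg A by (rule real_alg.intro) (rule A)
  have "act V A \<gamma> \<in> Bij (basis V \<rightarrow>\<^sub>E carrier A)" using is_rep_act[OF V A \<gamma>] by (simp add: GL_def)
  then have "act V A \<gamma> (unit_vec A (basis V) j) \<in> basis V \<rightarrow>\<^sub>E carrier A"
    by (rule funcset_mem[OF Bij_imp_funcset A.A.unit_vec_closed])
  with i show ?thesis by (auto simp: coeff_def)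
qed

lemma coeff_mult:
  assumes V: "is_rep G V" and A: "algebra real_ring A" and x: "x \<in> carrier (points G A)"
    and y: "y \<in> carrier (points G A)" and i: "i \<in> basis V" and k: "k \<in> basis V"
    and xy: "x \<otimes>\<^bsub>points G A\<^esub> y \<in> carrier (points G A)"
  shows "coeff V A (x \<otimes>\<^bsub>points G A\<^esub> y) i k = mat_mul A (basis V) (coeff V A x) (coeff V A y) i k"
proof -
  interpret A: real_alg A by (rule real_alg.intro) (rule A)
  have fin: "finite (basis V)" using V by (simp add: is_rep_def)
  let ?e = "unit_vec A (basis V) k"
  have e: "?e \<in> carrier (free_module A (basis V))" using A.A.unit_vec_closed[of "basis V" k] by simp
  have "act V A (x \<otimes>\<^bsub>points G A\<^esub> y) = act V A x \<otimes>\<^bsub>GL A (free_module A (basis V))\<^esub> act V A y"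
    using V A x y by (auto simp: is_rep_def hom_def)
  also have "\<dots> = compose (basis V \<rightarrow>\<^sub>E carrier A) (act V A x) (act V A y)"
    using is_rep_act[OF V A x] is_rep_act[OF V A y] by (simp add: GL_def BijGroup_def)
  finally have "coeff V A (x \<otimes>\<^bsub>points G A\<^esub> y) i k = act V A x (act V A y ?e) i"
    using e by (simp add: coeff_def compose_def)
  also have "act V A y ?e = mat_vec A (basis V) (basis V) (coeff V A y) ?e"
    by (rule rep_act_mat_vec[OF V A y e])
  also have "act V A x \<dots> = mat_vec A (basis V) (basis V) (coeff V A x) \<dots>"
    using e coeff_closed[OF V A y] by (intro rep_act_mat_vec[OF V A x]) (auto intro!: A.A.mat_vec_closed)
  also have "\<dots> = mat_vec A (basis V) (basis V) (mat_mul A (basis V) (coeff V A x) (coeff V A y)) ?e"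
    using e fin coeff_closed[OF V A y] coeff_closed[OF V A x] by (intro A.A.mat_vec_mat_vec) auto
  also have "\<dots> i = mat_mul A (basis V) (coeff V A x) (coeff V A y) i k"
    using fin i k coeff_closed[OF V A y] coeff_closed[OF V A x]
    by (intro A.A.mat_vec_unit_vec) (auto intro!: A.A.mat_mul_closed)
  finally show ?thesis .
qed

lemma coeff_one:
  assumes V: "is_rep G V" and A: "algebra real_ring A" and G: "group (points G A)"
    and i: "i \<in> basis V" and j: "j \<in> basis V"
  shows "coeff V A \<one>\<^bsub>points G A\<^esub> i j = (if i = j then \<one>\<^bsub>A\<^esub> else \<zero>\<^bsub>A\<^esub>)"
proof -
  interpret A: real_alg A by (rule real_alg.intro) (rule A)
  interpret G: group "points G A" by (rule G)
  let ?M = "basis V \<rightarrow>\<^sub>E carrier A" and ?e = "unit_vec A (basis V) j"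
  let ?f = "act V A \<one>\<^bsub>points G A\<^esub>"
  have e: "?e \<in> ?M" by (rule A.A.unit_vec_closed)
  have f: "?f \<in> Bij ?M" using is_rep_act[OF V A G.one_closed] by (simp add: GL_def)
  have "?f = act V A (\<one>\<^bsub>points G A\<^esub> \<otimes>\<^bsub>points G A\<^esub> \<one>\<^bsub>points G A\<^esub>)" by simp
  also have "\<dots> = ?f \<otimes>\<^bsub>GL A (free_module A (basis V))\<^esub> ?f"
    using V A G.one_closed unfolding is_rep_def hom_def by blast
  also have "\<dots> = compose ?M ?f ?f"
    using f by (simp add: GL_def BijGroup_def)
  finally have "?f ?e = ?f (?f ?e)" using e by (metis compose_eq)
  moreover have "?f ?e \<in> ?M" using e Bij_imp_funcset[OF f] by blast
  ultimately have "?f ?e = ?e"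
    using e f unfolding Bij_def bij_betw_def by (metis (mono_tags, lifting) Int_iff inj_onD mem_Collect_eq)
  then show ?thesis using i by (simp add: coeff_def unit_vec_def)
qed

lemma coeff_base_change:
  assumes V: "is_rep G V" and \<phi>: "alg_mor A B \<phi>" and x: "x \<in> carrier (points G A)"
    and y: "y \<in> carrier (points G B)" and xy: "base_change G A B \<phi> x y"
    and i: "i \<in> basis V" and j: "j \<in> basis V"
  shows "\<phi> (coeff V A x i j) = coeff V B y i j"
proof -
  interpret alg_mor A B \<phi> by (rule \<phi>)
  have e: "unit_vec A (basis V) j \<in> carrier (free_module A (basis V))"
    using A.A.unit_vec_closed[of "basis V" j] by simp
  have "vec_map \<phi> (basis V) (unit_vec A (basis V) j) = unit_vec B (basis V) j"
    by (auto simp: vec_map_def unit_vec_def)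
  moreover have "act V B y (vec_map \<phi> (basis V) (unit_vec A (basis V) j)) =
      vec_map \<phi> (basis V) (act V A x (unit_vec A (basis V) j))"
    using V A.alg B.alg \<phi> alg_mor.\<phi>[OF \<open>alg_mor A B \<phi>\<close>] x y xy e unfolding is_rep_def by blast
  ultimately show ?thesis using i by (simp add: coeff_def vec_map_def)
qed

lemma is_rep_mat_rep:
  fixes G :: "('u, 'p) grp_functor"
  assumes K: "finite K"
    and G: "\<And>A. algebra real_ring A \<Longrightarrow> group (points G A)"
    and closed: "\<And>A x i j. algebra real_ring A \<Longrightarrow> x \<in> carrier (points G A) \<Longrightarrow> i \<in> K \<Longrightarrow> j \<in> K \<Longrightarrow>
      R A x i j \<in> carrier A"
    and one: "\<And>A i j. algebra real_ring A \<Longrightarrow> i \<in> K \<Longrightarrow> j \<in> K \<Longrightarrow>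
      R A \<one>\<^bsub>points G A\<^esub> i j = (if i = j then \<one>\<^bsub>A\<^esub> else \<zero>\<^bsub>A\<^esub>)"
    and mult: "\<And>A x y i k. algebra real_ring A \<Longrightarrow> x \<in> carrier (points G A) \<Longrightarrow> y \<in> carrier (points G A) \<Longrightarrow>
      i \<in> K \<Longrightarrow> k \<in> K \<Longrightarrow> R A (x \<otimes>\<^bsub>points G A\<^esub> y) i k = mat_mul A K (R A x) (R A y) i k"
    and bc: "\<And>A B \<phi> x y i j. alg_mor A B \<phi> \<Longrightarrow> x \<in> carrier (points G A) \<Longrightarrow> y \<in> carrier (points G B) \<Longrightarrow>
      base_change G A B \<phi> x y \<Longrightarrow> i \<in> K \<Longrightarrow> j \<in> K \<Longrightarrow> \<phi> (R A x i j) = R B y i j"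
  shows "is_rep G (mat_rep K R)"
  unfolding is_rep_def
proof (intro conjI allI impI ballI)
  show "finite (basis (mat_rep K R))" using K by (simp add: mat_rep_def)
next
  fix A :: "(real, 'u) module" assume A: "algebra real_ring A"
  interpret A: real_alg A by (rule real_alg.intro) (rule A)
  interpret G: group "points G A" by (rule G[OF A])
  let ?M = "K \<rightarrow>\<^sub>E carrier A"
  have act: "act (mat_rep K R) A x = (\<lambda>v\<in>?M. mat_vec A K K (R A x) v)" for x
    by (simp add: mat_rep_def)
  have cl: "mat_vec A K K (R A x) v \<in> ?M" if "x \<in> carrier (points G A)" "v \<in> ?M" for x v
    using that closed[OF A] by (intro A.A.mat_vec_closed) auto
  have comp: "mat_vec A K K (R A x) (mat_vec A K K (R A y) v) = mat_vec A K K (R A (x \<otimes>\<^bsub>points G A\<^esub> y)) v"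
    if "x \<in> carrier (points G A)" "y \<in> carrier (points G A)" "v \<in> ?M" for x y v
  proof -
    have "mat_vec A K K (R A x) (mat_vec A K K (R A y) v) = mat_vec A K K (mat_mul A K (R A x) (R A y)) v"
      using that closed[OF A] K by (intro A.A.mat_vec_mat_vec) auto
    also have "\<dots> = mat_vec A K K (R A (x \<otimes>\<^bsub>points G A\<^esub> y)) v"
      using that closed[OF A] K mult[OF A] by (intro A.A.mat_vec_cong) auto
    finally show ?thesis .
  qed
  have id: "mat_vec A K K (R A \<one>\<^bsub>points G A\<^esub>) v = v" if "v \<in> ?M" for v
    using that K one[OF A] by (intro A.A.mat_vec_delta) auto
  have bij: "bij_betw (act (mat_rep K R) A x) ?M ?M" if x: "x \<in> carrier (points G A)" for x
  proof (rule bij_betw_byWitness[of _ "act (mat_rep K R) A (inv\<^bsub>points G A\<^esub> x)"])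
    show "\<forall>v\<in>?M. act (mat_rep K R) A (inv\<^bsub>points G A\<^esub> x) (act (mat_rep K R) A x v) = v"
      using x cl comp id by (simp add: act)
    show "\<forall>v\<in>?M. act (mat_rep K R) A x (act (mat_rep K R) A (inv\<^bsub>points G A\<^esub> x) v) = v"
      using x cl comp id by (simp add: act)
    show "act (mat_rep K R) A x ` ?M \<subseteq> ?M" "act (mat_rep K R) A (inv\<^bsub>points G A\<^esub> x) ` ?M \<subseteq> ?M"
      by (intro image_subsetI; simp only: act restrict_apply' cl[OF x] cl[OF G.inv_closed[OF x]])+
  qed
  have GL: "act (mat_rep K R) A x \<in> carrier (GL A (free_module A K))" if x: "x \<in> carrier (points G A)" for x
  proof -
    let ?f = "act (mat_rep K R) A x"
    have fM: "?f v = mat_vec A K K (R A x) v" if "v \<in> ?M" for v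
      by (simp only: act restrict_apply' that)
    have "?f \<in> Bij ?M" using bij[OF x] by (simp add: Bij_def act)
    moreover have "?f (\<lambda>i\<in>K. u i \<oplus>\<^bsub>A\<^esub> v i) = (\<lambda>i\<in>K. ?f u i \<oplus>\<^bsub>A\<^esub> ?f v i)" if "u \<in> ?M" "v \<in> ?M" for u v
    proof -
      have "(\<lambda>i\<in>K. u i \<oplus>\<^bsub>A\<^esub> v i) \<in> ?M" using that by auto
      moreover have "mat_vec A K K (R A x) (\<lambda>i\<in>K. u i \<oplus>\<^bsub>A\<^esub> v i) =
          (\<lambda>i\<in>K. mat_vec A K K (R A x) u i \<oplus>\<^bsub>A\<^esub> mat_vec A K K (R A x) v i)"
        by (rule A.A.mat_vec_add[OF K _ that]) (rule closed[OF A x])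
      ultimately show ?thesis by (simp only: fM that)
    qed
    moreover have "?f (\<lambda>i\<in>K. a \<otimes>\<^bsub>A\<^esub> v i) = (\<lambda>i\<in>K. a \<otimes>\<^bsub>A\<^esub> ?f v i)" if "a \<in> carrier A" "v \<in> ?M" for a v
    proof -
      have "(\<lambda>i\<in>K. a \<otimes>\<^bsub>A\<^esub> v i) \<in> ?M" using that by auto
      moreover have "mat_vec A K K (R A x) (\<lambda>i\<in>K. a \<otimes>\<^bsub>A\<^esub> v i) =
          (\<lambda>i\<in>K. a \<otimes>\<^bsub>A\<^esub> mat_vec A K K (R A x) v i)"
        by (rule A.A.mat_vec_smult[OF K _ that(2,1)]) (rule closed[OF A x])
      ultimately show ?thesis by (simp only: fM that)
    qed
    ultimately show ?thesis by (simp add: GL_def)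
  qed
  have "act (mat_rep K R) A (x \<otimes>\<^bsub>points G A\<^esub> y) =
      act (mat_rep K R) A x \<otimes>\<^bsub>GL A (free_module A K)\<^esub> act (mat_rep K R) A y"
    if xy: "x \<in> carrier (points G A)" "y \<in> carrier (points G A)" for x y
  proof -
    have "act (mat_rep K R) A x \<otimes>\<^bsub>GL A (free_module A K)\<^esub> act (mat_rep K R) A y =
        compose ?M (act (mat_rep K R) A x) (act (mat_rep K R) A y)"
      using GL[OF xy(1)] GL[OF xy(2)] by (simp add: GL_def BijGroup_def)
    also have "\<dots> = act (mat_rep K R) A (x \<otimes>\<^bsub>points G A\<^esub> y)"
      unfolding compose_def act
      by (rule restrict_ext) (simp only: restrict_apply' cl[OF xy(2)] comp[OF xy])
    finally show ?thesis by simp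
  qed
  with GL show "act (mat_rep K R) A \<in> hom (points G A) (GL A (free_module A (basis (mat_rep K R))))"
    by (auto simp: hom_def mat_rep_def)
next
  fix A B :: "(real, 'u) module" and \<phi> x y v
  assume "algebra real_ring A \<and> algebra real_ring B \<and> \<phi> \<in> alg_hom A B \<and>
    x \<in> carrier (points G A) \<and> y \<in> carrier (points G B) \<and> base_change G A B \<phi> x y"
  then have A: "algebra real_ring A" and B: "algebra real_ring B" and \<phi>: "\<phi> \<in> alg_hom A B"
    and x: "x \<in> carrier (points G A)" and y: "y \<in> carrier (points G B)" and xy: "base_change G A B \<phi> x y"
    by auto
  assume "v \<in> carrier (free_module A (basis (mat_rep K R)))"
  then have v: "v \<in> K \<rightarrow>\<^sub>E carrier A" by (simp add: mat_rep_def)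
  interpret f: alg_mor A B \<phi>
    by (intro alg_mor.intro real_alg.intro alg_mor_axioms.intro A B \<phi>)
  have vi: "\<And>i. i \<in> K \<Longrightarrow> v i \<in> carrier A" using v by auto
  have "mat_vec B K K (R B y) (vec_map \<phi> K v) i = \<phi> (mat_vec A K K (R A x) v i)" if i: "i \<in> K" for i
  proof -
    have "\<phi> (mat_vec A K K (R A x) v i) = (\<Oplus>\<^bsub>B\<^esub>j\<in>K. \<phi> (R A x i j \<otimes>\<^bsub>A\<^esub> v j))"
      using i K vi closed[OF A x] by (simp add: mat_vec_def f.finsum)
    also have "\<dots> = (\<Oplus>\<^bsub>B\<^esub>j\<in>K. R B y i j \<otimes>\<^bsub>B\<^esub> vec_map \<phi> K v j)"
      using i vi closed[OF A x] closed[OF B y] bc[OF f.alg_mor_axioms x y xy]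
      by (intro f.B.A.finsum_cong') (auto simp: vec_map_def)
    finally show ?thesis using i by (simp add: mat_vec_def)
  qed
  moreover have "vec_map \<phi> K v \<in> K \<rightarrow>\<^sub>E carrier B" using vi by (auto simp: vec_map_def)
  ultimately show "act (mat_rep K R) B y (vec_map \<phi> (basis (mat_rep K R)) v) =
      vec_map \<phi> (basis (mat_rep K R)) (act (mat_rep K R) A x v)"
    using v by (auto simp: mat_rep_def fun_eq_iff) (auto simp: vec_map_def mat_vec_def)
qed

lemma coeff_mat_rep:
  assumes "algebra real_ring A" "finite K" "i \<in> K" "j \<in> K" "\<And>j. j \<in> K \<Longrightarrow> R A x i j \<in> carrier A"
  shows "coeff (mat_rep K R) A x i j = R A x i j"
proof -
  interpret A: real_alg A by (rule real_alg.intro) (rule assms(1))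
  show ?thesis
    using assms A.A.unit_vec_closed[of K j] A.A.mat_vec_unit_vec[of K j i K "R A x"]
    by (simp add: coeff_def mat_rep_def)
qed

text \<open>
  It suffices to compare the matrices of both compositions.
\<close>

lemma rep_homI:
  fixes G :: "('u, 'p) grp_functor"
  assumes fin: "finite (basis U)" "finite (basis V)"
    and U: "\<And>A x v. algebra real_ring A \<Longrightarrow> x \<in> carrier (points G A) \<Longrightarrow> v \<in> basis U \<rightarrow>\<^sub>E carrier A \<Longrightarrow>
      act U A x v = mat_vec A (basis U) (basis U) (M A x) v"
    and V: "\<And>A x v. algebra real_ring A \<Longrightarrow> x \<in> carrier (points G A) \<Longrightarrow> v \<in> basis V \<rightarrow>\<^sub>E carrier A \<Longrightarrow>
      act V A x v = mat_vec A (basis V) (basis V) (N A x) v"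
    and M: "\<And>A x i j. algebra real_ring A \<Longrightarrow> x \<in> carrier (points G A) \<Longrightarrow> i \<in> basis U \<Longrightarrow> j \<in> basis U \<Longrightarrow>
      M A x i j \<in> carrier A"
    and N: "\<And>A x i j. algebra real_ring A \<Longrightarrow> x \<in> carrier (points G A) \<Longrightarrow> i \<in> basis V \<Longrightarrow> j \<in> basis V \<Longrightarrow>
      N A x i j \<in> carrier A"
    and eq: "\<And>A x i j. algebra real_ring A \<Longrightarrow> x \<in> carrier (points G A) \<Longrightarrow> i \<in> basis V \<Longrightarrow> j \<in> basis U \<Longrightarrow>
      mat_mul A (basis U) (\<lambda>i k. str_map A (f i k)) (M A x) i j =
      mat_mul A (basis V) (N A x) (\<lambda>k j. str_map A (f k j)) i j"
  shows "rep_hom G U V f"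
  unfolding rep_hom_def
proof (intro allI impI, elim conjE)
  fix A :: "(real, 'u) module" and x v
  assume A: "algebra real_ring A" and x: "x \<in> carrier (points G A)"
    and "v \<in> carrier (free_module A (basis U))"
  then have v: "v \<in> basis U \<rightarrow>\<^sub>E carrier A" by simp
  interpret A: real_alg A by (rule real_alg.intro) (rule A)
  let ?f = "\<lambda>i k. str_map A (f i k)"
  have "alg_lin_map A (basis U) (basis V) f (act U A x v) =
      mat_vec A (basis U) (basis V) ?f (mat_vec A (basis U) (basis U) (M A x) v)"
    by (simp add: lin_map_mat_vec U[OF A x v])
  also have "\<dots> = mat_vec A (basis U) (basis V) (mat_mul A (basis U) ?f (M A x)) v"
    using fin M[OF A x] v by (intro A.A.mat_vec_mat_vec) auto
  also have "\<dots> = mat_vec A (basis U) (basis V) (mat_mul A (basis V) (N A x) ?f) v"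
    using fin M[OF A x] N[OF A x] v eq[OF A x] by (intro A.A.mat_vec_cong) (auto intro!: A.A.mat_mul_closed)
  also have "\<dots> = mat_vec A (basis V) (basis V) (N A x) (mat_vec A (basis U) (basis V) ?f v)"
    using fin N[OF A x] v by (intro A.A.mat_vec_mat_vec[symmetric]) auto
  also have "\<dots> = act V A x (alg_lin_map A (basis U) (basis V) f v)"
    unfolding lin_map_mat_vec
    by (rule V[OF A x, symmetric]) (use v in \<open>auto intro!: A.A.mat_vec_closed\<close>)
  finally show "alg_lin_map A (basis U) (basis V) f (act U A x v) =
      act V A x (alg_lin_map A (basis U) (basis V) f v)" .
qed

section \<open>Products of a group with itself\<close>

text \<open>
  Points can be moved along every homomorphism of algebras, which makes values at different algebras
  comparable. A functor of points has this property by definition; here it is separate, because the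
  base change is a relation.
\<close>

locale bc_group =
  fixes G :: "('u, 'p) grp_functor"
  assumes grp: "algebra real_ring A \<Longrightarrow> group (points G A)"
    and bc_one: "alg_mor A B \<phi> \<Longrightarrow> base_change G A B \<phi> \<one>\<^bsub>points G A\<^esub> \<one>\<^bsub>points G B\<^esub>"
    and bc_ex: "alg_mor A B \<phi> \<Longrightarrow> x \<in> carrier (points G A) \<Longrightarrow>
      \<exists>y\<in>carrier (points G B). base_change G A B \<phi> x y"

locale power_rep = bc_group G for G :: "('u, 'p) grp_functor" +
  fixes g :: nat and V :: "('i, 'u, nat \<Rightarrow> 'p) rep_data"
  assumes rep: "is_rep (power_functor g G) V"
begin

abbreviation "P \<equiv> power_functor g G"
abbreviation "I \<equiv> basis V"
abbreviation "\<rho> \<equiv> coeff V"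

text \<open>
  The points of \<open>G\<^sup>g\<close> which are concentrated in the \<open>m\<close>-th copy, and the part of a point in the copies
  before the \<open>m\<close>-th.
\<close>

definition emb :: "(real, 'u) module \<Rightarrow> nat \<Rightarrow> 'p \<Rightarrow> nat \<Rightarrow> 'p" where
  "emb A m x = (\<lambda>\<nu>\<in>{..<g}. if \<nu> = m then x else \<one>\<^bsub>points G A\<^esub>)"

definition trunc :: "(real, 'u) module \<Rightarrow> nat \<Rightarrow> (nat \<Rightarrow> 'p) \<Rightarrow> nat \<Rightarrow> 'p" where
  "trunc A m \<gamma> = (\<lambda>\<nu>\<in>{..<g}. if \<nu> < m then \<gamma> \<nu> else \<one>\<^bsub>points G A\<^esub>)"

lemma points_P: "points P A = product_group {..<g} (\<lambda>_. points G A)"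
  by (simp add: power_functor_def)

lemma base_change_P: "base_change P A B \<phi> x y \<longleftrightarrow> (\<forall>\<mu><g. base_change G A B \<phi> (x \<mu>) (y \<mu>))"
  by (simp add: power_functor_def)

lemma grp_P: "algebra real_ring A \<Longrightarrow> group (points P A)"
  unfolding points_P by (rule product_group) (rule grp)

lemma finI: "finite I"
  using rep by (simp add: is_rep_def)

lemma carrier_P: "x \<in> carrier (points P A) \<longleftrightarrow> x \<in> {..<g} \<rightarrow>\<^sub>E carrier (points G A)"
  by (simp add: points_P)

lemma one_closed_G: "algebra real_ring A \<Longrightarrow> \<one>\<^bsub>points G A\<^esub> \<in> carrier (points G A)"
  using grp[THEN group.is_monoid] by (rule monoid.one_closed)

lemma emb_closed: "algebra real_ring A \<Longrightarrow> x \<in> carrier (points G A) \<Longrightarrow> emb A m x \<in> carrier (points P A)"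
  using one_closed_G[of A] by (auto simp: carrier_P emb_def)

lemma trunc_closed:
  assumes A: "algebra real_ring A" and \<gamma>: "\<gamma> \<in> carrier (points P A)"
  shows "trunc A m \<gamma> \<in> carrier (points P A)"
proof -
  have "\<gamma> \<nu> \<in> carrier (points G A)" if "\<nu> < g" for \<nu>
    using \<gamma> that unfolding carrier_P by blast
  then show ?thesis
    unfolding carrier_P trunc_def using one_closed_G[OF A] by simp
qed

lemma emb_mult:
  assumes A: "algebra real_ring A"
  shows "emb A m x \<otimes>\<^bsub>points P A\<^esub> emb A m y = emb A m (x \<otimes>\<^bsub>points G A\<^esub> y)"
proof -
  interpret group "points G A" by (rule grp[OF A])
  show ?thesis by (auto simp: points_P emb_def)
qed

lemma emb_one: "emb A m \<one>\<^bsub>points G A\<^esub> = \<one>\<^bsub>points P A\<^esub>"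
  by (auto simp: points_P emb_def)

lemma emb_trunc:
  assumes A: "algebra real_ring A" and m: "m < g" and \<gamma>: "\<gamma> \<in> carrier (points P A)"
    and x: "x \<in> carrier (points G A)"
  shows "emb A m x \<otimes>\<^bsub>points P A\<^esub> trunc A m \<gamma> = trunc A m \<gamma> \<otimes>\<^bsub>points P A\<^esub> emb A m x"
    and "emb A m (\<gamma> m) \<otimes>\<^bsub>points P A\<^esub> trunc A m \<gamma> = trunc A (Suc m) \<gamma>"
proof -
  interpret group "points G A" by (rule grp[OF A])
  have \<gamma>c: "\<And>\<nu>. \<nu> < g \<Longrightarrow> \<gamma> \<nu> \<in> carrier (points G A)" using \<gamma> by (auto simp: carrier_P)
  show "emb A m x \<otimes>\<^bsub>points P A\<^esub> trunc A m \<gamma> = trunc A m \<gamma> \<otimes>\<^bsub>points P A\<^esub> emb A m x"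
    unfolding points_P mult_product_group
    by (rule restrict_ext) (use x \<gamma>c in \<open>auto simp: emb_def trunc_def\<close>)
  have "emb A m (\<gamma> m) \<otimes>\<^bsub>points P A\<^esub> trunc A m \<gamma> = (\<lambda>\<nu>\<in>{..<g}. if \<nu> < Suc m then \<gamma> \<nu> else \<one>\<^bsub>points G A\<^esub>)"
    unfolding points_P mult_product_group
    by (rule restrict_ext) (use \<gamma>c in \<open>auto simp: emb_def trunc_def less_Suc_eq\<close>)
  then show "emb A m (\<gamma> m) \<otimes>\<^bsub>points P A\<^esub> trunc A m \<gamma> = trunc A (Suc m) \<gamma>"
    by (simp add: trunc_def)
qed

lemma trunc_g: "\<gamma> \<in> carrier (points P A) \<Longrightarrow> trunc A g \<gamma> = \<gamma>"
  by (auto simp: carrier_P trunc_def PiE_iff extensional_def fun_eq_iff)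

lemma trunc_1: "0 < g \<Longrightarrow> trunc A (Suc 0) \<gamma> = emb A 0 (\<gamma> 0)"
  by (auto simp: trunc_def emb_def)

lemma bc_emb:
  "alg_mor A B \<phi> \<Longrightarrow> base_change G A B \<phi> x y \<Longrightarrow> base_change P A B \<phi> (emb A m x) (emb B m y)"
  by (simp add: base_change_P emb_def bc_one)

lemma bc_trunc:
  "alg_mor A B \<phi> \<Longrightarrow> base_change P A B \<phi> \<gamma> \<delta> \<Longrightarrow> base_change P A B \<phi> (trunc A m \<gamma>) (trunc B m \<delta>)"
  by (simp add: base_change_P trunc_def bc_one)

lemma bc_ex_P:
  assumes \<phi>: "alg_mor A B \<phi>" and \<gamma>: "\<gamma> \<in> carrier (points P A)"
  shows "\<exists>\<delta>\<in>carrier (points P B). base_change P A B \<phi> \<gamma> \<delta>"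
proof -
  have "\<forall>\<nu>\<in>{..<g}. \<exists>y. y \<in> carrier (points G B) \<and> base_change G A B \<phi> (\<gamma> \<nu>) y"
    using bc_ex[OF \<phi>] \<gamma> by (fastforce simp: carrier_P)
  then obtain f where "\<forall>\<nu>\<in>{..<g}. f \<nu> \<in> carrier (points G B) \<and> base_change G A B \<phi> (\<gamma> \<nu>) (f \<nu>)"
    by (rule bchoice[THEN exE])
  then show ?thesis
    by (intro bexI[of _ "restrict f {..<g}"]) (auto simp: carrier_P base_change_P)
qed

text \<open>
  Matrix entries at points over two different algebras are multiplied inside the tensor product of
  the two algebras, where both points live.
\<close>

lemma form_coeff_mult:
  assumes \<phi>: "alg_mor A T \<phi>" and \<psi>: "alg_mor B T \<psi>" and n: "linear_form T n"
    and nm: "\<And>a b. a \<in> carrier A \<Longrightarrow> b \<in> carrier B \<Longrightarrow> n (\<phi> a \<otimes>\<^bsub>T\<^esub> \<psi> b) = l a * m b"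
    and x: "x \<in> carrier (points P A)" "x' \<in> carrier (points P T)" "base_change P A T \<phi> x x'"
    and y: "y \<in> carrier (points P B)" "y' \<in> carrier (points P T)" "base_change P B T \<psi> y y'"
    and i: "i \<in> I" and k: "k \<in> I"
  shows "n (\<rho> T (x' \<otimes>\<^bsub>points P T\<^esub> y') i k) = (\<Sum>j\<in>I. l (\<rho> A x i j) * m (\<rho> B y j k))"
    and "n (\<rho> T (y' \<otimes>\<^bsub>points P T\<^esub> x') i k) = (\<Sum>j\<in>I. m (\<rho> B y i j) * l (\<rho> A x j k))"
proof -
  interpret a: alg_mor A T \<phi> by (rule \<phi>)
  interpret b: alg_mor B T \<psi> by (rule \<psi>)
  interpret T: group "points P T" by (rule grp_P[OF a.B.alg])
  note cA = coeff_closed[OF rep a.A.alg x(1)] and cB = coeff_closed[OF rep b.A.alg y(1)]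
  note cx = coeff_closed[OF rep a.B.alg x(2)] and cy = coeff_closed[OF rep a.B.alg y(2)]
  note ex = coeff_base_change[OF rep \<phi> x(1,2,3)] and ey = coeff_base_change[OF rep \<psi> y(1,2,3)]
  have "n (\<rho> T (x' \<otimes>\<^bsub>points P T\<^esub> y') i k) = n (mat_mul T I (\<rho> T x') (\<rho> T y') i k)"
    by (subst coeff_mult[OF rep a.B.alg x(2) y(2) i k]) (simp_all only: T.m_closed x y)
  also have "\<dots> = (\<Sum>j\<in>I. n (\<rho> T x' i j \<otimes>\<^bsub>T\<^esub> \<rho> T y' j k))"
    unfolding mat_mul_def by (rule a.B.linear_form_sum[OF n finI]) (simp add: cx cy i k)
  also have "\<dots> = (\<Sum>j\<in>I. l (\<rho> A x i j) * m (\<rho> B y j k))"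
    by (rule sum.cong[OF refl]) (simp add: ex[symmetric] ey[symmetric] i k nm cA cB)
  finally show "n (\<rho> T (x' \<otimes>\<^bsub>points P T\<^esub> y') i k) = (\<Sum>j\<in>I. l (\<rho> A x i j) * m (\<rho> B y j k))" .
  have "n (\<rho> T (y' \<otimes>\<^bsub>points P T\<^esub> x') i k) = n (mat_mul T I (\<rho> T y') (\<rho> T x') i k)"
    by (subst coeff_mult[OF rep a.B.alg y(2) x(2) i k]) (simp_all only: T.m_closed x y)
  also have "\<dots> = (\<Sum>j\<in>I. n (\<rho> T y' i j \<otimes>\<^bsub>T\<^esub> \<rho> T x' j k))"
    unfolding mat_mul_def by (rule a.B.linear_form_sum[OF n finI]) (simp add: cx cy i k)
  also have "\<dots> = (\<Sum>j\<in>I. n (\<rho> T x' j k \<otimes>\<^bsub>T\<^esub> \<rho> T y' i j))"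
    by (rule sum.cong[OF refl]) (simp add: a.B.A.m_comm cx cy i k)
  also have "\<dots> = (\<Sum>j\<in>I. m (\<rho> B y i j) * l (\<rho> A x j k))"
    by (rule sum.cong[OF refl]) (simp add: ex[symmetric] ey[symmetric] i k nm cA cB)
  finally show "n (\<rho> T (y' \<otimes>\<^bsub>points P T\<^esub> x') i k) = (\<Sum>j\<in>I. m (\<rho> B y i j) * l (\<rho> A x j k))" .
qed

text \<open>
  The real matrices which occur as coefficients of the action of the \<open>m\<close>-th factor. The identity
  matrix is added by hand because \<open>'u\<close> may be so small that the zero ring is the only algebra.
\<close>

definition coeff_mats :: "nat \<Rightarrow> ('i \<times> 'i \<Rightarrow> real) set" where
  "coeff_mats m = insert (\<lambda>p. if fst p = snd p then 1 else 0)
     {(\<lambda>p. l (\<rho> A (emb A m x) (fst p) (snd p))) | A x l.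
        algebra real_ring A \<and> x \<in> carrier (points G A) \<and> linear_form A l}"

text \<open>
  The matrix \<open>b\<close> comes from points of the \<open>m\<close>-th copy over other algebras \<open>B\<close>. Over \<open>B \<otimes> A\<close> they commute with
  the part of \<open>\<gamma>\<close> in the copies before the \<open>m\<close>-th, and the two orders of multiplication give the two sides.
\<close>

lemma coeff_mats_commute:
  assumes b: "b \<in> fun_span (coeff_mats m)" and m: "m < g" and A: "algebra real_ring A"
    and \<gamma>: "\<gamma> \<in> carrier (points P A)" and i: "i \<in> I" and k: "k \<in> I"
  shows "mat_mul A I (\<lambda>a c. str_map A (b (a, c))) (\<rho> A (trunc A m \<gamma>)) i k =
    mat_mul A I (\<rho> A (trunc A m \<gamma>)) (\<lambda>a c. str_map A (b (a, c))) i k"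
proof -
  interpret A: real_alg A by (rule real_alg.intro) (rule A)
  note tc = trunc_closed[OF A \<gamma>, of m]
  note c = coeff_closed[OF rep A tc]
  have key: "(\<Sum>j\<in>I. b (i, j) * l (\<rho> A (trunc A m \<gamma>) j k)) = (\<Sum>j\<in>I. l (\<rho> A (trunc A m \<gamma>) i j) * b (j, k))"
    if l: "linear_form A l" for l
    using b
  proof (induction rule: fun_span.induct)
    case (base b)
    then consider "b = (\<lambda>p. if fst p = snd p then 1 else 0)"
      | B x l' where "algebra real_ring B" "x \<in> carrier (points G B)" "linear_form B l'"
        "b = (\<lambda>p. l' (\<rho> B (emb B m x) (fst p) (snd p)))"
      unfolding coeff_mats_def by blast
    then show ?case
    proof cases
      case 1
      have "(\<Sum>j\<in>I. (if i = j then 1 else 0) * l (\<rho> A (trunc A m \<gamma>) j k)) =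
          (\<Sum>j\<in>I. if i = j then l (\<rho> A (trunc A m \<gamma>) j k) else 0)"
        by (rule sum.cong) auto
      moreover have "(\<Sum>j\<in>I. l (\<rho> A (trunc A m \<gamma>) i j) * (if j = k then 1 else 0)) =
          (\<Sum>j\<in>I. if j = k then l (\<rho> A (trunc A m \<gamma>) i j) else 0)"
        by (rule sum.cong) auto
      ultimately show ?thesis using finI i k by (simp add: 1)
    next
      case (2 B x l')
      obtain T :: "(real, 'u) module" and \<phi> \<psi> n where T: "algebra real_ring T" "\<phi> \<in> alg_hom B T"
          "\<psi> \<in> alg_hom A T" "linear_form T n"
        and n: "\<And>a b. a \<in> carrier B \<Longrightarrow> b \<in> carrier A \<Longrightarrow> n (\<phi> a \<otimes>\<^bsub>T\<^esub> \<psi> b) = l' a * l b"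
        using tensor_product_exists[OF 2(1) A 2(3) l] by blast
      have \<phi>: "alg_mor B T \<phi>" and \<psi>: "alg_mor A T \<psi>"
        by (intro alg_mor.intro real_alg.intro alg_mor_axioms.intro T 2 A)+
      obtain y where y: "y \<in> carrier (points G T)" "base_change G B T \<phi> x y"
        using bc_ex[OF \<phi> 2(2)] by blast
      obtain \<delta> where \<delta>: "\<delta> \<in> carrier (points P T)" "base_change P A T \<psi> \<gamma> \<delta>"
        using bc_ex_P[OF \<psi> \<gamma>] by blast
      note fm = form_coeff_mult[OF \<phi> \<psi> T(4) n emb_closed[OF 2(1,2)] emb_closed[OF T(1) y(1)]
          bc_emb[OF \<phi> y(2)] tc trunc_closed[OF T(1) \<delta>(1)] bc_trunc[OF \<psi> \<delta>(2)] i k]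
      show ?thesis unfolding 2(4) fst_conv snd_conv
        using fm[of m] emb_trunc(1)[OF T(1) m \<delta>(1) y(1)] by simp
    qed
  next
    case (comb u v a b)
    then show ?case
      by (simp add: algebra_simps sum.distrib flip: sum_distrib_left)
  qed
  show ?thesis
  proof (rule A.linear_forms_separate)
    fix l assume l: "linear_form A l"
    have "l (mat_mul A I (\<lambda>a c. str_map A (b (a, c))) (\<rho> A (trunc A m \<gamma>)) i k) =
        (\<Sum>j\<in>I. l (str_map A (b (i, j)) \<otimes>\<^bsub>A\<^esub> \<rho> A (trunc A m \<gamma>) j k))"
      unfolding mat_mul_def by (rule A.linear_form_sum[OF l finI]) (simp add: c)
    also have "\<dots> = (\<Sum>j\<in>I. b (i, j) * l (\<rho> A (trunc A m \<gamma>) j k))"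
      using l c by (intro sum.cong) (simp_all add: A.str_map_mult linear_form_def)
    also have "\<dots> = (\<Sum>j\<in>I. l (\<rho> A (trunc A m \<gamma>) i j) * b (j, k))" by (rule key[OF l])
    also have "\<dots> = (\<Sum>j\<in>I. l (\<rho> A (trunc A m \<gamma>) i j \<otimes>\<^bsub>A\<^esub> str_map A (b (j, k))))"
      using l c i by (intro sum.cong) (simp_all add: A.str_map_mult' linear_form_def)
    also have "\<dots> = l (mat_mul A I (\<rho> A (trunc A m \<gamma>)) (\<lambda>a c. str_map A (b (a, c))) i k)"
      unfolding mat_mul_def by (rule A.linear_form_sum[OF l finI, symmetric]) (simp add: c i)
    finally show "l (mat_mul A I (\<lambda>a c. str_map A (b (a, c))) (\<rho> A (trunc A m \<gamma>)) i k) =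
        l (mat_mul A I (\<rho> A (trunc A m \<gamma>)) (\<lambda>a c. str_map A (b (a, c))) i k)" .
  qed (auto intro!: A.A.mat_mul_closed c i)
qed

text \<open>
  The product of \<open>l(\<rho>(x))\<close> and \<open>l'(\<rho>(y))\<close> is \<open>(l \<otimes> l')(\<rho>(xy))\<close> for the product of the images of \<open>x\<close> and \<open>y\<close> over
  the tensor product of the algebras.
\<close>

lemma coeff_mats_left_mult:
  assumes b: "b \<in> fun_span (coeff_mats m)" and A: "algebra real_ring A"
    and x: "x \<in> carrier (points G A)" and l: "linear_form A l"
  shows "\<exists>b'\<in>fun_span (coeff_mats m). \<forall>i\<in>I. \<forall>k\<in>I.
    b' (i, k) = (\<Sum>j\<in>I. l (\<rho> A (emb A m x) i j) * b (j, k))"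
  using b
proof (induction rule: fun_span.induct)
  case (base b)
  then consider "b = (\<lambda>p. if fst p = snd p then 1 else 0)"
    | B y l' where "algebra real_ring B" "y \<in> carrier (points G B)" "linear_form B l'"
      "b = (\<lambda>p. l' (\<rho> B (emb B m y) (fst p) (snd p)))"
    unfolding coeff_mats_def by blast
  then show ?case
  proof cases
    case 1
    have eq: "l (\<rho> A (emb A m x) i k) = (\<Sum>j\<in>I. l (\<rho> A (emb A m x) i j) * b (j, k))" if "k \<in> I" for i k
    proof -
      have "(\<Sum>j\<in>I. l (\<rho> A (emb A m x) i j) * b (j, k)) =
          (\<Sum>j\<in>I. if j = k then l (\<rho> A (emb A m x) i j) else 0)"
        unfolding 1 by (rule sum.cong) auto
      then show ?thesis using finI that by simp
    qed
    have "(\<lambda>p. l (\<rho> A (emb A m x) (fst p) (snd p))) \<in> coeff_mats m"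
      unfolding coeff_mats_def using A x l by blast
    from fun_span.base[OF this] show ?thesis by (rule rev_bexI) (simp add: eq)
  next
    case (2 B y l')
    obtain T :: "(real, 'u) module" and \<phi> \<psi> n where T: "algebra real_ring T" "\<phi> \<in> alg_hom A T"
        "\<psi> \<in> alg_hom B T" "linear_form T n"
      and n: "\<And>a b. a \<in> carrier A \<Longrightarrow> b \<in> carrier B \<Longrightarrow> n (\<phi> a \<otimes>\<^bsub>T\<^esub> \<psi> b) = l a * l' b"
      using tensor_product_exists[OF A 2(1) l 2(3)] by blast
    have \<phi>: "alg_mor A T \<phi>" and \<psi>: "alg_mor B T \<psi>"
      by (intro alg_mor.intro real_alg.intro alg_mor_axioms.intro T 2 A)+
    obtain x' where x': "x' \<in> carrier (points G T)" "base_change G A T \<phi> x x'"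
      using bc_ex[OF \<phi> x] by blast
    obtain y' where y': "y' \<in> carrier (points G T)" "base_change G B T \<psi> y y'"
      using bc_ex[OF \<psi> 2(2)] by blast
    interpret T: group "points G T" by (rule grp[OF T(1)])
    have "(\<lambda>p. n (\<rho> T (emb T m (x' \<otimes>\<^bsub>points G T\<^esub> y')) (fst p) (snd p))) \<in> coeff_mats m"
      unfolding coeff_mats_def using T(1,4) T.m_closed[OF x'(1) y'(1)] by blast
    moreover have "n (\<rho> T (emb T m (x' \<otimes>\<^bsub>points G T\<^esub> y')) i k) =
        (\<Sum>j\<in>I. l (\<rho> A (emb A m x) i j) * b (j, k))" if "i \<in> I" "k \<in> I" for i k
      unfolding 2(4) fst_conv snd_conv emb_mult[OF T(1), symmetric]
      by (rule form_coeff_mult(1)[OF \<phi> \<psi> T(4) n emb_closed[OF A x] emb_closed[OF T(1) x'(1)]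
            bc_emb[OF \<phi> x'(2)] emb_closed[OF 2(1,2)] emb_closed[OF T(1) y'(1)] bc_emb[OF \<psi> y'(2)] that])
    ultimately show ?thesis by (intro bexI[OF _ fun_span.base]) auto
  qed
next
  case (comb u v a b)
  then obtain u' v' where *: "u' \<in> fun_span (coeff_mats m)" "v' \<in> fun_span (coeff_mats m)"
    "\<And>i k. i \<in> I \<Longrightarrow> k \<in> I \<Longrightarrow> u' (i, k) = (\<Sum>j\<in>I. l (\<rho> A (emb A m x) i j) * u (j, k))"
    "\<And>i k. i \<in> I \<Longrightarrow> k \<in> I \<Longrightarrow> v' (i, k) = (\<Sum>j\<in>I. l (\<rho> A (emb A m x) i j) * v (j, k))"
    by blast
  show ?case
    by (rule bexI[OF _ fun_span.comb[OF *(1,2), of a b]])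
      (simp add: *(3,4) algebra_simps sum.distrib sum_distrib_left)
qed

end

section \<open>Assembling the exterior product\<close>

text \<open>
  The \<open>m\<close>-th factor of the exterior product has dimension \<open>N m\<close> and matrix entries \<open>R m\<close>. For \<open>m > 0\<close>, its
  basis stands for the endomorphisms \<open>e m 0, e m 1, \<dots>\<close> of \<open>V\<close>, on which the \<open>m\<close>-th copy of \<open>G\<close> acts by
  left multiplication, and \<open>d m\<close> are the coefficients of the identity. The factor with index \<open>0\<close> is \<open>V\<close>
  itself, with its basis numbered by \<open>p0\<close>.
\<close>

locale factor_data = power_rep G g V for G :: "('u, 'p) grp_functor" and g and V :: "('i, 'u, nat \<Rightarrow> 'p) rep_data" +
  fixes N :: "nat \<Rightarrow> nat"
    and R :: "nat \<Rightarrow> (real, 'u) module \<Rightarrow> 'p \<Rightarrow> nat \<Rightarrow> nat \<Rightarrow> 'u"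
    and e :: "nat \<Rightarrow> nat \<Rightarrow> 'i \<Rightarrow> 'i \<Rightarrow> real"
    and d :: "nat \<Rightarrow> nat \<Rightarrow> real"
    and p0 :: "nat \<Rightarrow> 'i"
  assumes R_closed: "m < g \<Longrightarrow> algebra real_ring A \<Longrightarrow> x \<in> carrier (points G A) \<Longrightarrow>
      i < N m \<Longrightarrow> j < N m \<Longrightarrow> R m A x i j \<in> carrier A"
    and R_one: "m < g \<Longrightarrow> algebra real_ring A \<Longrightarrow> i < N m \<Longrightarrow> j < N m \<Longrightarrow>
      R m A \<one>\<^bsub>points G A\<^esub> i j = (if i = j then \<one>\<^bsub>A\<^esub> else \<zero>\<^bsub>A\<^esub>)"
    and R_mult: "m < g \<Longrightarrow> algebra real_ring A \<Longrightarrow> x \<in> carrier (points G A) \<Longrightarrow> y \<in> carrier (points G A) \<Longrightarrow>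
      i < N m \<Longrightarrow> k < N m \<Longrightarrow> R m A (x \<otimes>\<^bsub>points G A\<^esub> y) i k = mat_mul A {..<N m} (R m A x) (R m A y) i k"
    and R_bc: "m < g \<Longrightarrow> alg_mor A B \<phi> \<Longrightarrow> x \<in> carrier (points G A) \<Longrightarrow> y \<in> carrier (points G B) \<Longrightarrow>
      base_change G A B \<phi> x y \<Longrightarrow> i < N m \<Longrightarrow> j < N m \<Longrightarrow> \<phi> (R m A x i j) = R m B y i j"
    and p0: "bij_betw p0 {..<N 0} (basis V)"
    and R_0: "algebra real_ring A \<Longrightarrow> x \<in> carrier (points G A) \<Longrightarrow> i < N 0 \<Longrightarrow> j < N 0 \<Longrightarrow>
      R 0 A x i j = coeff V A (emb A 0 x) (p0 i) (p0 j)"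
    and e_act: "0 < m \<Longrightarrow> m < g \<Longrightarrow> algebra real_ring A \<Longrightarrow> x \<in> carrier (points G A) \<Longrightarrow>
      a \<in> basis V \<Longrightarrow> c \<in> basis V \<Longrightarrow> i < N m \<Longrightarrow>
      (\<Oplus>\<^bsub>A\<^esub>q\<in>basis V. coeff V A (emb A m x) a q \<otimes>\<^bsub>A\<^esub> str_map A (e m i q c)) =
      (\<Oplus>\<^bsub>A\<^esub>k\<in>{..<N m}. str_map A (e m k a c) \<otimes>\<^bsub>A\<^esub> R m A x k i)"
    and e_comm: "0 < m \<Longrightarrow> m < g \<Longrightarrow> algebra real_ring A \<Longrightarrow> \<gamma> \<in> carrier (points (power_functor g G) A) \<Longrightarrow>
      a \<in> basis V \<Longrightarrow> c \<in> basis V \<Longrightarrow> i < N m \<Longrightarrow>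
      mat_mul A (basis V) (\<lambda>a c. str_map A (e m i a c)) (coeff V A (trunc A m \<gamma>)) a c =
      mat_mul A (basis V) (coeff V A (trunc A m \<gamma>)) (\<lambda>a c. str_map A (e m i a c)) a c"
    and e_one: "0 < m \<Longrightarrow> m < g \<Longrightarrow> a \<in> basis V \<Longrightarrow> c \<in> basis V \<Longrightarrow>
      (\<Sum>j<N m. d m j * e m j a c) = (if a = c then 1 else 0)"
    and g_pos: "g \<ge> 1"
begin

abbreviation "K \<mu> \<equiv> {..<N \<mu>}"
abbreviation "X m \<equiv> PiE {..<m} (\<lambda>\<mu>. {..<N \<mu>})"

text \<open>
  The matrix of the action on the tensor product of the first \<open>m\<close> factors. The entries make sense for all
  indices whose first \<open>m\<close> components are in range, which saves restricting indices in inductions on \<open>m\<close>.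
\<close>

definition XP :: "nat \<Rightarrow> (real, 'u) module \<Rightarrow> (nat \<Rightarrow> 'p) \<Rightarrow> (nat \<Rightarrow> nat) \<Rightarrow> (nat \<Rightarrow> nat) \<Rightarrow> 'u" where
  "XP m A \<gamma> j i = (\<Otimes>\<^bsub>A\<^esub>\<mu>\<in>{..<m}. R \<mu> A (\<gamma> \<mu>) (j \<mu>) (i \<mu>))"

lemma fin_X: "finite (X m)"
  by (intro finite_PiE) auto

lemma X_D: "j \<in> X m \<Longrightarrow> \<mu> < m \<Longrightarrow> j \<mu> < N \<mu>"
  by auto

lemma upd_range: "j \<in> X m \<Longrightarrow> k \<in> K m \<Longrightarrow> \<forall>\<mu><Suc m. (j(m := k)) \<mu> < N \<mu>"
  by (auto simp: less_Suc_eq dest: X_D)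

lemma pt: "\<gamma> \<in> carrier (points P A) \<Longrightarrow> \<mu> < g \<Longrightarrow> \<gamma> \<mu> \<in> carrier (points G A)"
  by (auto simp: carrier_P)

lemma XP_closed:
  assumes "algebra real_ring A" "m \<le> g" "\<gamma> \<in> carrier (points P A)" "\<forall>\<mu><m. j \<mu> < N \<mu>" "\<forall>\<mu><m. i \<mu> < N \<mu>"
  shows "XP m A \<gamma> j i \<in> carrier A"
proof -
  interpret A: real_alg A by (rule real_alg.intro) (rule assms(1))
  show ?thesis unfolding XP_def
    by (rule A.A.finprod_closed) (use assms in \<open>auto intro!: R_closed pt\<close>)
qed

lemma XP_Suc:
  assumes "algebra real_ring A" "m < g" "\<gamma> \<in> carrier (points P A)" "\<forall>\<mu><Suc m. j \<mu> < N \<mu>" "\<forall>\<mu><Suc m. i \<mu> < N \<mu>"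
  shows "XP (Suc m) A \<gamma> j i = R m A (\<gamma> m) (j m) (i m) \<otimes>\<^bsub>A\<^esub> XP m A \<gamma> j i"
proof -
  interpret A: real_alg A by (rule real_alg.intro) (rule assms(1))
  show ?thesis unfolding XP_def lessThan_Suc
    by (rule A.A.finprod_insert) (use assms in \<open>auto intro!: R_closed pt\<close>)
qed

lemma XP_Suc_upd:
  assumes A: "algebra real_ring A" and m: "m < g" and \<gamma>: "\<gamma> \<in> carrier (points P A)"
    and k: "k < N m" and j: "j \<in> X m" and i: "\<forall>\<mu><m. i \<mu> < N \<mu>" "i m < N m"
  shows "XP (Suc m) A \<gamma> (j(m := k)) i = R m A (\<gamma> m) k (i m) \<otimes>\<^bsub>A\<^esub> XP m A \<gamma> j i"
    and "XP (Suc m) A \<gamma> i (j(m := k)) = R m A (\<gamma> m) (i m) k \<otimes>\<^bsub>A\<^esub> XP m A \<gamma> i j"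
proof -
  interpret A: real_alg A by (rule real_alg.intro) (rule A)
  have jN: "\<And>\<mu>. \<mu> < m \<Longrightarrow> j \<mu> < N \<mu>" using j by auto
  have "XP m A \<gamma> (j(m := k)) i = XP m A \<gamma> j i" "XP m A \<gamma> i (j(m := k)) = XP m A \<gamma> i j"
    unfolding XP_def
    by (rule A.A.finprod_cong'[OF refl]; use m i jN in \<open>auto intro!: R_closed A pt[OF \<gamma>]\<close>)+
  moreover have "XP (Suc m) A \<gamma> (j(m := k)) i = R m A (\<gamma> m) k (i m) \<otimes>\<^bsub>A\<^esub> XP m A \<gamma> (j(m := k)) i"
    "XP (Suc m) A \<gamma> i (j(m := k)) = R m A (\<gamma> m) (i m) k \<otimes>\<^bsub>A\<^esub> XP m A \<gamma> i (j(m := k))"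
    using jN i k by (subst XP_Suc[OF A m \<gamma>]; simp add: less_Suc_eq)+
  ultimately show "XP (Suc m) A \<gamma> (j(m := k)) i = R m A (\<gamma> m) k (i m) \<otimes>\<^bsub>A\<^esub> XP m A \<gamma> j i"
    "XP (Suc m) A \<gamma> i (j(m := k)) = R m A (\<gamma> m) (i m) k \<otimes>\<^bsub>A\<^esub> XP m A \<gamma> i j" by simp_all
qed

lemma XP_one:
  assumes A: "algebra real_ring A"
  shows "m \<le> g \<Longrightarrow> \<forall>\<mu><m. j \<mu> < N \<mu> \<Longrightarrow> \<forall>\<mu><m. i \<mu> < N \<mu> \<Longrightarrow>
    XP m A \<one>\<^bsub>points P A\<^esub> j i = (if \<forall>\<mu><m. j \<mu> = i \<mu> then \<one>\<^bsub>A\<^esub> else \<zero>\<^bsub>A\<^esub>)"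
proof (induction m)
  case 0
  interpret A: real_alg A by (rule real_alg.intro) (rule A)
  show ?case by (simp add: XP_def)
next
  case (Suc m)
  interpret A: real_alg A by (rule real_alg.intro) (rule A)
  interpret P: group "points P A" by (rule grp_P[OF A])
  have "XP (Suc m) A \<one>\<^bsub>points P A\<^esub> j i =
      R m A (\<one>\<^bsub>points P A\<^esub> m) (j m) (i m) \<otimes>\<^bsub>A\<^esub> XP m A \<one>\<^bsub>points P A\<^esub> j i"
    by (rule XP_Suc[OF A]) (use Suc.prems in auto)
  moreover have "\<one>\<^bsub>points P A\<^esub> m = \<one>\<^bsub>points G A\<^esub>" using Suc.prems by (simp add: points_P)
  moreover have "R m A \<one>\<^bsub>points G A\<^esub> (j m) (i m) = (if j m = i m then \<one>\<^bsub>A\<^esub> else \<zero>\<^bsub>A\<^esub>)"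
    by (rule R_one[OF _ A]) (use Suc.prems in auto)
  moreover have "XP m A \<one>\<^bsub>points P A\<^esub> j i = (if \<forall>\<mu><m. j \<mu> = i \<mu> then \<one>\<^bsub>A\<^esub> else \<zero>\<^bsub>A\<^esub>)"
    using Suc by auto
  ultimately show ?case by (auto simp: less_Suc_eq)
qed

lemma XP_mult:
  assumes A: "algebra real_ring A" and \<gamma>: "\<gamma> \<in> carrier (points P A)" and \<delta>: "\<delta> \<in> carrier (points P A)"
  shows "m \<le> g \<Longrightarrow> \<forall>\<mu><m. i \<mu> < N \<mu> \<Longrightarrow> \<forall>\<mu><m. k \<mu> < N \<mu> \<Longrightarrow>
    XP m A (\<gamma> \<otimes>\<^bsub>points P A\<^esub> \<delta>) i k = mat_mul A (X m) (XP m A \<gamma>) (XP m A \<delta>) i k"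
proof (induction m)
  case 0
  interpret A: real_alg A by (rule real_alg.intro) (rule A)
  show ?case by (simp add: XP_def mat_mul_def)
next
  case (Suc m)
  interpret A: real_alg A by (rule real_alg.intro) (rule A)
  interpret P: group "points P A" by (rule grp_P[OF A])
  have m: "m < g" "m \<le> g" using Suc.prems by auto
  have i: "\<forall>\<mu><m. i \<mu> < N \<mu>" "i m < N m" and k: "\<forall>\<mu><m. k \<mu> < N \<mu>" "k m < N m" using Suc.prems by auto
  note Rc = R_closed[OF m(1) A pt[OF \<gamma> m(1)]] R_closed[OF m(1) A pt[OF \<delta> m(1)]]
  have Xc: "XP m A \<gamma> i j \<in> carrier A" "XP m A \<delta> j k \<in> carrier A" if "j \<in> X m" for j
    using that i k by (auto intro!: XP_closed A m \<gamma> \<delta>)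
  have "mat_mul A (X (Suc m)) (XP (Suc m) A \<gamma>) (XP (Suc m) A \<delta>) i k =
      (\<Oplus>\<^bsub>A\<^esub>l\<in>K m. \<Oplus>\<^bsub>A\<^esub>j\<in>X m. XP (Suc m) A \<gamma> i (j(m := l)) \<otimes>\<^bsub>A\<^esub> XP (Suc m) A \<delta> (j(m := l)) k)"
    unfolding mat_mul_def
    by (rule A.A.finsum_PiE_Suc) (simp, intro A.A.m_closed XP_closed A \<gamma> \<delta> upd_range Suc.prems)
  also have "\<dots> = (\<Oplus>\<^bsub>A\<^esub>l\<in>K m. \<Oplus>\<^bsub>A\<^esub>j\<in>X m. (R m A (\<gamma> m) (i m) l \<otimes>\<^bsub>A\<^esub> R m A (\<delta> m) l (k m)) \<otimes>\<^bsub>A\<^esub>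
      (XP m A \<gamma> i j \<otimes>\<^bsub>A\<^esub> XP m A \<delta> j k))"
  proof (intro A.A.finsum_cong' refl)
    fix l j assume l: "l \<in> K m" and j: "j \<in> X m"
    have "XP (Suc m) A \<gamma> i (j(m := l)) = R m A (\<gamma> m) (i m) l \<otimes>\<^bsub>A\<^esub> XP m A \<gamma> i j"
      using l i by (intro XP_Suc_upd(2) A m \<gamma> j) auto
    moreover have "XP (Suc m) A \<delta> (j(m := l)) k = R m A (\<delta> m) l (k m) \<otimes>\<^bsub>A\<^esub> XP m A \<delta> j k"
      using l k by (intro XP_Suc_upd(1) A m \<delta> j) auto
    ultimately show "XP (Suc m) A \<gamma> i (j(m := l)) \<otimes>\<^bsub>A\<^esub> XP (Suc m) A \<delta> (j(m := l)) k =
      (R m A (\<gamma> m) (i m) l \<otimes>\<^bsub>A\<^esub> R m A (\<delta> m) l (k m)) \<otimes>\<^bsub>A\<^esub> (XP m A \<gamma> i j \<otimes>\<^bsub>A\<^esub> XP m A \<delta> j k)"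
      using l i(2) k(2) Xc[OF j] by (simp add: Rc A.A.m_ac)
  qed (use i k in \<open>auto intro!: A.A.finsum_closed Rc Xc\<close>)
  also have "\<dots> = (\<Oplus>\<^bsub>A\<^esub>l\<in>K m. R m A (\<gamma> m) (i m) l \<otimes>\<^bsub>A\<^esub> R m A (\<delta> m) l (k m)) \<otimes>\<^bsub>A\<^esub>
      (\<Oplus>\<^bsub>A\<^esub>j\<in>X m. XP m A \<gamma> i j \<otimes>\<^bsub>A\<^esub> XP m A \<delta> j k)"
    by (rule A.A.finsum_prod_distrib) (use i k fin_X in \<open>auto intro!: Rc Xc\<close>)
  also have "\<dots> = R m A (\<gamma> m \<otimes>\<^bsub>points G A\<^esub> \<delta> m) (i m) (k m) \<otimes>\<^bsub>A\<^esub> XP m A (\<gamma> \<otimes>\<^bsub>points P A\<^esub> \<delta>) i k"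
    using R_mult[OF m(1) A pt[OF \<gamma> m(1)] pt[OF \<delta> m(1)] i(2) k(2)] Suc.IH[OF m(2) i(1) k(1)]
    by (simp add: mat_mul_def)
  also have "\<dots> = XP (Suc m) A (\<gamma> \<otimes>\<^bsub>points P A\<^esub> \<delta>) i k"
    using Suc.prems m P.m_closed[OF \<gamma> \<delta>] by (subst XP_Suc[OF A m(1)]) (auto simp: points_P)
  finally show ?case by simp
qed

lemma XP_bc:
  assumes \<phi>: "alg_mor A B \<phi>" and m: "m \<le> g" and \<gamma>: "\<gamma> \<in> carrier (points P A)" and \<delta>: "\<delta> \<in> carrier (points P B)"
    and bc: "base_change P A B \<phi> \<gamma> \<delta>" and j: "\<forall>\<mu><m. j \<mu> < N \<mu>" and i: "\<forall>\<mu><m. i \<mu> < N \<mu>"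
  shows "\<phi> (XP m A \<gamma> j i) = XP m B \<delta> j i"
proof -
  interpret f: alg_mor A B \<phi> by (rule \<phi>)
  have "\<phi> (XP m A \<gamma> j i) = (\<Otimes>\<^bsub>B\<^esub>\<mu>\<in>{..<m}. \<phi> (R \<mu> A (\<gamma> \<mu>) (j \<mu>) (i \<mu>)))"
    unfolding XP_def using m i j by (intro f.finprod) (auto intro!: R_closed pt[OF \<gamma>] f.A.alg)
  also have "\<dots> = XP m B \<delta> j i"
    unfolding XP_def
  proof (rule f.B.A.finprod_cong'[OF refl])
    fix \<mu> assume "\<mu> \<in> {..<m}"
    then show "\<phi> (R \<mu> A (\<gamma> \<mu>) (j \<mu>) (i \<mu>)) = R \<mu> B (\<delta> \<mu>) (j \<mu>) (i \<mu>)"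
      using m i j bc by (intro R_bc[OF _ \<phi> pt[OF \<gamma>] pt[OF \<delta>]]) (auto simp: base_change_P)
  qed (use m i j in \<open>auto intro!: R_closed pt[OF \<delta>] f.B.alg\<close>)
  finally show ?thesis .
qed

text \<open>The matrix of \<open>v \<otimes> b\<^sub>1 \<otimes> \<dots> \<otimes> b\<^sub>m \<mapsto> b\<^sub>m \<cdots> b\<^sub>1 v\<close>.\<close>

primrec PM :: "nat \<Rightarrow> 'i \<Rightarrow> (nat \<Rightarrow> nat) \<Rightarrow> real" where
  "PM 0 a j = (if a = p0 (j 0) then 1 else 0)"
| "PM (Suc m) a j = (\<Sum>q\<in>I. e (Suc m) (j (Suc m)) a q * PM m q j)"

lemma PM_upd: "m < n \<Longrightarrow> PM m a (j(n := k)) = PM m a j"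
  by (induction m arbitrary: a) auto

lemma p0_I: "i < N 0 \<Longrightarrow> p0 i \<in> I"
  using p0 by (auto simp: bij_betw_def)

text \<open>
  Inductively, left multiplication by the \<open>m\<close>-th component of \<open>\<gamma>\<close> acts on the new factor \<open>b\<^sub>m\<close>, and the
  components before it, which by induction come out between \<open>b\<^sub>m\<close> and \<open>b\<^bsub>m-1\<^esub> \<cdots> b\<^sub>1 v\<close>, are moved past \<open>b\<^sub>m\<close>.
\<close>

lemma PM_equivariant:
  assumes A: "algebra real_ring A" and \<gamma>: "\<gamma> \<in> carrier (points P A)"
  shows "m < g \<Longrightarrow> a \<in> I \<Longrightarrow> \<forall>\<mu>\<le>m. i \<mu> < N \<mu> \<Longrightarrow>
    (\<Oplus>\<^bsub>A\<^esub>j\<in>X (Suc m). str_map A (PM m a j) \<otimes>\<^bsub>A\<^esub> XP (Suc m) A \<gamma> j i) =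
    (\<Oplus>\<^bsub>A\<^esub>q\<in>I. \<rho> A (trunc A (Suc m) \<gamma>) a q \<otimes>\<^bsub>A\<^esub> str_map A (PM m q i))"
proof (induction m arbitrary: a)
  case 0
  interpret A: real_alg A by (rule real_alg.intro) (rule A)
  have i0: "i 0 < N 0" using 0 by auto
  have x: "\<gamma> 0 \<in> carrier (points G A)" using pt[OF \<gamma>] 0 by auto
  note c = coeff_closed[OF rep A emb_closed[OF A x, of 0]]
  have "(\<Oplus>\<^bsub>A\<^esub>j\<in>X (Suc 0). str_map A (PM 0 a j) \<otimes>\<^bsub>A\<^esub> XP (Suc 0) A \<gamma> j i) =
      (\<Oplus>\<^bsub>A\<^esub>k\<in>K 0. \<Oplus>\<^bsub>A\<^esub>j\<in>X 0. str_map A (PM 0 a (j(0 := k))) \<otimes>\<^bsub>A\<^esub> XP (Suc 0) A \<gamma> (j(0 := k)) i)"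
    by (rule A.A.finsum_PiE_Suc) (use 0 in \<open>auto intro!: XP_closed[OF A _ \<gamma>] A.A.m_closed\<close>)
  also have "\<dots> = (\<Oplus>\<^bsub>A\<^esub>k\<in>K 0. str_map A (if a = p0 k then 1 else 0) \<otimes>\<^bsub>A\<^esub> \<rho> A (emb A 0 (\<gamma> 0)) (p0 k) (p0 (i 0)))"
  proof (rule A.A.finsum_cong'[OF refl])
    fix k assume k: "k \<in> K 0"
    have "XP (Suc 0) A \<gamma> ((\<lambda>_. undefined)(0 := k)) i = R 0 A (\<gamma> 0) k (i 0) \<otimes>\<^bsub>A\<^esub> XP 0 A \<gamma> (\<lambda>_. undefined) i"
      using k i0 0 by (intro XP_Suc_upd(1) A \<gamma>) auto
    also have "\<dots> = \<rho> A (emb A 0 (\<gamma> 0)) (p0 k) (p0 (i 0))"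
      using k i0 0 R_0[OF A x] c p0_I by (simp add: XP_def)
    finally have "XP (Suc 0) A \<gamma> ((\<lambda>_. undefined)(0 := k)) i = \<rho> A (emb A 0 (\<gamma> 0)) (p0 k) (p0 (i 0))" .
    then show "(\<Oplus>\<^bsub>A\<^esub>j\<in>X 0. str_map A (PM 0 a (j(0 := k))) \<otimes>\<^bsub>A\<^esub> XP (Suc 0) A \<gamma> (j(0 := k)) i) =
      str_map A (if a = p0 k then 1 else 0) \<otimes>\<^bsub>A\<^esub> \<rho> A (emb A 0 (\<gamma> 0)) (p0 k) (p0 (i 0))"
      using c k p0_I by simp
  qed (use c p0_I in auto)
  also have "\<dots> = (\<Oplus>\<^bsub>A\<^esub>q\<in>I. str_map A (if a = q then 1 else 0) \<otimes>\<^bsub>A\<^esub> \<rho> A (emb A 0 (\<gamma> 0)) q (p0 (i 0)))"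
    by (rule A.A.finsum_reindex_bij[OF p0, symmetric]) (use c in auto)
  also have "\<dots> = \<rho> A (emb A 0 (\<gamma> 0)) a (p0 (i 0))"
    using A.A.mat_mul_delta_left[OF finI \<open>a \<in> I\<close>, of "\<lambda>a q. str_map A (if a = q then 1 else 0)"
        "\<rho> A (emb A 0 (\<gamma> 0))" "p0 (i 0)"] c unfolding mat_mul_def by auto
  also have "\<dots> = (\<Oplus>\<^bsub>A\<^esub>q\<in>I. \<rho> A (emb A 0 (\<gamma> 0)) a q \<otimes>\<^bsub>A\<^esub> str_map A (PM 0 q i))"
    using A.A.mat_mul_delta_right[OF finI p0_I[OF i0], of "\<lambda>q _. str_map A (PM 0 q i)"
        "\<rho> A (emb A 0 (\<gamma> 0))" a] c \<open>a \<in> I\<close> unfolding mat_mul_def by auto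
  finally show ?case using 0 by (simp add: trunc_1)
next
  case (Suc m)
  interpret A: real_alg A by (rule real_alg.intro) (rule A)
  let ?m = "Suc m" and ?x = "\<gamma> (Suc m)"
  have m: "m < g" "?m < g" and im: "i ?m < N ?m" and i: "\<forall>\<mu>\<le>m. i \<mu> < N \<mu>" and aI: "a \<in> I" using Suc.prems by auto
  have x: "?x \<in> carrier (points G A)" using pt[OF \<gamma>] m by auto
  note ec = emb_closed[OF A x, of ?m] and tc = trunc_closed[OF A \<gamma>, of ?m]
  note c1 = coeff_closed[OF rep A ec] and c2 = coeff_closed[OF rep A tc]
  note Rc = R_closed[OF m(2) A x]
  have Xc: "XP ?m A \<gamma> j i \<in> carrier A" if "j \<in> X ?m" for j
    using that i m by (auto intro!: XP_closed A \<gamma>)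
  let ?E = "\<lambda>q u. str_map A (e ?m (i ?m) q u)" and ?Q = "\<lambda>q (_::unit). str_map A (PM m q i)"
  let ?R1 = "\<rho> A (emb A ?m ?x)" and ?R2 = "\<rho> A (trunc A ?m \<gamma>)"
  define C where "C = (\<lambda>q. \<Oplus>\<^bsub>A\<^esub>k\<in>K ?m. str_map A (e ?m k a q) \<otimes>\<^bsub>A\<^esub> R ?m A ?x k (i ?m))"
  define D where "D = (\<lambda>q. \<Oplus>\<^bsub>A\<^esub>j\<in>X ?m. str_map A (PM m q j) \<otimes>\<^bsub>A\<^esub> XP ?m A \<gamma> j i)"
  have Cc: "C q \<in> carrier A" for q unfolding C_def by (rule A.A.finsum_closed) (use im Rc in auto)
  have Dc: "D q \<in> carrier A" for q unfolding D_def by (rule A.A.finsum_closed) (use Xc in auto)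
  have CE: "C q = mat_mul A I ?R1 ?E a q" if "q \<in> I" for q
    unfolding C_def mat_mul_def by (rule e_act[OF _ m(2) A x aI that im, symmetric]) simp
  have DE: "D q = mat_mul A I ?R2 ?Q q ()" if "q \<in> I" for q
    unfolding D_def mat_mul_def by (rule Suc.IH[OF m(1) that i])
  have sc: "(str_map A (e ?m k a q) \<otimes>\<^bsub>A\<^esub> R ?m A ?x k (i ?m)) \<otimes>\<^bsub>A\<^esub> (str_map A (PM m q j) \<otimes>\<^bsub>A\<^esub> XP ?m A \<gamma> j i) \<in> carrier A"
    if "k \<in> K ?m" "j \<in> X ?m" for k j q
  proof -
    have "R ?m A ?x k (i ?m) \<in> carrier A" using that(1) im Rc by simp
    with Xc[OF that(2)] show ?thesis by simp
  qed
  have as1: "mat_mul A I ?E (mat_mul A I ?R2 ?Q) u () = mat_mul A I (mat_mul A I ?E ?R2) ?Q u ()" for u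
    by (rule A.A.mat_mul_assoc[OF finI finI, symmetric]) (auto intro: c2)
  have as2: "mat_mul A I (mat_mul A I ?R2 ?E) ?Q u () = mat_mul A I ?R2 (mat_mul A I ?E ?Q) u ()" if "u \<in> I" for u
    by (rule A.A.mat_mul_assoc[OF finI finI]) (auto intro: c2 that)
  have "(\<Oplus>\<^bsub>A\<^esub>j\<in>X (Suc ?m). str_map A (PM ?m a j) \<otimes>\<^bsub>A\<^esub> XP (Suc ?m) A \<gamma> j i) =
      (\<Oplus>\<^bsub>A\<^esub>k\<in>K ?m. \<Oplus>\<^bsub>A\<^esub>j\<in>X ?m. str_map A (PM ?m a (j(?m := k))) \<otimes>\<^bsub>A\<^esub> XP (Suc ?m) A \<gamma> (j(?m := k)) i)"
  proof (rule A.A.finsum_PiE_Suc)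
    fix j k assume jk: "j \<in> X ?m" "k \<in> K ?m"
    have "\<forall>\<mu><Suc ?m. i \<mu> < N \<mu>" using Suc.prems by (simp add: less_Suc_eq_le)
    then show "str_map A (PM ?m a (j(?m := k))) \<otimes>\<^bsub>A\<^esub> XP (Suc ?m) A \<gamma> (j(?m := k)) i \<in> carrier A"
      using m by (intro A.A.m_closed A.str_map_closed XP_closed[OF A _ \<gamma>] upd_range jk) auto
  qed simp
  also have "\<dots> = (\<Oplus>\<^bsub>A\<^esub>k\<in>K ?m. \<Oplus>\<^bsub>A\<^esub>j\<in>X ?m. \<Oplus>\<^bsub>A\<^esub>q\<in>I.
      (str_map A (e ?m k a q) \<otimes>\<^bsub>A\<^esub> R ?m A ?x k (i ?m)) \<otimes>\<^bsub>A\<^esub> (str_map A (PM m q j) \<otimes>\<^bsub>A\<^esub> XP ?m A \<gamma> j i))"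
  proof (intro A.A.finsum_cong' refl)
    fix k j assume k: "k \<in> K ?m" and j: "j \<in> X ?m"
    have XS: "XP (Suc ?m) A \<gamma> (j(?m := k)) i = R ?m A ?x k (i ?m) \<otimes>\<^bsub>A\<^esub> XP ?m A \<gamma> j i"
      using k i im by (intro XP_Suc_upd(1) A m \<gamma> j) (auto simp: less_Suc_eq_le)
    have "str_map A (PM ?m a (j(?m := k))) = (\<Oplus>\<^bsub>A\<^esub>q\<in>I. str_map A (e ?m k a q) \<otimes>\<^bsub>A\<^esub> str_map A (PM m q j))"
      using finI by (simp add: PM_upd A.str_map_sum A.str_map_times)
    then have "str_map A (PM ?m a (j(?m := k))) \<otimes>\<^bsub>A\<^esub> XP (Suc ?m) A \<gamma> (j(?m := k)) i =
      (\<Oplus>\<^bsub>A\<^esub>q\<in>I. (str_map A (e ?m k a q) \<otimes>\<^bsub>A\<^esub> str_map A (PM m q j)) \<otimes>\<^bsub>A\<^esub> (R ?m A ?x k (i ?m) \<otimes>\<^bsub>A\<^esub> XP ?m A \<gamma> j i))"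
    proof -
      assume eq: "str_map A (PM ?m a (j(?m := k))) = (\<Oplus>\<^bsub>A\<^esub>q\<in>I. str_map A (e ?m k a q) \<otimes>\<^bsub>A\<^esub> str_map A (PM m q j))"
      show ?thesis
        unfolding XS eq by (rule A.A.finsum_ldistr[OF finI]) (use k im in \<open>auto intro!: A.A.m_closed Rc Xc j\<close>)
    qed
    also have "\<dots> = (\<Oplus>\<^bsub>A\<^esub>q\<in>I. (str_map A (e ?m k a q) \<otimes>\<^bsub>A\<^esub> R ?m A ?x k (i ?m)) \<otimes>\<^bsub>A\<^esub> (str_map A (PM m q j) \<otimes>\<^bsub>A\<^esub> XP ?m A \<gamma> j i))"
    proof (rule A.A.finsum_cong'[OF refl])
      have c: "R ?m A ?x k (i ?m) \<in> carrier A" "XP ?m A \<gamma> j i \<in> carrier A"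
        using k im by (auto intro!: Rc Xc j)
      fix q
      show "(str_map A (e ?m k a q) \<otimes>\<^bsub>A\<^esub> str_map A (PM m q j)) \<otimes>\<^bsub>A\<^esub> (R ?m A ?x k (i ?m) \<otimes>\<^bsub>A\<^esub> XP ?m A \<gamma> j i) =
        (str_map A (e ?m k a q) \<otimes>\<^bsub>A\<^esub> R ?m A ?x k (i ?m)) \<otimes>\<^bsub>A\<^esub> (str_map A (PM m q j) \<otimes>\<^bsub>A\<^esub> XP ?m A \<gamma> j i)"
        using c by (simp add: A.A.m_ac)
    qed (intro funcsetI sc k j)
    finally show "str_map A (PM ?m a (j(?m := k))) \<otimes>\<^bsub>A\<^esub> XP (Suc ?m) A \<gamma> (j(?m := k)) i =
      (\<Oplus>\<^bsub>A\<^esub>q\<in>I. (str_map A (e ?m k a q) \<otimes>\<^bsub>A\<^esub> R ?m A ?x k (i ?m)) \<otimes>\<^bsub>A\<^esub> (str_map A (PM m q j) \<otimes>\<^bsub>A\<^esub> XP ?m A \<gamma> j i))" .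
  qed (intro funcsetI A.A.finsum_closed sc; assumption)+
  also have "\<dots> = (\<Oplus>\<^bsub>A\<^esub>k\<in>K ?m. \<Oplus>\<^bsub>A\<^esub>q\<in>I. \<Oplus>\<^bsub>A\<^esub>j\<in>X ?m.
      (str_map A (e ?m k a q) \<otimes>\<^bsub>A\<^esub> R ?m A ?x k (i ?m)) \<otimes>\<^bsub>A\<^esub> (str_map A (PM m q j) \<otimes>\<^bsub>A\<^esub> XP ?m A \<gamma> j i))"
    by (intro A.A.finsum_cong'[OF refl] A.A.finsum_swap funcsetI A.A.finsum_closed sc finI fin_X)
  also have "\<dots> = (\<Oplus>\<^bsub>A\<^esub>q\<in>I. \<Oplus>\<^bsub>A\<^esub>k\<in>K ?m. \<Oplus>\<^bsub>A\<^esub>j\<in>X ?m.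
      (str_map A (e ?m k a q) \<otimes>\<^bsub>A\<^esub> R ?m A ?x k (i ?m)) \<otimes>\<^bsub>A\<^esub> (str_map A (PM m q j) \<otimes>\<^bsub>A\<^esub> XP ?m A \<gamma> j i))"
    by (intro A.A.finsum_swap funcsetI A.A.finsum_closed sc finI finite_lessThan)
  \<comment> \<open>The sums over \<open>k\<close> and \<open>j\<close> factor, and \<open>C\<close> and \<open>D\<close> are \<open>\<gamma>\<^sub>m b\<^sub>m\<close> and the image under the earlier components.\<close>
  also have "\<dots> = (\<Oplus>\<^bsub>A\<^esub>q\<in>I. C q \<otimes>\<^bsub>A\<^esub> D q)"
  proof (rule A.A.finsum_cong'[OF refl])
    fix q assume "q \<in> I"
    show "(\<Oplus>\<^bsub>A\<^esub>k\<in>K ?m. \<Oplus>\<^bsub>A\<^esub>j\<in>X ?m.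
      (str_map A (e ?m k a q) \<otimes>\<^bsub>A\<^esub> R ?m A ?x k (i ?m)) \<otimes>\<^bsub>A\<^esub> (str_map A (PM m q j) \<otimes>\<^bsub>A\<^esub> XP ?m A \<gamma> j i)) = C q \<otimes>\<^bsub>A\<^esub> D q"
      unfolding C_def D_def
      by (rule A.A.finsum_prod_distrib[OF finite_lessThan fin_X])
         (simp_all only: A.A.m_closed A.str_map_closed Rc im Xc lessThan_iff)
  qed (use Cc Dc in auto)
  also have "\<dots> = mat_mul A I (mat_mul A I ?R1 ?E) (mat_mul A I ?R2 ?Q) a ()"
    unfolding mat_mul_def[of A I "mat_mul A I ?R1 ?E"]
    by (rule A.A.finsum_cong'[OF refl]) (use Cc Dc in \<open>auto simp flip: CE DE\<close>)
  also have "\<dots> = mat_mul A I ?R1 (mat_mul A I ?E (mat_mul A I ?R2 ?Q)) a ()"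
    by (rule A.A.mat_mul_assoc[OF finI finI]) (auto intro!: A.A.mat_mul_closed c1 c2 aI)
  also have "\<dots> = mat_mul A I ?R1 (mat_mul A I (mat_mul A I ?E ?R2) ?Q) a ()"
    by (rule A.A.mat_mul_cong[OF refl]) (simp_all add: as1 A.A.mat_mul_closed c1 c2 aI)
  \<comment> \<open>Here the copies of \<open>G\<close> are interchanged.\<close>
  also have "\<dots> = mat_mul A I ?R1 (mat_mul A I (mat_mul A I ?R2 ?E) ?Q) a ()"
  proof (rule A.A.mat_mul_cong[OF refl])
    fix j assume "j \<in> I"
    then show "mat_mul A I (mat_mul A I ?E ?R2) ?Q j () = mat_mul A I (mat_mul A I ?R2 ?E) ?Q j ()"
      by (intro A.A.mat_mul_cong refl e_comm[OF _ m(2) A \<gamma>] im) (auto intro!: A.A.mat_mul_closed c2)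
  qed (auto intro!: A.A.mat_mul_closed c1 c2 aI)
  also have "\<dots> = mat_mul A I ?R1 (mat_mul A I ?R2 (mat_mul A I ?E ?Q)) a ()"
    by (rule A.A.mat_mul_cong[OF refl]) (simp_all add: as2 A.A.mat_mul_closed c1 c2 aI)
  also have "\<dots> = mat_mul A I (mat_mul A I ?R1 ?R2) (mat_mul A I ?E ?Q) a ()"
    by (rule A.A.mat_mul_assoc[OF finI finI, symmetric]) (auto intro!: A.A.mat_mul_closed c1 c2 aI)
  also have "\<dots> = mat_mul A I (\<rho> A (trunc A (Suc ?m) \<gamma>)) (\<lambda>q _. str_map A (PM ?m q i)) a ()"
  proof (rule A.A.mat_mul_cong)
    fix q assume q: "q \<in> I"
    interpret P: group "points P A" by (rule grp_P[OF A])
    show "mat_mul A I ?R1 ?R2 a q = \<rho> A (trunc A (Suc ?m) \<gamma>) a q"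
      unfolding emb_trunc(2)[OF A m(2) \<gamma> x, symmetric]
      by (rule coeff_mult[OF rep A ec tc aI q P.m_closed[OF ec tc], symmetric])
    show "mat_mul A I ?E ?Q q () = str_map A (PM ?m q i)"
      using finI by (simp add: mat_mul_def A.str_map_sum A.str_map_times)
    show "\<rho> A (trunc A (Suc ?m) \<gamma>) a q \<in> carrier A"
      by (rule coeff_closed[OF rep A trunc_closed[OF A \<gamma>] aI])
  qed simp
  finally show ?case by (simp add: mat_mul_def)
qed

text \<open>
  A preimage of \<open>v\<close> is \<open>v \<otimes> 1 \<otimes> \<dots> \<otimes> 1\<close>.
\<close>

lemma PM_surj: "m < g \<Longrightarrow> \<exists>w. \<forall>a\<in>I. v a = (\<Sum>j\<in>X (Suc m). PM m a j * w j)"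
proof (induction m)
  case 0
  interpret R: cring real_ring by (rule cring_real_ring)
  have split: "(\<Sum>j\<in>X (Suc 0). f j) = (\<Sum>k\<in>K 0. \<Sum>j\<in>X 0. f (j(0 := k)))" for f :: "_ \<Rightarrow> real"
    using R.finsum_PiE_Suc[of 0 "\<lambda>\<mu>. {..<N \<mu>}" f] fin_X[of "Suc 0"] by simp
  have "v a = (\<Sum>j\<in>X (Suc 0). PM 0 a j * v (p0 (j 0)))" if a: "a \<in> I" for a
  proof -
    have "(\<Sum>j\<in>X (Suc 0). PM 0 a j * v (p0 (j 0))) = (\<Sum>k\<in>K 0. (if a = p0 k then 1 else 0) * v (p0 k))"
      unfolding split by simp
    also have "\<dots> = (\<Sum>q\<in>I. (if a = q then 1 else 0) * v q)"
      by (rule sum.reindex_bij_betw[OF p0])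
    also have "\<dots> = (\<Sum>q\<in>I. if q = a then v q else 0)" by (rule sum.cong) auto
    also have "\<dots> = v a" using a finI by simp
    finally show ?thesis by simp
  qed
  then show ?case by (intro exI[of _ "\<lambda>j. v (p0 (j 0))"]) simp
next
  case (Suc m)
  interpret R: cring real_ring by (rule cring_real_ring)
  let ?m = "Suc m"
  have split: "(\<Sum>j\<in>X (Suc ?m). f j) = (\<Sum>k\<in>K ?m. \<Sum>j\<in>X ?m. f (j(?m := k)))" for f :: "_ \<Rightarrow> real"
    using R.finsum_PiE_Suc[of ?m "\<lambda>\<mu>. {..<N \<mu>}" f] fin_X by simp
  from Suc obtain w where w: "\<And>a. a \<in> I \<Longrightarrow> v a = (\<Sum>j\<in>X ?m. PM m a j * w j)" by fastforce
  have "v a = (\<Sum>j\<in>X (Suc ?m). PM ?m a j * (d ?m (j ?m) * w (restrict j {..<?m})))" if a: "a \<in> I" for a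
  proof -
    have res: "restrict (j(?m := k)) {..<?m} = j" if "j \<in> X ?m" for j k
      using that by (auto simp: PiE_iff extensional_def restrict_def fun_eq_iff)
    have "(\<Sum>j\<in>X (Suc ?m). PM ?m a j * (d ?m (j ?m) * w (restrict j {..<?m}))) =
        (\<Sum>k\<in>K ?m. \<Sum>j\<in>X ?m. \<Sum>q\<in>I. (d ?m k * e ?m k a q) * (PM m q j * w j))"
      unfolding split
      by (intro sum.cong refl) (simp add: res PM_upd sum_distrib_left sum_distrib_right algebra_simps)
    also have "\<dots> = (\<Sum>k\<in>K ?m. \<Sum>q\<in>I. (d ?m k * e ?m k a q) * (\<Sum>j\<in>X ?m. PM m q j * w j))"
      by (intro sum.cong refl) (subst sum.swap, simp add: sum_distrib_left)
    also have "\<dots> = (\<Sum>q\<in>I. (\<Sum>k\<in>K ?m. d ?m k * e ?m k a q) * v q)"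
      by (subst sum.swap) (simp add: w sum_distrib_right)
    also have "\<dots> = (\<Sum>q\<in>I. if q = a then v q else 0)"
      by (intro sum.cong refl) (use Suc.prems a in \<open>auto simp: e_one\<close>)
    also have "\<dots> = v a" using a finI by simp
    finally show ?thesis by simp
  qed
  then show ?case by (intro exI[of _ "\<lambda>j. d ?m (j ?m) * w (restrict j {..<?m})"]) simp
qed

definition Vs :: "nat \<Rightarrow> (nat, 'u, 'p) rep_data" where
  "Vs \<mu> = mat_rep (K \<mu>) (R \<mu>)"

lemma is_rep_Vs: "\<mu> < g \<Longrightarrow> is_rep G (Vs \<mu>)"
  unfolding Vs_def
  by (rule is_rep_mat_rep) (auto intro: grp R_closed R_mult R_bc simp: R_one)

lemma basis_ext: "basis (exterior_product g Vs) = X g"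
  by (simp add: exterior_product_def Let_def Vs_def mat_rep_def)

lemma act_ext:
  assumes A: "algebra real_ring A" and \<gamma>: "\<gamma> \<in> carrier (points P A)" and x: "x \<in> X g \<rightarrow>\<^sub>E carrier A"
  shows "act (exterior_product g Vs) A \<gamma> x = mat_vec A (X g) (X g) (XP g A \<gamma>) x"
proof -
  interpret A: real_alg A by (rule real_alg.intro) (rule A)
  have c: "act (Vs \<mu>) A (\<gamma> \<mu>) (unit_vec A (basis (Vs \<mu>)) (i \<mu>)) (j \<mu>) = R \<mu> A (\<gamma> \<mu>) (j \<mu>) (i \<mu>)"
    if "i \<in> X g" "j \<in> X g" "\<mu> < g" for i j \<mu>
  proof -
    have "i \<mu> \<in> K \<mu>" "j \<mu> \<in> K \<mu>" using that by auto
    then have "coeff (Vs \<mu>) A (\<gamma> \<mu>) (j \<mu>) (i \<mu>) = R \<mu> A (\<gamma> \<mu>) (j \<mu>) (i \<mu>)"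
      unfolding Vs_def using that R_closed[OF that(3) A pt[OF \<gamma> that(3)]]
      by (intro coeff_mat_rep[OF A]) auto
    then show ?thesis by (simp add: coeff_def)
  qed
  have p: "(\<Otimes>\<^bsub>A\<^esub>\<mu>\<in>{..<g}. act (Vs \<mu>) A (\<gamma> \<mu>) (unit_vec A (basis (Vs \<mu>)) (i \<mu>)) (j \<mu>)) = XP g A \<gamma> j i"
    if "i \<in> X g" "j \<in> X g" for i j
    unfolding XP_def
  proof (rule A.A.finprod_cong'[OF refl])
    show "(\<lambda>\<mu>. R \<mu> A (\<gamma> \<mu>) (j \<mu>) (i \<mu>)) \<in> {..<g} \<rightarrow> carrier A"
      using that by (auto intro!: R_closed A pt[OF \<gamma>] dest: X_D)
  qed (use c that in auto)
  have XPc: "XP g A \<gamma> j i \<in> carrier A" if "i \<in> X g" "j \<in> X g" for i j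
    using that by (intro XP_closed A \<gamma>) (auto dest: X_D)
  have xc: "x i \<in> carrier A" if "i \<in> X g" for i
    by (rule PiE_mem[OF x that])
  have "act (exterior_product g Vs) A \<gamma> x = (\<lambda>j\<in>X g. \<Oplus>\<^bsub>A\<^esub>i\<in>X g. x i \<otimes>\<^bsub>A\<^esub>
      (\<Otimes>\<^bsub>A\<^esub>\<mu>\<in>{..<g}. act (Vs \<mu>) A (\<gamma> \<mu>) (unit_vec A (basis (Vs \<mu>)) (i \<mu>)) (j \<mu>)))"
    using x basis_ext by (simp add: exterior_product_def Let_def)
  also have "\<dots> = mat_vec A (X g) (X g) (XP g A \<gamma>) x"
    unfolding mat_vec_def
  proof (intro restrict_ext A.A.finsum_cong'[OF refl])
    fix j assume j: "j \<in> X g"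
    show "(\<lambda>i. XP g A \<gamma> j i \<otimes>\<^bsub>A\<^esub> x i) \<in> X g \<rightarrow> carrier A" using XPc xc j by auto
    show "x i \<otimes>\<^bsub>A\<^esub> (\<Otimes>\<^bsub>A\<^esub>\<mu>\<in>{..<g}. act (Vs \<mu>) A (\<gamma> \<mu>) (unit_vec A (basis (Vs \<mu>)) (i \<mu>)) (j \<mu>)) =
      XP g A \<gamma> j i \<otimes>\<^bsub>A\<^esub> x i" if i: "i \<in> X g" for i
      unfolding p[OF i j] by (rule A.A.m_comm[OF xc[OF i] XPc[OF i j]])
  qed
  finally show ?thesis .
qed

text \<open>
  The subrepresentation is the whole exterior product. It only has to be rewritten as a representation
  \<open>Y\<close> with a basis of natural numbers, by means of a numbering \<open>b\<close> of the multi-indices.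
\<close>

lemma subquotient_of_exterior_product:
  "iso_to_subquotient (power_functor g G) V (exterior_product g Vs)"
proof -
  obtain m where m: "g = Suc m" using g_pos by (cases g) auto
  obtain b where b: "bij_betw b {..<card (X g)} (X g)"
    using ex_bij_betw_nat_finite[OF fin_X[of g]] by (auto simp: atLeast0LessThan)
  let ?L = "{..<card (X g)}"
  have bX: "\<And>k. k \<in> ?L \<Longrightarrow> b k \<in> X g" using b by (auto simp: bij_betw_def)
  have beq: "\<And>k l. k \<in> ?L \<Longrightarrow> l \<in> ?L \<Longrightarrow> b k = b l \<longleftrightarrow> k = l"
    using b by (auto simp: bij_betw_def inj_on_def)
  have brange: "\<forall>\<mu><g. b k \<mu> < N \<mu>" if "k \<in> ?L" for k using bX[OF that] by (auto dest: X_D)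
  define RY where "RY A \<gamma> k l = XP g A \<gamma> (b k) (b l)" for A \<gamma> k l
  define Y where "Y = mat_rep ?L RY"
  define \<iota> where "\<iota> j k = (if j = b k then 1 else 0 :: real)" for j k
  define \<pi> where "\<pi> a k = PM m a (b k)" for a k
  have bY: "basis Y = ?L" by (simp add: Y_def mat_rep_def)
  have RYc: "RY A \<gamma> k l \<in> carrier A"
    if "algebra real_ring A" "\<gamma> \<in> carrier (points P A)" "k \<in> ?L" "l \<in> ?L" for A \<gamma> k l
    unfolding RY_def by (rule XP_closed[OF that(1) order_refl that(2) brange[OF that(3)] brange[OF that(4)]])
  have actY: "act Y A \<gamma> v = mat_vec A (basis Y) (basis Y) (RY A \<gamma>) v"
    if "v \<in> basis Y \<rightarrow>\<^sub>E carrier A" for A \<gamma> v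
    using that by (simp add: Y_def mat_rep_def)
  have "is_rep P Y"
    unfolding Y_def
  proof (rule is_rep_mat_rep)
    fix A :: "(real, 'u) module" and k l
    assume A: "algebra real_ring A" and kl: "k \<in> ?L" "l \<in> ?L"
    have "(\<forall>\<mu><g. b k \<mu> = b l \<mu>) \<longleftrightarrow> b k = b l"
      using PiE_ext[OF bX[OF kl(1)] bX[OF kl(2)]] by auto
    then show "RY A \<one>\<^bsub>points P A\<^esub> k l = (if k = l then \<one>\<^bsub>A\<^esub> else \<zero>\<^bsub>A\<^esub>)"
      unfolding RY_def using XP_one[OF A order_refl brange[OF kl(1)] brange[OF kl(2)]] beq[OF kl] by simp
  next
    fix A :: "(real, 'u) module" and x y i k
    assume A: "algebra real_ring A" and x: "x \<in> carrier (points P A)" and y: "y \<in> carrier (points P A)"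
      and ik: "i \<in> ?L" "k \<in> ?L"
    interpret A: real_alg A by (rule real_alg.intro) (rule A)
    have c: "XP g A x (b i) j \<in> carrier A" "XP g A y j (b k) \<in> carrier A" if "j \<in> X g" for j
      using that brange[OF ik(1)] brange[OF ik(2)] by (auto intro!: XP_closed A x y dest: X_D)
    have "RY A (x \<otimes>\<^bsub>points P A\<^esub> y) i k = mat_mul A (X g) (XP g A x) (XP g A y) (b i) (b k)"
      unfolding RY_def by (rule XP_mult[OF A x y order_refl brange[OF ik(1)] brange[OF ik(2)]])
    also have "\<dots> = mat_mul A ?L (RY A x) (RY A y) i k"
      unfolding mat_mul_def RY_def by (rule A.A.finsum_reindex_bij[OF b]) (use c in auto)
    finally show "RY A (x \<otimes>\<^bsub>points P A\<^esub> y) i k = mat_mul A ?L (RY A x) (RY A y) i k" .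
  next
    fix A B :: "(real, 'u) module" and \<phi> x y i j
    assume "alg_mor A B \<phi>" "x \<in> carrier (points P A)" "y \<in> carrier (points P B)" "base_change P A B \<phi> x y"
      "i \<in> ?L" "j \<in> ?L"
    then show "\<phi> (RY A x i j) = RY B y i j"
      unfolding RY_def by (intro XP_bc brange) auto
  qed (auto intro: grp_P RYc)
  moreover have "rep_hom P Y (exterior_product g Vs) \<iota>"
  proof (rule rep_homI[where M = RY and N = "XP g"])
    fix A :: "(real, 'u) module" and \<gamma> j k
    assume A: "algebra real_ring A" and \<gamma>: "\<gamma> \<in> carrier (points P A)"
      and "j \<in> basis (exterior_product g Vs)" "k \<in> basis Y"
    then have j: "j \<in> X g" and k: "k \<in> ?L" by (auto simp: basis_ext bY)
    interpret A: real_alg A by (rule real_alg.intro) (rule A)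
    obtain l where l: "l \<in> ?L" "j = b l" using j b unfolding bij_betw_def by blast
    have c: "XP g A \<gamma> j i \<in> carrier A" if "i \<in> X g" for i
      using that j by (auto intro!: XP_closed A \<gamma> dest: X_D)
    have "mat_mul A ?L (\<lambda>i k. str_map A (\<iota> i k)) (RY A \<gamma>) j k = mat_mul A ?L (\<lambda>i k. str_map A (if k = i then 1 else 0)) (RY A \<gamma>) l k"
      using RYc[OF A \<gamma> _ k] by (intro A.A.mat_mul_cong) (auto simp: \<iota>_def l(2) beq[OF l(1)])
    also have "\<dots> = RY A \<gamma> l k"
      by (rule A.A.mat_mul_delta_left) (use l RYc[OF A \<gamma> _ k] in auto)
    also have "\<dots> = mat_mul A (X g) (XP g A \<gamma>) (\<lambda>i i'. str_map A (if i = i' then 1 else 0)) j (b k)"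
      unfolding RY_def l(2)[symmetric]
      by (rule A.A.mat_mul_delta_right[OF fin_X bX[OF k], symmetric]) (simp_all add: c)
    also have "\<dots> = mat_mul A (X g) (XP g A \<gamma>) (\<lambda>k j. str_map A (\<iota> k j)) j k"
      by (simp add: mat_mul_def \<iota>_def)
    finally show "mat_mul A (basis Y) (\<lambda>i k. str_map A (\<iota> i k)) (RY A \<gamma>) j k =
        mat_mul A (basis (exterior_product g Vs)) (XP g A \<gamma>) (\<lambda>k j. str_map A (\<iota> k j)) j k"
      by (simp only: bY basis_ext)
  qed (use act_ext actY RYc fin_X in \<open>auto simp: bY basis_ext intro!: XP_closed dest: X_D\<close>)
  moreover have "inj_on (rep_map Y (exterior_product g Vs) \<iota>) (carrier (free_module real_ring (basis Y)))"
  proof (rule inj_onI)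
    fix v w assume v: "v \<in> carrier (free_module real_ring (basis Y))" and w: "w \<in> carrier (free_module real_ring (basis Y))"
      and eq: "rep_map Y (exterior_product g Vs) \<iota> v = rep_map Y (exterior_product g Vs) \<iota> w"
    have val: "rep_map Y (exterior_product g Vs) \<iota> u (b l) = u l" if "l \<in> ?L" for u l
    proof -
      have "rep_map Y (exterior_product g Vs) \<iota> u (b l) = (\<Sum>k\<in>?L. \<iota> (b l) k * u k)"
        using bX[OF that] by (simp add: lin_map_def bY basis_ext)
      also have "\<dots> = (\<Sum>k\<in>?L. if k = l then u k else 0)"
        by (rule sum.cong) (auto simp: \<iota>_def beq[OF that])
      finally show ?thesis using that by simp
    qed
    show "v = w"
    proof (rule PiE_ext[of v ?L "\<lambda>_. UNIV" w])
      show "v l = w l" if "l \<in> ?L" for l using val[OF that, of v] val[OF that, of w] eq by simp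
    qed (use v w in \<open>simp_all add: bY\<close>)
  qed
  moreover have "rep_hom P Y V \<pi>"
  proof (rule rep_homI[where M = RY and N = \<rho>])
    fix A :: "(real, 'u) module" and \<gamma> a k
    assume A: "algebra real_ring A" and \<gamma>: "\<gamma> \<in> carrier (points P A)" and a: "a \<in> I" and "k \<in> basis Y"
    then have k: "k \<in> ?L" by (simp add: bY)
    interpret A: real_alg A by (rule real_alg.intro) (rule A)
    have c: "XP g A \<gamma> j (b k) \<in> carrier A" if "j \<in> X g" for j
      using that brange[OF k] by (auto intro!: XP_closed A \<gamma> dest: X_D)
    have "mat_mul A ?L (\<lambda>i k. str_map A (\<pi> i k)) (RY A \<gamma>) a k = (\<Oplus>\<^bsub>A\<^esub>j\<in>X g. str_map A (PM m a j) \<otimes>\<^bsub>A\<^esub> XP g A \<gamma> j (b k))"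
      unfolding mat_mul_def RY_def \<pi>_def by (rule A.A.finsum_reindex_bij[OF b, symmetric]) (use c in auto)
    also have "\<dots> = (\<Oplus>\<^bsub>A\<^esub>q\<in>I. \<rho> A (trunc A g \<gamma>) a q \<otimes>\<^bsub>A\<^esub> str_map A (PM m q (b k)))"
    proof (rule PM_equivariant[OF A \<gamma> _ a, of m "b k", folded m])
      show "m < g" "\<forall>\<mu>\<le>m. b k \<mu> < N \<mu>" using brange[OF k] unfolding m by (simp_all add: less_Suc_eq_le)
    qed
    finally show "mat_mul A (basis Y) (\<lambda>i k. str_map A (\<pi> i k)) (RY A \<gamma>) a k = mat_mul A I (\<rho> A \<gamma>) (\<lambda>k j. str_map A (\<pi> k j)) a k"
      by (simp only: bY trunc_g[OF \<gamma>] mat_mul_def \<pi>_def)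
  qed (use rep_act_mat_vec[OF rep] coeff_closed[OF rep] actY RYc finI in \<open>auto simp: bY\<close>)
  moreover have "rep_map Y V \<pi> ` carrier (free_module real_ring (basis Y)) = carrier (free_module real_ring I)"
  proof (intro equalityI subsetI)
    fix v assume "v \<in> rep_map Y V \<pi> ` carrier (free_module real_ring (basis Y))"
    then show "v \<in> carrier (free_module real_ring I)" by (auto simp: lin_map_def)
  next
    fix v assume v: "v \<in> carrier (free_module real_ring I)"
    obtain w where w: "\<And>a. a \<in> I \<Longrightarrow> v a = (\<Sum>j\<in>X g. PM m a j * w j)"
      using PM_surj[of m v] m by auto
    have "rep_map Y V \<pi> (\<lambda>k\<in>?L. w (b k)) a = v a" if "a \<in> I" for a
    proof -
      have "rep_map Y V \<pi> (\<lambda>k\<in>?L. w (b k)) a = (\<Sum>k\<in>?L. PM m a (b k) * w (b k))"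
        using that by (simp add: lin_map_def bY \<pi>_def)
      also have "\<dots> = (\<Sum>j\<in>X g. PM m a j * w j)" by (rule sum.reindex_bij_betw[OF b])
      finally show ?thesis using w[OF that] by simp
    qed
    then have "rep_map Y V \<pi> (\<lambda>k\<in>?L. w (b k)) = v"
      using v by (intro PiE_ext[of _ I "\<lambda>_. UNIV"]) (auto simp: lin_map_def)
    moreover have "(\<lambda>k\<in>?L. w (b k)) \<in> carrier (free_module real_ring (basis Y))" by (simp add: bY)
    ultimately show "v \<in> rep_map Y V \<pi> ` carrier (free_module real_ring (basis Y))" by blast
  qed
  ultimately show ?thesis unfolding iso_to_subquotient_def by blast
qed

end

lemma choice_of_four:
  assumes "\<And>m. \<exists>a b c d. Q m a b c d"
  shows "\<exists>a b c d. \<forall>m. Q m (a m) (b m) (c m) (d m)"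
  using assms by metis

context power_rep
begin

text \<open>
  The representation of \<open>G\<close> on the span of the coefficient matrices, by left multiplication, in terms of
  a basis \<open>e 0, \<dots>, e (n - 1)\<close> of this span; \<open>d\<close> are the coordinates of the identity matrix.
\<close>

definition is_factor :: "nat \<Rightarrow> nat \<Rightarrow> ((real, 'u) module \<Rightarrow> 'p \<Rightarrow> nat \<Rightarrow> nat \<Rightarrow> 'u) \<Rightarrow>
    (nat \<Rightarrow> 'i \<Rightarrow> 'i \<Rightarrow> real) \<Rightarrow> (nat \<Rightarrow> real) \<Rightarrow> bool" where
  "is_factor m n R e d \<longleftrightarrow>
    (\<forall>A x i j. algebra real_ring A \<longrightarrow> x \<in> carrier (points G A) \<longrightarrow> i < n \<longrightarrow> j < n \<longrightarrow> R A x i j \<in> carrier A) \<and>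
    (\<forall>A i j. algebra real_ring A \<longrightarrow> i < n \<longrightarrow> j < n \<longrightarrow>
      R A \<one>\<^bsub>points G A\<^esub> i j = (if i = j then \<one>\<^bsub>A\<^esub> else \<zero>\<^bsub>A\<^esub>)) \<and>
    (\<forall>A x y i k. algebra real_ring A \<longrightarrow> x \<in> carrier (points G A) \<longrightarrow> y \<in> carrier (points G A) \<longrightarrow> i < n \<longrightarrow> k < n \<longrightarrow>
      R A (x \<otimes>\<^bsub>points G A\<^esub> y) i k = mat_mul A {..<n} (R A x) (R A y) i k) \<and>
    (\<forall>A B \<phi> x y i j. alg_mor A B \<phi> \<longrightarrow> x \<in> carrier (points G A) \<longrightarrow> y \<in> carrier (points G B) \<longrightarrow>
      base_change G A B \<phi> x y \<longrightarrow> i < n \<longrightarrow> j < n \<longrightarrow> \<phi> (R A x i j) = R B y i j) \<and>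
    (\<forall>A x a c i. algebra real_ring A \<longrightarrow> x \<in> carrier (points G A) \<longrightarrow> a \<in> I \<longrightarrow> c \<in> I \<longrightarrow> i < n \<longrightarrow>
      (\<Oplus>\<^bsub>A\<^esub>q\<in>I. \<rho> A (emb A m x) a q \<otimes>\<^bsub>A\<^esub> str_map A (e i q c)) =
      (\<Oplus>\<^bsub>A\<^esub>k\<in>{..<n}. str_map A (e k a c) \<otimes>\<^bsub>A\<^esub> R A x k i)) \<and>
    (\<forall>A \<gamma> a c i. algebra real_ring A \<longrightarrow> \<gamma> \<in> carrier (points P A) \<longrightarrow> a \<in> I \<longrightarrow> c \<in> I \<longrightarrow> i < n \<longrightarrow>
      mat_mul A I (\<lambda>a c. str_map A (e i a c)) (\<rho> A (trunc A m \<gamma>)) a c =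
      mat_mul A I (\<rho> A (trunc A m \<gamma>)) (\<lambda>a c. str_map A (e i a c)) a c) \<and>
    (\<forall>a\<in>I. \<forall>c\<in>I. (\<Sum>j<n. d j * e j a c) = (if a = c then 1 else 0 :: real))"

text \<open>
  Left multiplication by a point over \<open>A\<close> maps a basis element to an \<open>A\<close>-linear combination of the basis,
  because it does so after every linear form is applied. The coefficients are the entries at the pivots
  of an echelon basis.
\<close>

lemma factor_exists:
  assumes m: "m < g"
  shows "\<exists>n R e d. is_factor m n R e d"
proof -
  let ?S = "fun_span (coeff_mats m)"
  have fin: "finite (I \<times> I)" using finI by simp
  have comb: "(\<lambda>i. a * u i + b * v i) \<in> ?S" if "u \<in> ?S" "v \<in> ?S" for a b u v
    by (rule fun_span.comb[OF that])
  have "\<exists>(n :: nat) s p. (\<forall>j<n. s j \<in> ?S) \<and> (\<forall>j<n. p j \<in> I \<times> I) \<and>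
    (\<forall>i<n. \<forall>j<n. s j (p i) = (if i = j then 1 else 0)) \<and>
    (\<forall>v\<in>?S. \<forall>i\<in>I \<times> I. v i = (\<Sum>j<n. v (p j) * s j i))"
    by (rule echelon_basis[OF fin]) (rule comb)
  then obtain n :: nat and s p where E: "\<forall>j<n. s j \<in> ?S" "\<forall>j<n. p j \<in> I \<times> I"
    "\<forall>i<n. \<forall>j<n. s j (p i) = (if i = j then 1 else 0)"
    "\<forall>v\<in>?S. \<forall>i\<in>I \<times> I. v i = (\<Sum>j<n. v (p j) * s j i)"
    by blast
  note s = E(1)[rule_format] and p = E(2)[rule_format] and sp = E(3)[rule_format] and span = E(4)[rule_format]
  \<comment> \<open>Left multiplication of the \<open>i\<close>-th basis element by \<open>x\<close>, and its entries at the pivots.\<close>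
  define M where "M A x i = (\<lambda>a c. \<Oplus>\<^bsub>A\<^esub>q\<in>I. \<rho> A (emb A m x) a q \<otimes>\<^bsub>A\<^esub> str_map A (s i (q, c)))" for A x i
  define R where "R A x j i = M A x i (fst (p j)) (snd (p j))" for A x j i
  define e where "e j a c = s j (a, c)" for j a c
  \<comment> \<open>The coordinates of the identity matrix are likewise its entries at the pivots.\<close>
  define d where "d j = (if fst (p j) = snd (p j) then 1 else 0 :: real)" for j
  have pI: "fst (p j) \<in> I" "snd (p j) \<in> I" if "j < n" for j using p[OF that] by auto
  have Mc: "M A x i a c \<in> carrier A" if "algebra real_ring A" "x \<in> carrier (points G A)" "a \<in> I" for A x i a c
  proof -
    interpret A: real_alg A by (rule real_alg.intro) (rule that(1))
    show ?thesis unfolding M_def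
      by (rule A.A.finsum_closed) (use coeff_closed[OF rep that(1) emb_closed[OF that(1,2)] that(3)] in auto)
  qed
  have Rc: "R A x j i \<in> carrier A" if "algebra real_ring A" "x \<in> carrier (points G A)" "j < n" for A x i j
    unfolding R_def by (rule Mc[OF that(1,2) pI(1)[OF that(3)]])
  have act: "M A x i a c = (\<Oplus>\<^bsub>A\<^esub>k\<in>{..<n}. str_map A (e k a c) \<otimes>\<^bsub>A\<^esub> R A x k i)"
    if A: "algebra real_ring A" and x: "x \<in> carrier (points G A)" and ac: "a \<in> I" "c \<in> I" and i: "i < n" for A x a c i
  proof -
    interpret A: real_alg A by (rule real_alg.intro) (rule A)
    note c = coeff_closed[OF rep A emb_closed[OF A x]]
    show ?thesis
    proof (rule A.linear_forms_separate)
      show "M A x i a c \<in> carrier A" by (rule Mc[OF A x ac(1)])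
      show "(\<Oplus>\<^bsub>A\<^esub>k\<in>{..<n}. str_map A (e k a c) \<otimes>\<^bsub>A\<^esub> R A x k i) \<in> carrier A"
        by (rule A.A.finsum_closed) (use Rc[OF A x] in auto)
      fix l assume l: "linear_form A l"
      have lM: "l (M A x i a c) = (\<Sum>q\<in>I. l (\<rho> A (emb A m x) a q) * s i (q, c))" if "a \<in> I" for a c
      proof -
        have "l (M A x i a c) = (\<Sum>q\<in>I. l (\<rho> A (emb A m x) a q \<otimes>\<^bsub>A\<^esub> str_map A (s i (q, c))))"
          unfolding M_def by (rule A.linear_form_sum[OF l finI]) (use c that in auto)
        also have "\<dots> = (\<Sum>q\<in>I. l (\<rho> A (emb A m x) a q) * s i (q, c))"
          using l c that by (intro sum.cong) (simp_all add: A.str_map_mult' linear_form_def)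
        finally show ?thesis .
      qed
      obtain b where b: "b \<in> ?S" "\<And>a c. a \<in> I \<Longrightarrow> c \<in> I \<Longrightarrow>
          b (a, c) = (\<Sum>j\<in>I. l (\<rho> A (emb A m x) a j) * s i (j, c))"
        using coeff_mats_left_mult[OF s[OF i] A x l] by blast
      have "l (M A x i a c) = b (a, c)" by (simp add: lM b(2) ac)
      also have "\<dots> = (\<Sum>j<n. b (p j) * s j (a, c))" by (rule span[OF b(1)]) (use ac in simp)
      also have "\<dots> = (\<Sum>j<n. e j a c * l (R A x j i))"
      proof (rule sum.cong[OF refl])
        fix j assume "j \<in> {..<n}"
        then have "b (fst (p j), snd (p j)) = l (R A x j i)"
          unfolding R_def using pI[of j] by (simp only: lM b(2) lessThan_iff)
        then show "b (p j) * s j (a, c) = e j a c * l (R A x j i)" by (simp add: e_def)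
      qed
      also have "\<dots> = (\<Sum>j<n. l (str_map A (e j a c) \<otimes>\<^bsub>A\<^esub> R A x j i))"
        using l Rc[OF A x] by (intro sum.cong) (simp_all add: A.str_map_mult linear_form_def)
      also have "\<dots> = l (\<Oplus>\<^bsub>A\<^esub>k\<in>{..<n}. str_map A (e k a c) \<otimes>\<^bsub>A\<^esub> R A x k i)"
        by (rule A.linear_form_sum[OF l, symmetric]) (use Rc[OF A x] in auto)
      finally show "l (M A x i a c) = l (\<Oplus>\<^bsub>A\<^esub>k\<in>{..<n}. str_map A (e k a c) \<otimes>\<^bsub>A\<^esub> R A x k i)" .
    qed
  qed
  have one: "R A \<one>\<^bsub>points G A\<^esub> j i = (if j = i then \<one>\<^bsub>A\<^esub> else \<zero>\<^bsub>A\<^esub>)"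
    if A: "algebra real_ring A" and ij: "j < n" "i < n" for A j i
  proof -
    interpret A: real_alg A by (rule real_alg.intro) (rule A)
    have "R A \<one>\<^bsub>points G A\<^esub> j i =
        mat_mul A I (\<rho> A (emb A m \<one>\<^bsub>points G A\<^esub>)) (\<lambda>q c. str_map A (s i (q, c))) (fst (p j)) (snd (p j))"
      by (simp add: R_def M_def mat_mul_def)
    also have "\<dots> = str_map A (s i (fst (p j), snd (p j)))"
      by (rule A.A.mat_mul_delta_left[OF finI pI(1)[OF ij(1)]])
         (use coeff_one[OF rep A grp_P[OF A] pI(1)[OF ij(1)]] in \<open>auto simp: emb_one\<close>)
    also have "\<dots> = (if j = i then \<one>\<^bsub>A\<^esub> else \<zero>\<^bsub>A\<^esub>)" using sp[OF ij] by simp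
    finally show ?thesis .
  qed
  have mult: "R A (x \<otimes>\<^bsub>points G A\<^esub> y) i k = mat_mul A {..<n} (R A x) (R A y) i k"
    if A: "algebra real_ring A" and x: "x \<in> carrier (points G A)" and y: "y \<in> carrier (points G A)"
      and ik: "i < n" "k < n" for A x y i k
  proof -
    interpret A: real_alg A by (rule real_alg.intro) (rule A)
    interpret GA: group "points G A" by (rule grp[OF A])
    let ?a = "fst (p i)" and ?c = "snd (p i)" and ?S = "\<lambda>k q c. str_map A (s k (q, c))"
    let ?x = "\<rho> A (emb A m x)" and ?y = "\<rho> A (emb A m y)"
    note cx = coeff_closed[OF rep A emb_closed[OF A x]] and cy = coeff_closed[OF rep A emb_closed[OF A y]]
    note a = pI(1)[OF ik(1)] and c = pI(2)[OF ik(1)]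
    have "R A (x \<otimes>\<^bsub>points G A\<^esub> y) i k = mat_mul A I (\<rho> A (emb A m (x \<otimes>\<^bsub>points G A\<^esub> y))) (?S k) ?a ?c"
      by (simp add: R_def M_def mat_mul_def)
    also have "\<dots> = mat_mul A I (mat_mul A I ?x ?y) (?S k) ?a ?c"
    proof (rule A.A.mat_mul_cong)
      fix q assume q: "q \<in> I"
      show "\<rho> A (emb A m (x \<otimes>\<^bsub>points G A\<^esub> y)) ?a q = mat_mul A I ?x ?y ?a q"
        unfolding emb_mult[OF A, symmetric]
        by (rule coeff_mult[OF rep A emb_closed[OF A x] emb_closed[OF A y] a q])
           (simp add: emb_mult[OF A] emb_closed[OF A GA.m_closed[OF x y]])
      show "mat_mul A I ?x ?y ?a q \<in> carrier A" by (rule A.A.mat_mul_closed) (auto intro: cx cy a)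
    qed auto
    also have "\<dots> = mat_mul A I ?x (mat_mul A I ?y (?S k)) ?a ?c"
      by (rule A.A.mat_mul_assoc[OF finI finI]) (auto intro: cx cy a)
    also have "\<dots> = mat_mul A I ?x (mat_mul A {..<n} (\<lambda>q (l::nat). ?S l q ?c) (R A y)) ?a k"
    proof (rule A.A.mat_mul_cong[OF refl])
      fix q assume q: "q \<in> I"
      show "mat_mul A I ?y (?S k) q ?c = mat_mul A {..<n} (\<lambda>q l. ?S l q ?c) (R A y) q k"
        using act[OF A y q c ik(2)] by (simp add: M_def mat_mul_def e_def)
      show "mat_mul A {..<n} (\<lambda>q l. ?S l q ?c) (R A y) q k \<in> carrier A"
        by (rule A.A.mat_mul_closed) (auto intro: Rc[OF A y])
    qed (rule cx[OF a])
    also have "\<dots> = mat_mul A {..<n} (mat_mul A I ?x (\<lambda>q l. ?S l q ?c)) (R A y) ?a k"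
      by (rule A.A.mat_mul_assoc[OF finI _, symmetric]) (auto intro: cx a Rc[OF A y])
    also have "\<dots> = mat_mul A {..<n} (R A x) (R A y) i k"
    proof (rule A.A.mat_mul_cong)
      show "mat_mul A I ?x (\<lambda>q l. ?S l q ?c) ?a j = R A x i j" for j
        by (simp add: R_def M_def mat_mul_def)
    qed (simp_all add: Rc[OF A x ik(1)] Rc[OF A y])
    finally show ?thesis .
  qed
  have bc: "\<phi> (R A x i j) = R B y i j"
    if \<phi>: "alg_mor A B \<phi>" and x: "x \<in> carrier (points G A)" and y: "y \<in> carrier (points G B)"
      and xy: "base_change G A B \<phi> x y" and ij: "i < n" "j < n" for A B \<phi> x y i j
  proof -
    interpret f: alg_mor A B \<phi> by (rule \<phi>)
    note a = pI(1)[OF ij(1)]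
    note ex = emb_closed[OF f.A.alg x] and ey = emb_closed[OF f.B.alg y]
    have "\<phi> (R A x i j) = (\<Oplus>\<^bsub>B\<^esub>q\<in>I. \<phi> (\<rho> A (emb A m x) (fst (p i)) q \<otimes>\<^bsub>A\<^esub> str_map A (s j (q, snd (p i)))))"
      unfolding R_def M_def by (rule f.finsum[OF finI]) (use coeff_closed[OF rep f.A.alg ex a] in auto)
    also have "\<dots> = R B y i j"
      unfolding R_def M_def
    proof (rule f.B.A.finsum_cong'[OF refl])
      fix q assume q: "q \<in> I"
      show "\<phi> (\<rho> A (emb A m x) (fst (p i)) q \<otimes>\<^bsub>A\<^esub> str_map A (s j (q, snd (p i)))) =
          \<rho> B (emb B m y) (fst (p i)) q \<otimes>\<^bsub>B\<^esub> str_map B (s j (q, snd (p i)))"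
        using coeff_base_change[OF rep \<phi> ex ey bc_emb[OF \<phi> xy] a q] coeff_closed[OF rep f.A.alg ex a]
        by simp
    qed (use coeff_closed[OF rep f.B.alg ey a] in auto)
    finally show ?thesis .
  qed
  have comm: "mat_mul A I (\<lambda>a c. str_map A (e i a c)) (\<rho> A (trunc A m \<gamma>)) a c =
      mat_mul A I (\<rho> A (trunc A m \<gamma>)) (\<lambda>a c. str_map A (e i a c)) a c"
    if "algebra real_ring A" "\<gamma> \<in> carrier (points P A)" "a \<in> I" "c \<in> I" "i < n" for A \<gamma> a c i
    unfolding e_def by (rule coeff_mats_commute[OF s[OF that(5)] m that(1-4)])
  have e_one: "(\<Sum>j<n. d j * e j a c) = (if a = c then 1 else 0)" if "a \<in> I" "c \<in> I" for a c
  proof -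
    have "(\<lambda>p. if fst p = snd p then 1 else 0) \<in> ?S"
      by (rule fun_span.base) (simp add: coeff_mats_def)
    from span[OF this, of "(a, c)"] that show ?thesis by (simp add: d_def e_def)
  qed
  show ?thesis
    unfolding is_factor_def
    by (intro exI[of _ n] exI[of _ R] exI[of _ e] exI[of _ d] conjI allI impI ballI;
        (rule Rc one mult bc comm e_one act[unfolded M_def, folded e_def]; assumption))
qed

text \<open>
  The span of the coefficients of the copy with the number \<open>0\<close> is replaced by \<open>V\<close>.
\<close>

lemma subquotient:
  assumes g: "g \<ge> 1"
  shows "\<exists>Vs :: nat \<Rightarrow> (nat, 'u, 'p) rep_data. (\<forall>\<mu><g. is_rep G (Vs \<mu>)) \<and>
    iso_to_subquotient (power_functor g G) V (exterior_product g Vs)"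
proof -
  obtain p0 where p0: "bij_betw p0 {..<card I} I"
    using ex_bij_betw_nat_finite[OF finI] by (auto simp: atLeast0LessThan)
  have pI: "p0 i \<in> I" if "i < card I" for i using p0 that by (auto simp: bij_betw_def)
  have peq: "p0 i = p0 j \<longleftrightarrow> i = j" if "i < card I" "j < card I" for i j
    using p0 that by (auto simp: bij_betw_def inj_on_def)
  have "\<exists>n R e d. \<forall>m. m < g \<longrightarrow> is_factor m (n m) (R m) (e m) (d m)"
    by (rule choice_of_four) (use factor_exists in blast)
  then obtain n R e d where "\<And>m. m < g \<Longrightarrow> is_factor m (n m) (R m) (e m) (d m)" by blast
  note F = this[unfolded is_factor_def]
  note F1 = F[THEN conjunct1, rule_format]
    and F2 = F[THEN conjunct2, THEN conjunct1, rule_format]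
    and F3 = F[THEN conjunct2, THEN conjunct2, THEN conjunct1, rule_format]
    and F4 = F[THEN conjunct2, THEN conjunct2, THEN conjunct2, THEN conjunct1, rule_format]
    and F5 = F[THEN conjunct2, THEN conjunct2, THEN conjunct2, THEN conjunct2, THEN conjunct1, rule_format]
    and F6 = F[THEN conjunct2, THEN conjunct2, THEN conjunct2, THEN conjunct2, THEN conjunct2, THEN conjunct1, rule_format]
    and F7 = F[THEN conjunct2, THEN conjunct2, THEN conjunct2, THEN conjunct2, THEN conjunct2, THEN conjunct2, rule_format]
  have "factor_data G g V (n(0 := card I))
      (R(0 := \<lambda>A x i j. \<rho> A (emb A 0 x) (p0 i) (p0 j))) e d p0"
  proof (unfold_locales, goal_cases)
    case (1 m A x i j)
    then show ?case by (cases "m = 0") (auto intro: F1 coeff_closed[OF rep] emb_closed pI)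
  next
    case (2 m A i j)
    then show ?case
      using coeff_one[OF rep 2(2) grp_P[OF 2(2)]] pI peq
      by (cases "m = 0") (simp_all add: F2 emb_one)
  next
    case (3 m A x y i k)
    show ?case
    proof (cases "m = 0")
      case True
      interpret A: real_alg A by (rule real_alg.intro) (rule 3(2))
      interpret GA: group "points G A" by (rule grp[OF 3(2)])
      let ?x = "\<rho> A (emb A 0 x)" and ?y = "\<rho> A (emb A 0 y)"
      note cx = coeff_closed[OF rep 3(2) emb_closed[OF 3(2,3)]] and cy = coeff_closed[OF rep 3(2) emb_closed[OF 3(2,4)]]
      have ik: "p0 i \<in> I" "p0 k \<in> I" using 3 True pI by auto
      have "\<rho> A (emb A 0 (x \<otimes>\<^bsub>points G A\<^esub> y)) (p0 i) (p0 k) = mat_mul A I ?x ?y (p0 i) (p0 k)"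
        unfolding emb_mult[OF 3(2), symmetric]
        by (rule coeff_mult[OF rep 3(2) emb_closed[OF 3(2,3)] emb_closed[OF 3(2,4)] ik])
           (simp add: emb_mult[OF 3(2)] emb_closed[OF 3(2) GA.m_closed[OF 3(3,4)]])
      also have "\<dots> = (\<Oplus>\<^bsub>A\<^esub>j\<in>{..<card I}. ?x (p0 i) (p0 j) \<otimes>\<^bsub>A\<^esub> ?y (p0 j) (p0 k))"
        unfolding mat_mul_def by (rule A.A.finsum_reindex_bij[OF p0]) (use cx cy ik in auto)
      finally show ?thesis using True by (simp add: mat_mul_def)
    qed (use 3 in \<open>simp add: F3\<close>)
  next
    case (4 m A B \<phi> x y i j)
    interpret f: alg_mor A B \<phi> by (rule 4(2))
    show ?case
    proof (cases "m = 0")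
      case True
      then show ?thesis
        using coeff_base_change[OF rep 4(2) emb_closed[OF f.A.alg 4(3)] emb_closed[OF f.B.alg 4(4)] bc_emb[OF 4(2,5)]]
          4 pI by simp
    qed (use 4 in \<open>simp add: F4\<close>)
  next
    case 5
    show ?case using p0 by simp
  next
    case (7 m A x a c i)
    then show ?case by (simp add: F5)
  next
    case (8 m A \<gamma> a c i)
    then show ?case by (simp add: F6)
  qed (use F7 g in simp_all)
  then interpret D: factor_data G g V "n(0 := card I)" "R(0 := \<lambda>A x i j. \<rho> A (emb A 0 x) (p0 i) (p0 j))" e d p0 .
  show ?thesis using D.is_rep_Vs D.subquotient_of_exterior_product by blast
qed

end

section \<open>Quotients and direct sums of modules\<close>

lemma module_free_module:
  assumes R: "cring R" shows "module R (free_module R I)"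
proof -
  interpret R: cring R by (rule R)
  show ?thesis
  proof (rule moduleI[OF R])
    show "abelian_group (free_module R I)"
    proof (rule abelian_groupI)
      fix x assume x: "x \<in> carrier (free_module R I)"
      have "(\<lambda>i\<in>I. \<ominus>\<^bsub>R\<^esub> x i) \<oplus>\<^bsub>free_module R I\<^esub> x = \<zero>\<^bsub>free_module R I\<^esub>"
        unfolding free_module_simps
      proof (rule restrict_ext)
        fix i assume "i \<in> I"
        then have "x i \<in> carrier R" using x by auto
        then show "(\<lambda>i\<in>I. \<ominus>\<^bsub>R\<^esub> x i) i \<oplus>\<^bsub>R\<^esub> x i = \<zero>\<^bsub>R\<^esub>" using \<open>i \<in> I\<close> by (simp add: R.l_neg)
      qed
      then show "\<exists>y\<in>carrier (free_module R I). y \<oplus>\<^bsub>free_module R I\<^esub> x = \<zero>\<^bsub>free_module R I\<^esub>"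
        using x by (intro bexI[of _ "\<lambda>i\<in>I. \<ominus>\<^bsub>R\<^esub> x i"]) auto
    next
      fix x assume "x \<in> carrier (free_module R I)"
      then show "\<zero>\<^bsub>free_module R I\<^esub> \<oplus>\<^bsub>free_module R I\<^esub> x = x"
        by (auto simp: PiE_iff extensional_def fun_eq_iff)
    qed (auto simp: R.a_ac PiE_iff intro!: restrict_ext)
  next
    fix x assume "x \<in> carrier (free_module R I)"
    then show "\<one>\<^bsub>R\<^esub> \<odot>\<^bsub>free_module R I\<^esub> x = x"
      by (auto simp: PiE_iff extensional_def fun_eq_iff)
  qed (auto simp: R.l_distr R.r_distr R.m_assoc PiE_iff intro!: restrict_ext)
qed

context module
begin

lemma submodule_add_subgroup: "submodule N R M \<Longrightarrow> abelian_subgroup N M"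
  by (intro abelian_subgroupI3 additive_subgroupI submodule.axioms(1) M.abelian_group_axioms)

lemma coset_smult:
  assumes N: "submodule N R M" and a: "a \<in> carrier R" and x: "x \<in> carrier M"
  shows "N <+>\<^bsub>M\<^esub> ((\<lambda>x. a \<odot>\<^bsub>M\<^esub> x) ` (N +>\<^bsub>M\<^esub> x)) = N +>\<^bsub>M\<^esub> (a \<odot>\<^bsub>M\<^esub> x)"
proof -
  interpret N: abelian_subgroup N M by (rule submodule_add_subgroup[OF N])
  have Ns: "\<And>n. n \<in> N \<Longrightarrow> a \<odot>\<^bsub>M\<^esub> n \<in> N" using submoduleE(4)[OF N a] .
  show ?thesis
  proof (intro equalityI subsetI)
    fix y assume "y \<in> N <+>\<^bsub>M\<^esub> ((\<lambda>x. a \<odot>\<^bsub>M\<^esub> x) ` (N +>\<^bsub>M\<^esub> x))"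
    then obtain n n' where n: "n \<in> N" "n' \<in> N" "y = n \<oplus>\<^bsub>M\<^esub> a \<odot>\<^bsub>M\<^esub> (n' \<oplus>\<^bsub>M\<^esub> x)"
      by (auto simp: set_add_def' a_r_coset_def')
    then have "y = (n \<oplus>\<^bsub>M\<^esub> a \<odot>\<^bsub>M\<^esub> n') \<oplus>\<^bsub>M\<^esub> a \<odot>\<^bsub>M\<^esub> x"
      using a x by (simp add: smult_r_distr M.a_assoc)
    moreover have "n \<oplus>\<^bsub>M\<^esub> a \<odot>\<^bsub>M\<^esub> n' \<in> N" using n Ns by simp
    ultimately show "y \<in> N +>\<^bsub>M\<^esub> (a \<odot>\<^bsub>M\<^esub> x)" unfolding a_r_coset_def' by blast
  next
    fix y assume "y \<in> N +>\<^bsub>M\<^esub> (a \<odot>\<^bsub>M\<^esub> x)"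
    then obtain n where "n \<in> N" "y = n \<oplus>\<^bsub>M\<^esub> a \<odot>\<^bsub>M\<^esub> x" by (auto simp: a_r_coset_def')
    moreover have "x \<in> N +>\<^bsub>M\<^esub> x" by (rule N.a_rcos_self[OF x])
    ultimately show "y \<in> N <+>\<^bsub>M\<^esub> ((\<lambda>x. a \<odot>\<^bsub>M\<^esub> x) ` (N +>\<^bsub>M\<^esub> x))"
      by (auto simp: set_add_def')
  qed
qed

lemma quot_module_simps:
  assumes N: "submodule N R M"
  shows "carrier (quot_module M N) = (\<lambda>x. N +>\<^bsub>M\<^esub> x) ` carrier M"
    and "\<zero>\<^bsub>quot_module M N\<^esub> = N +>\<^bsub>M\<^esub> \<zero>\<^bsub>M\<^esub>"
    and "x \<in> carrier M \<Longrightarrow> y \<in> carrier M \<Longrightarrow>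
      (N +>\<^bsub>M\<^esub> x) \<oplus>\<^bsub>quot_module M N\<^esub> (N +>\<^bsub>M\<^esub> y) = N +>\<^bsub>M\<^esub> (x \<oplus>\<^bsub>M\<^esub> y)"
    and "a \<in> carrier R \<Longrightarrow> x \<in> carrier M \<Longrightarrow>
      a \<odot>\<^bsub>quot_module M N\<^esub> (N +>\<^bsub>M\<^esub> x) = N +>\<^bsub>M\<^esub> (a \<odot>\<^bsub>M\<^esub> x)"
proof -
  interpret N: abelian_subgroup N M by (rule submodule_add_subgroup[OF N])
  show "carrier (quot_module M N) = (\<lambda>x. N +>\<^bsub>M\<^esub> x) ` carrier M"
    by (auto simp: quot_module_def A_RCOSETS_def')
  show "\<zero>\<^bsub>quot_module M N\<^esub> = N +>\<^bsub>M\<^esub> \<zero>\<^bsub>M\<^esub>"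
    by (simp add: quot_module_def N.a_rcos_const)
  show "(N +>\<^bsub>M\<^esub> x) \<oplus>\<^bsub>quot_module M N\<^esub> (N +>\<^bsub>M\<^esub> y) = N +>\<^bsub>M\<^esub> (x \<oplus>\<^bsub>M\<^esub> y)"
    if "x \<in> carrier M" "y \<in> carrier M"
    using N.a_rcos_sum[OF that] by (simp add: quot_module_def)
  show "a \<odot>\<^bsub>quot_module M N\<^esub> (N +>\<^bsub>M\<^esub> x) = N +>\<^bsub>M\<^esub> (a \<odot>\<^bsub>M\<^esub> x)"
    if "a \<in> carrier R" "x \<in> carrier M"
    using coset_smult[OF N that] by (simp add: quot_module_def)
qed

lemma module_quot_module:
  assumes N: "submodule N R M"
  shows "module R (quot_module M N)"
proof -
  note q = quot_module_simps[OF N]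
  show ?thesis
  proof (rule moduleI[OF R.is_cring])
    show "abelian_group (quot_module M N)"
    proof (rule abelian_groupI)
      fix X assume "X \<in> carrier (quot_module M N)"
      then obtain x where x: "x \<in> carrier M" "X = N +>\<^bsub>M\<^esub> x" by (auto simp: q)
      show "\<exists>Y\<in>carrier (quot_module M N). Y \<oplus>\<^bsub>quot_module M N\<^esub> X = \<zero>\<^bsub>quot_module M N\<^esub>"
        by (rule bexI[of _ "N +>\<^bsub>M\<^esub> (\<ominus>\<^bsub>M\<^esub> x)"]) (use x in \<open>auto simp: q M.l_neg\<close>)
    qed (auto simp: q M.a_ac)
  qed (auto simp: q smult_l_distr smult_r_distr smult_assoc1)
qed

end

lemma direct_sum_simps:
  "x \<in> carrier (direct_sum_module M) \<longleftrightarrow> (\<forall>k. x k \<in> carrier (M k)) \<and> finite {k. x k \<noteq> \<zero>\<^bsub>M k\<^esub>}"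
  "\<zero>\<^bsub>direct_sum_module M\<^esub> = (\<lambda>k. \<zero>\<^bsub>M k\<^esub>)"
  "x \<oplus>\<^bsub>direct_sum_module M\<^esub> y = (\<lambda>k. x k \<oplus>\<^bsub>M k\<^esub> y k)"
  "a \<odot>\<^bsub>direct_sum_module M\<^esub> x = (\<lambda>k. a \<odot>\<^bsub>M k\<^esub> x k)"
  by (simp_all add: direct_sum_module_def)

lemma module_direct_sum:
  assumes R: "cring R" and M: "\<And>k. module R (M k)"
  shows "module R (direct_sum_module M)"
proof -
  have ag: "\<And>k. abelian_group (M k)" by (rule module.axioms(2)[OF M])
  have am: "\<And>k. abelian_monoid (M k)" by (rule abelian_group.axioms(1)[OF ag])
  note c = abelian_monoid.a_closed[OF am] abelian_monoid.zero_closed[OF am]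
  have addc: "x \<oplus>\<^bsub>direct_sum_module M\<^esub> y \<in> carrier (direct_sum_module M)"
    if "x \<in> carrier (direct_sum_module M)" "y \<in> carrier (direct_sum_module M)" for x y
  proof -
    have "{k. x k \<oplus>\<^bsub>M k\<^esub> y k \<noteq> \<zero>\<^bsub>M k\<^esub>} \<subseteq> {k. x k \<noteq> \<zero>\<^bsub>M k\<^esub>} \<union> {k. y k \<noteq> \<zero>\<^bsub>M k\<^esub>}"
      using abelian_monoid.l_zero[OF am] c(2) by auto
    then have "finite {k. x k \<oplus>\<^bsub>M k\<^esub> y k \<noteq> \<zero>\<^bsub>M k\<^esub>}"
      by (rule finite_subset) (use that in \<open>auto simp: direct_sum_simps\<close>)
    with that show ?thesis by (auto simp: direct_sum_simps c)
  qed
  have smc: "a \<odot>\<^bsub>direct_sum_module M\<^esub> x \<in> carrier (direct_sum_module M)"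
    if "a \<in> carrier R" "x \<in> carrier (direct_sum_module M)" for a x
  proof -
    have "{k. a \<odot>\<^bsub>M k\<^esub> x k \<noteq> \<zero>\<^bsub>M k\<^esub>} \<subseteq> {k. x k \<noteq> \<zero>\<^bsub>M k\<^esub>}"
      using module.smult_r_null[OF M that(1)] by auto
    then have "finite {k. a \<odot>\<^bsub>M k\<^esub> x k \<noteq> \<zero>\<^bsub>M k\<^esub>}"
      by (rule finite_subset) (use that in \<open>auto simp: direct_sum_simps\<close>)
    with that show ?thesis by (auto simp: direct_sum_simps module.smult_closed[OF M])
  qed
  show ?thesis
  proof (rule moduleI[OF R])
    show "abelian_group (direct_sum_module M)"
    proof (rule abelian_groupI)
      fix x assume x: "x \<in> carrier (direct_sum_module M)"
      let ?y = "(\<ominus>\<^bsub>R\<^esub> \<one>\<^bsub>R\<^esub>) \<odot>\<^bsub>direct_sum_module M\<^esub> x"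
      interpret R: cring R by (rule R)
      have "?y k \<oplus>\<^bsub>M k\<^esub> x k = \<zero>\<^bsub>M k\<^esub>" for k
      proof -
        interpret Mk: module R "M k" by (rule M)
        have "x k \<in> carrier (M k)" using x by (simp add: direct_sum_simps)
        then show ?thesis by (simp add: direct_sum_simps Mk.smult_l_minus Mk.M.l_neg)
      qed
      then have "?y \<oplus>\<^bsub>direct_sum_module M\<^esub> x = \<zero>\<^bsub>direct_sum_module M\<^esub>" by (simp add: direct_sum_simps(2,3))
      moreover have "?y \<in> carrier (direct_sum_module M)" using x by (intro smc) auto
      ultimately show "\<exists>y\<in>carrier (direct_sum_module M). y \<oplus>\<^bsub>direct_sum_module M\<^esub> x = \<zero>\<^bsub>direct_sum_module M\<^esub>"
        by blast
    next
      show "\<zero>\<^bsub>direct_sum_module M\<^esub> \<in> carrier (direct_sum_module M)" by (simp add: direct_sum_simps c)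
    next
      fix x y z assume "x \<in> carrier (direct_sum_module M)" "y \<in> carrier (direct_sum_module M)"
        "z \<in> carrier (direct_sum_module M)"
      then show "x \<oplus>\<^bsub>direct_sum_module M\<^esub> y \<oplus>\<^bsub>direct_sum_module M\<^esub> z =
          x \<oplus>\<^bsub>direct_sum_module M\<^esub> (y \<oplus>\<^bsub>direct_sum_module M\<^esub> z)"
        by (simp add: direct_sum_simps abelian_monoid.a_assoc[OF am])
    next
      fix x y assume "x \<in> carrier (direct_sum_module M)" "y \<in> carrier (direct_sum_module M)"
      then show "x \<oplus>\<^bsub>direct_sum_module M\<^esub> y = y \<oplus>\<^bsub>direct_sum_module M\<^esub> x"
        using abelian_monoid.a_comm[OF am] by (simp add: direct_sum_simps fun_eq_iff)
    next
      fix x assume "x \<in> carrier (direct_sum_module M)"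
      then show "\<zero>\<^bsub>direct_sum_module M\<^esub> \<oplus>\<^bsub>direct_sum_module M\<^esub> x = x"
        by (simp add: direct_sum_simps abelian_monoid.l_zero[OF am])
    qed (rule addc)
  qed (use smc in \<open>auto simp: direct_sum_simps module.smult_l_distr[OF M] module.smult_r_distr[OF M]
        module.smult_assoc1[OF M] module.smult_one[OF M]\<close>)
qed


section \<open>Base change of linear maps\<close>

text \<open>
  A semilinear map \<open>f : M \<rightarrow> N\<close> which exhibits \<open>N\<close> as the scalar extension of \<open>M\<close>: the elements \<open>e i\<close>
  generate \<open>M\<close>, their images generate \<open>N\<close>, and in both cases the coordinates can be chosen
  linearly and compatibly with \<open>f\<close>. The \<open>e i\<close> need not be a basis.
\<close>

locale scalar_ext = alg_mor A B \<phi> + M: module A M + N: module B N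
  for A B :: "(real, 'u) module" and \<phi> and M :: "('u, 'm) module" and N :: "('u, 'n) module" +
  fixes f :: "'m \<Rightarrow> 'n" and E :: "'e set" and e :: "'e \<Rightarrow> 'm" and c :: "'e \<Rightarrow> 'm \<Rightarrow> 'u" and c' :: "'e \<Rightarrow> 'n \<Rightarrow> 'u"
  assumes finE: "finite E"
    and e_closed: "i \<in> E \<Longrightarrow> e i \<in> carrier M"
    and f_closed: "x \<in> carrier M \<Longrightarrow> f x \<in> carrier N"
    and f_add: "x \<in> carrier M \<Longrightarrow> x' \<in> carrier M \<Longrightarrow> f (x \<oplus>\<^bsub>M\<^esub> x') = f x \<oplus>\<^bsub>N\<^esub> f x'"
    and f_smult: "a \<in> carrier A \<Longrightarrow> x \<in> carrier M \<Longrightarrow> f (a \<odot>\<^bsub>M\<^esub> x) = \<phi> a \<odot>\<^bsub>N\<^esub> f x"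
    and c_closed: "i \<in> E \<Longrightarrow> x \<in> carrier M \<Longrightarrow> c i x \<in> carrier A"
    and c'_closed: "i \<in> E \<Longrightarrow> y \<in> carrier N \<Longrightarrow> c' i y \<in> carrier B"
    and c'_add: "i \<in> E \<Longrightarrow> y \<in> carrier N \<Longrightarrow> z \<in> carrier N \<Longrightarrow> c' i (y \<oplus>\<^bsub>N\<^esub> z) = c' i y \<oplus>\<^bsub>B\<^esub> c' i z"
    and c'_smult: "i \<in> E \<Longrightarrow> b \<in> carrier B \<Longrightarrow> y \<in> carrier N \<Longrightarrow> c' i (b \<odot>\<^bsub>N\<^esub> y) = b \<otimes>\<^bsub>B\<^esub> c' i y"
    and c'_f: "i \<in> E \<Longrightarrow> x \<in> carrier M \<Longrightarrow> c' i (f x) = \<phi> (c i x)"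
    and expand: "x \<in> carrier M \<Longrightarrow> x = (\<Oplus>\<^bsub>M\<^esub>i\<in>E. c i x \<odot>\<^bsub>M\<^esub> e i)"
    and expand': "y \<in> carrier N \<Longrightarrow> y = (\<Oplus>\<^bsub>N\<^esub>i\<in>E. c' i y \<odot>\<^bsub>N\<^esub> f (e i))"

definition lin :: "('r, 'k) ring_scheme \<Rightarrow> ('r, 'v, 'l) module_scheme \<Rightarrow> ('r, 'w, 'o) module_scheme \<Rightarrow> ('v \<Rightarrow> 'w) \<Rightarrow> bool" where
  "lin R M N h \<longleftrightarrow> (\<forall>x\<in>carrier M. h x \<in> carrier N) \<and>
     (\<forall>x\<in>carrier M. \<forall>y\<in>carrier M. h (x \<oplus>\<^bsub>M\<^esub> y) = h x \<oplus>\<^bsub>N\<^esub> h y) \<and>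
     (\<forall>a\<in>carrier R. \<forall>x\<in>carrier M. h (a \<odot>\<^bsub>M\<^esub> x) = a \<odot>\<^bsub>N\<^esub> h x)"

lemma linD:
  assumes "lin R M N h"
  shows "x \<in> carrier M \<Longrightarrow> h x \<in> carrier N"
    and "x \<in> carrier M \<Longrightarrow> y \<in> carrier M \<Longrightarrow> h (x \<oplus>\<^bsub>M\<^esub> y) = h x \<oplus>\<^bsub>N\<^esub> h y"
    and "a \<in> carrier R \<Longrightarrow> x \<in> carrier M \<Longrightarrow> h (a \<odot>\<^bsub>M\<^esub> x) = a \<odot>\<^bsub>N\<^esub> h x"
  using assms by (simp_all add: lin_def)

lemma lin_zero:
  assumes "module R M" "module R N" "lin R M N h"
  shows "h \<zero>\<^bsub>M\<^esub> = \<zero>\<^bsub>N\<^esub>"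
proof -
  interpret M: module R M by fact
  interpret N: module R N by fact
  have "h (\<zero>\<^bsub>R\<^esub> \<odot>\<^bsub>M\<^esub> \<zero>\<^bsub>M\<^esub>) = \<zero>\<^bsub>R\<^esub> \<odot>\<^bsub>N\<^esub> h \<zero>\<^bsub>M\<^esub>"
    using linD(3)[OF assms(3)] M.R.zero_closed M.M.zero_closed by blast
  then show ?thesis using linD(1)[OF assms(3)] by simp
qed

lemma lin_sum:
  assumes "module R M" "module R N" "lin R M N h" "finite I" "\<And>i. i \<in> I \<Longrightarrow> u i \<in> carrier M"
  shows "h (\<Oplus>\<^bsub>M\<^esub>i\<in>I. u i) = (\<Oplus>\<^bsub>N\<^esub>i\<in>I. h (u i))"
proof -
  interpret M: module R M by fact
  interpret N: module R N by fact
  show ?thesis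
    by (rule M.M.finsum_hom) (use assms(4,5) linD[OF assms(3)] lin_zero[OF assms(1-3)] N.M.abelian_monoid_axioms in auto)
qed

context scalar_ext
begin

text \<open>
  The image of \<open>M\<close> generates \<open>N\<close>.
\<close>

lemma lin_eqI:
  assumes P: "module B P" and h: "lin B N P h" and h': "lin B N P h'"
    and eq: "\<And>x. x \<in> carrier M \<Longrightarrow> h (f x) = h' (f x)" and y: "y \<in> carrier N"
  shows "h y = h' y"
proof -
  interpret P: module B P by (rule P)
  have t: "c' i y \<odot>\<^bsub>N\<^esub> f (e i) \<in> carrier N" if "i \<in> E" for i
    using that c'_closed[OF that y] f_closed[OF e_closed[OF that]] by simp
  have "h y = (\<Oplus>\<^bsub>P\<^esub>i\<in>E. h (c' i y \<odot>\<^bsub>N\<^esub> f (e i)))"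
    by (subst expand'[OF y]) (rule lin_sum[OF N.module_axioms P h finE t])
  also have "\<dots> = (\<Oplus>\<^bsub>P\<^esub>i\<in>E. h' (c' i y \<odot>\<^bsub>N\<^esub> f (e i)))"
  proof (rule P.M.finsum_cong'[OF refl])
    show "(\<lambda>i. h' (c' i y \<odot>\<^bsub>N\<^esub> f (e i))) \<in> E \<rightarrow> carrier P" using linD(1)[OF h' t] by simp
    fix i assume i: "i \<in> E"
    then show "h (c' i y \<odot>\<^bsub>N\<^esub> f (e i)) = h' (c' i y \<odot>\<^bsub>N\<^esub> f (e i))"
      using linD(3)[OF h c'_closed[OF i y] f_closed[OF e_closed[OF i]]]
        linD(3)[OF h' c'_closed[OF i y] f_closed[OF e_closed[OF i]]] eq[OF e_closed[OF i]] by simp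
  qed
  also have "\<dots> = h' y"
    by (subst (2) expand'[OF y]) (rule lin_sum[OF N.module_axioms P h' finE t, symmetric])
  finally show ?thesis .
qed

lemma f_zero: "f \<zero>\<^bsub>M\<^esub> = \<zero>\<^bsub>N\<^esub>"
proof -
  have "f (\<zero>\<^bsub>A\<^esub> \<odot>\<^bsub>M\<^esub> \<zero>\<^bsub>M\<^esub>) = \<phi> \<zero>\<^bsub>A\<^esub> \<odot>\<^bsub>N\<^esub> f \<zero>\<^bsub>M\<^esub>" by (rule f_smult) auto
  then show ?thesis using f_closed[OF M.M.zero_closed] by simp
qed

text \<open>
  A formula in coordinates: \<open>h y = \<Sum>\<^sub>i c'\<^sub>i(y) f (g (e\<^sub>i))\<close>. It is \<open>B\<close>-linear whether or not the \<open>e\<^sub>i\<close> are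
  independent, because the coordinates \<open>c'\<^sub>i\<close> are linear functions.
\<close>

lemma ext_exists:
  assumes g: "lin A M M g"
  shows "\<exists>h. lin B N N h \<and> (\<forall>x\<in>carrier M. h (f x) = f (g x))"
proof -
  define h where "h y = (\<Oplus>\<^bsub>N\<^esub>i\<in>E. c' i y \<odot>\<^bsub>N\<^esub> f (g (e i)))" for y
  have fg: "f (g (e i)) \<in> carrier N" if "i \<in> E" for i
    by (rule f_closed[OF linD(1)[OF g e_closed[OF that]]])
  have "lin B N N h"
    unfolding lin_def
  proof (intro conjI ballI)
    fix y assume y: "y \<in> carrier N"
    show "h y \<in> carrier N" unfolding h_def
      by (rule N.M.finsum_closed) (use fg c'_closed y in auto)
    show "h (y \<oplus>\<^bsub>N\<^esub> z) = h y \<oplus>\<^bsub>N\<^esub> h z" if z: "z \<in> carrier N" for z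
    proof -
      have "h (y \<oplus>\<^bsub>N\<^esub> z) = (\<Oplus>\<^bsub>N\<^esub>i\<in>E. c' i y \<odot>\<^bsub>N\<^esub> f (g (e i)) \<oplus>\<^bsub>N\<^esub> c' i z \<odot>\<^bsub>N\<^esub> f (g (e i)))"
        unfolding h_def
        by (rule N.M.finsum_cong'[OF refl])
           (use fg c'_closed y z in \<open>auto simp: c'_add N.smult_l_distr\<close>)
      also have "\<dots> = h y \<oplus>\<^bsub>N\<^esub> h z"
        unfolding h_def by (rule N.M.finsum_addf) (use fg c'_closed y z in auto)
      finally show ?thesis .
    qed
    show "h (b \<odot>\<^bsub>N\<^esub> y) = b \<odot>\<^bsub>N\<^esub> h y" if b: "b \<in> carrier B" for b
    proof -
      have "h (b \<odot>\<^bsub>N\<^esub> y) = (\<Oplus>\<^bsub>N\<^esub>i\<in>E. b \<odot>\<^bsub>N\<^esub> (c' i y \<odot>\<^bsub>N\<^esub> f (g (e i))))"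
        unfolding h_def
        by (rule N.M.finsum_cong'[OF refl])
           (use fg c'_closed y b in \<open>auto simp: c'_smult N.smult_assoc1\<close>)
      also have "\<dots> = b \<odot>\<^bsub>N\<^esub> h y"
        unfolding h_def by (rule N.finsum_smult_ldistr[symmetric]) (use fg c'_closed y b finE in auto)
      finally show ?thesis .
    qed
  qed
  moreover have "h (f x) = f (g x)" if x: "x \<in> carrier M" for x
  proof -
    have "g x = (\<Oplus>\<^bsub>M\<^esub>i\<in>E. g (c i x \<odot>\<^bsub>M\<^esub> e i))"
      by (subst expand[OF x]) (rule lin_sum[OF M.module_axioms M.module_axioms g finE], use c_closed x e_closed in auto)
    also have "\<dots> = (\<Oplus>\<^bsub>M\<^esub>i\<in>E. c i x \<odot>\<^bsub>M\<^esub> g (e i))"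
      by (rule M.M.finsum_cong'[OF refl]) (use linD[OF g] c_closed x e_closed in auto)
    finally have "f (g x) = f (\<Oplus>\<^bsub>M\<^esub>i\<in>E. c i x \<odot>\<^bsub>M\<^esub> g (e i))" by (rule arg_cong)
    also have "\<dots> = (\<Oplus>\<^bsub>N\<^esub>i\<in>E. f (c i x \<odot>\<^bsub>M\<^esub> g (e i)))"
      by (rule M.M.finsum_hom)
         (use f_add f_zero f_closed finE linD[OF g] c_closed x e_closed N.M.abelian_monoid_axioms in auto)
    also have "\<dots> = h (f x)"
      unfolding h_def
      by (rule N.M.finsum_cong'[OF refl])
         (use fg c'_closed f_closed x c_closed linD[OF g] e_closed in \<open>auto simp: f_smult c'_f\<close>)
    finally show ?thesis by simp
  qed
  ultimately show ?thesis by blast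
qed

end

section \<open>Weight filtrations over an algebra\<close>

lemma hull_submodule:
  assumes M: "module R M" and S: "S \<subseteq> carrier M"
  shows "submodule (span_submodule R M S) R M" and "S \<subseteq> span_submodule R M S"
    and "submodule N R M \<Longrightarrow> S \<subseteq> N \<Longrightarrow> span_submodule R M S \<subseteq> N"
proof -
  interpret module R M by (rule M)
  let ?F = "{N. submodule N R M \<and> S \<subseteq> N}"
  have c: "carrier M \<in> ?F" using carrier_is_submodule S by blast
  have eq: "span_submodule R M S = \<Inter>?F" by (simp add: span_submodule_def hull_def)
  show "submodule (span_submodule R M S) R M"
    unfolding eq
  proof (rule submoduleI)
    show "\<Inter>?F \<subseteq> carrier M" using c by blast
    show "\<zero>\<^bsub>M\<^esub> \<in> \<Inter>?F"
    proof
      fix N assume "N \<in> ?F"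
      then interpret N: abelian_subgroup N M using submodule_add_subgroup by blast
      show "\<zero>\<^bsub>M\<^esub> \<in> N" by simp
    qed
  next
    show "\<ominus>\<^bsub>M\<^esub> a \<in> \<Inter>?F" if "a \<in> \<Inter>?F" for a
      using that by (auto intro: submoduleE(3))
    show "a \<oplus>\<^bsub>M\<^esub> b \<in> \<Inter>?F" if "a \<in> \<Inter>?F" "b \<in> \<Inter>?F" for a b
      using that by (auto intro: submoduleE(5))
    show "a \<odot>\<^bsub>M\<^esub> x \<in> \<Inter>?F" if "a \<in> carrier R" "x \<in> \<Inter>?F" for a x
      using that by (auto intro: submoduleE(4))
  qed
  show "S \<subseteq> span_submodule R M S" unfolding eq by blast
  show "span_submodule R M S \<subseteq> N" if "submodule N R M" "S \<subseteq> N" unfolding eq using that by blast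
qed

text \<open>
  The part of a mixed Hodge structure on which the functor \<open>\<omega>\<close> and its tensor structure depend.
\<close>

definition filtered :: "mhs_data \<Rightarrow> bool" where
  "filtered H \<longleftrightarrow> (\<forall>k. submodule (weight H k) real_ring (free_module real_ring {..<dim H})) \<and>
     mono (weight H) \<and>
     (\<exists>k. weight H k = {\<zero>\<^bsub>free_module real_ring {..<dim H}\<^esub>}) \<and>
     (\<exists>k. weight H k = carrier (free_module real_ring {..<dim H}))"

lemma is_mhs_filtered: "is_mhs H \<Longrightarrow> filtered H"
  by (simp add: is_mhs_def filtered_def Let_def)

text \<open>
  A projection of \<open>\<real>\<^sup>d\<close> to the subspace \<open>W\<close>: send \<open>v\<close> to the element of \<open>W\<close> with the same coordinates at the
  pivots.
\<close>

lemma weight_projection: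
  assumes "submodule W real_ring (free_module real_ring {..<d})"
  shows "\<exists>Q :: nat \<Rightarrow> nat \<Rightarrow> real. (\<forall>l<d. (\<lambda>i\<in>{..<d}. Q i l) \<in> W) \<and>
    (\<forall>w\<in>W. \<forall>i<d. w i = (\<Sum>l<d. Q i l * w l))"
proof -
  interpret M: module real_ring "free_module real_ring {..<d}"
    by (rule module_free_module[OF cring_real_ring])
  note W = M.submoduleE[OF assms]
  define S where "S = {v. (\<lambda>i\<in>{..<d}. v i) \<in> W}"
  have S: "(\<lambda>i. a * u i + b * v i) \<in> S" if "u \<in> S" "v \<in> S" for a b u v
  proof -
    have u: "(\<lambda>i\<in>{..<d}. u i) \<in> W" and v: "(\<lambda>i\<in>{..<d}. v i) \<in> W" using that by (auto simp: S_def)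
    have "(a \<odot>\<^bsub>free_module real_ring {..<d}\<^esub> (\<lambda>i\<in>{..<d}. u i)) \<oplus>\<^bsub>free_module real_ring {..<d}\<^esub>
        (b \<odot>\<^bsub>free_module real_ring {..<d}\<^esub> (\<lambda>i\<in>{..<d}. v i)) \<in> W"
      using W(4)[OF _ u] W(4)[OF _ v] by (intro W(5)) auto
    moreover have "(a \<odot>\<^bsub>free_module real_ring {..<d}\<^esub> (\<lambda>i\<in>{..<d}. u i)) \<oplus>\<^bsub>free_module real_ring {..<d}\<^esub>
        (b \<odot>\<^bsub>free_module real_ring {..<d}\<^esub> (\<lambda>i\<in>{..<d}. v i)) = (\<lambda>i\<in>{..<d}. a * u i + b * v i)"
      unfolding free_module_simps real_ring_simps by (rule restrict_ext) simp
    ultimately show ?thesis by (simp add: S_def)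
  qed
  have "\<exists>(n :: nat) s p. (\<forall>j<n. s j \<in> S) \<and> (\<forall>j<n. p j \<in> {..<d}) \<and>
    (\<forall>i<n. \<forall>j<n. s j (p i) = (if i = j then 1 else 0)) \<and>
    (\<forall>v\<in>S. \<forall>i\<in>{..<d}. v i = (\<Sum>j<n. v (p j) * s j i))"
    by (rule echelon_basis[OF finite_lessThan]) (rule S)
  then obtain n :: nat and s p where E: "\<forall>j<n. s j \<in> S" "\<forall>j<n. p j \<in> {..<d}"
    "\<forall>i<n. \<forall>j<n. s j (p i) = (if i = j then 1 else 0)"
    "\<forall>v\<in>S. \<forall>i\<in>{..<d}. v i = (\<Sum>j<n. v (p j) * s j i)" by blast
  define Q where "Q i l = (\<Sum>j<n. (if p j = l then 1 else 0) * s j i)" for i l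
  have "(\<lambda>i. \<Sum>j<m. (if p j = l then 1 else 0) * s j i) \<in> S" if "m \<le> n" for m l
    using that
  proof (induction m)
    case 0
    have "(\<lambda>i\<in>{..<d}. 0) \<in> W" using M.submoduleE(5)[OF assms] W(2) W(4)[of 0] by fastforce
    then show ?case by (simp add: S_def)
  next
    case (Suc m)
    then show ?case using S[of "\<lambda>i. \<Sum>j<m. (if p j = l then 1 else 0) * s j i" "s m" 1 "if p m = l then 1 else 0"] E(1)
      by (simp add: Suc_le_eq)
  qed
  then have "\<forall>l<d. (\<lambda>i\<in>{..<d}. Q i l) \<in> W" unfolding Q_def S_def by blast
  moreover have "w i = (\<Sum>l<d. Q i l * w l)" if w: "w \<in> W" and i: "i < d" for w i
  proof -
    have "(\<lambda>i\<in>{..<d}. w i) = w" using W(1) w by (intro ext) (auto simp: PiE_iff extensional_def)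
    then have "w \<in> S" using w by (simp add: S_def)
    then have "w i = (\<Sum>j<n. w (p j) * s j i)" using E(4) i by auto
    also have "\<dots> = (\<Sum>j<n. \<Sum>l<d. (if p j = l then 1 else 0) * s j i * w l)"
    proof (rule sum.cong[OF refl])
      fix j assume "j \<in> {..<n}"
      then have "p j < d" using E(2) by auto
      have "(\<Sum>l<d. (if p j = l then 1 else 0) * s j i * w l) = (\<Sum>l<d. if l = p j then s j i * w l else 0)"
        by (rule sum.cong) auto
      then show "w (p j) * s j i = (\<Sum>l<d. (if p j = l then 1 else 0) * s j i * w l)"
        using \<open>p j < d\<close> by simp
    qed
    also have "\<dots> = (\<Sum>l<d. Q i l * w l)"
      unfolding Q_def by (subst sum.swap) (simp add: sum_distrib_right)
    finally show ?thesis .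
  qed
  ultimately show ?thesis by blast
qed

definition wproj :: "mhs_data \<Rightarrow> int \<Rightarrow> nat \<Rightarrow> nat \<Rightarrow> real" where
  "wproj H k = (SOME Q. (\<forall>l<dim H. (\<lambda>i\<in>{..<dim H}. Q i l) \<in> weight H k) \<and>
    (\<forall>w\<in>weight H k. \<forall>i<dim H. w i = (\<Sum>l<dim H. Q i l * w l)))"

lemma wproj:
  assumes "filtered H"
  shows "l < dim H \<Longrightarrow> (\<lambda>i\<in>{..<dim H}. wproj H k i l) \<in> weight H k"
    and "w \<in> weight H k \<Longrightarrow> i < dim H \<Longrightarrow> w i = (\<Sum>l<dim H. wproj H k i l * w l)"
proof -
  have "(\<forall>l<dim H. (\<lambda>i\<in>{..<dim H}. wproj H k i l) \<in> weight H k) \<and>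
    (\<forall>w\<in>weight H k. \<forall>i<dim H. w i = (\<Sum>l<dim H. wproj H k i l * w l))"
    unfolding wproj_def
    by (rule someI_ex[OF weight_projection]) (use assms in \<open>simp add: filtered_def\<close>)
  then show "l < dim H \<Longrightarrow> (\<lambda>i\<in>{..<dim H}. wproj H k i l) \<in> weight H k"
    and "w \<in> weight H k \<Longrightarrow> i < dim H \<Longrightarrow> w i = (\<Sum>l<dim H. wproj H k i l * w l)" by blast+
qed

locale filt = real_alg A for A :: "(real, 'u) module" (structure) +
  fixes H :: mhs_data
  assumes filt: "filtered H"
begin

abbreviation "D \<equiv> {..<dim H}"
abbreviation "M \<equiv> free_module A D"
abbreviation "N k \<equiv> weight_ext A (str_map A) H k"
abbreviation "\<eta> \<equiv> str_map A"

lemma module_M: "module A M" by (rule module_free_module[OF A.is_cring])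

sublocale M: module A M by (rule module_M)

lemma N_base: "vec_map \<eta> D ` weight H k \<subseteq> carrier M"
  by (rule image_subsetI) (simp add: vec_map_def)

lemma N_submodule: "submodule (N k) A M"
  unfolding weight_ext_def by (rule hull_submodule(1)[OF module_M N_base])

lemma N_gen: "w \<in> weight H k \<Longrightarrow> vec_map \<eta> D w \<in> N k"
  unfolding weight_ext_def using hull_submodule(2)[OF module_M N_base] by blast

lemma N_least: "submodule X A M \<Longrightarrow> (\<And>w. w \<in> weight H k \<Longrightarrow> vec_map \<eta> D w \<in> X) \<Longrightarrow> N k \<subseteq> X"
  unfolding weight_ext_def by (rule hull_submodule(3)[OF module_M N_base]) auto

lemma N_carrier: "v \<in> N k \<Longrightarrow> v \<in> carrier M"
  using M.submoduleE(1)[OF N_submodule] by blast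

lemma N_mono: "j \<le> k \<Longrightarrow> N j \<subseteq> N k"
  by (rule N_least[OF N_submodule], rule N_gen) (use filt in \<open>auto simp: filtered_def mono_def\<close>)

lemma N_sub: "abelian_subgroup (N k) M"
  by (rule M.submodule_add_subgroup[OF N_submodule])

lemma N_add: "u \<in> N k \<Longrightarrow> v \<in> N k \<Longrightarrow> u \<oplus>\<^bsub>M\<^esub> v \<in> N k"
  by (rule M.submoduleE(5)[OF N_submodule])

lemma N_smult: "a \<in> carrier A \<Longrightarrow> v \<in> N k \<Longrightarrow> a \<odot>\<^bsub>M\<^esub> v \<in> N k"
  by (rule M.submoduleE(4)[OF N_submodule])

lemma N_zero: "\<zero>\<^bsub>M\<^esub> \<in> N k"
proof -
  interpret abelian_subgroup "N k" M by (rule N_sub)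
  show ?thesis by (rule zero_closed)
qed

lemma N_inv: "v \<in> N k \<Longrightarrow> \<ominus>\<^bsub>M\<^esub> v \<in> N k"
  by (rule M.submoduleE(3)[OF N_submodule])

text \<open>The class in \<open>Gr\<^sub>k\<close> of an element of \<open>W\<^sub>k\<close>.\<close>

definition cl :: "int \<Rightarrow> (nat \<Rightarrow> 'u) \<Rightarrow> (nat \<Rightarrow> 'u) set" where
  "cl k v = N (k - 1) +>\<^bsub>M\<^esub> v"

abbreviation "Gr k \<equiv> gr A \<eta> H k"

lemma restricted_module: "module A (M\<lparr>carrier := N k\<rparr>)"
  by (rule submodule.submodule_is_module[OF N_submodule module_M])

lemma restricted_submodule: "submodule (N (k - 1)) A (M\<lparr>carrier := N k\<rparr>)"
proof (rule module.module_incl_imp_submodule[OF restricted_module])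
  show "N (k - 1) \<subseteq> carrier (M\<lparr>carrier := N k\<rparr>)" using N_mono[of "k - 1" k] by simp
  show "module A (M\<lparr>carrier := N k, carrier := N (k - 1)\<rparr>)"
    using restricted_module[of "k - 1"] by simp
qed

lemma module_Gr: "module A (Gr k)"
  unfolding gr_def by (rule module.module_quot_module[OF restricted_module restricted_submodule])

lemma coset_restrict: "X +>\<^bsub>M\<lparr>carrier := Y\<rparr>\<^esub> v = X +>\<^bsub>M\<^esub> v"
  by (simp add: a_r_coset_def')

lemma carrier_Gr: "X \<in> carrier (Gr k) \<longleftrightarrow> (\<exists>v\<in>N k. X = cl k v)"
  using module.quot_module_simps(1)[OF restricted_module restricted_submodule]
  by (auto simp: gr_def cl_def coset_restrict)

lemma zero_Gr: "\<zero>\<^bsub>Gr k\<^esub> = cl k \<zero>\<^bsub>M\<^esub>"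
  using module.quot_module_simps(2)[OF restricted_module restricted_submodule, of k]
  by (simp add: gr_def cl_def coset_restrict)

lemma add_Gr: "u \<in> N k \<Longrightarrow> v \<in> N k \<Longrightarrow> cl k u \<oplus>\<^bsub>Gr k\<^esub> cl k v = cl k (u \<oplus>\<^bsub>M\<^esub> v)"
  using module.quot_module_simps(3)[OF restricted_module restricted_submodule, of u k v]
  by (simp add: gr_def cl_def coset_restrict)

lemma smult_Gr: "a \<in> carrier A \<Longrightarrow> v \<in> N k \<Longrightarrow> a \<odot>\<^bsub>Gr k\<^esub> cl k v = cl k (a \<odot>\<^bsub>M\<^esub> v)"
  using module.quot_module_simps(4)[OF restricted_module restricted_submodule, of a v k]
  by (simp add: gr_def cl_def coset_restrict)

lemma cl_closed: "v \<in> N k \<Longrightarrow> cl k v \<in> carrier (Gr k)"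
  by (auto simp: carrier_Gr)

lemma cl_shift: "n \<in> N (k - 1) \<Longrightarrow> v \<in> carrier M \<Longrightarrow> cl k (n \<oplus>\<^bsub>M\<^esub> v) = cl k v"
proof -
  assume n: "n \<in> N (k - 1)" and v: "v \<in> carrier M"
  interpret abelian_subgroup "N (k - 1)" M by (rule N_sub)
  have "n \<oplus>\<^bsub>M\<^esub> v \<in> N (k - 1) +>\<^bsub>M\<^esub> v" unfolding a_r_coset_def' using n by blast
  from a_repr_independence'[OF this v] show "cl k (n \<oplus>\<^bsub>M\<^esub> v) = cl k v" by (simp add: cl_def)
qed

lemma cl_zero: "n \<in> N (k - 1) \<Longrightarrow> cl k n = \<zero>\<^bsub>Gr k\<^esub>"
  using cl_shift[of n k "\<zero>\<^bsub>M\<^esub>"] N_carrier[of n] by (simp only: zero_Gr M.M.r_zero M.M.zero_closed)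

lemma cl_memD: "w \<in> cl k v \<Longrightarrow> \<exists>n\<in>N (k - 1). w = n \<oplus>\<^bsub>M\<^esub> v"
  by (auto simp: cl_def a_r_coset_def')

lemma cl_self: "v \<in> carrier M \<Longrightarrow> v \<in> cl k v"
  unfolding cl_def by (rule abelian_subgroup.a_rcos_self[OF N_sub])

text \<open>
  The projection of \<open>A\<^sup>d\<close> to \<open>W\<^sub>k\<close>, and a projection with kernel \<open>W\<^bsub>k-1\<^esub>\<close>. Both have real matrices and hence
  commute with base change.
\<close>

definition pr :: "int \<Rightarrow> (nat \<Rightarrow> 'u) \<Rightarrow> nat \<Rightarrow> 'u" where
  "pr k = mat_vec A D D (\<lambda>i l. \<eta> (wproj H k i l))"

definition co :: "int \<Rightarrow> (nat \<Rightarrow> 'u) \<Rightarrow> nat \<Rightarrow> 'u" where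
  "co k w = (\<lambda>i\<in>D. w i \<ominus> pr (k - 1) w i)"

lemma pr_closed: "w \<in> carrier M \<Longrightarrow> pr k w \<in> carrier M"
  unfolding pr_def using A.mat_vec_closed[of D D "\<lambda>i l. \<eta> (wproj H k i l)" w] by simp

lemma pr_add: "u \<in> carrier M \<Longrightarrow> v \<in> carrier M \<Longrightarrow> pr k (u \<oplus>\<^bsub>M\<^esub> v) = pr k u \<oplus>\<^bsub>M\<^esub> pr k v"
  unfolding pr_def using A.mat_vec_add[of D D "\<lambda>i l. \<eta> (wproj H k i l)" u v] by simp

lemma pr_smult: "a \<in> carrier A \<Longrightarrow> v \<in> carrier M \<Longrightarrow> pr k (a \<odot>\<^bsub>M\<^esub> v) = a \<odot>\<^bsub>M\<^esub> pr k v"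
  unfolding pr_def using A.mat_vec_smult[of D D "\<lambda>i l. \<eta> (wproj H k i l)" v a] by simp

text \<open>
  The columns of the projection matrix generate \<open>W\<^sub>k\<close>.
\<close>

definition gen :: "int \<Rightarrow> nat \<Rightarrow> nat \<Rightarrow> 'u" where
  "gen k l = vec_map \<eta> D (\<lambda>i\<in>D. wproj H k i l)"

lemma gen_N: "l < dim H \<Longrightarrow> gen k l \<in> N k"
  unfolding gen_def by (rule N_gen, rule wproj(1)[OF filt])

lemma submodule_comb:
  assumes X: "submodule X A M" and L: "finite L" and v: "\<And>l. l \<in> L \<Longrightarrow> v l \<in> X" and c: "\<And>l. l \<in> L \<Longrightarrow> c l \<in> carrier A"
  shows "(\<lambda>i\<in>D. \<Oplus>l\<in>L. c l \<otimes> v l i) \<in> X"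
  using L v c
proof (induction L)
  case empty
  have "\<zero>\<^bsub>M\<^esub> \<in> X" using abelian_subgroup.axioms(1)[OF M.submodule_add_subgroup[OF X]] additive_subgroup.zero_closed by blast
  then show ?case by (simp add: restrict_def)
next
  case (insert a L)
  have Xc: "X \<subseteq> carrier M" by (rule M.submoduleE(1)[OF X])
  have vc: "v l i \<in> carrier A" if "l \<in> insert a L" "i \<in> D" for l i
    using insert.prems(1)[OF that(1)] Xc that(2) by auto
  have "(c a \<odot>\<^bsub>M\<^esub> v a) \<oplus>\<^bsub>M\<^esub> (\<lambda>i\<in>D. \<Oplus>l\<in>L. c l \<otimes> v l i) \<in> X"
    by (intro M.submoduleE(5)[OF X] M.submoduleE(4)[OF X] insert.IH insert.prems) simp_all
  moreover have "(c a \<odot>\<^bsub>M\<^esub> v a) \<oplus>\<^bsub>M\<^esub> (\<lambda>i\<in>D. \<Oplus>l\<in>L. c l \<otimes> v l i) = (\<lambda>i\<in>D. \<Oplus>l\<in>insert a L. c l \<otimes> v l i)"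
    unfolding free_module_simps
  proof (rule restrict_ext)
    fix i assume i: "i \<in> D"
    have "(\<Oplus>l\<in>insert a L. c l \<otimes> v l i) = c a \<otimes> v a i \<oplus> (\<Oplus>l\<in>L. c l \<otimes> v l i)"
      by (rule A.finsum_insert) (use insert.hyps insert.prems(2) vc i in auto)
    then show "(\<lambda>i\<in>D. c a \<otimes> v a i) i \<oplus> (\<lambda>i\<in>D. \<Oplus>l\<in>L. c l \<otimes> v l i) i = (\<Oplus>l\<in>insert a L. c l \<otimes> v l i)"
      using i by simp
  qed
  ultimately show ?case by (simp only:)
qed

lemma pr_eq_comb:
  assumes "w \<in> carrier M"
  shows "pr k w = (\<lambda>i\<in>D. \<Oplus>l\<in>D. w l \<otimes> gen k l i)"
  unfolding pr_def mat_vec_def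
proof (intro restrict_ext A.finsum_cong'[OF refl])
  fix i l assume "i \<in> D" "l \<in> D"
  moreover from this have "w l \<in> carrier A" using assms by auto
  moreover have "gen k l i = \<eta> (wproj H k i l)" using \<open>i \<in> D\<close> by (simp add: gen_def vec_map_def)
  ultimately show "\<eta> (wproj H k i l) \<otimes> w l = w l \<otimes> gen k l i"
    using A.m_comm[of "\<eta> (wproj H k i l)" "w l"] by simp
next
  fix i assume i: "i \<in> D"
  have "w l \<in> carrier A" if "l \<in> D" for l using assms that by auto
  with i show "(\<lambda>l. w l \<otimes> gen k l i) \<in> D \<rightarrow> carrier A" by (simp add: gen_def vec_map_def)
qed

lemma pr_N: "w \<in> carrier M \<Longrightarrow> pr k w \<in> N k"
  unfolding pr_eq_comb by (rule submodule_comb[OF N_submodule]) (auto simp: gen_N)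

text \<open>
  The fixed points of \<open>pr k\<close> form a submodule, which contains the image of the real subspace.
\<close>

lemma pr_id:
  assumes w: "w \<in> N k" shows "pr k w = w"
proof -
  let ?X = "{w \<in> carrier M. pr k w = w}"
  have "submodule ?X A M"
  proof (rule M.submoduleI)
    show z: "\<zero>\<^bsub>M\<^esub> \<in> ?X"
    proof -
      have "pr k (\<zero> \<odot>\<^bsub>M\<^esub> \<zero>\<^bsub>M\<^esub>) = \<zero> \<odot>\<^bsub>M\<^esub> pr k \<zero>\<^bsub>M\<^esub>" by (rule pr_smult[OF A.zero_closed M.M.zero_closed])
      then have "pr k \<zero>\<^bsub>M\<^esub> = \<zero>\<^bsub>M\<^esub>"
        unfolding M.smult_l_null[OF M.M.zero_closed] M.smult_l_null[OF pr_closed[OF M.M.zero_closed]] .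
      then show ?thesis by (simp only: mem_Collect_eq M.M.zero_closed simp_thms)
    qed
    show "\<ominus>\<^bsub>M\<^esub> a \<in> ?X" if "a \<in> ?X" for a
    proof -
      have a: "a \<in> carrier M" "pr k a = a" using that by auto
      have eq: "\<ominus>\<^bsub>M\<^esub> a = (\<ominus> \<one>) \<odot>\<^bsub>M\<^esub> a" using M.smult_l_minus[of \<one> a] a by (simp only: A.one_closed M.smult_one)
      show ?thesis unfolding eq using a pr_smult[of "\<ominus> \<one>" a] by (simp only: mem_Collect_eq A.a_inv_closed A.one_closed M.smult_closed)
    qed
  next
    fix a b assume "a \<in> ?X" "b \<in> ?X"
    then show "a \<oplus>\<^bsub>M\<^esub> b \<in> ?X" using pr_add[of a b] M.M.a_closed[of a b] by (simp only: mem_Collect_eq)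
  next
    fix a x assume "a \<in> carrier A" "x \<in> ?X"
    then show "a \<odot>\<^bsub>M\<^esub> x \<in> ?X" using pr_smult[of a x] M.smult_closed[of a x] by (simp only: mem_Collect_eq)
  qed auto
  moreover have "vec_map \<eta> D v \<in> ?X" if v: "v \<in> weight H k" for v
  proof -
    have "pr k (vec_map \<eta> D v) = vec_map \<eta> D v"
      unfolding pr_def mat_vec_def vec_map_def
    proof (rule restrict_ext)
      fix i assume i: "i \<in> D"
      have "\<eta> (v i) = (\<Oplus>l\<in>D. \<eta> (wproj H k i l) \<otimes> \<eta> (v l))"
        using wproj(2)[OF filt v, of i] i by (simp add: str_map_sum str_map_times)
      also have "\<dots> = (\<Oplus>l\<in>D. \<eta> (wproj H k i l) \<otimes> (\<lambda>i\<in>D. \<eta> (v i)) l)"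
        by (rule A.finsum_cong'[OF refl]) auto
      finally show "(\<Oplus>l\<in>D. \<eta> (wproj H k i l) \<otimes> (\<lambda>i\<in>D. \<eta> (v i)) l) = \<eta> (v i)" by simp
    qed
    then show ?thesis using N_base v by blast
  qed
  ultimately have "N k \<subseteq> ?X" by (rule N_least)
  with w show ?thesis by blast
qed

lemma co_eq: "w \<in> carrier M \<Longrightarrow> co k w = w \<ominus>\<^bsub>M\<^esub> pr (k - 1) w"
proof -
  assume w: "w \<in> carrier M"
  let ?p = "pr (k - 1) w"
  have p: "?p \<in> carrier M" by (rule pr_closed[OF w])
  have "co k w \<oplus>\<^bsub>M\<^esub> ?p = w"
  proof
    fix i
    show "(co k w \<oplus>\<^bsub>M\<^esub> ?p) i = w i"
    proof (cases "i \<in> D")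
      case True
      then have "w i \<in> carrier A" "?p i \<in> carrier A" using w p by auto
      then show ?thesis using True by (simp add: co_def A.minus_eq A.a_assoc A.l_neg)
    next
      case False
      have "w i = undefined" using w False PiE_arb[of w D "\<lambda>_. carrier A" i] by simp
      with False show ?thesis by simp
    qed
  qed
  moreover have "co k w \<in> carrier M"
    unfolding free_module_simps co_def
  proof (rule restrict_PiE_iff[THEN iffD2], rule ballI)
    fix i assume "i \<in> D"
    then show "w i \<ominus> ?p i \<in> carrier A" using w p by (intro A.minus_closed) auto
  qed
  ultimately show ?thesis using p by (metis M.M.add.inv_solve_right M.M.minus_eq w)
qed

lemma co_closed: "w \<in> carrier M \<Longrightarrow> co k w \<in> carrier M"
  using pr_closed by (simp only: co_eq M.M.minus_closed)

lemma co_add: "u \<in> carrier M \<Longrightarrow> v \<in> carrier M \<Longrightarrow> co k (u \<oplus>\<^bsub>M\<^esub> v) = co k u \<oplus>\<^bsub>M\<^esub> co k v"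
  by (simp only: co_eq M.M.a_closed pr_add M.M.minus_eq M.M.minus_add pr_closed M.M.a_ac M.M.a_inv_closed)

lemma co_smult: "a \<in> carrier A \<Longrightarrow> v \<in> carrier M \<Longrightarrow> co k (a \<odot>\<^bsub>M\<^esub> v) = a \<odot>\<^bsub>M\<^esub> co k v"
  by (simp only: co_eq M.smult_closed pr_smult M.M.minus_eq M.smult_r_distr pr_closed M.smult_r_minus M.M.a_inv_closed)

lemma co_zero: "n \<in> N (k - 1) \<Longrightarrow> co k n = \<zero>\<^bsub>M\<^esub>"
  using N_carrier[of n] by (simp only: co_eq pr_id M.M.minus_eq M.M.r_neg)

lemma co_N: "w \<in> N k \<Longrightarrow> co k w \<in> N k"
proof -
  assume w: "w \<in> N k"
  have "pr (k - 1) w \<in> N k" using pr_N[OF N_carrier[OF w], of "k - 1"] N_mono[of "k - 1" k] by auto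
  then show ?thesis using w by (simp only: co_eq N_carrier M.M.minus_eq N_add N_inv)
qed

lemma cl_co: "w \<in> N k \<Longrightarrow> cl k (co k w) = cl k w"
proof -
  assume w: "w \<in> N k"
  note wc = N_carrier[OF w]
  have "cl k (pr (k - 1) w \<oplus>\<^bsub>M\<^esub> co k w) = cl k (co k w)"
    by (rule cl_shift[OF pr_N[OF wc] co_closed[OF wc]])
  moreover have "pr (k - 1) w \<oplus>\<^bsub>M\<^esub> co k w = w"
    using wc pr_closed[OF wc, of "k - 1"] by (simp only: co_eq M.M.minus_eq M.M.a_ac M.M.a_inv_closed M.M.r_neg M.M.l_neg M.M.r_zero)
  ultimately show ?thesis by simp
qed

text \<open>
  Coordinates on \<open>Gr\<^sub>k\<close>. The choice of the representative does not matter, because \<open>co k\<close> vanishes on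
  \<open>W\<^bsub>k-1\<^esub>\<close>.
\<close>

definition kap :: "int \<Rightarrow> nat \<Rightarrow> (nat \<Rightarrow> 'u) set \<Rightarrow> 'u" where
  "kap k l X = co k (SOME w. w \<in> X) l"

lemma kap_cl: "v \<in> N k \<Longrightarrow> kap k l (cl k v) = co k v l"
proof -
  assume v: "v \<in> N k"
  have "(SOME w. w \<in> cl k v) \<in> cl k v" using cl_self[OF N_carrier[OF v], of k] by (rule someI[of "\<lambda>w. w \<in> cl k v"])
  then obtain n where n: "n \<in> N (k - 1)" "(SOME w. w \<in> cl k v) = n \<oplus>\<^bsub>M\<^esub> v" using cl_memD by blast
  have "co k (n \<oplus>\<^bsub>M\<^esub> v) = co k n \<oplus>\<^bsub>M\<^esub> co k v" by (rule co_add[OF N_carrier[OF n(1)] N_carrier[OF v]])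
  also have "\<dots> = co k v" using co_closed[OF N_carrier[OF v]] by (simp only: co_zero[OF n(1)] M.M.l_zero)
  finally show ?thesis by (simp add: kap_def n(2))
qed

text \<open>
  If \<open>v\<close> in \<open>W\<^sub>k\<close> represents \<open>X\<close>, so does \<open>w = co k v\<close>, and \<open>w = pr k w = \<Sum>\<^sub>l w\<^sub>l gen k l\<close>.
\<close>

lemma Gr_expand:
  assumes X: "X \<in> carrier (Gr k)"
  shows "X = (\<Oplus>\<^bsub>Gr k\<^esub>l\<in>D. kap k l X \<odot>\<^bsub>Gr k\<^esub> cl k (gen k l))"
proof -
  interpret G: module A "Gr k" by (rule module_Gr)
  obtain v where v: "v \<in> N k" "X = cl k v" using X by (auto simp: carrier_Gr)
  let ?w = "co k v"
  have w: "?w \<in> N k" "?w \<in> carrier M" by (rule co_N[OF v(1)], rule co_closed[OF N_carrier[OF v(1)]])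
  have wl: "?w l \<in> carrier A" if "l \<in> D" for l using w(2) that by auto
  have comb: "cl k (\<lambda>i\<in>D. \<Oplus>l\<in>L. ?w l \<otimes> gen k l i) = (\<Oplus>\<^bsub>Gr k\<^esub>l\<in>L. ?w l \<odot>\<^bsub>Gr k\<^esub> cl k (gen k l))"
    if "finite L" "L \<subseteq> D" for L
    using that
  proof (induction L)
    case empty
    then show ?case by (simp add: zero_Gr restrict_def)
  next
    case (insert a L)
    have g: "gen k l \<in> N k" "l \<in> D" if "l \<in> insert a L" for l using that insert.prems gen_N by auto
    have gc: "gen k l i \<in> carrier A" if "l \<in> insert a L" "i \<in> D" for l i
      using N_carrier[OF g(1)[OF that(1)]] that(2) by auto
    have L: "(\<lambda>i\<in>D. \<Oplus>l\<in>L. ?w l \<otimes> gen k l i) \<in> N k"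
      by (rule submodule_comb[OF N_submodule insert.hyps(1)]) (use g wl in auto)
    have "(\<lambda>i\<in>D. \<Oplus>l\<in>insert a L. ?w l \<otimes> gen k l i) = (?w a \<odot>\<^bsub>M\<^esub> gen k a) \<oplus>\<^bsub>M\<^esub> (\<lambda>i\<in>D. \<Oplus>l\<in>L. ?w l \<otimes> gen k l i)"
      unfolding free_module_simps
    proof (rule restrict_ext)
      fix i assume i: "i \<in> D"
      have "(\<Oplus>l\<in>insert a L. ?w l \<otimes> gen k l i) = ?w a \<otimes> gen k a i \<oplus> (\<Oplus>l\<in>L. ?w l \<otimes> gen k l i)"
        by (rule A.finsum_insert) (use insert.hyps wl g gc i in auto)
      then show "(\<Oplus>l\<in>insert a L. ?w l \<otimes> gen k l i) =
          (\<lambda>i\<in>D. ?w a \<otimes> gen k a i) i \<oplus> (\<lambda>i\<in>D. \<Oplus>l\<in>L. ?w l \<otimes> gen k l i) i"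
        using i by simp
    qed
    then have "cl k (\<lambda>i\<in>D. \<Oplus>l\<in>insert a L. ?w l \<otimes> gen k l i) =
        ?w a \<odot>\<^bsub>Gr k\<^esub> cl k (gen k a) \<oplus>\<^bsub>Gr k\<^esub> (\<Oplus>\<^bsub>Gr k\<^esub>l\<in>L. ?w l \<odot>\<^bsub>Gr k\<^esub> cl k (gen k l))"
      using insert.IH insert.prems N_smult[OF wl[OF g(2)] g(1), of a] L
      by (simp only: add_Gr[symmetric] smult_Gr[OF wl[OF g(2)] g(1), of a] insertI1 insert_subset)
    also have "\<dots> = (\<Oplus>\<^bsub>Gr k\<^esub>l\<in>insert a L. ?w l \<odot>\<^bsub>Gr k\<^esub> cl k (gen k l))"
      by (rule G.M.finsum_insert[symmetric]) (use insert.hyps wl g cl_closed in auto)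
    finally show ?case .
  qed
  have "X = cl k ?w" using v by (simp add: cl_co)
  also have "?w = (\<lambda>i\<in>D. \<Oplus>l\<in>D. ?w l \<otimes> gen k l i)"
    using pr_id[OF w(1)] pr_eq_comb[OF w(2), of k] by simp
  also have "cl k \<dots> = (\<Oplus>\<^bsub>Gr k\<^esub>l\<in>D. ?w l \<odot>\<^bsub>Gr k\<^esub> cl k (gen k l))" by (rule comb) auto
  also have "\<dots> = (\<Oplus>\<^bsub>Gr k\<^esub>l\<in>D. kap k l X \<odot>\<^bsub>Gr k\<^esub> cl k (gen k l))"
    by (simp only: v(2) kap_cl[OF v(1)])
  finally show ?thesis .
qed

lemma kap_closed: "X \<in> carrier (Gr k) \<Longrightarrow> l \<in> D \<Longrightarrow> kap k l X \<in> carrier A"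
proof -
  assume "X \<in> carrier (Gr k)" and l: "l \<in> D"
  then obtain v where v: "v \<in> N k" "X = cl k v" by (auto simp: carrier_Gr)
  then show ?thesis using co_closed[OF N_carrier[OF v(1)], of k] l by (auto simp: kap_cl)
qed

lemma kap_add: "X \<in> carrier (Gr k) \<Longrightarrow> Y \<in> carrier (Gr k) \<Longrightarrow> l \<in> D \<Longrightarrow>
    kap k l (X \<oplus>\<^bsub>Gr k\<^esub> Y) = kap k l X \<oplus> kap k l Y"
proof -
  assume "X \<in> carrier (Gr k)" "Y \<in> carrier (Gr k)" and l: "l \<in> D"
  then obtain u v where u: "u \<in> N k" "X = cl k u" and v: "v \<in> N k" "Y = cl k v" by (auto simp: carrier_Gr)
  have "co k (u \<oplus>\<^bsub>M\<^esub> v) l = co k u l \<oplus> co k v l"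
    unfolding co_add[OF N_carrier[OF u(1)] N_carrier[OF v(1)]] using l by simp
  then show ?thesis unfolding u(2) v(2) add_Gr[OF u(1) v(1)] kap_cl[OF u(1)] kap_cl[OF v(1)] kap_cl[OF N_add[OF u(1) v(1)]] .
qed

lemma kap_smult: "a \<in> carrier A \<Longrightarrow> X \<in> carrier (Gr k) \<Longrightarrow> l \<in> D \<Longrightarrow>
    kap k l (a \<odot>\<^bsub>Gr k\<^esub> X) = a \<otimes> kap k l X"
proof -
  assume a: "a \<in> carrier A" and "X \<in> carrier (Gr k)" and l: "l \<in> D"
  then obtain u where u: "u \<in> N k" "X = cl k u" by (auto simp: carrier_Gr)
  have "co k (a \<odot>\<^bsub>M\<^esub> u) l = a \<otimes> co k u l"
    unfolding co_smult[OF a N_carrier[OF u(1)]] using l by simp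
  then show ?thesis unfolding u(2) smult_Gr[OF a u(1)] kap_cl[OF u(1)] kap_cl[OF N_smult[OF a u(1)]] .
qed

end

section \<open>The fiber functor and base change\<close>

definition jumps :: "mhs_data \<Rightarrow> int set" where
  "jumps H = {k. weight H k \<noteq> weight H (k - 1)}"

text \<open>
  The filtration is constant below an index where it vanishes and above an index where it is everything.
\<close>

lemma finite_jumps:
  assumes "filtered H" shows "finite (jumps H)"
proof -
  let ?M = "free_module real_ring {..<dim H}"
  interpret M: module real_ring ?M by (rule module_free_module[OF cring_real_ring])
  have sub: "\<And>k. submodule (weight H k) real_ring ?M" and mono: "\<And>j k. j \<le> k \<Longrightarrow> weight H j \<subseteq> weight H k"
    using assms by (auto simp: filtered_def mono_def)
  obtain a b where a: "weight H a = {\<zero>\<^bsub>?M\<^esub>}" and b: "weight H b = carrier ?M"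
    using assms unfolding filtered_def by blast
  have z: "\<zero>\<^bsub>?M\<^esub> \<in> weight H k" for k
    using additive_subgroup.zero_closed[OF abelian_subgroup.axioms(1)[OF M.submodule_add_subgroup[OF sub]]] .
  have lo: "weight H k = {\<zero>\<^bsub>?M\<^esub>}" if "k \<le> a" for k
    using mono[OF that] z[of k] unfolding a by blast
  have hi: "weight H k = carrier ?M" if "b \<le> k" for k
    using mono[OF that] M.submoduleE(1)[OF sub[of k]] unfolding b by blast
  have "jumps H \<subseteq> {a..b}"
  proof
    fix k assume k: "k \<in> jumps H"
    have ne: "weight H k \<noteq> weight H (k - 1)" using k by (simp add: jumps_def)
    have "\<not> k \<le> a"
    proof
      assume "k \<le> a"
      then have "weight H k = {\<zero>\<^bsub>?M\<^esub>}" "weight H (k - 1) = {\<zero>\<^bsub>?M\<^esub>}" by (auto intro!: lo simp del: free_module_simps)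
      with ne show False by (simp only:)
    qed
    moreover have "\<not> b < k"
    proof
      assume "b < k"
      then have "weight H k = carrier ?M" "weight H (k - 1) = carrier ?M" by (auto intro!: hi simp del: free_module_simps)
      with ne show False by (simp only:)
    qed
    ultimately show "k \<in> {a..b}" by simp
  qed
  then show ?thesis using finite_subset by blast
qed

context filt
begin

abbreviation "Fib \<equiv> fiber A H"

lemma module_Fib: "module A Fib"
  unfolding fiber_def by (rule module_direct_sum[OF A.is_cring module_Gr])

lemma Gr_trivial: "k \<notin> jumps H \<Longrightarrow> X \<in> carrier (Gr k) \<Longrightarrow> X = \<zero>\<^bsub>Gr k\<^esub>"
proof -
  assume "k \<notin> jumps H" and X: "X \<in> carrier (Gr k)"
  then have "N k = N (k - 1)" by (simp add: jumps_def weight_ext_def)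
  with X cl_zero show ?thesis unfolding carrier_Gr by blast
qed

lemma Fib_simps:
  "x \<in> carrier Fib \<longleftrightarrow> (\<forall>k. x k \<in> carrier (Gr k))"
  "\<zero>\<^bsub>Fib\<^esub> = (\<lambda>k. \<zero>\<^bsub>Gr k\<^esub>)"
  "x \<oplus>\<^bsub>Fib\<^esub> y = (\<lambda>k. x k \<oplus>\<^bsub>Gr k\<^esub> y k)"
  "a \<odot>\<^bsub>Fib\<^esub> x = (\<lambda>k. a \<odot>\<^bsub>Gr k\<^esub> x k)"
proof -
  have "finite {k. x k \<noteq> \<zero>\<^bsub>Gr k\<^esub>}" if "\<forall>k. x k \<in> carrier (Gr k)"
    by (rule finite_subset[OF _ finite_jumps[OF filt]]) (use that Gr_trivial in blast)
  then show "x \<in> carrier Fib \<longleftrightarrow> (\<forall>k. x k \<in> carrier (Gr k))"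
    unfolding fiber_def direct_sum_simps by blast
qed (simp_all add: fiber_def direct_sum_simps)

lemma Fib_cl: "x \<in> carrier Fib \<Longrightarrow> \<exists>v\<in>N k. x k = cl k v"
  by (simp add: Fib_simps carrier_Gr)

text \<open>
  Generators of the fiber, numbered by a weight and an index of a coordinate, and coordinates for them.
\<close>

definition E where "E = jumps H \<times> D"

definition bvec :: "int \<times> nat \<Rightarrow> int \<Rightarrow> (nat \<Rightarrow> 'u) set" where
  "bvec p k = (if k = fst p then cl k (gen k (snd p)) else cl k \<zero>\<^bsub>M\<^esub>)"

definition crd :: "int \<times> nat \<Rightarrow> (int \<Rightarrow> (nat \<Rightarrow> 'u) set) \<Rightarrow> 'u" where
  "crd p x = kap (fst p) (snd p) (x (fst p))"

lemma bvec_closed: "p \<in> E \<Longrightarrow> bvec p \<in> carrier Fib"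
  unfolding Fib_simps(1) bvec_def E_def by (auto intro!: cl_closed gen_N N_zero simp del: free_module_simps)

lemma crd_closed: "p \<in> E \<Longrightarrow> x \<in> carrier Fib \<Longrightarrow> crd p x \<in> carrier A"
  unfolding crd_def E_def by (rule kap_closed) (auto simp: Fib_simps(1))

lemma crd_add: "p \<in> E \<Longrightarrow> x \<in> carrier Fib \<Longrightarrow> y \<in> carrier Fib \<Longrightarrow> crd p (x \<oplus>\<^bsub>Fib\<^esub> y) = crd p x \<oplus> crd p y"
  unfolding crd_def E_def Fib_simps(3) by (rule kap_add) (auto simp: Fib_simps(1))

lemma crd_smult: "p \<in> E \<Longrightarrow> a \<in> carrier A \<Longrightarrow> x \<in> carrier Fib \<Longrightarrow> crd p (a \<odot>\<^bsub>Fib\<^esub> x) = a \<otimes> crd p x"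
  unfolding crd_def E_def Fib_simps(4) by (rule kap_smult) (auto simp: Fib_simps(1))

lemma finite_E: "finite E"
  unfolding E_def using finite_jumps[OF filt] by simp

lemma Fib_expand:
  assumes x: "x \<in> carrier Fib"
  shows "x = (\<Oplus>\<^bsub>Fib\<^esub>p\<in>E. crd p x \<odot>\<^bsub>Fib\<^esub> bvec p)"
proof
  fix k
  interpret F: module A Fib by (rule module_Fib)
  interpret G: module A "Gr k" by (rule module_Gr)
  have t: "crd p x \<odot>\<^bsub>Fib\<^esub> bvec p \<in> carrier Fib" if "p \<in> E" for p
    by (rule F.smult_closed[OF crd_closed[OF that x] bvec_closed[OF that]])
  have s: "(\<Oplus>\<^bsub>Fib\<^esub>p\<in>E. crd p x \<odot>\<^bsub>Fib\<^esub> bvec p) \<in> carrier Fib"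
    by (rule F.M.finsum_closed) (use t in blast)
  have "(\<Oplus>\<^bsub>Fib\<^esub>p\<in>E. crd p x \<odot>\<^bsub>Fib\<^esub> bvec p) k = (\<Oplus>\<^bsub>Gr k\<^esub>p\<in>E. (crd p x \<odot>\<^bsub>Fib\<^esub> bvec p) k)"
    by (rule F.M.finsum_hom[where h = "\<lambda>x. x k"])
       (use G.M.abelian_monoid_axioms finite_E t in \<open>auto simp: Fib_simps\<close>)
  also have "\<dots> = x k"
  proof (cases "k \<in> jumps H")
    case True
    have t': "(crd p x \<odot>\<^bsub>Fib\<^esub> bvec p) k \<in> carrier (Gr k)" if "p \<in> E" for p
      using t[OF that] by (simp only: Fib_simps(1))
    have "(\<Oplus>\<^bsub>Gr k\<^esub>p\<in>E. (crd p x \<odot>\<^bsub>Fib\<^esub> bvec p) k) =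
        (\<Oplus>\<^bsub>Gr k\<^esub>j\<in>jumps H. \<Oplus>\<^bsub>Gr k\<^esub>l\<in>D. (crd (j, l) x \<odot>\<^bsub>Fib\<^esub> bvec (j, l)) k)"
      unfolding E_def by (rule G.M.finsum_Times[OF finite_jumps[OF filt] finite_lessThan]) (rule t', simp add: E_def)
    also have "\<dots> = (\<Oplus>\<^bsub>Gr k\<^esub>j\<in>jumps H. if j = k then x j else \<zero>\<^bsub>Gr k\<^esub>)"
    proof (rule G.M.finsum_cong'[OF refl])
      show "(\<lambda>j. if j = k then x j else \<zero>\<^bsub>Gr k\<^esub>) \<in> jumps H \<rightarrow> carrier (Gr k)"
        using x by (auto simp: Fib_simps(1))
      fix j assume j: "j \<in> jumps H"
      show "(\<Oplus>\<^bsub>Gr k\<^esub>l\<in>D. (crd (j, l) x \<odot>\<^bsub>Fib\<^esub> bvec (j, l)) k) = (if j = k then x j else \<zero>\<^bsub>Gr k\<^esub>)"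
      proof (cases "j = k")
        case True
        have "x k = (\<Oplus>\<^bsub>Gr k\<^esub>l\<in>D. kap k l (x k) \<odot>\<^bsub>Gr k\<^esub> cl k (gen k l))"
          by (rule Gr_expand) (use x in \<open>simp add: Fib_simps(1)\<close>)
        with True show ?thesis by (simp add: Fib_simps(4) bvec_def crd_def)
      next
        case False
        have "(\<Oplus>\<^bsub>Gr k\<^esub>l\<in>D. (crd (j, l) x \<odot>\<^bsub>Fib\<^esub> bvec (j, l)) k) = (\<Oplus>\<^bsub>Gr k\<^esub>l\<in>D. \<zero>\<^bsub>Gr k\<^esub>)"
        proof (rule G.M.finsum_cong'[OF refl])
          fix l assume "l \<in> D"
          then have "crd (j, l) x \<in> carrier A" using j by (intro crd_closed[OF _ x]) (simp add: E_def)
          then show "(crd (j, l) x \<odot>\<^bsub>Fib\<^esub> bvec (j, l)) k = \<zero>\<^bsub>Gr k\<^esub>"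
            using False G.smult_r_null[of "crd (j, l) x"] by (simp add: Fib_simps(4) bvec_def zero_Gr[symmetric] del: free_module_simps)
        qed simp
        then show ?thesis using False by (simp add: G.M.finsum_zero)
      qed
    qed
    also have "\<dots> = x k"
      by (rule G.M.finsum_delta[OF finite_jumps[OF filt] True]) (use x in \<open>simp add: Fib_simps(1)\<close>)
    finally show ?thesis .
  next
    case False
    have a: "(\<Oplus>\<^bsub>Gr k\<^esub>p\<in>E. (crd p x \<odot>\<^bsub>Fib\<^esub> bvec p) k) \<in> carrier (Gr k)"
      by (rule G.M.finsum_closed) (use t in \<open>auto simp: Fib_simps(1)\<close>)
    have b: "x k \<in> carrier (Gr k)" using x by (simp add: Fib_simps(1))
    show ?thesis by (rule trans[OF Gr_trivial[OF False a] Gr_trivial[OF False b, symmetric]])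
  qed
  finally show "x k = (\<Oplus>\<^bsub>Fib\<^esub>p\<in>E. crd p x \<odot>\<^bsub>Fib\<^esub> bvec p) k" by simp
qed

end

text \<open>
  This covers both the maps induced by morphisms of mixed Hodge structures, where \<open>\<phi>\<close> is the identity,
  and the base change along \<open>\<phi>\<close>, where \<open>H = H'\<close>.
\<close>

locale filt_map = alg_mor A B \<phi> + S: filt A H + T: filt B H'
  for A B :: "(real, 'u) module" and \<phi> and H H' +
  fixes f :: "(nat \<Rightarrow> 'u) \<Rightarrow> (nat \<Rightarrow> 'u)"
  assumes f_closed: "v \<in> carrier S.M \<Longrightarrow> f v \<in> carrier T.M"
    and f_add: "u \<in> carrier S.M \<Longrightarrow> v \<in> carrier S.M \<Longrightarrow> f (u \<oplus>\<^bsub>S.M\<^esub> v) = f u \<oplus>\<^bsub>T.M\<^esub> f v"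
    and f_smult: "a \<in> carrier A \<Longrightarrow> v \<in> carrier S.M \<Longrightarrow> f (a \<odot>\<^bsub>S.M\<^esub> v) = \<phi> a \<odot>\<^bsub>T.M\<^esub> f v"
    and f_weight: "w \<in> weight H k \<Longrightarrow> f (vec_map (str_map A) S.D w) \<in> T.N k"
begin

lemma f_N:
  assumes "v \<in> S.N k" shows "f v \<in> T.N k"
proof -
  let ?X = "{v \<in> carrier S.M. f v \<in> T.N k}"
  have "submodule ?X A S.M"
  proof (rule S.M.submoduleI)
    have "f (\<zero>\<^bsub>A\<^esub> \<odot>\<^bsub>S.M\<^esub> \<zero>\<^bsub>S.M\<^esub>) = \<phi> \<zero>\<^bsub>A\<^esub> \<odot>\<^bsub>T.M\<^esub> f \<zero>\<^bsub>S.M\<^esub>"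
      by (rule f_smult[OF A.A.zero_closed S.M.M.zero_closed])
    then have "f \<zero>\<^bsub>S.M\<^esub> = \<zero>\<^bsub>T.M\<^esub>"
      unfolding zero S.M.smult_l_null[OF S.M.M.zero_closed] T.M.smult_l_null[OF f_closed[OF S.M.M.zero_closed]] .
    then show "\<zero>\<^bsub>S.M\<^esub> \<in> ?X" by (simp only: mem_Collect_eq S.M.M.zero_closed T.N_zero simp_thms)
    show "\<ominus>\<^bsub>S.M\<^esub> a \<in> ?X" if "a \<in> ?X" for a
    proof -
      have a: "a \<in> carrier S.M" "f a \<in> T.N k" using that by auto
      have "\<ominus>\<^bsub>S.M\<^esub> a = (\<ominus>\<^bsub>A\<^esub> \<one>\<^bsub>A\<^esub>) \<odot>\<^bsub>S.M\<^esub> a"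
        using S.M.smult_l_minus[of "\<one>\<^bsub>A\<^esub>" a] a by (simp only: A.A.one_closed S.M.smult_one)
      then have "f (\<ominus>\<^bsub>S.M\<^esub> a) = \<phi> (\<ominus>\<^bsub>A\<^esub> \<one>\<^bsub>A\<^esub>) \<odot>\<^bsub>T.M\<^esub> f a"
        using f_smult[of "\<ominus>\<^bsub>A\<^esub> \<one>\<^bsub>A\<^esub>" a] a by (simp only: A.A.one_closed A.A.a_inv_closed)
      also have "\<dots> \<in> T.N k" by (rule T.N_smult[OF closed a(2)]) simp
      finally show ?thesis using a by (simp only: mem_Collect_eq S.M.M.a_inv_closed simp_thms)
    qed
    show "a \<oplus>\<^bsub>S.M\<^esub> b \<in> ?X" if "a \<in> ?X" "b \<in> ?X" for a b
      using that f_add[of a b] T.N_add[of "f a" k "f b"] by (simp only: mem_Collect_eq S.M.M.a_closed simp_thms)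
    show "a \<odot>\<^bsub>S.M\<^esub> x \<in> ?X" if "a \<in> carrier A" "x \<in> ?X" for a x
      using that f_smult[of a x] T.N_smult[of "\<phi> a" "f x" k] closed[of a]
      by (simp only: mem_Collect_eq S.M.smult_closed simp_thms)
  qed blast
  moreover have "vec_map (str_map A) S.D w \<in> ?X" if "w \<in> weight H k" for w
    using f_weight[OF that] S.N_base that by blast
  ultimately have "S.N k \<subseteq> ?X" by (rule S.N_least)
  with assms show ?thesis by blast
qed

abbreviation "fm \<equiv> fiber_map B H' f"

text \<open>
  The image of a coset of \<open>W\<^bsub>k-1\<^esub>\<close> is contained in a coset, which adding \<open>W\<^bsub>k-1\<^esub>\<close> fills up.
\<close>

lemma coset_map:
  assumes v: "v \<in> S.N k"
  shows "T.N (k - 1) <+>\<^bsub>T.M\<^esub> (f ` S.cl k v) = T.cl k (f v)"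
proof (intro equalityI subsetI)
  note vc = S.N_carrier[OF v] and fv = f_closed[OF S.N_carrier[OF v]]
  fix y assume "y \<in> T.N (k - 1) <+>\<^bsub>T.M\<^esub> (f ` S.cl k v)"
  then obtain n w where n: "n \<in> T.N (k - 1)" "w \<in> S.cl k v" "y = n \<oplus>\<^bsub>T.M\<^esub> f w"
    unfolding set_add_def' by blast
  then obtain m where m: "m \<in> S.N (k - 1)" "w = m \<oplus>\<^bsub>S.M\<^esub> v" using S.cl_memD by blast
  note mc = S.N_carrier[OF m(1)]
  have "y = (n \<oplus>\<^bsub>T.M\<^esub> f m) \<oplus>\<^bsub>T.M\<^esub> f v"
    unfolding n(3) m(2) f_add[OF mc vc] using T.M.M.a_assoc[OF T.N_carrier[OF n(1)] f_closed[OF mc] fv] by (rule sym)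
  moreover have "n \<oplus>\<^bsub>T.M\<^esub> f m \<in> T.N (k - 1)" by (rule T.N_add[OF n(1) f_N[OF m(1)]])
  ultimately show "y \<in> T.cl k (f v)" unfolding T.cl_def a_r_coset_def' by blast
next
  fix y assume "y \<in> T.cl k (f v)"
  then obtain n where n: "n \<in> T.N (k - 1)" "y = n \<oplus>\<^bsub>T.M\<^esub> f v" using T.cl_memD by blast
  then show "y \<in> T.N (k - 1) <+>\<^bsub>T.M\<^esub> (f ` S.cl k v)"
    using S.cl_self[OF S.N_carrier[OF v]] unfolding set_add_def' by blast
qed

lemma fm_cl: "x k = S.cl k v \<Longrightarrow> v \<in> S.N k \<Longrightarrow> fm x k = T.cl k (f v)"
  unfolding fiber_map_def by (simp only: coset_map)

lemma fm_closed: "x \<in> carrier S.Fib \<Longrightarrow> fm x \<in> carrier T.Fib"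
  unfolding T.Fib_simps(1)
proof
  fix k assume "x \<in> carrier S.Fib"
  then obtain v where v: "v \<in> S.N k" "x k = S.cl k v" using S.Fib_cl by blast
  show "fm x k \<in> carrier (T.Gr k)" unfolding fm_cl[of x, OF v(2,1)] by (rule T.cl_closed[OF f_N[OF v(1)]])
qed

lemma fm_add:
  assumes x: "x \<in> carrier S.Fib" and y: "y \<in> carrier S.Fib"
  shows "fm (x \<oplus>\<^bsub>S.Fib\<^esub> y) = fm x \<oplus>\<^bsub>T.Fib\<^esub> fm y"
proof
  fix k
  obtain u where u: "u \<in> S.N k" "x k = S.cl k u" using S.Fib_cl[OF x] by blast
  obtain v where v: "v \<in> S.N k" "y k = S.cl k v" using S.Fib_cl[OF y] by blast
  have "(x \<oplus>\<^bsub>S.Fib\<^esub> y) k = S.cl k (u \<oplus>\<^bsub>S.M\<^esub> v)"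
    unfolding S.Fib_simps(3) u(2) v(2) by (rule S.add_Gr[OF u(1) v(1)])
  from fm_cl[of "x \<oplus>\<^bsub>S.Fib\<^esub> y", OF this S.N_add[OF u(1) v(1)]]
  have "fm (x \<oplus>\<^bsub>S.Fib\<^esub> y) k = T.cl k (f u \<oplus>\<^bsub>T.M\<^esub> f v)"
    unfolding f_add[OF S.N_carrier[OF u(1)] S.N_carrier[OF v(1)]] .
  also have "\<dots> = (fm x \<oplus>\<^bsub>T.Fib\<^esub> fm y) k"
    unfolding T.Fib_simps(3) fm_cl[of x, OF u(2,1)] fm_cl[of y, OF v(2,1)]
    by (rule T.add_Gr[OF f_N[OF u(1)] f_N[OF v(1)], symmetric])
  finally show "fm (x \<oplus>\<^bsub>S.Fib\<^esub> y) k = (fm x \<oplus>\<^bsub>T.Fib\<^esub> fm y) k" .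
qed

lemma fm_smult:
  assumes a: "a \<in> carrier A" and x: "x \<in> carrier S.Fib"
  shows "fm (a \<odot>\<^bsub>S.Fib\<^esub> x) = \<phi> a \<odot>\<^bsub>T.Fib\<^esub> fm x"
proof
  fix k
  obtain u where u: "u \<in> S.N k" "x k = S.cl k u" using S.Fib_cl[OF x] by blast
  have "(a \<odot>\<^bsub>S.Fib\<^esub> x) k = S.cl k (a \<odot>\<^bsub>S.M\<^esub> u)"
    unfolding S.Fib_simps(4) u(2) by (rule S.smult_Gr[OF a u(1)])
  from fm_cl[of "a \<odot>\<^bsub>S.Fib\<^esub> x", OF this S.N_smult[OF a u(1)]]
  have "fm (a \<odot>\<^bsub>S.Fib\<^esub> x) k = T.cl k (\<phi> a \<odot>\<^bsub>T.M\<^esub> f u)"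
    unfolding f_smult[OF a S.N_carrier[OF u(1)]] .
  also have "\<dots> = (\<phi> a \<odot>\<^bsub>T.Fib\<^esub> fm x) k"
    unfolding T.Fib_simps(4) fm_cl[of x, OF u(2,1)]
    by (rule T.smult_Gr[OF closed[OF a] f_N[OF u(1)], symmetric])
  finally show "fm (a \<odot>\<^bsub>S.Fib\<^esub> x) k = (\<phi> a \<odot>\<^bsub>T.Fib\<^esub> fm x) k" .
qed

end

lemma alg_mor_id: "algebra real_ring A \<Longrightarrow> alg_mor A A (\<lambda>x. x)"
  by (intro alg_mor.intro real_alg.intro alg_mor_axioms.intro) (auto simp: alg_hom_def ring_hom_def)

lemma filt_map_vec_map:
  assumes \<phi>: "alg_mor A B \<phi>" and H: "filtered H"
  shows "filt_map A B \<phi> H H (vec_map \<phi> {..<dim H})"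
proof -
  interpret alg_mor A B \<phi> by (rule \<phi>)
  interpret S: filt A H by (intro filt.intro A.real_alg_axioms filt_axioms.intro H)
  interpret T: filt B H by (intro filt.intro B.real_alg_axioms filt_axioms.intro H)
  show ?thesis
  proof (intro filt_map.intro alg_mor_axioms S.filt_axioms T.filt_axioms filt_map_axioms.intro)
    fix w k assume w: "w \<in> weight H k"
    have "vec_map \<phi> {..<dim H} (vec_map (str_map A) {..<dim H} w) = vec_map (str_map B) {..<dim H} w"
      unfolding vec_map_def by (rule restrict_ext) simp
    then show "vec_map \<phi> {..<dim H} (vec_map (str_map A) {..<dim H} w) \<in> T.N k"
      using T.N_gen[OF w] by simp
  next
    fix v assume "v \<in> carrier S.M"
    then show "vec_map \<phi> {..<dim H} v \<in> carrier T.M" by (auto simp: vec_map_def)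
  next
    fix u v assume "u \<in> carrier S.M" "v \<in> carrier S.M"
    then have "\<And>i. i < dim H \<Longrightarrow> u i \<in> carrier A" "\<And>i. i < dim H \<Longrightarrow> v i \<in> carrier A" by auto
    then show "vec_map \<phi> {..<dim H} (u \<oplus>\<^bsub>S.M\<^esub> v) = vec_map \<phi> {..<dim H} u \<oplus>\<^bsub>T.M\<^esub> vec_map \<phi> {..<dim H} v"
      unfolding free_module_simps vec_map_def by (intro restrict_ext) simp
  next
    fix a v assume "a \<in> carrier A" "v \<in> carrier S.M"
    then have "a \<in> carrier A" "\<And>i. i < dim H \<Longrightarrow> v i \<in> carrier A" by auto
    then show "vec_map \<phi> {..<dim H} (a \<odot>\<^bsub>S.M\<^esub> v) = \<phi> a \<odot>\<^bsub>T.M\<^esub> vec_map \<phi> {..<dim H} v"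
      unfolding free_module_simps vec_map_def by (intro restrict_ext) simp
  qed
qed

lemma filt_map_lin_map:
  assumes A: "algebra real_ring A" and H: "filtered H" "filtered H'" and f: "mhs_hom H H' f"
  shows "filt_map A A (\<lambda>x. x) H H' (alg_lin_map A {..<dim H} {..<dim H'} f)"
proof -
  interpret A: real_alg A by (rule real_alg.intro) (rule A)
  interpret S: filt A H by (intro filt.intro A.real_alg_axioms filt_axioms.intro H)
  interpret T: filt A H' by (intro filt.intro A.real_alg_axioms filt_axioms.intro H)
  let ?f = "alg_lin_map A {..<dim H} {..<dim H'} f"
  have f': "?f = mat_vec A {..<dim H} {..<dim H'} (\<lambda>j i. str_map A (f j i))" by (rule lin_map_mat_vec)
  show ?thesis
  proof (intro filt_map.intro alg_mor_id[OF A] S.filt_axioms T.filt_axioms filt_map_axioms.intro)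
    fix w k assume w: "w \<in> weight H k"
    have "?f (vec_map (str_map A) {..<dim H} w) =
        vec_map (str_map A) {..<dim H'} (lin_map real_ring (\<lambda>r. r) {..<dim H} {..<dim H'} f w)"
      unfolding f' mat_vec_def vec_map_def
    proof (rule restrict_ext)
      fix j assume j: "j \<in> {..<dim H'}"
      have "(\<Oplus>\<^bsub>A\<^esub>i\<in>{..<dim H}. str_map A (f j i) \<otimes>\<^bsub>A\<^esub> (\<lambda>i\<in>{..<dim H}. str_map A (w i)) i) =
          (\<Oplus>\<^bsub>A\<^esub>i\<in>{..<dim H}. str_map A (f j i * w i))"
        by (rule A.A.finsum_cong'[OF refl]) (auto simp: A.str_map_times)
      then show "(\<Oplus>\<^bsub>A\<^esub>i\<in>{..<dim H}. str_map A (f j i) \<otimes>\<^bsub>A\<^esub> (\<lambda>i\<in>{..<dim H}. str_map A (w i)) i) =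
          str_map A (lin_map real_ring (\<lambda>r. r) {..<dim H} {..<dim H'} f w j)"
        using j by (simp add: lin_map_def A.str_map_sum)
    qed
    moreover have "lin_map real_ring (\<lambda>r. r) {..<dim H} {..<dim H'} f w \<in> weight H' k"
      using f w unfolding mhs_hom_def by blast
    ultimately show "?f (vec_map (str_map A) {..<dim H} w) \<in> T.N k" using T.N_gen by simp
  next
    fix v assume "v \<in> carrier S.M"
    then show "?f v \<in> carrier T.M"
      unfolding f' free_module_simps by (intro A.A.mat_vec_closed) auto
  next
    fix u v assume "u \<in> carrier S.M" "v \<in> carrier S.M"
    then show "?f (u \<oplus>\<^bsub>S.M\<^esub> v) = ?f u \<oplus>\<^bsub>T.M\<^esub> ?f v"
      unfolding f' free_module_simps by (intro A.A.mat_vec_add) auto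
  next
    fix a v assume "a \<in> carrier A" "v \<in> carrier S.M"
    then show "?f (a \<odot>\<^bsub>S.M\<^esub> v) = a \<odot>\<^bsub>T.M\<^esub> ?f v"
      unfolding f' free_module_simps by (intro A.A.mat_vec_smult) auto
  qed
qed

text \<open>
  The generators and the coordinates on both sides come from the same real matrices.
\<close>

lemma scalar_ext_fiber:
  assumes \<phi>: "alg_mor A B \<phi>" and H: "filtered H"
  shows "scalar_ext A B \<phi> (fiber A H) (fiber B H) (fiber_map B H (vec_map \<phi> {..<dim H}))
    (filt.E H) (filt.bvec A H) (filt.crd A H) (filt.crd B H)"
proof -
  interpret fm: filt_map A B \<phi> H H "vec_map \<phi> {..<dim H}" by (rule filt_map_vec_map[OF \<phi> H])
  let ?f = "vec_map \<phi> {..<dim H}"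
  have f0: "?f \<zero>\<^bsub>fm.S.M\<^esub> = \<zero>\<^bsub>fm.T.M\<^esub>"
    unfolding vec_map_def free_module_simps by (rule restrict_ext) simp
  have fgen: "?f (fm.S.gen k l) = fm.T.gen k l" for k l
    unfolding vec_map_def fm.S.gen_def fm.T.gen_def by (rule restrict_ext) simp
  have fb: "fiber_map B H ?f (fm.S.bvec p) = fm.T.bvec p" if p: "p \<in> fm.S.E" for p
  proof
    fix k
    show "fiber_map B H ?f (fm.S.bvec p) k = fm.T.bvec p k"
    proof (cases "k = fst p")
      case True
      have "snd p < dim H" using p by (auto simp: fm.S.E_def)
      from fm.fm_cl[OF _ fm.S.gen_N[OF this, of k], of "fm.S.bvec p"] show ?thesis
        using True by (simp add: fm.S.bvec_def fm.T.bvec_def fgen)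
    next
      case False
      from fm.fm_cl[OF _ fm.S.N_zero[of k], of "fm.S.bvec p"] False show ?thesis
        unfolding f0 by (simp only: fm.S.bvec_def fm.T.bvec_def if_False)
    qed
  qed
  have fpr: "fm.T.pr k (?f v) = ?f (fm.S.pr k v)" if v: "v \<in> carrier fm.S.M" for k v
    unfolding fm.T.pr_def fm.S.pr_def mat_vec_def vec_map_def
  proof (rule restrict_ext)
    fix i assume i: "i \<in> {..<dim H}"
    have vl: "\<And>l. l < dim H \<Longrightarrow> v l \<in> carrier A" using v by auto
    have "\<phi> (\<Oplus>\<^bsub>A\<^esub>l\<in>{..<dim H}. str_map A (wproj H k i l) \<otimes>\<^bsub>A\<^esub> v l) =
        (\<Oplus>\<^bsub>B\<^esub>l\<in>{..<dim H}. \<phi> (str_map A (wproj H k i l) \<otimes>\<^bsub>A\<^esub> v l))"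
      by (rule fm.finsum) (use vl in auto)
    also have "\<dots> = (\<Oplus>\<^bsub>B\<^esub>l\<in>{..<dim H}. str_map B (wproj H k i l) \<otimes>\<^bsub>B\<^esub> (\<lambda>i\<in>{..<dim H}. \<phi> (v i)) l)"
      by (rule fm.B.A.finsum_cong'[OF refl]) (use vl in auto)
    finally show "(\<Oplus>\<^bsub>B\<^esub>l\<in>{..<dim H}. str_map B (wproj H k i l) \<otimes>\<^bsub>B\<^esub> (\<lambda>i\<in>{..<dim H}. \<phi> (v i)) l) =
      \<phi> ((\<lambda>j\<in>{..<dim H}. \<Oplus>\<^bsub>A\<^esub>l\<in>{..<dim H}. str_map A (wproj H k j l) \<otimes>\<^bsub>A\<^esub> v l) i)"
      using i by simp
  qed
  have fco: "fm.T.co k (?f v) l = \<phi> (fm.S.co k v l)" if v: "v \<in> carrier fm.S.M" and l: "l < dim H" for k v l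
  proof -
    have c: "v l \<in> carrier A" "fm.S.pr (k - 1) v l \<in> carrier A"
      using v fm.S.pr_closed[OF v, of "k - 1"] l by auto
    have "\<phi> (\<ominus>\<^bsub>A\<^esub> a) = \<ominus>\<^bsub>B\<^esub> \<phi> a" if "a \<in> carrier A" for a
      using fm.smult[OF that, of "- 1"] that by (simp add: fm.A.smult_neg1 fm.B.smult_neg1)
    then show ?thesis
      unfolding fm.T.co_def fm.S.co_def fpr[OF v] using l c
      by (simp add: vec_map_def fm.A.A.minus_eq fm.B.A.minus_eq)
  qed
  show ?thesis
  proof (intro scalar_ext.intro \<phi> fm.S.module_Fib fm.T.module_Fib scalar_ext_axioms.intro)
    fix p x assume p: "p \<in> fm.S.E" and x: "x \<in> carrier fm.S.Fib"
    obtain v where v: "v \<in> fm.S.N (fst p)" "x (fst p) = fm.S.cl (fst p) v" using fm.S.Fib_cl[OF x] by blast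
    have l: "snd p < dim H" using p by (auto simp: fm.S.E_def)
    show "fm.T.crd p (fiber_map B H ?f x) = \<phi> (fm.S.crd p x)"
      unfolding fm.T.crd_def fm.S.crd_def fm.fm_cl[of x, OF v(2,1)] v(2) fm.S.kap_cl[OF v(1)] fm.T.kap_cl[OF fm.f_N[OF v(1)]]
      by (rule fco[OF fm.S.N_carrier[OF v(1)] l])
  next
    fix y assume y: "y \<in> carrier fm.T.Fib"
    interpret F: module B fm.T.Fib by (rule fm.T.module_Fib)
    have "y = (\<Oplus>\<^bsub>fm.T.Fib\<^esub>p\<in>fm.T.E. fm.T.crd p y \<odot>\<^bsub>fm.T.Fib\<^esub> fm.T.bvec p)" by (rule fm.T.Fib_expand[OF y])
    also have "\<dots> = (\<Oplus>\<^bsub>fm.T.Fib\<^esub>p\<in>fm.S.E. fm.T.crd p y \<odot>\<^bsub>fm.T.Fib\<^esub> fiber_map B H ?f (fm.S.bvec p))"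
    proof (rule F.M.finsum_cong'[OF refl])
      show "(\<lambda>p. fm.T.crd p y \<odot>\<^bsub>fm.T.Fib\<^esub> fiber_map B H ?f (fm.S.bvec p)) \<in> fm.S.E \<rightarrow> carrier fm.T.Fib"
      proof
        fix p assume p: "p \<in> fm.S.E"
        show "fm.T.crd p y \<odot>\<^bsub>fm.T.Fib\<^esub> fiber_map B H ?f (fm.S.bvec p) \<in> carrier fm.T.Fib"
          by (rule F.smult_closed[OF fm.T.crd_closed[OF p y] fm.fm_closed[OF fm.S.bvec_closed[OF p]]])
      qed
      fix p assume "p \<in> fm.S.E"
      then show "fm.T.crd p y \<odot>\<^bsub>fm.T.Fib\<^esub> fm.T.bvec p = fm.T.crd p y \<odot>\<^bsub>fm.T.Fib\<^esub> fiber_map B H ?f (fm.S.bvec p)"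
        by (simp only: fb)
    qed
    finally show "y = (\<Oplus>\<^bsub>fm.T.Fib\<^esub>p\<in>fm.S.E. fm.T.crd p y \<odot>\<^bsub>fm.T.Fib\<^esub> fiber_map B H ?f (fm.S.bvec p))" .
  qed (rule fm.S.finite_E fm.S.bvec_closed fm.fm_closed fm.fm_add fm.fm_smult fm.S.crd_closed
      fm.T.crd_closed fm.T.crd_add fm.T.crd_smult fm.S.Fib_expand; assumption)+
qed

section \<open>Tensor products of fibers\<close>

lemma lin_preimage:
  assumes M: "module R M" and M': "module R M'" and f: "lin R M M' f" and N: "submodule N R M'"
  shows "submodule {x \<in> carrier M. f x \<in> N} R M"
proof -
  interpret M: module R M by (rule M)
  interpret M': module R M' by (rule M')
  have z: "f \<zero>\<^bsub>M\<^esub> = \<zero>\<^bsub>M'\<^esub>" by (rule lin_zero[OF M M' f])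
  show ?thesis
  proof (rule M.submoduleI)
    show "\<zero>\<^bsub>M\<^esub> \<in> {x \<in> carrier M. f x \<in> N}"
      using additive_subgroup.zero_closed[OF abelian_subgroup.axioms(1)[OF M'.submodule_add_subgroup[OF N]]]
      by (simp add: z)
  next
    fix a assume a: "a \<in> {x \<in> carrier M. f x \<in> N}"
    have "\<ominus>\<^bsub>M\<^esub> a = (\<ominus>\<^bsub>R\<^esub> \<one>\<^bsub>R\<^esub>) \<odot>\<^bsub>M\<^esub> a" using a by (simp add: M.smult_l_minus)
    moreover from this have "f (\<ominus>\<^bsub>M\<^esub> a) = (\<ominus>\<^bsub>R\<^esub> \<one>\<^bsub>R\<^esub>) \<odot>\<^bsub>M'\<^esub> f a" using a linD(3)[OF f] by simp
    ultimately show "\<ominus>\<^bsub>M\<^esub> a \<in> {x \<in> carrier M. f x \<in> N}"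
      using a M'.submoduleE(4)[OF N, of "\<ominus>\<^bsub>R\<^esub> \<one>\<^bsub>R\<^esub>" "f a"] by simp
  qed (use linD(2,3)[OF f] M'.submoduleE(4,5)[OF N] in auto)
qed

lemma dim_tensor [simp]: "dim (mhs_tensor H H') = dim H * dim H'"
  by (simp add: mhs_tensor_def)

lemma weight_tensor:
  assumes w: "w \<in> weight H k" and z: "z \<in> weight H' l"
  shows "vec_tensor real_ring (dim H) (dim H') w z \<in> weight (mhs_tensor H H') (k + l)"
proof -
  let ?S = "{vec_tensor real_ring (dim H) (dim H') u v | u v k' l'.
    k' + l' = k + l \<and> u \<in> weight H k' \<and> v \<in> weight H' l'}"
  have "?S \<subseteq> carrier (free_module real_ring {..<dim H * dim H'})"
    by (rule subsetI) (elim CollectE exE conjE; simp add: vec_tensor_def)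
  from hull_submodule(2)[OF module_free_module[OF cring_real_ring] this]
  have "?S \<subseteq> weight (mhs_tensor H H') (k + l)" by (simp add: mhs_tensor_def)
  moreover have "vec_tensor real_ring (dim H) (dim H') w z \<in> ?S" using w z by blast
  ultimately show ?thesis by blast
qed

locale tens = S: filt A H + T: filt A H' + U: filt A "mhs_tensor H H'"
  for A :: "(real, 'u) module" and H H'
begin

abbreviation "vt \<equiv> vec_tensor A (dim H) (dim H')"

lemma index: "i < dim H * dim H' \<Longrightarrow> i div dim H' < dim H \<and> i mod dim H' < dim H'"
  by (metis less_mult_imp_div_less mod_less_divisor mult_0_right not_less_zero gr0I)

lemma comp_closed: "u \<in> carrier S.M \<Longrightarrow> i < dim H \<Longrightarrow> u i \<in> carrier A"
  "v \<in> carrier T.M \<Longrightarrow> j < dim H' \<Longrightarrow> v j \<in> carrier A"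
  by auto

lemma vt_closed: "u \<in> carrier S.M \<Longrightarrow> v \<in> carrier T.M \<Longrightarrow> vt u v \<in> carrier U.M"
proof -
  assume u: "u \<in> carrier S.M" and v: "v \<in> carrier T.M"
  have "u (i div dim H') \<otimes>\<^bsub>A\<^esub> v (i mod dim H') \<in> carrier A" if "i < dim H * dim H'" for i
    using index[OF that] comp_closed(1)[OF u] comp_closed(2)[OF v] by blast
  then show ?thesis by (simp add: vec_tensor_def)
qed

lemma vt_add_left:
  assumes u: "u \<in> carrier S.M" "u' \<in> carrier S.M" and v: "v \<in> carrier T.M"
  shows "vt (u \<oplus>\<^bsub>S.M\<^esub> u') v = vt u v \<oplus>\<^bsub>U.M\<^esub> vt u' v"
  unfolding vec_tensor_def free_module_simps dim_tensor
proof (rule restrict_ext)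
  fix i assume "i \<in> {..<dim H * dim H'}"
  then have i: "i < dim H * dim H'" by simp
  then show "(\<lambda>i\<in>S.D. u i \<oplus>\<^bsub>A\<^esub> u' i) (i div dim H') \<otimes>\<^bsub>A\<^esub> v (i mod dim H') =
    (\<lambda>k\<in>{..<dim H * dim H'}. u (k div dim H') \<otimes>\<^bsub>A\<^esub> v (k mod dim H')) i \<oplus>\<^bsub>A\<^esub>
    (\<lambda>k\<in>{..<dim H * dim H'}. u' (k div dim H') \<otimes>\<^bsub>A\<^esub> v (k mod dim H')) i"
    using index[OF i] comp_closed(1)[OF u(1)] comp_closed(1)[OF u(2)] comp_closed(2)[OF v]
    by (simp add: S.A.l_distr)
qed

lemma vt_add_right:
  assumes u: "u \<in> carrier S.M" and v: "v \<in> carrier T.M" "v' \<in> carrier T.M"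
  shows "vt u (v \<oplus>\<^bsub>T.M\<^esub> v') = vt u v \<oplus>\<^bsub>U.M\<^esub> vt u v'"
  unfolding vec_tensor_def free_module_simps dim_tensor
proof (rule restrict_ext)
  fix i assume "i \<in> {..<dim H * dim H'}"
  then have i: "i < dim H * dim H'" by simp
  then show "u (i div dim H') \<otimes>\<^bsub>A\<^esub> (\<lambda>i\<in>T.D. v i \<oplus>\<^bsub>A\<^esub> v' i) (i mod dim H') =
    (\<lambda>k\<in>{..<dim H * dim H'}. u (k div dim H') \<otimes>\<^bsub>A\<^esub> v (k mod dim H')) i \<oplus>\<^bsub>A\<^esub>
    (\<lambda>k\<in>{..<dim H * dim H'}. u (k div dim H') \<otimes>\<^bsub>A\<^esub> v' (k mod dim H')) i"
    using index[OF i] comp_closed(1)[OF u(1)] comp_closed(2)[OF v(1)] comp_closed(2)[OF v(2)]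
    by (simp add: S.A.r_distr)
qed

lemma vt_smult_left:
  assumes a: "a \<in> carrier A" and u: "u \<in> carrier S.M" and v: "v \<in> carrier T.M"
  shows "vt (a \<odot>\<^bsub>S.M\<^esub> u) v = a \<odot>\<^bsub>U.M\<^esub> vt u v"
  unfolding vec_tensor_def free_module_simps dim_tensor
proof (rule restrict_ext)
  fix i assume "i \<in> {..<dim H * dim H'}"
  then have i: "i < dim H * dim H'" by simp
  then show "(\<lambda>i\<in>S.D. a \<otimes>\<^bsub>A\<^esub> u i) (i div dim H') \<otimes>\<^bsub>A\<^esub> v (i mod dim H') =
    a \<otimes>\<^bsub>A\<^esub> (\<lambda>k\<in>{..<dim H * dim H'}. u (k div dim H') \<otimes>\<^bsub>A\<^esub> v (k mod dim H')) i"
    using index[OF i] comp_closed(1)[OF u] comp_closed(2)[OF v] a by (simp add: S.A.m_assoc)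
qed

lemma vt_smult_right:
  assumes a: "a \<in> carrier A" and u: "u \<in> carrier S.M" and v: "v \<in> carrier T.M"
  shows "vt u (a \<odot>\<^bsub>T.M\<^esub> v) = a \<odot>\<^bsub>U.M\<^esub> vt u v"
  unfolding vec_tensor_def free_module_simps dim_tensor
proof (rule restrict_ext)
  fix i assume "i \<in> {..<dim H * dim H'}"
  then have i: "i < dim H * dim H'" by simp
  then show "u (i div dim H') \<otimes>\<^bsub>A\<^esub> (\<lambda>i\<in>T.D. a \<otimes>\<^bsub>A\<^esub> v i) (i mod dim H') =
    a \<otimes>\<^bsub>A\<^esub> (\<lambda>k\<in>{..<dim H * dim H'}. u (k div dim H') \<otimes>\<^bsub>A\<^esub> v (k mod dim H')) i"
    using index[OF i] comp_closed(1)[OF u] comp_closed(2)[OF v] a by (simp add: S.A.m_lcomm)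
qed

lemma lin_vt_left: "v \<in> carrier T.M \<Longrightarrow> lin A S.M U.M (\<lambda>u. vt u v)"
  unfolding lin_def by (intro conjI ballI vt_closed vt_add_left vt_smult_left)

lemma lin_vt_right: "u \<in> carrier S.M \<Longrightarrow> lin A T.M U.M (\<lambda>v. vt u v)"
  unfolding lin_def by (intro conjI ballI vt_closed vt_add_right vt_smult_right)

text \<open>
  For fixed \<open>v\<close>, the \<open>u\<close> with \<open>u \<otimes> v\<close> in \<open>W\<^bsub>k+l\<^esub>\<close> form a submodule, and similarly for fixed \<open>u\<close>. Hence it
  suffices to consider real \<open>u\<close> and \<open>v\<close>.
\<close>

lemma vt_N:
  assumes u: "u \<in> S.N k" and v: "v \<in> T.N l"
  shows "vt u v \<in> U.N (k + l)"
proof -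
  have base: "vt (vec_map (str_map A) S.D w) (vec_map (str_map A) T.D z) \<in> U.N (k + l)"
    if w: "w \<in> weight H k" and z: "z \<in> weight H' l" for w z
  proof -
    have "vt (vec_map (str_map A) S.D w) (vec_map (str_map A) T.D z) =
        vec_map (str_map A) {..<dim H * dim H'} (vec_tensor real_ring (dim H) (dim H') w z)"
      unfolding vec_tensor_def vec_map_def
      by (rule restrict_ext) (use index in \<open>simp add: S.str_map_times\<close>)
    then show ?thesis using U.N_gen[OF weight_tensor[OF w z]] by simp
  qed
  have step: "vt (vec_map (str_map A) S.D w) v \<in> U.N (k + l)" if w: "w \<in> weight H k" for w
  proof -
    have wc: "vec_map (str_map A) S.D w \<in> carrier S.M" using S.N_base w by blast
    have "T.N l \<subseteq> {v \<in> carrier T.M. vt (vec_map (str_map A) S.D w) v \<in> U.N (k + l)}"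
      by (rule T.N_least[OF lin_preimage[OF T.module_M U.module_M lin_vt_right[OF wc] U.N_submodule]])
         (use base[OF w] T.N_base in blast)
    with v show ?thesis by blast
  qed
  have "S.N k \<subseteq> {u \<in> carrier S.M. vt u v \<in> U.N (k + l)}"
    by (rule S.N_least[OF lin_preimage[OF S.module_M U.module_M lin_vt_left[OF T.N_carrier[OF v]] U.N_submodule]])
       (use step S.N_base in blast)
  with u show ?thesis by blast
qed

text \<open>
  The map \<open>Gr\<^sub>k \<times> Gr\<^sub>l \<rightarrow> Gr\<^bsub>k+l\<^esub>\<close>, a component of the tensor structure.
\<close>

definition tcomp :: "int \<Rightarrow> int \<Rightarrow> (nat \<Rightarrow> 'u) set \<Rightarrow> (nat \<Rightarrow> 'u) set \<Rightarrow> (nat \<Rightarrow> 'u) set" where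
  "tcomp k l X Y = U.N (k + l - 1) <+>\<^bsub>U.M\<^esub> {vt u v | u v. u \<in> X \<and> v \<in> Y}"

lemma tcomp_cl:
  assumes u: "u \<in> S.N k" and v: "v \<in> T.N l"
  shows "tcomp k l (S.cl k u) (T.cl l v) = U.cl (k + l) (vt u v)"
proof (intro equalityI subsetI)
  note uc = S.N_carrier[OF u] and vc = T.N_carrier[OF v]
  note uvc = vt_closed[OF uc vc]
  fix y assume "y \<in> tcomp k l (S.cl k u) (T.cl l v)"
  then obtain n u' v' where n: "n \<in> U.N (k + l - 1)" "u' \<in> S.cl k u" "v' \<in> T.cl l v" "y = n \<oplus>\<^bsub>U.M\<^esub> vt u' v'"
    unfolding tcomp_def set_add_def' by blast
  obtain a where a: "a \<in> S.N (k - 1)" "u' = a \<oplus>\<^bsub>S.M\<^esub> u" using S.cl_memD[OF n(2)] by blast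
  obtain b where b: "b \<in> T.N (l - 1)" "v' = b \<oplus>\<^bsub>T.M\<^esub> v" using T.cl_memD[OF n(3)] by blast
  note ac = S.N_carrier[OF a(1)] and bc = T.N_carrier[OF b(1)]
  have u'k: "a \<oplus>\<^bsub>S.M\<^esub> u \<in> S.N k" using S.N_add[of a k u] a(1) u S.N_mono[of "k - 1" k] by auto
  have "vt (a \<oplus>\<^bsub>S.M\<^esub> u) b \<in> U.N (k + (l - 1))" by (rule vt_N[OF u'k b(1)])
  then have ub: "vt (a \<oplus>\<^bsub>S.M\<^esub> u) b \<in> U.N (k + l - 1)" by (simp add: algebra_simps)
  have "vt a v \<in> U.N (k - 1 + l)" by (rule vt_N[OF a(1) v])
  then have av: "vt a v \<in> U.N (k + l - 1)" by (simp add: algebra_simps)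
  note ubc = U.N_carrier[OF ub] and avc = U.N_carrier[OF av] and nc = U.N_carrier[OF n(1)]
  have "y = n \<oplus>\<^bsub>U.M\<^esub> (vt (a \<oplus>\<^bsub>S.M\<^esub> u) b \<oplus>\<^bsub>U.M\<^esub> (vt a v \<oplus>\<^bsub>U.M\<^esub> vt u v))"
    unfolding n(4) a(2) b(2) vt_add_right[OF S.N_carrier[OF u'k] bc vc] vt_add_left[OF ac uc vc] ..
  also have "\<dots> = (n \<oplus>\<^bsub>U.M\<^esub> (vt (a \<oplus>\<^bsub>S.M\<^esub> u) b \<oplus>\<^bsub>U.M\<^esub> vt a v)) \<oplus>\<^bsub>U.M\<^esub> vt u v"
    by (simp only: U.M.M.a_assoc nc ubc avc uvc U.M.M.a_closed)
  finally have "y = (n \<oplus>\<^bsub>U.M\<^esub> (vt (a \<oplus>\<^bsub>S.M\<^esub> u) b \<oplus>\<^bsub>U.M\<^esub> vt a v)) \<oplus>\<^bsub>U.M\<^esub> vt u v" .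
  moreover have "n \<oplus>\<^bsub>U.M\<^esub> (vt (a \<oplus>\<^bsub>S.M\<^esub> u) b \<oplus>\<^bsub>U.M\<^esub> vt a v) \<in> U.N (k + l - 1)"
    by (intro U.N_add n(1) ub av)
  ultimately show "y \<in> U.cl (k + l) (vt u v)" unfolding U.cl_def a_r_coset_def' by blast
next
  fix y assume "y \<in> U.cl (k + l) (vt u v)"
  then obtain n where n: "n \<in> U.N (k + l - 1)" "y = n \<oplus>\<^bsub>U.M\<^esub> vt u v" using U.cl_memD by blast
  moreover have "vt u v \<in> {vt u' v' | u' v'. u' \<in> S.cl k u \<and> v' \<in> T.cl l v}"
    using S.cl_self[OF S.N_carrier[OF u]] T.cl_self[OF T.N_carrier[OF v]] by blast
  ultimately show "y \<in> tcomp k l (S.cl k u) (T.cl l v)" unfolding tcomp_def set_add_def' by blast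
qed

lemma tcomp_closed:
  assumes "X \<in> carrier (S.Gr k)" "Y \<in> carrier (T.Gr l)"
  shows "tcomp k l X Y \<in> carrier (U.Gr (k + l))"
proof -
  obtain u v where "u \<in> S.N k" "X = S.cl k u" "v \<in> T.N l" "Y = T.cl l v"
    using assms unfolding S.carrier_Gr T.carrier_Gr by blast
  then show ?thesis by (simp only: tcomp_cl U.cl_closed vt_N)
qed

lemma lin_tcomp_left:
  assumes Y: "Y \<in> carrier (T.Gr l)"
  shows "lin A (S.Gr k) (U.Gr (k + l)) (\<lambda>X. tcomp k l X Y)"
  unfolding lin_def
proof (intro conjI ballI)
  obtain v where v: "v \<in> T.N l" "Y = T.cl l v" using Y unfolding T.carrier_Gr by blast
  fix X assume X: "X \<in> carrier (S.Gr k)"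
  then obtain u where u: "u \<in> S.N k" "X = S.cl k u" unfolding S.carrier_Gr by blast
  show "tcomp k l X Y \<in> carrier (U.Gr (k + l))" by (rule tcomp_closed[OF X Y])
  show "tcomp k l (X \<oplus>\<^bsub>S.Gr k\<^esub> X') Y = tcomp k l X Y \<oplus>\<^bsub>U.Gr (k + l)\<^esub> tcomp k l X' Y"
    if X': "X' \<in> carrier (S.Gr k)" for X'
  proof -
    obtain u' where u': "u' \<in> S.N k" "X' = S.cl k u'" using X' unfolding S.carrier_Gr by blast
    show ?thesis
      unfolding u(2) v(2) u'(2) S.add_Gr[OF u(1) u'(1)] tcomp_cl[OF u(1) v(1)] tcomp_cl[OF u'(1) v(1)]
        tcomp_cl[OF S.N_add[OF u(1) u'(1)] v(1)] U.add_Gr[OF vt_N[OF u(1) v(1)] vt_N[OF u'(1) v(1)]]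
        vt_add_left[OF S.N_carrier[OF u(1)] S.N_carrier[OF u'(1)] T.N_carrier[OF v(1)]] ..
  qed
  show "tcomp k l (a \<odot>\<^bsub>S.Gr k\<^esub> X) Y = a \<odot>\<^bsub>U.Gr (k + l)\<^esub> tcomp k l X Y" if a: "a \<in> carrier A" for a
    unfolding u(2) v(2) S.smult_Gr[OF a u(1)] tcomp_cl[OF u(1) v(1)]
      tcomp_cl[OF S.N_smult[OF a u(1)] v(1)] U.smult_Gr[OF a vt_N[OF u(1) v(1)]]
      vt_smult_left[OF a S.N_carrier[OF u(1)] T.N_carrier[OF v(1)]] ..
qed

lemma lin_tcomp_right:
  assumes X: "X \<in> carrier (S.Gr k)"
  shows "lin A (T.Gr l) (U.Gr (k + l)) (\<lambda>Y. tcomp k l X Y)"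
  unfolding lin_def
proof (intro conjI ballI)
  obtain u where u: "u \<in> S.N k" "X = S.cl k u" using X unfolding S.carrier_Gr by blast
  fix Y assume Y: "Y \<in> carrier (T.Gr l)"
  then obtain v where v: "v \<in> T.N l" "Y = T.cl l v" unfolding T.carrier_Gr by blast
  show "tcomp k l X Y \<in> carrier (U.Gr (k + l))" by (rule tcomp_closed[OF X Y])
  show "tcomp k l X (Y \<oplus>\<^bsub>T.Gr l\<^esub> Y') = tcomp k l X Y \<oplus>\<^bsub>U.Gr (k + l)\<^esub> tcomp k l X Y'"
    if Y': "Y' \<in> carrier (T.Gr l)" for Y'
  proof -
    obtain v' where v': "v' \<in> T.N l" "Y' = T.cl l v'" using Y' unfolding T.carrier_Gr by blast
    show ?thesis
      unfolding u(2) v(2) v'(2) T.add_Gr[OF v(1) v'(1)] tcomp_cl[OF u(1) v(1)] tcomp_cl[OF u(1) v'(1)]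
        tcomp_cl[OF u(1) T.N_add[OF v(1) v'(1)]] U.add_Gr[OF vt_N[OF u(1) v(1)] vt_N[OF u(1) v'(1)]]
        vt_add_right[OF S.N_carrier[OF u(1)] T.N_carrier[OF v(1)] T.N_carrier[OF v'(1)]] ..
  qed
  show "tcomp k l X (a \<odot>\<^bsub>T.Gr l\<^esub> Y) = a \<odot>\<^bsub>U.Gr (k + l)\<^esub> tcomp k l X Y" if a: "a \<in> carrier A" for a
    unfolding u(2) v(2) T.smult_Gr[OF a v(1)] tcomp_cl[OF u(1) v(1)]
      tcomp_cl[OF u(1) T.N_smult[OF a v(1)]] U.smult_Gr[OF a vt_N[OF u(1) v(1)]]
      vt_smult_right[OF a S.N_carrier[OF u(1)] T.N_carrier[OF v(1)]] ..
qed

abbreviation "ft \<equiv> fiber_tensor A H H'"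

lemma tc:
  assumes x: "x \<in> carrier S.Fib" and y: "y \<in> carrier T.Fib"
  shows "tcomp k (m - k) (x k) (y (m - k)) \<in> carrier (U.Gr m)"
  using tcomp_closed[of "x k" k "y (m - k)" "m - k"] x y by (simp add: S.Fib_simps(1) T.Fib_simps(1))

text \<open>The summands outside the weights of \<open>H\<close> vanish, so the range of summation can be fixed.\<close>

lemma ft_eq:
  assumes x: "x \<in> carrier S.Fib" and y: "y \<in> carrier T.Fib"
  shows "ft x y m = (\<Oplus>\<^bsub>U.Gr m\<^esub>k\<in>jumps H. tcomp k (m - k) (x k) (y (m - k)))"
proof -
  interpret G: module A "U.Gr m" by (rule U.module_Gr)
  have xk: "\<And>k. x k \<in> carrier (S.Gr k)" and yk: "\<And>k. y k \<in> carrier (T.Gr k)"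
    using x y by (simp_all add: S.Fib_simps(1) T.Fib_simps(1))
  have zl: "tcomp k l \<zero>\<^bsub>S.Gr k\<^esub> Y = \<zero>\<^bsub>U.Gr (k + l)\<^esub>" if "Y \<in> carrier (T.Gr l)" for k l Y
    by (rule lin_zero[OF S.module_Gr U.module_Gr lin_tcomp_left[OF that]])
  have zr: "tcomp k l X \<zero>\<^bsub>T.Gr l\<^esub> = \<zero>\<^bsub>U.Gr (k + l)\<^esub>" if "X \<in> carrier (S.Gr k)" for k l X
    by (rule lin_zero[OF T.module_Gr U.module_Gr lin_tcomp_right[OF that]])
  let ?A = "{k. x k \<noteq> \<zero>\<^bsub>S.Gr k\<^esub> \<and> y (m - k) \<noteq> \<zero>\<^bsub>T.Gr (m - k)\<^esub>}"
  have "ft x y m = (\<Oplus>\<^bsub>U.Gr m\<^esub>k\<in>?A. tcomp k (m - k) (x k) (y (m - k)))"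
    unfolding fiber_tensor_def tcomp_def dim_tensor by simp
  also have "\<dots> = (\<Oplus>\<^bsub>U.Gr m\<^esub>k\<in>jumps H. tcomp k (m - k) (x k) (y (m - k)))"
  proof (rule G.M.add.finprod_mono_neutral_cong_left[OF finite_jumps[OF S.filt]])
    show "?A \<subseteq> jumps H" using S.Gr_trivial xk by blast
    show "tcomp k (m - k) (x k) (y (m - k)) = \<zero>\<^bsub>U.Gr m\<^esub>" if "k \<in> jumps H - ?A" for k
      using that zl[OF yk, of k "m - k"] zr[OF xk, of k "m - k"] by auto
    show "(\<lambda>k. tcomp k (m - k) (x k) (y (m - k))) \<in> jumps H \<rightarrow> carrier (U.Gr m)"
      using tc[OF x y] by blast
  qed (rule refl)
  finally show ?thesis .
qed

lemma ft_closed: "x \<in> carrier S.Fib \<Longrightarrow> y \<in> carrier T.Fib \<Longrightarrow> ft x y \<in> carrier U.Fib"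
  unfolding U.Fib_simps(1)
proof
  fix m assume x: "x \<in> carrier S.Fib" and y: "y \<in> carrier T.Fib"
  interpret G: module A "U.Gr m" by (rule U.module_Gr)
  show "ft x y m \<in> carrier (U.Gr m)" unfolding ft_eq[OF x y]
    by (rule G.M.finsum_closed) (use tc[OF x y] in blast)
qed

lemma lin_ft_left:
  assumes y: "y \<in> carrier T.Fib" shows "lin A S.Fib U.Fib (\<lambda>x. ft x y)"
  unfolding lin_def
proof (intro conjI ballI)
  fix x assume x: "x \<in> carrier S.Fib"
  interpret SF: module A S.Fib by (rule S.module_Fib)
  have lt: "lin A (S.Gr k) (U.Gr m) (\<lambda>X. tcomp k (m - k) X (y (m - k)))" for k m
    using lin_tcomp_left[of "y (m - k)" "m - k" k] y by (simp add: T.Fib_simps(1))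
  have xk: "x k \<in> carrier (S.Gr k)" for k using x by (simp add: S.Fib_simps(1))
  show "ft x y \<in> carrier U.Fib" by (rule ft_closed[OF x y])
  show "ft (x \<oplus>\<^bsub>S.Fib\<^esub> x') y = ft x y \<oplus>\<^bsub>U.Fib\<^esub> ft x' y" if x': "x' \<in> carrier S.Fib" for x'
  proof
    fix m
    interpret G: module A "U.Gr m" by (rule U.module_Gr)
    have x'k: "x' k \<in> carrier (S.Gr k)" for k using x' by (simp add: S.Fib_simps(1))
    have "ft (x \<oplus>\<^bsub>S.Fib\<^esub> x') y m = (\<Oplus>\<^bsub>U.Gr m\<^esub>k\<in>jumps H. tcomp k (m - k) (x k) (y (m - k)) \<oplus>\<^bsub>U.Gr m\<^esub> tcomp k (m - k) (x' k) (y (m - k)))"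
      unfolding ft_eq[OF SF.M.a_closed[OF x x'] y] unfolding S.Fib_simps(3)
      by (rule G.M.finsum_cong'[OF refl]) (use linD(2)[OF lt xk x'k] tc[OF x y] tc[OF x' y] in auto)
    also have "\<dots> = (ft x y \<oplus>\<^bsub>U.Fib\<^esub> ft x' y) m"
      unfolding U.Fib_simps(3) ft_eq[OF x y] ft_eq[OF x' y]
      by (rule G.M.finsum_addf) (use tc[OF x y] tc[OF x' y] in auto)
    finally show "ft (x \<oplus>\<^bsub>S.Fib\<^esub> x') y m = (ft x y \<oplus>\<^bsub>U.Fib\<^esub> ft x' y) m" .
  qed
  show "ft (a \<odot>\<^bsub>S.Fib\<^esub> x) y = a \<odot>\<^bsub>U.Fib\<^esub> ft x y" if a: "a \<in> carrier A" for a
  proof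
    fix m
    interpret G: module A "U.Gr m" by (rule U.module_Gr)
    have "ft (a \<odot>\<^bsub>S.Fib\<^esub> x) y m = (\<Oplus>\<^bsub>U.Gr m\<^esub>k\<in>jumps H. a \<odot>\<^bsub>U.Gr m\<^esub> tcomp k (m - k) (x k) (y (m - k)))"
      unfolding ft_eq[OF SF.smult_closed[OF a x] y] unfolding S.Fib_simps(4)
      by (rule G.M.finsum_cong'[OF refl]) (use linD(3)[OF lt a xk] tc[OF x y] a in auto)
    also have "\<dots> = (a \<odot>\<^bsub>U.Fib\<^esub> ft x y) m"
      unfolding U.Fib_simps(4) ft_eq[OF x y]
      by (rule G.finsum_smult_ldistr[symmetric]) (use tc[OF x y] a finite_jumps[OF S.filt] in auto)
    finally show "ft (a \<odot>\<^bsub>S.Fib\<^esub> x) y m = (a \<odot>\<^bsub>U.Fib\<^esub> ft x y) m" .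
  qed
qed

lemma lin_ft_right:
  assumes x: "x \<in> carrier S.Fib" shows "lin A T.Fib U.Fib (\<lambda>y. ft x y)"
  unfolding lin_def
proof (intro conjI ballI)
  fix y assume y: "y \<in> carrier T.Fib"
  interpret TF: module A T.Fib by (rule T.module_Fib)
  have lt: "lin A (T.Gr (m - k)) (U.Gr m) (\<lambda>Y. tcomp k (m - k) (x k) Y)" for k m
    using lin_tcomp_right[of "x k" k "m - k"] x by (simp add: S.Fib_simps(1))
  have yk: "y k \<in> carrier (T.Gr k)" for k using y by (simp add: T.Fib_simps(1))
  show "ft x y \<in> carrier U.Fib" by (rule ft_closed[OF x y])
  show "ft x (y \<oplus>\<^bsub>T.Fib\<^esub> y') = ft x y \<oplus>\<^bsub>U.Fib\<^esub> ft x y'" if y': "y' \<in> carrier T.Fib" for y'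
  proof
    fix m
    interpret G: module A "U.Gr m" by (rule U.module_Gr)
    have y'k: "y' k \<in> carrier (T.Gr k)" for k using y' by (simp add: T.Fib_simps(1))
    have "ft x (y \<oplus>\<^bsub>T.Fib\<^esub> y') m = (\<Oplus>\<^bsub>U.Gr m\<^esub>k\<in>jumps H. tcomp k (m - k) (x k) (y (m - k)) \<oplus>\<^bsub>U.Gr m\<^esub> tcomp k (m - k) (x k) (y' (m - k)))"
      unfolding ft_eq[OF x TF.M.a_closed[OF y y']] unfolding T.Fib_simps(3)
      by (rule G.M.finsum_cong'[OF refl]) (use linD(2)[OF lt yk y'k] tc[OF x y] tc[OF x y'] in auto)
    also have "\<dots> = (ft x y \<oplus>\<^bsub>U.Fib\<^esub> ft x y') m"
      unfolding U.Fib_simps(3) ft_eq[OF x y] ft_eq[OF x y']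
      by (rule G.M.finsum_addf) (use tc[OF x y] tc[OF x y'] in auto)
    finally show "ft x (y \<oplus>\<^bsub>T.Fib\<^esub> y') m = (ft x y \<oplus>\<^bsub>U.Fib\<^esub> ft x y') m" .
  qed
  show "ft x (a \<odot>\<^bsub>T.Fib\<^esub> y) = a \<odot>\<^bsub>U.Fib\<^esub> ft x y" if a: "a \<in> carrier A" for a
  proof
    fix m
    interpret G: module A "U.Gr m" by (rule U.module_Gr)
    have "ft x (a \<odot>\<^bsub>T.Fib\<^esub> y) m = (\<Oplus>\<^bsub>U.Gr m\<^esub>k\<in>jumps H. a \<odot>\<^bsub>U.Gr m\<^esub> tcomp k (m - k) (x k) (y (m - k)))"
      unfolding ft_eq[OF x TF.smult_closed[OF a y]] unfolding T.Fib_simps(4)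
      by (rule G.M.finsum_cong'[OF refl]) (use linD(3)[OF lt a yk] tc[OF x y] a in auto)
    also have "\<dots> = (a \<odot>\<^bsub>U.Fib\<^esub> ft x y) m"
      unfolding U.Fib_simps(4) ft_eq[OF x y]
      by (rule G.finsum_smult_ldistr[symmetric]) (use tc[OF x y] a finite_jumps[OF S.filt] in auto)
    finally show "ft x (a \<odot>\<^bsub>T.Fib\<^esub> y) m = (a \<odot>\<^bsub>U.Fib\<^esub> ft x y) m" .
  qed
qed

end

lemma tens_fiber:
  assumes "algebra real_ring A" "filtered H" "filtered H'" "filtered (mhs_tensor H H')"
  shows "tens A H H'"
  by (intro tens.intro filt.intro real_alg.intro filt_axioms.intro assms)

text \<open>
  Both sides are \<open>[\<phi> u \<otimes> \<phi> v]\<close> summed over the weights of \<open>H\<close>, if \<open>[u]\<close> and \<open>[v]\<close> are the components of \<open>x\<close> and \<open>y\<close>.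
\<close>

lemma fiber_tensor_base_change:
  assumes \<phi>: "alg_mor A B \<phi>" and H: "filtered H" "filtered H'" "filtered (mhs_tensor H H')"
    and x: "x \<in> carrier (fiber A H)" and y: "y \<in> carrier (fiber A H')"
  shows "fiber_map B (mhs_tensor H H') (vec_map \<phi> {..<dim (mhs_tensor H H')}) (fiber_tensor A H H' x y) =
    fiber_tensor B H H' (fiber_map B H (vec_map \<phi> {..<dim H}) x) (fiber_map B H' (vec_map \<phi> {..<dim H'}) y)"
proof
  fix m
  interpret \<phi>: alg_mor A B \<phi> by (rule \<phi>)
  interpret a: tens A H H' by (rule tens_fiber[OF \<phi>.A.alg H])
  interpret b: tens B H H' by (rule tens_fiber[OF \<phi>.B.alg H])
  interpret f: filt_map A B \<phi> H H "vec_map \<phi> {..<dim H}" by (rule filt_map_vec_map[OF \<phi> H(1)])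
  interpret f': filt_map A B \<phi> H' H' "vec_map \<phi> {..<dim H'}" by (rule filt_map_vec_map[OF \<phi> H(2)])
  interpret h: filt_map A B \<phi> "mhs_tensor H H'" "mhs_tensor H H'" "vec_map \<phi> {..<dim (mhs_tensor H H')}"
    by (rule filt_map_vec_map[OF \<phi> H(3)])
  interpret GA: module A "a.U.Gr m" by (rule a.U.module_Gr)
  interpret GB: module B "b.U.Gr m" by (rule b.U.module_Gr)
  let ?h = "vec_map \<phi> {..<dim (mhs_tensor H H')}"
  define pm where "pm X = b.U.N (m - 1) <+>\<^bsub>b.U.M\<^esub> (?h ` X)" for X
  have pm: "pm (a.U.cl m v) = b.U.cl m (?h v)" if "v \<in> a.U.N m" for v
    unfolding pm_def by (rule h.coset_map[OF that])
  have pm_closed: "pm X \<in> carrier (b.U.Gr m)" if "X \<in> carrier (a.U.Gr m)" for X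
  proof -
    obtain v where v: "v \<in> a.U.N m" "X = a.U.cl m v" using \<open>X \<in> _\<close> unfolding a.U.carrier_Gr by blast
    show ?thesis unfolding v(2) pm[OF v(1)] by (rule b.U.cl_closed[OF h.f_N[OF v(1)]])
  qed
  have pm_add: "pm (X \<oplus>\<^bsub>a.U.Gr m\<^esub> Y) = pm X \<oplus>\<^bsub>b.U.Gr m\<^esub> pm Y"
    if "X \<in> carrier (a.U.Gr m)" "Y \<in> carrier (a.U.Gr m)" for X Y
  proof -
    obtain u where u: "u \<in> a.U.N m" "X = a.U.cl m u" using \<open>X \<in> _\<close> unfolding a.U.carrier_Gr by blast
    obtain v where v: "v \<in> a.U.N m" "Y = a.U.cl m v" using \<open>Y \<in> _\<close> unfolding a.U.carrier_Gr by blast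
    show ?thesis
      unfolding u(2) v(2) a.U.add_Gr[OF u(1) v(1)] pm[OF u(1)] pm[OF v(1)] pm[OF a.U.N_add[OF u(1) v(1)]]
        b.U.add_Gr[OF h.f_N[OF u(1)] h.f_N[OF v(1)]]
        h.f_add[OF a.U.N_carrier[OF u(1)] a.U.N_carrier[OF v(1)]] ..
  qed
  have pm_zero: "pm \<zero>\<^bsub>a.U.Gr m\<^esub> = \<zero>\<^bsub>b.U.Gr m\<^esub>"
  proof -
    have "pm \<zero>\<^bsub>a.U.Gr m\<^esub> \<oplus>\<^bsub>b.U.Gr m\<^esub> pm \<zero>\<^bsub>a.U.Gr m\<^esub> = pm \<zero>\<^bsub>a.U.Gr m\<^esub>"
      using pm_add[OF GA.M.zero_closed GA.M.zero_closed] by (simp only: GA.M.l_zero GA.M.zero_closed)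
    then show ?thesis using pm_closed[OF GA.M.zero_closed] by (metis GB.M.add.r_cancel_one)
  qed
  have fx: "fiber_map B H (vec_map \<phi> {..<dim H}) x \<in> carrier b.S.Fib" by (rule f.fm_closed[OF x])
  have fy: "fiber_map B H' (vec_map \<phi> {..<dim H'}) y \<in> carrier b.T.Fib" by (rule f'.fm_closed[OF y])
  have hv: "?h (a.vt u v) = b.vt (vec_map \<phi> {..<dim H} u) (vec_map \<phi> {..<dim H'} v)"
    if "u \<in> carrier a.S.M" "v \<in> carrier a.T.M" for u v
    unfolding vec_tensor_def vec_map_def dim_tensor
  proof (rule restrict_ext)
    fix i assume i: "i \<in> {..<dim H * dim H'}"
    have ij: "i div dim H' < dim H" "i mod dim H' < dim H'" using a.index i by auto
    show "\<phi> ((\<lambda>k\<in>{..<dim H * dim H'}. u (k div dim H') \<otimes>\<^bsub>A\<^esub> v (k mod dim H')) i) =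
        (\<lambda>i\<in>{..<dim H}. \<phi> (u i)) (i div dim H') \<otimes>\<^bsub>B\<^esub> (\<lambda>i\<in>{..<dim H'}. \<phi> (v i)) (i mod dim H')"
      using i ij a.comp_closed(1)[OF that(1) ij(1)] a.comp_closed(2)[OF that(2) ij(2)] by simp
  qed
  have "h.fm (a.ft x y) m = pm (a.ft x y m)" by (simp add: fiber_map_def pm_def)
  also have "\<dots> = (\<Oplus>\<^bsub>b.U.Gr m\<^esub>k\<in>jumps H. pm (a.tcomp k (m - k) (x k) (y (m - k))))"
    unfolding a.ft_eq[OF x y]
    by (rule GA.M.finsum_hom[OF GB.M.abelian_monoid_axioms pm_add pm_zero pm_closed finite_jumps[OF H(1)] a.tc[OF x y]])
  also have "\<dots> = (\<Oplus>\<^bsub>b.U.Gr m\<^esub>k\<in>jumps H. b.tcomp k (m - k)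
      (fiber_map B H (vec_map \<phi> {..<dim H}) x k) (fiber_map B H' (vec_map \<phi> {..<dim H'}) y (m - k)))"
  proof (rule GB.M.finsum_cong'[OF refl])
    show "(\<lambda>k. b.tcomp k (m - k) (fiber_map B H (vec_map \<phi> {..<dim H}) x k)
        (fiber_map B H' (vec_map \<phi> {..<dim H'}) y (m - k))) \<in> jumps H \<rightarrow> carrier (b.U.Gr m)"
      using b.tc[OF fx fy] by blast
    fix k
    obtain u where u: "u \<in> a.S.N k" "x k = a.S.cl k u" using a.S.Fib_cl[OF x] by blast
    obtain v where v: "v \<in> a.T.N (m - k)" "y (m - k) = a.T.cl (m - k) v" using a.T.Fib_cl[OF y] by blast
    have km: "k + (m - k) = m" by simp
    have uv: "a.vt u v \<in> a.U.N m" using a.vt_N[OF u(1) v(1)] unfolding km .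
    show "pm (a.tcomp k (m - k) (x k) (y (m - k))) = b.tcomp k (m - k)
      (fiber_map B H (vec_map \<phi> {..<dim H}) x k) (fiber_map B H' (vec_map \<phi> {..<dim H'}) y (m - k))"
      unfolding f.fm_cl[of x, OF u(2,1)] f'.fm_cl[of y, OF v(2,1)] u(2) v(2) a.tcomp_cl[OF u(1) v(1)]
        b.tcomp_cl[OF f.f_N[OF u(1)] f'.f_N[OF v(1)]] km pm[OF uv] hv[OF a.S.N_carrier[OF u(1)] a.T.N_carrier[OF v(1)]] ..
  qed
  also have "\<dots> = b.ft (fiber_map B H (vec_map \<phi> {..<dim H}) x) (fiber_map B H' (vec_map \<phi> {..<dim H'}) y) m"
    by (rule b.ft_eq[OF fx fy, symmetric])
  finally show "h.fm (a.ft x y) m = b.ft (fiber_map B H (vec_map \<phi> {..<dim H}) x)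
      (fiber_map B H' (vec_map \<phi> {..<dim H'}) y) m" .
qed

section \<open>The unit object\<close>

lemma complex_ring_simps [simp]:
  "carrier complex_ring = UNIV" "x \<otimes>\<^bsub>complex_ring\<^esub> y = x * y" "\<one>\<^bsub>complex_ring\<^esub> = 1"
  "\<zero>\<^bsub>complex_ring\<^esub> = 0" "x \<oplus>\<^bsub>complex_ring\<^esub> y = x + y"
  by (simp_all add: complex_ring_def)

lemma cring_complex_ring: "cring complex_ring"
  by (rule cringI, rule abelian_groupI)
     (auto simp: algebra_simps intro!: comm_monoidI exI[of _ "- _"])

lemma submodule_zero:
  assumes "module R M" shows "submodule {\<zero>\<^bsub>M\<^esub>} R M"
proof -
  interpret module R M by (rule assms)
  show ?thesis by (rule submoduleI) auto
qed

text \<open>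
  \<open>Gr\<^sub>k\<close> vanishes except for \<open>k = 0\<close>. In this case, \<open>p + q = 1\<close> implies that exactly one of \<open>p\<close> and \<open>q\<close> is
  positive, so one of \<open>F\<^sup>p\<close> and \<open>F\<^sup>q\<close> is zero and the other one is everything.

  This is needed because the points of the group are families indexed by the mixed Hodge structures:
  their product and inverse are those of the components at \<open>H\<close> only if \<open>is_mhs H\<close> holds.
\<close>

lemma is_mhs_unit: "is_mhs mhs_unit"
proof -
  let ?V = "free_module real_ring {..<1::nat}" and ?C = "free_module complex_ring {..<1::nat}"
  have V: "module real_ring ?V" and C: "module complex_ring ?C"
    by (rule module_free_module[OF cring_real_ring] module_free_module[OF cring_complex_ring])+
  interpret V: module real_ring ?V by (rule V)
  interpret C: module complex_ring ?C by (rule C)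
  let ?W = "weight_ext complex_ring complex_of_real mhs_unit"
  let ?z = "{\<zero>\<^bsub>?C\<^esub>}" and ?c = "carrier ?C"
  have d: "dim mhs_unit = 1" by (simp add: mhs_unit_def)
  have w: "weight mhs_unit k = (if 0 \<le> k then carrier ?V else {\<zero>\<^bsub>?V\<^esub>})" for k
    by (simp add: mhs_unit_def)
  have h: "hodge mhs_unit p = (if p \<le> 0 then ?c else ?z)" for p
    by (simp add: mhs_unit_def)
  note zs = submodule_zero[OF C] and cs = C.carrier_is_submodule
  have Wneg: "?W k = ?z" if "k < 0" for k
  proof -
    have eq: "vec_map complex_of_real {..<1} ` weight mhs_unit k = ?z"
    proof -
      have "vec_map complex_of_real {..<1} \<zero>\<^bsub>?V\<^esub> = \<zero>\<^bsub>?C\<^esub>"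
        unfolding vec_map_def free_module_simps by (rule restrict_ext) simp
      then show ?thesis using that unfolding w by (simp only: image_insert image_empty if_False not_le[symmetric])
    qed
    have "?z \<subseteq> ?c" by simp
    from hull_submodule(2)[OF C this] hull_submodule(3)[OF C this zs subset_refl]
    show ?thesis unfolding weight_ext_def d eq by (rule subset_antisym[rotated])
  qed
  have Wpos: "?W k = ?c" if "0 \<le> k" for k
  proof -
    let ?S = "vec_map complex_of_real {..<1} ` carrier ?V"
    have S: "?S \<subseteq> ?c" by (rule image_subsetI) (simp add: vec_map_def)
    have "?c \<subseteq> span_submodule complex_ring ?C ?S"
    proof
      fix v assume v: "v \<in> ?c"
      let ?u = "vec_map complex_of_real {..<1} (\<lambda>i\<in>{..<1::nat}. 1)"
      have "?u \<in> span_submodule complex_ring ?C ?S"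
        using hull_submodule(2)[OF C S] by (rule subsetD) (rule imageI, unfold free_module_simps real_ring_simps, rule restrict_PiE_iff[THEN iffD2], simp)
      then have "v 0 \<odot>\<^bsub>?C\<^esub> ?u \<in> span_submodule complex_ring ?C ?S"
        by (intro C.submoduleE(4)[OF hull_submodule(1)[OF C S]]) auto
      moreover have "v 0 \<odot>\<^bsub>?C\<^esub> ?u = v"
      proof
        fix i show "(v 0 \<odot>\<^bsub>?C\<^esub> ?u) i = v i"
          using v PiE_arb[of v "{..<1}" "\<lambda>_. UNIV" i] by (cases "i = 0") (auto simp: vec_map_def)
      qed
      ultimately show "v \<in> span_submodule complex_ring ?C ?S" by simp
    qed
    moreover have "span_submodule complex_ring ?C ?S \<subseteq> ?c"
      by (rule C.submoduleE(1)[OF hull_submodule(1)[OF C S]])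
    ultimately show ?thesis using that unfolding weight_ext_def d w by simp
  qed
  have conj_c: "vec_map cnj {..<1} ` ?c = ?c"
  proof (intro equalityI subsetI)
    fix v assume "v \<in> vec_map cnj {..<1} ` ?c"
    then obtain w where w: "v = vec_map cnj {..<1} w" by blast
    show "v \<in> ?c" unfolding w by (simp add: vec_map_def)
  next
    fix v assume v: "v \<in> ?c"
    have "v = vec_map cnj {..<1} (vec_map cnj {..<1} v)"
      using v by (auto simp: vec_map_def PiE_iff extensional_def fun_eq_iff)
    moreover have "vec_map cnj {..<1} v \<in> ?c" by (simp add: vec_map_def)
    ultimately show "v \<in> vec_map cnj {..<1} ` ?c" by (rule image_eqI)
  qed
  have conj_z: "vec_map cnj {..<1} ` {v} = {vec_map cnj {..<1} v}" for v :: "nat \<Rightarrow> complex" by simp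
  have hg: "hodge_gr_conj mhs_unit k q = (\<lambda>X. vec_map cnj {..<1} ` X) ` hodge_gr mhs_unit k q" for k q
    by (simp add: hodge_gr_conj_def d)
  have hgr: "hodge_gr mhs_unit k p = (\<lambda>v. ?W (k - 1) +>\<^bsub>?C\<^esub> v) ` (hodge mhs_unit p \<inter> ?W k)" for k p
    by (simp add: hodge_gr_def d)
  have gr: "gr_complex mhs_unit k = quot_module (?C\<lparr>carrier := ?W k\<rparr>) (?W (k - 1))" for k
    by (simp add: gr_def d)
  have zset: "?z +>\<^bsub>?C\<^esub> v = {v}" if "v \<in> ?c" for v
    using that by (simp only: a_r_coset_def') (simp only: UN_insert UN_empty Un_empty_right C.M.l_zero)
  have cset: "?c +>\<^bsub>?C\<^esub> v = ?c" if "v \<in> ?c" for v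
    using abelian_subgroup.a_rcos_const[OF C.submodule_add_subgroup[OF cs] that] .
  have set_add_c: "X <+>\<^bsub>gr_complex mhs_unit k\<^esub> Y = {x <+>\<^bsub>?C\<^esub> y | x y. x \<in> X \<and> y \<in> Y}" for X Y k
    by (auto simp: set_add_def' gr quot_module_def)
  have main: "hodge_gr mhs_unit k p <+>\<^bsub>gr_complex mhs_unit k\<^esub> hodge_gr_conj mhs_unit k q = carrier (gr_complex mhs_unit k) \<and>
         hodge_gr mhs_unit k p \<inter> hodge_gr_conj mhs_unit k q = {\<zero>\<^bsub>gr_complex mhs_unit k\<^esub>}"
    if pq: "p + q = k + 1" for k p q
  proof -
    have zero: "\<zero>\<^bsub>gr_complex mhs_unit k\<^esub> = ?W (k - 1)" by (simp add: gr quot_module_def)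
    have carr: "carrier (gr_complex mhs_unit k) = (\<lambda>v. ?W (k - 1) +>\<^bsub>?C\<^esub> v) ` ?W k"
      by (auto simp: gr quot_module_def A_RCOSETS_def' a_r_coset_def')
    have addz: "?z <+>\<^bsub>?C\<^esub> ?z = ?z"
      using C.M.subgroup_add_id[OF submodule.axioms(1)[OF zs]] .
    have addc: "?c <+>\<^bsub>?C\<^esub> ?c = ?c"
      using C.M.subgroup_add_id[OF submodule.axioms(1)[OF cs]] .
    have hz: "\<zero>\<^bsub>?C\<^esub> \<in> hodge mhs_unit r" for r by (simp add: h)
    have cnj0: "vec_map cnj {..<1} \<zero>\<^bsub>?C\<^esub> = \<zero>\<^bsub>?C\<^esub>"
      unfolding vec_map_def free_module_simps by (rule restrict_ext) simp
    consider "k < 0" | "k = 0" | "k > 0" by linarith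
    then show ?thesis
    proof cases
      case 1
      have W: "?W k = ?z" "?W (k - 1) = ?z" using 1 Wneg by auto
      have hk: "hodge_gr mhs_unit k r = {?z}" for r
      proof -
        have "hodge mhs_unit r \<inter> ?W k = ?z" using hz[of r] unfolding W by blast
        then show ?thesis unfolding hgr using zset[of "\<zero>\<^bsub>?C\<^esub>"] by (simp only: W image_insert image_empty C.M.zero_closed)
      qed
      have hc: "hodge_gr_conj mhs_unit k r = {?z}" for r
        unfolding hg hk by (simp only: image_insert image_empty cnj0)
      show ?thesis
        unfolding set_add_c zero carr hk hc W
        using addz zset[of "\<zero>\<^bsub>?C\<^esub>"] by (simp only: image_insert image_empty C.M.zero_closed) blast
    next
      case 3
      have W: "?W k = ?c" "?W (k - 1) = ?c" using 3 Wpos by auto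
      have hk: "hodge_gr mhs_unit k r = {?c}" for r
      proof -
        have "(\<lambda>v. ?c +>\<^bsub>?C\<^esub> v) ` (hodge mhs_unit r \<inter> ?c) = (\<lambda>v. ?c) ` (hodge mhs_unit r \<inter> ?c)"
          by (rule image_cong[OF refl]) (rule cset, blast)
        moreover have "hodge mhs_unit r \<inter> ?c \<noteq> {}" using hz[of r] C.M.zero_closed by blast
        ultimately show ?thesis unfolding hgr W by (simp only: image_constant_conv if_False)
      qed
      have hc: "hodge_gr_conj mhs_unit k r = {?c}" for r
        unfolding hg hk by (simp only: image_insert image_empty conj_c)
      have "(\<lambda>v. ?c +>\<^bsub>?C\<^esub> v) ` ?c = {?c}"
        using cset C.M.zero_closed by (auto simp del: free_module_simps)
      then show ?thesis
        unfolding set_add_c zero carr hk hc W using addc by (simp only:) blast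
    next
      case 2
      have W: "?W k = ?c" "?W (k - 1) = ?z" using 2 Wpos Wneg by auto
      have sing: "(\<lambda>v. ?z +>\<^bsub>?C\<^esub> v) ` X = (\<lambda>v. {v}) ` X" if "X \<subseteq> ?c" for X
        by (rule image_cong[OF refl]) (rule zset, use that in blast)
      have hk: "hodge_gr mhs_unit k r = (\<lambda>v. {v}) ` (if r \<le> 0 then ?c else ?z)" for r
      proof -
        have "hodge mhs_unit r \<inter> ?c = (if r \<le> 0 then ?c else ?z)" unfolding h using C.M.zero_closed by auto
        then show ?thesis unfolding hgr W using sing[of "if r \<le> 0 then ?c else ?z"] C.M.zero_closed by auto
      qed
      have hc: "hodge_gr_conj mhs_unit k r = (\<lambda>v. {v}) ` (if r \<le> 0 then ?c else ?z)" for r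
      proof -
        have "hodge_gr_conj mhs_unit k r = (\<lambda>v. {v}) ` (vec_map cnj {..<1} ` (if r \<le> 0 then ?c else ?z))"
          unfolding hg hk image_image conj_z ..
        also have "vec_map cnj {..<1} ` (if r \<le> 0 then ?c else ?z) = (if r \<le> 0 then ?c else ?z)"
          using conj_c cnj0 by (simp only: if_distrib image_insert image_empty split: if_split) simp
        finally show ?thesis .
      qed
      have zc: "\<zero>\<^bsub>?C\<^esub> \<in> ?c" by (rule C.M.zero_closed)
      have sadd: "{x} <+>\<^bsub>?C\<^esub> {y} = {x \<oplus>\<^bsub>?C\<^esub> y}" for x y by (simp add: set_add_def' del: free_module_simps)
      have exch: "(p \<le> 0 \<and> \<not> q \<le> 0) \<or> (\<not> p \<le> 0 \<and> q \<le> 0)" using pq 2 by linarith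
      have carr': "carrier (gr_complex mhs_unit k) = (\<lambda>v. {v}) ` ?c" unfolding carr W by (rule sing) blast
      show ?thesis
        using exch
      proof
        assume "p \<le> 0 \<and> \<not> q \<le> 0"
        then have e: "hodge_gr mhs_unit k p = (\<lambda>v. {v}) ` ?c" "hodge_gr_conj mhs_unit k q = {?z}"
          unfolding hk hc by simp_all
        have "{x <+>\<^bsub>?C\<^esub> y | x y. x \<in> (\<lambda>v. {v}) ` ?c \<and> y \<in> {?z}} = (\<lambda>v. {v}) ` ?c"
        proof -
          have "{x <+>\<^bsub>?C\<^esub> y | x y. x \<in> (\<lambda>v. {v}) ` ?c \<and> y \<in> {?z}} = (\<lambda>v. {v} <+>\<^bsub>?C\<^esub> ?z) ` ?c" by blast
          also have "\<dots> = (\<lambda>v. {v \<oplus>\<^bsub>?C\<^esub> \<zero>\<^bsub>?C\<^esub>}) ` ?c" by (simp only: sadd)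
          also have "\<dots> = (\<lambda>v. {v}) ` ?c" by (rule image_cong[OF refl]) (simp only: C.M.r_zero)
          finally show ?thesis .
        qed
        then show ?thesis unfolding set_add_c e carr' zero W using zc by (auto simp del: free_module_simps)
      next
        assume "\<not> p \<le> 0 \<and> q \<le> 0"
        then have e: "hodge_gr mhs_unit k p = {?z}" "hodge_gr_conj mhs_unit k q = (\<lambda>v. {v}) ` ?c"
          unfolding hk hc by simp_all
        have "{x <+>\<^bsub>?C\<^esub> y | x y. x \<in> {?z} \<and> y \<in> (\<lambda>v. {v}) ` ?c} = (\<lambda>v. {v}) ` ?c"
        proof -
          have "{x <+>\<^bsub>?C\<^esub> y | x y. x \<in> {?z} \<and> y \<in> (\<lambda>v. {v}) ` ?c} = (\<lambda>v. ?z <+>\<^bsub>?C\<^esub> {v}) ` ?c" by blast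
          also have "\<dots> = (\<lambda>v. {\<zero>\<^bsub>?C\<^esub> \<oplus>\<^bsub>?C\<^esub> v}) ` ?c" by (simp only: sadd)
          also have "\<dots> = (\<lambda>v. {v}) ` ?c" by (rule image_cong[OF refl]) (simp only: C.M.l_zero)
          finally show ?thesis .
        qed
        then show ?thesis unfolding set_add_c e carr' zero W using zc by (auto simp del: free_module_simps)
      qed
    qed
  qed
  show ?thesis
    unfolding is_mhs_def Let_def d
  proof (intro conjI allI impI)
    show "submodule (weight mhs_unit k) real_ring ?V" for k
      unfolding w using V.carrier_is_submodule submodule_zero[OF V] by (simp split: if_split)
    show "mono (weight mhs_unit)" unfolding w mono_def using V.M.zero_closed by (auto simp: le_fun_def w simp del: free_module_simps)
    show "\<exists>k. weight mhs_unit k = {\<zero>\<^bsub>?V\<^esub>}" by (rule exI[of _ "-1"]) (simp add: w)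
    show "\<exists>k. weight mhs_unit k = carrier ?V" by (rule exI[of _ 0]) (simp add: w)
    show "submodule (hodge mhs_unit p) complex_ring ?C" for p
      unfolding h using cs zs by (simp split: if_split)
    show "antimono (hodge mhs_unit)" unfolding antimono_def using C.M.zero_closed by (auto simp: h simp del: free_module_simps)
    show "\<exists>p. hodge mhs_unit p = ?c" by (rule exI[of _ 0]) (simp add: h)
    show "\<exists>p. hodge mhs_unit p = ?z" by (rule exI[of _ 1]) (simp add: h)
  qed (use main in blast)+
qed


section \<open>The tannakian group as a functor of points\<close>

lemma carrier_GL: "h \<in> carrier (GL R M) \<longleftrightarrow> h \<in> Bij (carrier M) \<and> lin R M M h"
  by (auto simp: GL_def lin_def dest: Bij_imp_funcset)

lemma mult_GL: "h \<in> carrier (GL R M) \<Longrightarrow> h' \<in> carrier (GL R M) \<Longrightarrow> h \<otimes>\<^bsub>GL R M\<^esub> h' = compose (carrier M) h h'"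
  by (simp add: GL_def BijGroup_def)

lemma one_GL: "\<one>\<^bsub>GL R M\<^esub> = (\<lambda>x\<in>carrier M. x)"
  by (simp add: GL_def BijGroup_def)

lemma group_GL:
  assumes M: "module R M" shows "group (GL R M)"
proof -
  interpret M: module R M by (rule M)
  interpret B: group "BijGroup (carrier M)" by (rule group_BijGroup)
  have "subgroup (carrier (GL R M)) (BijGroup (carrier M))"
  proof (rule B.subgroupI)
    show "carrier (GL R M) \<subseteq> carrier (BijGroup (carrier M))" by (auto simp: GL_def BijGroup_def)
    have "(\<lambda>x\<in>carrier M. x) \<in> carrier (GL R M)" by (simp add: carrier_GL id_Bij lin_def)
    then show "carrier (GL R M) \<noteq> {}" by blast
  next
    fix h assume h: "h \<in> carrier (GL R M)"
    then have B: "h \<in> Bij (carrier M)" and l: "lin R M M h" by (simp_all add: carrier_GL)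
    let ?i = "\<lambda>x\<in>carrier M. inv_into (carrier M) h x"
    have ic: "inv_into (carrier M) h x \<in> carrier M" if "x \<in> carrier M" for x by (rule Bij_inv_into_mem[OF B that])
    have hi: "h (inv_into (carrier M) h x) = x" if "x \<in> carrier M" for x
      using B that by (simp add: Bij_def bij_betw_def f_inv_into_f)
    have inj: "x = y" if "x \<in> carrier M" "y \<in> carrier M" "h x = h y" for x y
      using B that by (auto simp: Bij_def bij_betw_def inj_on_def)
    have "lin R M M ?i"
      unfolding lin_def
    proof (intro conjI ballI)
      fix x assume x: "x \<in> carrier M"
      show "?i x \<in> carrier M" using ic x by simp
      show "?i (x \<oplus>\<^bsub>M\<^esub> y) = ?i x \<oplus>\<^bsub>M\<^esub> ?i y" if y: "y \<in> carrier M" for y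
        by (rule inj) (use x y ic hi linD(2)[OF l] in simp_all)
      show "?i (a \<odot>\<^bsub>M\<^esub> x) = a \<odot>\<^bsub>M\<^esub> ?i x" if a: "a \<in> carrier R" for a
        by (rule inj) (use x a ic hi linD(3)[OF l] in simp_all)
    qed
    then show "inv\<^bsub>BijGroup (carrier M)\<^esub> h \<in> carrier (GL R M)"
      unfolding inv_BijGroup[OF B] by (simp add: carrier_GL restrict_inv_into_Bij[OF B])
  next
    fix h h' assume "h \<in> carrier (GL R M)" "h' \<in> carrier (GL R M)"
    then have B: "h \<in> Bij (carrier M)" "h' \<in> Bij (carrier M)" and l: "lin R M M h" "lin R M M h'"
      by (simp_all add: carrier_GL)
    have "lin R M M (compose (carrier M) h h')"
      unfolding lin_def compose_def using linD[OF l(1)] linD[OF l(2)] by simp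
    then show "h \<otimes>\<^bsub>BijGroup (carrier M)\<^esub> h' \<in> carrier (GL R M)"
      using B by (simp add: BijGroup_def carrier_GL compose_Bij)
  qed
  then have "group (BijGroup (carrier M)\<lparr>carrier := carrier (GL R M)\<rparr>)"
    by (rule subgroup.subgroup_is_group[OF _ group_BijGroup])
  moreover have "BijGroup (carrier M)\<lparr>carrier := carrier (GL R M)\<rparr> = GL R M"
    by (simp add: GL_def)
  ultimately show ?thesis by simp
qed

definition tannaka :: "(real, 'u) module \<Rightarrow> 'u tannaka_point \<Rightarrow> bool" where
  "tannaka A g \<longleftrightarrow> g \<in> (\<Pi>\<^sub>E H\<in>{H. is_mhs H}. carrier (GL A (fiber A H))) \<and>
     (\<forall>H H' f. is_mhs H \<and> is_mhs H' \<and> mhs_hom H H' f \<longrightarrow>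
       (\<forall>x\<in>carrier (fiber A H). g H' (fiber_map A H' (alg_lin_map A {..<dim H} {..<dim H'} f) x) =
         fiber_map A H' (alg_lin_map A {..<dim H} {..<dim H'} f) (g H x))) \<and>
     (\<forall>H H'. is_mhs H \<and> is_mhs H' \<and> is_mhs (mhs_tensor H H') \<longrightarrow>
       (\<forall>x\<in>carrier (fiber A H). \<forall>y\<in>carrier (fiber A H').
         g (mhs_tensor H H') (fiber_tensor A H H' x y) = fiber_tensor A H H' (g H x) (g H' y))) \<and>
     (\<forall>x\<in>carrier (fiber A mhs_unit). g mhs_unit x = x)"

abbreviation GLs :: "(real, 'u) module \<Rightarrow> 'u tannaka_point monoid" where
  "GLs A \<equiv> product_group {H. is_mhs H} (\<lambda>H. GL A (fiber A H))"

lemma points_mhs_group: "points mhs_group A = GLs A\<lparr>carrier := {g. tannaka A g}\<rparr>"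
proof -
  have "{g \<in> (\<Pi>\<^sub>E H\<in>{H. is_mhs H}. carrier (GL A (fiber A H))).
           (\<forall>H H' f. is_mhs H \<and> is_mhs H' \<and> mhs_hom H H' f \<longrightarrow>
              (let \<omega>f = fiber_map A H' (alg_lin_map A {..<dim H} {..<dim H'} f) in
               \<forall>x\<in>carrier (fiber A H). g H' (\<omega>f x) = \<omega>f (g H x))) \<and>
           (\<forall>H H' K. is_mhs H \<and> is_mhs H' \<and> is_mhs K \<and> K = mhs_tensor H H' \<longrightarrow>
              (\<forall>x\<in>carrier (fiber A H). \<forall>y\<in>carrier (fiber A H').
                 g K (fiber_tensor A H H' x y) = fiber_tensor A H H' (g H x) (g H' y))) \<and>
           (\<forall>x\<in>carrier (fiber A mhs_unit). g mhs_unit x = x)} = {g. tannaka A g}"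
    by (intro Collect_cong) (simp add: tannaka_def Let_def)
  then show ?thesis unfolding mhs_group_def by (simp only: grp_functor.simps)
qed

lemma filt_mhs: "algebra real_ring A \<Longrightarrow> is_mhs H \<Longrightarrow> filt A H"
  by (intro filt.intro real_alg.intro filt_axioms.intro is_mhs_filtered)

lemma module_fiber: "algebra real_ring A \<Longrightarrow> is_mhs H \<Longrightarrow> module A (fiber A H)"
  by (rule filt.module_Fib[OF filt_mhs])

lemma fiber_map_hom_closed:
  assumes "algebra real_ring A" "is_mhs H" "is_mhs H'" "mhs_hom H H' f" "x \<in> carrier (fiber A H)"
  shows "fiber_map A H' (alg_lin_map A {..<dim H} {..<dim H'} f) x \<in> carrier (fiber A H')"
  using filt_map.fm_closed[OF filt_map_lin_map[OF assms(1) is_mhs_filtered[OF assms(2)] is_mhs_filtered[OF assms(3)] assms(4)]]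
    assms(5) by blast

lemma fiber_map_hom_lin:
  assumes A: "algebra real_ring A" and H: "is_mhs H" "is_mhs H'" "mhs_hom H H' f"
  shows "lin A (fiber A H) (fiber A H') (fiber_map A H' (alg_lin_map A {..<dim H} {..<dim H'} f))"
proof -
  interpret f: filt_map A A "\<lambda>x. x" H H' "alg_lin_map A {..<dim H} {..<dim H'} f"
    by (rule filt_map_lin_map[OF A is_mhs_filtered[OF H(1)] is_mhs_filtered[OF H(2)] H(3)])
  show ?thesis unfolding lin_def by (intro conjI ballI f.fm_closed f.fm_add f.fm_smult)
qed

lemma tens_mhs: "algebra real_ring A \<Longrightarrow> is_mhs H \<Longrightarrow> is_mhs H' \<Longrightarrow> is_mhs (mhs_tensor H H') \<Longrightarrow> tens A H H'"
  by (intro tens_fiber is_mhs_filtered)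

lemma lin_compose:
  assumes "lin R L M f" "lin R M N h" shows "lin R L N (\<lambda>x. h (f x))"
  unfolding lin_def using linD[OF assms(1)] linD[OF assms(2)] by simp

lemma tannakaD:
  assumes g: "tannaka A g" and H: "is_mhs H"
  shows "g H \<in> carrier (GL A (fiber A H))" "g H \<in> Bij (carrier (fiber A H))" "lin A (fiber A H) (fiber A H) (g H)"
    "x \<in> carrier (fiber A H) \<Longrightarrow> g H x \<in> carrier (fiber A H)"
proof -
  show gG: "g H \<in> carrier (GL A (fiber A H))" using g H unfolding tannaka_def by blast
  then show "g H \<in> Bij (carrier (fiber A H))" and l: "lin A (fiber A H) (fiber A H) (g H)"
    unfolding carrier_GL by blast+
  show "x \<in> carrier (fiber A H) \<Longrightarrow> g H x \<in> carrier (fiber A H)" by (rule linD(1)[OF l])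
qed

text \<open>
  Naturality and compatibility with tensor products pass to inverses because \<open>\<omega>(f)\<close> and the tensor
  structure map fibers to fibers, where \<open>g\<close> may be cancelled.
\<close>

lemma group_points:
  assumes A: "algebra real_ring A"
  shows "group (points mhs_group A)"
proof -
  have gr: "group (GL A (fiber A H))" if "is_mhs H" for H by (rule group_GL[OF module_fiber[OF A that]])
  have P: "group (GLs A)" by (rule product_group) (use gr in blast)
  interpret P: group "GLs A" by (rule P)
  have sub: "{g. tannaka A g} \<subseteq> carrier (GLs A)" by (auto simp: tannaka_def)
  have "subgroup {g. tannaka A g} (GLs A)"
  proof (rule P.subgroupI[OF sub])
    have "tannaka A (\<lambda>H\<in>{H. is_mhs H}. \<lambda>x\<in>carrier (fiber A H). x)"
      unfolding tannaka_def
    proof (intro conjI allI impI ballI)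
      show "(\<lambda>H\<in>{H. is_mhs H}. \<lambda>x\<in>carrier (fiber A H). x) \<in> (\<Pi>\<^sub>E H\<in>{H. is_mhs H}. carrier (GL A (fiber A H)))"
      proof (rule restrict_PiE_iff[THEN iffD2], intro ballI, unfold mem_Collect_eq)
        fix H assume H: "is_mhs H"
        show "(\<lambda>x\<in>carrier (fiber A H). x) \<in> carrier (GL A (fiber A H))"
          unfolding one_GL[of A "fiber A H", symmetric] by (rule group.is_monoid[OF gr[OF H], THEN monoid.one_closed])
      qed
    next
      fix H H' f x assume "is_mhs H \<and> is_mhs H' \<and> mhs_hom H H' f" and x: "x \<in> carrier (fiber A H)"
      then have H: "is_mhs H" "is_mhs H'" "mhs_hom H H' f" by blast+
      show "(\<lambda>H\<in>{H. is_mhs H}. \<lambda>x\<in>carrier (fiber A H). x) H' (fiber_map A H' (alg_lin_map A {..<dim H} {..<dim H'} f) x) =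
        fiber_map A H' (alg_lin_map A {..<dim H} {..<dim H'} f) ((\<lambda>H\<in>{H. is_mhs H}. \<lambda>x\<in>carrier (fiber A H). x) H x)"
        using fiber_map_hom_closed[OF A H x] H x by simp
    next
      fix H H' x y assume "is_mhs H \<and> is_mhs H' \<and> is_mhs (mhs_tensor H H')"
        and xy: "x \<in> carrier (fiber A H)" "y \<in> carrier (fiber A H')"
      then have H: "is_mhs H" "is_mhs H'" "is_mhs (mhs_tensor H H')" by blast+
      show "(\<lambda>H\<in>{H. is_mhs H}. \<lambda>x\<in>carrier (fiber A H). x) (mhs_tensor H H') (fiber_tensor A H H' x y) =
        fiber_tensor A H H' ((\<lambda>H\<in>{H. is_mhs H}. \<lambda>x\<in>carrier (fiber A H). x) H x) ((\<lambda>H\<in>{H. is_mhs H}. \<lambda>x\<in>carrier (fiber A H). x) H' y)"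
        using tens.ft_closed[OF tens_mhs[OF A H] xy] H xy by simp
    qed (simp add: is_mhs_unit)
    then show "{g. tannaka A g} \<noteq> {}" by blast
  next
    fix g assume "g \<in> {g. tannaka A g}"
    then have g: "tannaka A g" by simp
    let ?i = "inv\<^bsub>GLs A\<^esub> g"
    have gc: "g \<in> (\<Pi>\<^sub>E H\<in>{H. is_mhs H}. carrier (GL A (fiber A H)))" using g by (simp add: tannaka_def)
    have ic: "?i \<in> (\<Pi>\<^sub>E H\<in>{H. is_mhs H}. carrier (GL A (fiber A H)))"
      using P.inv_closed[of g] gc by simp
    have iH: "?i H \<in> carrier (GL A (fiber A H))" if "is_mhs H" for H using ic that by blast
    have i1: "?i H (g H x) = x" "g H (?i H x) = x" "?i H x \<in> carrier (fiber A H)"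
      if H: "is_mhs H" and x: "x \<in> carrier (fiber A H)" for H x
    proof -
      interpret GH: group "GL A (fiber A H)" by (rule gr[OF H])
      note gH = tannakaD(1)[OF g H]
      have iv: "?i H = inv\<^bsub>GL A (fiber A H)\<^esub> (g H)"
        using inv_product_group[of g "{H. is_mhs H}" "\<lambda>H. GL A (fiber A H)"] gc gr H by simp
      have "?i H \<otimes>\<^bsub>GL A (fiber A H)\<^esub> g H = (\<lambda>x\<in>carrier (fiber A H). x)"
        unfolding iv GH.l_inv[OF gH] by (rule one_GL)
      then show "?i H (g H x) = x"
        unfolding mult_GL[OF iH[OF H] gH] using x by (auto dest: fun_cong[of _ _ x] simp: compose_def)
      have "g H \<otimes>\<^bsub>GL A (fiber A H)\<^esub> ?i H = (\<lambda>x\<in>carrier (fiber A H). x)"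
        unfolding iv GH.r_inv[OF gH] by (rule one_GL)
      then show "g H (?i H x) = x"
        unfolding mult_GL[OF gH iH[OF H]] using x by (auto dest: fun_cong[of _ _ x] simp: compose_def)
      show "?i H x \<in> carrier (fiber A H)" using iH[OF H] x unfolding carrier_GL lin_def by blast
    qed
    have "tannaka A ?i"
      unfolding tannaka_def
    proof (intro conjI allI impI ballI ic)
      fix H H' f x assume "is_mhs H \<and> is_mhs H' \<and> mhs_hom H H' f" and x: "x \<in> carrier (fiber A H)"
      then have H: "is_mhs H" "is_mhs H'" "mhs_hom H H' f" by blast+
      let ?w = "fiber_map A H' (alg_lin_map A {..<dim H} {..<dim H'} f)"
      have "g H' (?w (?i H x)) = ?w (g H (?i H x))"
        using g H i1(3)[OF H(1) x] unfolding tannaka_def by blast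
      then have "?i H' (?w x) = ?i H' (g H' (?w (?i H x)))" unfolding i1(2)[OF H(1) x] by simp
      also have "\<dots> = ?w (?i H x)" by (rule i1(1)[OF H(2) fiber_map_hom_closed[OF A H i1(3)[OF H(1) x]]])
      finally show "?i H' (?w x) = ?w (?i H x)" .
    next
      fix H H' x y assume "is_mhs H \<and> is_mhs H' \<and> is_mhs (mhs_tensor H H')"
        and x: "x \<in> carrier (fiber A H)" and y: "y \<in> carrier (fiber A H')"
      then have H: "is_mhs H" "is_mhs H'" "is_mhs (mhs_tensor H H')" by blast+
      have "g (mhs_tensor H H') (fiber_tensor A H H' (?i H x) (?i H' y)) = fiber_tensor A H H' (g H (?i H x)) (g H' (?i H' y))"
        using g H i1(3)[OF H(1) x] i1(3)[OF H(2) y] unfolding tannaka_def by blast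
      then have "?i (mhs_tensor H H') (fiber_tensor A H H' x y) =
          ?i (mhs_tensor H H') (g (mhs_tensor H H') (fiber_tensor A H H' (?i H x) (?i H' y)))"
        unfolding i1(2)[OF H(1) x] i1(2)[OF H(2) y] by simp
      also have "\<dots> = fiber_tensor A H H' (?i H x) (?i H' y)"
        by (rule i1(1)[OF H(3) tens.ft_closed[OF tens_mhs[OF A H] i1(3)[OF H(1) x] i1(3)[OF H(2) y]]])
      finally show "?i (mhs_tensor H H') (fiber_tensor A H H' x y) = fiber_tensor A H H' (?i H x) (?i H' y)" .
    next
      fix x assume x: "x \<in> carrier (fiber A mhs_unit)"
      have "g mhs_unit x = x" using g x unfolding tannaka_def by blast
      with i1(1)[OF is_mhs_unit x] show "?i mhs_unit x = x" by simp
    qed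
    then show "?i \<in> {g. tannaka A g}" by simp
  next
    fix g h assume "g \<in> {g. tannaka A g}" "h \<in> {g. tannaka A g}"
    then have g: "tannaka A g" and h: "tannaka A h" by auto
    let ?m = "g \<otimes>\<^bsub>GLs A\<^esub> h"
    have mc: "?m \<in> (\<Pi>\<^sub>E H\<in>{H. is_mhs H}. carrier (GL A (fiber A H)))"
      using P.m_closed[of g h] g h by (simp add: tannaka_def)
    have m: "?m H x = g H (h H x)" if H: "is_mhs H" and x: "x \<in> carrier (fiber A H)" for H x
      using H x mult_GL[OF tannakaD(1)[OF g H] tannakaD(1)[OF h H]] by (simp add: compose_def)
    have "tannaka A ?m"
      unfolding tannaka_def
    proof (intro conjI allI impI ballI mc)
      fix H H' f x assume "is_mhs H \<and> is_mhs H' \<and> mhs_hom H H' f" and x: "x \<in> carrier (fiber A H)"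
      then have H: "is_mhs H" "is_mhs H'" "mhs_hom H H' f" by blast+
      let ?w = "fiber_map A H' (alg_lin_map A {..<dim H} {..<dim H'} f)"
      have "h H' (?w x) = ?w (h H x)" using h H x unfolding tannaka_def by blast
      moreover have "g H' (?w (h H x)) = ?w (g H (h H x))"
        using g H tannakaD(4)[OF h H(1) x] unfolding tannaka_def by blast
      ultimately show "?m H' (?w x) = ?w (?m H x)"
        unfolding m[OF H(2) fiber_map_hom_closed[OF A H x]] m[OF H(1) x] by simp
    next
      fix H H' x y assume "is_mhs H \<and> is_mhs H' \<and> is_mhs (mhs_tensor H H')"
        and x: "x \<in> carrier (fiber A H)" and y: "y \<in> carrier (fiber A H')"
      then have H: "is_mhs H" "is_mhs H'" "is_mhs (mhs_tensor H H')" by blast+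
      have "h (mhs_tensor H H') (fiber_tensor A H H' x y) = fiber_tensor A H H' (h H x) (h H' y)"
        using h H x y unfolding tannaka_def by blast
      moreover have "g (mhs_tensor H H') (fiber_tensor A H H' (h H x) (h H' y)) =
          fiber_tensor A H H' (g H (h H x)) (g H' (h H' y))"
        using g H tannakaD(4)[OF h H(1) x] tannakaD(4)[OF h H(2) y] unfolding tannaka_def by blast
      ultimately show "?m (mhs_tensor H H') (fiber_tensor A H H' x y) = fiber_tensor A H H' (?m H x) (?m H' y)"
        unfolding m[OF H(3) tens.ft_closed[OF tens_mhs[OF A H] x y]] m[OF H(1) x] m[OF H(2) y] by simp
    next
      fix x assume x: "x \<in> carrier (fiber A mhs_unit)"
      have "h mhs_unit x = x" "g mhs_unit x = x" using g h x unfolding tannaka_def by blast+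
      then show "?m mhs_unit x = x" unfolding m[OF is_mhs_unit x] by simp
    qed
    then show "?m \<in> {g. tannaka A g}" by simp
  qed
  then show ?thesis unfolding points_mhs_group by (rule subgroup.subgroup_is_group[OF _ P])
qed

lemma (in alg_mor) lin_map_vec_map:
  assumes I: "finite I" and v: "v \<in> carrier (free_module A I)"
  shows "alg_lin_map B I J F (vec_map \<phi> I v) = vec_map \<phi> J (alg_lin_map A I J F v)"
  unfolding lin_map_def vec_map_def
proof (rule restrict_ext)
  fix j assume j: "j \<in> J"
  have vi: "\<And>i. i \<in> I \<Longrightarrow> v i \<in> carrier A" using v by auto
  have "\<phi> (\<Oplus>\<^bsub>A\<^esub>i\<in>I. str_map A (F j i) \<otimes>\<^bsub>A\<^esub> v i) = (\<Oplus>\<^bsub>B\<^esub>i\<in>I. \<phi> (str_map A (F j i) \<otimes>\<^bsub>A\<^esub> v i))"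
    by (rule finsum[OF I]) (intro A.A.m_closed A.str_map_closed vi)
  also have "\<dots> = (\<Oplus>\<^bsub>B\<^esub>i\<in>I. str_map B (F j i) \<otimes>\<^bsub>B\<^esub> (\<lambda>i\<in>I. \<phi> (v i)) i)"
    by (rule B.A.finsum_cong'[OF refl]) (use vi in auto)
  finally show "(\<Oplus>\<^bsub>B\<^esub>i\<in>I. str_map B (F j i) \<otimes>\<^bsub>B\<^esub> (\<lambda>i\<in>I. \<phi> (v i)) i) =
      \<phi> ((\<lambda>j\<in>J. \<Oplus>\<^bsub>A\<^esub>i\<in>I. str_map A (F j i) \<otimes>\<^bsub>A\<^esub> v i) j)"
    using j by simp
qed

text \<open>
  On representatives, both sides are given by the same real matrix, applied after and before \<open>\<phi>\<close>.
\<close>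

lemma fiber_map_commute:
  assumes \<phi>: "alg_mor A B \<phi>" and H: "is_mhs H" "is_mhs H'" "mhs_hom H H' F" and x: "x \<in> carrier (fiber A H)"
  shows "fiber_map B H' (alg_lin_map B {..<dim H} {..<dim H'} F) (fiber_map B H (vec_map \<phi> {..<dim H}) x) =
    fiber_map B H' (vec_map \<phi> {..<dim H'}) (fiber_map A H' (alg_lin_map A {..<dim H} {..<dim H'} F) x)"
proof
  fix k
  interpret \<phi>: alg_mor A B \<phi> by (rule \<phi>)
  note fH = is_mhs_filtered[OF H(1)] and fH' = is_mhs_filtered[OF H(2)]
  interpret a: filt_map A A "\<lambda>x. x" H H' "alg_lin_map A {..<dim H} {..<dim H'} F"
    by (rule filt_map_lin_map[OF \<phi>.A.alg fH fH' H(3)])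
  interpret b: filt_map B B "\<lambda>x. x" H H' "alg_lin_map B {..<dim H} {..<dim H'} F"
    by (rule filt_map_lin_map[OF \<phi>.B.alg fH fH' H(3)])
  interpret f: filt_map A B \<phi> H H "vec_map \<phi> {..<dim H}" by (rule filt_map_vec_map[OF \<phi> fH])
  interpret f': filt_map A B \<phi> H' H' "vec_map \<phi> {..<dim H'}" by (rule filt_map_vec_map[OF \<phi> fH'])
  obtain v where v: "v \<in> a.S.N k" "x k = a.S.cl k v" using a.S.Fib_cl[OF x] by blast
  have eq: "alg_lin_map B {..<dim H} {..<dim H'} F (vec_map \<phi> {..<dim H} v) =
      vec_map \<phi> {..<dim H'} (alg_lin_map A {..<dim H} {..<dim H'} F v)"
    by (rule \<phi>.lin_map_vec_map[OF finite_lessThan a.S.N_carrier[OF v(1)]])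
  show "fiber_map B H' (alg_lin_map B {..<dim H} {..<dim H'} F) (fiber_map B H (vec_map \<phi> {..<dim H}) x) k =
    fiber_map B H' (vec_map \<phi> {..<dim H'}) (fiber_map A H' (alg_lin_map A {..<dim H} {..<dim H'} F) x) k"
    using b.fm_cl[of "fiber_map B H (vec_map \<phi> {..<dim H}) x", OF f.fm_cl[of x, OF v(2,1)] f.f_N[OF v(1)]]
      f'.fm_cl[of "fiber_map A H' (alg_lin_map A {..<dim H} {..<dim H'} F) x", OF a.fm_cl[of x, OF v(2,1)] a.f_N[OF v(1)]]
    unfolding eq by (rule trans[OF _ sym])
qed

lemma base_change_mhs_group:
  "base_change mhs_group A B \<phi> g h \<longleftrightarrow> (\<forall>H. is_mhs H \<longrightarrow> (\<forall>x\<in>carrier (fiber A H).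
     h H (fiber_map B H (vec_map \<phi> {..<dim H}) x) = fiber_map B H (vec_map \<phi> {..<dim H}) (g H x)))"
  by (simp add: mhs_group_def Let_def)

lemma ext_mhs: "alg_mor A B \<phi> \<Longrightarrow> is_mhs H \<Longrightarrow>
    scalar_ext A B \<phi> (fiber A H) (fiber B H) (fiber_map B H (vec_map \<phi> {..<dim H}))
    (filt.E H) (filt.bvec A H) (filt.crd A H) (filt.crd B H)"
  by (rule scalar_ext_fiber[OF _ is_mhs_filtered])

text \<open>
  The scalar extension of an automorphism of \<open>\<omega> \<otimes> A\<close>. All required identities hold on the image of
  \<open>\<omega>(H) \<otimes> A\<close>, which generates \<open>\<omega>(H) \<otimes> B\<close>; for the inverse one extends the inverse automorphism.
\<close>

lemma base_change_exists:
  assumes \<phi>: "alg_mor A B \<phi>" and g: "g \<in> carrier (points mhs_group A)"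
  shows "\<exists>h\<in>carrier (points mhs_group B). base_change mhs_group A B \<phi> g h"
proof -
  interpret \<phi>: alg_mor A B \<phi> by (rule \<phi>)
  note A = \<phi>.A.alg and B = \<phi>.B.alg
  interpret P: group "points mhs_group A" by (rule group_points[OF A])
  let ?f = "\<lambda>H. fiber_map B H (vec_map \<phi> {..<dim H})"
  note ext = ext_mhs[OF \<phi>]
  have fc: "?f H x \<in> carrier (fiber B H)" if "is_mhs H" "x \<in> carrier (fiber A H)" for H x
    by (rule scalar_ext.f_closed[OF ext[OF that(1)] that(2)])
  have tg: "tannaka A g" using g by (simp add: points_mhs_group)
  define i where "i = inv\<^bsub>points mhs_group A\<^esub> g"
  have ti: "tannaka A i" using P.inv_closed[OF g] by (simp add: points_mhs_group i_def)
  have gi: "g H (i H x) = x" "i H (g H x) = x" if H: "is_mhs H" and x: "x \<in> carrier (fiber A H)" for H x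
  proof -
    have "(g \<otimes>\<^bsub>points mhs_group A\<^esub> i) H = \<one>\<^bsub>points mhs_group A\<^esub> H" "(i \<otimes>\<^bsub>points mhs_group A\<^esub> g) H = \<one>\<^bsub>points mhs_group A\<^esub> H"
      unfolding i_def using P.r_inv[OF g] P.l_inv[OF g] by simp_all
    then have "compose (carrier (fiber A H)) (g H) (i H) = (\<lambda>x\<in>carrier (fiber A H). x)"
      "compose (carrier (fiber A H)) (i H) (g H) = (\<lambda>x\<in>carrier (fiber A H). x)"
      using H mult_GL[OF tannakaD(1)[OF tg H] tannakaD(1)[OF ti H]] mult_GL[OF tannakaD(1)[OF ti H] tannakaD(1)[OF tg H]]
      by (simp_all add: points_mhs_group one_GL)
    from this[THEN fun_cong, of x] show "g H (i H x) = x" "i H (g H x) = x" using x by (simp_all add: compose_def)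
  qed
  have "\<exists>h. \<forall>H. is_mhs H \<longrightarrow> lin B (fiber B H) (fiber B H) (h H) \<and>
      (\<forall>x\<in>carrier (fiber A H). h H (?f H x) = ?f H (k H x))" if k: "tannaka A k" for k
    by (rule choice) (use scalar_ext.ext_exists[OF ext tannakaD(3)[OF k]] in blast)
  from this[OF tg] this[OF ti] obtain h j where
    h: "\<And>H. is_mhs H \<Longrightarrow> lin B (fiber B H) (fiber B H) (h H)"
      "\<And>H x. is_mhs H \<Longrightarrow> x \<in> carrier (fiber A H) \<Longrightarrow> h H (?f H x) = ?f H (g H x)"
    and j: "\<And>H. is_mhs H \<Longrightarrow> lin B (fiber B H) (fiber B H) (j H)"
      "\<And>H x. is_mhs H \<Longrightarrow> x \<in> carrier (fiber A H) \<Longrightarrow> j H (?f H x) = ?f H (i H x)"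
    by metis
  note mB = module_fiber[OF B]
  have id: "lin B (fiber B H) (fiber B H) (\<lambda>x. x)" if "is_mhs H" for H
    by (simp add: lin_def)
  have hj: "h H (j H y) = y" "j H (h H y) = y" if H: "is_mhs H" and y: "y \<in> carrier (fiber B H)" for H y
  proof -
    show "h H (j H y) = y"
      by (rule scalar_ext.lin_eqI[OF ext[OF H] mB[OF H] lin_compose[OF j(1)[OF H] h(1)[OF H]] id[OF H] _ y])
         (simp add: j(2)[OF H] h(2)[OF H] tannakaD(4)[OF ti H] gi[OF H])
    show "j H (h H y) = y"
      by (rule scalar_ext.lin_eqI[OF ext[OF H] mB[OF H] lin_compose[OF h(1)[OF H] j(1)[OF H]] id[OF H] _ y])
         (simp add: j(2)[OF H] h(2)[OF H] tannakaD(4)[OF tg H] gi[OF H])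
  qed
  define h' where "h' = (\<lambda>H\<in>{H. is_mhs H}. \<lambda>y\<in>carrier (fiber B H). h H y)"
  have h': "h' H y = h H y" if "is_mhs H" "y \<in> carrier (fiber B H)" for H y
    using that by (simp add: h'_def)
  have hc: "h H y \<in> carrier (fiber B H)" if "is_mhs H" "y \<in> carrier (fiber B H)" for H y
    by (rule linD(1)[OF h(1)[OF that(1)] that(2)])
  have GL: "h' H \<in> carrier (GL B (fiber B H))" if H: "is_mhs H" for H
    unfolding carrier_GL
  proof
    interpret F: module B "fiber B H" by (rule mB[OF H])
    have "bij_betw (h' H) (carrier (fiber B H)) (carrier (fiber B H))"
      by (rule bij_betw_byWitness[of _ "j H"])
         (use hj[OF H] h'[OF H] hc[OF H] linD(1)[OF j(1)[OF H]] in auto)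
    then show "h' H \<in> Bij (carrier (fiber B H))" using H by (simp add: Bij_def h'_def)
    show "lin B (fiber B H) (fiber B H) (h' H)"
      using linD[OF h(1)[OF H]] h'[OF H] by (simp add: lin_def)
  qed
  have "tannaka B h'"
    unfolding tannaka_def
  proof (intro conjI allI impI ballI)
    show "h' \<in> (\<Pi>\<^sub>E H\<in>{H. is_mhs H}. carrier (GL B (fiber B H)))"
      using GL by (intro PiE_I) (auto simp: h'_def)
  next
    fix H H' F y assume "is_mhs H \<and> is_mhs H' \<and> mhs_hom H H' F" and y: "y \<in> carrier (fiber B H)"
    then have H: "is_mhs H" "is_mhs H'" "mhs_hom H H' F" by blast+
    let ?wA = "fiber_map A H' (alg_lin_map A {..<dim H} {..<dim H'} F)"
      and ?wB = "fiber_map B H' (alg_lin_map B {..<dim H} {..<dim H'} F)"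
    have lB: "lin B (fiber B H) (fiber B H') ?wB" by (rule fiber_map_hom_lin[OF B H])
    have "h H' (?wB y) = ?wB (h H y)"
    proof (rule scalar_ext.lin_eqI[OF ext[OF H(1)] mB[OF H(2)] lin_compose[OF lB h(1)[OF H(2)]] lin_compose[OF h(1)[OF H(1)] lB] _ y])
      fix x assume x: "x \<in> carrier (fiber A H)"
      have "h H' (?wB (?f H x)) = h H' (?f H' (?wA x))" by (simp only: fiber_map_commute[OF \<phi> H x])
      also have "\<dots> = ?f H' (g H' (?wA x))" by (rule h(2)[OF H(2) fiber_map_hom_closed[OF A H x]])
      also have "g H' (?wA x) = ?wA (g H x)" using tg H x unfolding tannaka_def by blast
      also have "?f H' (?wA (g H x)) = ?wB (?f H (g H x))"
        by (rule fiber_map_commute[OF \<phi> H tannakaD(4)[OF tg H(1) x], symmetric])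
      also have "\<dots> = ?wB (h H (?f H x))" by (simp only: h(2)[OF H(1) x])
      finally show "h H' (?wB (?f H x)) = ?wB (h H (?f H x))" .
    qed
    then show "h' H' (?wB y) = ?wB (h' H y)"
      using h'[OF H(2) fiber_map_hom_closed[OF B H y]] h'[OF H(1) y] by simp
  next
    fix H H' y z assume "is_mhs H \<and> is_mhs H' \<and> is_mhs (mhs_tensor H H')"
      and y: "y \<in> carrier (fiber B H)" and z: "z \<in> carrier (fiber B H')"
    then have H: "is_mhs H" "is_mhs H'" "is_mhs (mhs_tensor H H')" by blast+
    let ?K = "mhs_tensor H H'"
    interpret a: tens A H H' by (rule tens_mhs[OF A H])
    interpret b: tens B H H' by (rule tens_mhs[OF B H])
    note tbc = fiber_tensor_base_change[OF \<phi> is_mhs_filtered[OF H(1)] is_mhs_filtered[OF H(2)] is_mhs_filtered[OF H(3)]]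
    \<comment> \<open>Linearity is used in one argument after the other; first only the second argument is arbitrary.\<close>
    have step: "h ?K (b.ft (?f H x) z) = b.ft (h H (?f H x)) (h H' z)"
      if x: "x \<in> carrier (fiber A H)" and z: "z \<in> carrier (fiber B H')" for x z
    proof (rule scalar_ext.lin_eqI[OF ext[OF H(2)] mB[OF H(3)]
          lin_compose[OF b.lin_ft_right[OF fc[OF H(1) x]] h(1)[OF H(3)]]
          lin_compose[OF h(1)[OF H(2)] b.lin_ft_right[OF hc[OF H(1) fc[OF H(1) x]]]] _ z])
      fix w assume w: "w \<in> carrier (fiber A H')"
      have "h ?K (b.ft (?f H x) (?f H' w)) = h ?K (?f ?K (a.ft x w))" by (simp only: tbc[OF x w])
      also have "\<dots> = ?f ?K (g ?K (a.ft x w))" by (rule h(2)[OF H(3) a.ft_closed[OF x w]])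
      also have "g ?K (a.ft x w) = a.ft (g H x) (g H' w)" using tg H x w unfolding tannaka_def by blast
      also have "?f ?K (a.ft (g H x) (g H' w)) = b.ft (?f H (g H x)) (?f H' (g H' w))"
        by (rule tbc[OF tannakaD(4)[OF tg H(1) x] tannakaD(4)[OF tg H(2) w]])
      also have "\<dots> = b.ft (h H (?f H x)) (h H' (?f H' w))" by (simp only: h(2)[OF H(1) x] h(2)[OF H(2) w])
      finally show "h ?K (b.ft (?f H x) (?f H' w)) = b.ft (h H (?f H x)) (h H' (?f H' w))" .
    qed
    have "h ?K (b.ft y z) = b.ft (h H y) (h H' z)"
      by (rule scalar_ext.lin_eqI[OF ext[OF H(1)] mB[OF H(3)]
          lin_compose[OF b.lin_ft_left[OF z] h(1)[OF H(3)]]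
          lin_compose[OF h(1)[OF H(1)] b.lin_ft_left[OF hc[OF H(2) z]]] step[OF _ z] y])
    then show "h' ?K (b.ft y z) = b.ft (h' H y) (h' H' z)"
      using h'[OF H(3) b.ft_closed[OF y z]] h'[OF H(1) y] h'[OF H(2) z] by simp
  next
    fix y assume y: "y \<in> carrier (fiber B mhs_unit)"
    have "h mhs_unit y = y"
    proof (rule scalar_ext.lin_eqI[OF ext[OF is_mhs_unit] mB[OF is_mhs_unit] h(1)[OF is_mhs_unit] id[OF is_mhs_unit] _ y])
      fix x assume x: "x \<in> carrier (fiber A mhs_unit)"
      have "g mhs_unit x = x" using tg x unfolding tannaka_def by blast
      then show "h mhs_unit (?f mhs_unit x) = ?f mhs_unit x" using h(2)[OF is_mhs_unit x] by simp
    qed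
    then show "h' mhs_unit y = y" using h'[OF is_mhs_unit y] by simp
  qed
  moreover have "base_change mhs_group A B \<phi> g h'"
    unfolding base_change_mhs_group using h(2) h' fc by simp
  ultimately show ?thesis by (intro bexI[of _ h']) (simp_all add: points_mhs_group)
qed

lemma bc_group_mhs_group: "bc_group (mhs_group :: ('u, 'u tannaka_point) grp_functor)"
proof (rule bc_group.intro)
  fix A :: "(real, 'u) module" assume "algebra real_ring A"
  then show "group (points mhs_group A)" by (rule group_points)
next
  fix A B :: "(real, 'u) module" and \<phi> assume \<phi>: "alg_mor A B \<phi>"
  have one: "\<one>\<^bsub>points mhs_group A\<^esub> H = (\<lambda>x\<in>carrier (fiber A H). x)" if "is_mhs H" for H and A :: "(real, 'u) module"
    using that by (simp add: points_mhs_group one_GL)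
  show "base_change mhs_group A B \<phi> \<one>\<^bsub>points mhs_group A\<^esub> \<one>\<^bsub>points mhs_group B\<^esub>"
    unfolding base_change_mhs_group
  proof (intro allI impI ballI)
    fix H x assume H: "is_mhs H" and x: "x \<in> carrier (fiber A H)"
    show "\<one>\<^bsub>points mhs_group B\<^esub> H (fiber_map B H (vec_map \<phi> {..<dim H}) x) =
        fiber_map B H (vec_map \<phi> {..<dim H}) (\<one>\<^bsub>points mhs_group A\<^esub> H x)"
      using scalar_ext.f_closed[OF ext_mhs[OF \<phi> H] x] x unfolding one[OF H] by simp
  qed
next
  fix A B :: "(real, 'u) module" and \<phi> and x :: "'u tannaka_point"
  assume "alg_mor A B \<phi>" "x \<in> carrier (points mhs_group A)"
  then show "\<exists>y\<in>carrier (points mhs_group B). base_change mhs_group A B \<phi> x y" by (rule base_change_exists)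
qed

theorem corollary5p15:
  fixes g :: nat
    and V :: "('i, 'u, nat \<Rightarrow> 'u tannaka_point) rep_data"
  assumes "g \<ge> 1"
    and "is_rep (power_functor g mhs_group) V"
  shows "\<exists>Vs :: nat \<Rightarrow> (nat, 'u, 'u tannaka_point) rep_data.
           (\<forall>\<mu><g. is_rep mhs_group (Vs \<mu>)) \<and>
           iso_to_subquotient (power_functor g mhs_group) V (exterior_product g Vs)"
proof -
  interpret power_rep mhs_group g V
    by (intro power_rep.intro bc_group_mhs_group power_rep_axioms.intro assms(2))
  show ?thesis by (rule subquotient[OF assms(1)])
qed

end
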